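(* Let $\phi\in\mathcal C^\infty((-\frac12,\frac12),\mathbb R)$ and $G(x',x_3)=e^{2\phi(x_3)}Id_3$, with $G^h=G|_{\Omega^h}$. Suppose $\phi^{(k)}(0)=0$ for $k=1,\dots,n-1$, for some integer $n>2$. Then $\inf\mathcal E^h\le Ch^{2n}$ and $$\liminf_{h\to0}\frac1{h^{2n}}\inf\mathcal E^h\ge c_n\,\phi^{(n)}(0)^2\,|\omega|\,\mathcal Q_2(Id_2)$$ for some constant $c_n>0$ depending only on $n$. In particular, if $\phi^{(n)}(0)\neq0$ then $ch^{2n}\le\inf\mathcal E^h\le Ch^{2n}$ with $c,C>0$.
   Context: $\omega\subset\mathbb R^2$ open, bounded, connected, Lipschitz; $\Omega^h=\omega\times(-h/2,h/2)$. $W:\mathbb R^{3\times3}\to[0,\infty]$ Borel with $W(RF)=W(F)$ for $R\in SO(3)$, $W=0$ on $SO(3)$, $W(F)\ge c\,\mathrm{dist}^2(F,SO(3))$ ($c>0$), $W$ finite and $\mathcal C^2$ near $SO(3)$. $\mathcal E^h(u)=\frac1h\int_{\Omega^h}W(\nabla u\,(G^h)^{-1/2})dx$, infimum over $u\in W^{1,2}(\Omega^h,\mathbb R^3)$. $\mathcal Q_2(F)=\min\{D^2W(Id_3)(\tilde F,\tilde F):\tilde F\in\mathbb R^{3\times3},\tilde F_{2\times2}=F\}$ for $F\in\mathbb R^{2\times2}$, $\tilde F_{2\times2}$ the principal $2\times2$ minor. *)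

theory Defs
  imports "HOL-Analysis.Analysis"
begin

fun Ck_on :: "nat \<Rightarrow> 'a::euclidean_space set \<Rightarrow> ('a \<Rightarrow> real) \<Rightarrow> bool" where
  "Ck_on 0 S f = continuous_on S f"
| "Ck_on (Suc k) S f =
     ((\<forall>x\<in>S. f differentiable (at x)) \<and>
      (\<forall>i\<in>Basis. Ck_on k S (\<lambda>x. frechet_derivative f (at x) i)))"

definition smooth_on :: "'a::euclidean_space set \<Rightarrow> ('a \<Rightarrow> real) \<Rightarrow> bool" where
  "smooth_on S f \<longleftrightarrow> (\<forall>k. Ck_on k S f)"

definition lipschitz_domain :: "(real^2) set \<Rightarrow> bool" where
  "lipschitz_domain \<omega> \<longleftrightarrow> open \<omega> \<and> bounded \<omega> \<and> connected \<omega> \<and> \<omega> \<noteq> {} \<and>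
     (\<forall>p\<in>frontier \<omega>. \<exists>(R::real^2^2) a b L (g::real \<Rightarrow> real).
        orthogonal_matrix R \<and> a > 0 \<and> b > 0 \<and> L-lipschitz_on UNIV g \<and> g 0 = 0 \<and> L * a < b \<and>
        (let cyl = {x. \<bar>(R *v (x - p)) $ 1\<bar> < a \<and> \<bar>(R *v (x - p)) $ 2\<bar> < b} in
           \<omega> \<inter> cyl = {x \<in> cyl. (R *v (x - p)) $ 2 > g ((R *v (x - p)) $ 1)}))"

definition SO3 :: "(real^3^3) set" where
  "SO3 = {R. orthogonal_matrix R \<and> det R = 1}"

definition Wreal :: "(real^3^3 \<Rightarrow> ennreal) \<Rightarrow> real^3^3 \<Rightarrow> real" where
  "Wreal W F = enn2real (W F)"

definition admissible_density :: "(real^3^3 \<Rightarrow> ennreal) \<Rightarrow> bool" where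
  "admissible_density W \<longleftrightarrow>
     W \<in> borel_measurable borel \<and>
     (\<forall>R\<in>SO3. \<forall>F. W (R ** F) = W F) \<and>
     (\<forall>R\<in>SO3. W R = 0) \<and>
     (\<exists>c>0. \<forall>F. W F \<ge> ennreal (c * (infdist F SO3)\<^sup>2)) \<and>
     (\<exists>U. open U \<and> SO3 \<subseteq> U \<and> (\<forall>F\<in>U. W F \<noteq> \<infinity>) \<and> Ck_on 2 U (Wreal W))"

definition D2W :: "(real^3^3 \<Rightarrow> ennreal) \<Rightarrow> real^3^3 \<Rightarrow> real^3^3 \<Rightarrow> real^3^3 \<Rightarrow> real" where
  "D2W W A F1 F2 = frechet_derivative (\<lambda>X. frechet_derivative (Wreal W) (at X) F1) (at A) F2"

definition minor22 :: "real^3^3 \<Rightarrow> real^2^2" where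
  "minor22 F = (\<chi> i j. F $ (if i = 1 then 1 else 2) $ (if j = 1 then 1 else 2))"

definition Q2 :: "(real^3^3 \<Rightarrow> ennreal) \<Rightarrow> real^2^2 \<Rightarrow> real" where
  "Q2 W F = Inf {D2W W (mat 1) Ft Ft | Ft. minor22 Ft = F}"

definition Omega :: "(real^2) set \<Rightarrow> real \<Rightarrow> (real^3) set" where
  "Omega \<omega> h = {x. vector [x $ 1, x $ 2] \<in> \<omega> \<and> \<bar>x $ 3\<bar> < h / 2}"

definition metricG :: "(real \<Rightarrow> real) \<Rightarrow> real^3 \<Rightarrow> real^3^3" where
  "metricG \<phi> x = exp (2 * \<phi> (x $ 3)) *\<^sub>R mat 1"

definition pos_def :: "real^3^3 \<Rightarrow> bool" where
  "pos_def S \<longleftrightarrow> transpose S = S \<and> (\<forall>v. v \<noteq> 0 \<longrightarrow> v \<bullet> (S *v v) > 0)"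

definition inv_sqrt :: "real^3^3 \<Rightarrow> real^3^3" where
  "inv_sqrt G = (THE S. pos_def S \<and> S ** S = matrix_inv G)"

definition test_fn :: "(real^3) set \<Rightarrow> (real^3 \<Rightarrow> real) \<Rightarrow> bool" where
  "test_fn \<Omega> \<psi> \<longleftrightarrow> smooth_on UNIV \<psi> \<and> compact (closure {x. \<psi> x \<noteq> 0}) \<and>
     closure {x. \<psi> x \<noteq> 0} \<subseteq> \<Omega>"

text \<open>u in W^{1,2}(Omega, R^3) with weak gradient Du, (Du x) $ i $ j = d_j u_i.\<close>
definition sobolev12 :: "(real^3) set \<Rightarrow> (real^3 \<Rightarrow> real^3) \<Rightarrow> (real^3 \<Rightarrow> real^3^3) \<Rightarrow> bool" where
  "sobolev12 \<Omega> u Du \<longleftrightarrow>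
     u \<in> borel_measurable (lebesgue_on \<Omega>) \<and> Du \<in> borel_measurable (lebesgue_on \<Omega>) \<and>
     (\<forall>i. integrable (lebesgue_on \<Omega>) (\<lambda>x. (u x $ i)\<^sup>2)) \<and>
     (\<forall>i j. integrable (lebesgue_on \<Omega>) (\<lambda>x. (Du x $ i $ j)\<^sup>2)) \<and>
     (\<forall>\<psi> i j. test_fn \<Omega> \<psi> \<longrightarrow>
        (\<integral>x. u x $ i * frechet_derivative \<psi> (at x) (axis j 1) \<partial>(lebesgue_on \<Omega>))
        = - (\<integral>x. Du x $ i $ j * \<psi> x \<partial>(lebesgue_on \<Omega>)))"

definition energy :: "(real^3^3 \<Rightarrow> ennreal) \<Rightarrow> (real \<Rightarrow> real) \<Rightarrow> (real^2) set \<Rightarrow> real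
    \<Rightarrow> (real^3 \<Rightarrow> real^3^3) \<Rightarrow> ennreal" where
  "energy W \<phi> \<omega> h Du = ennreal (1 / h) *
     (\<integral>\<^sup>+ x\<in>Omega \<omega> h. W (Du x ** inv_sqrt (metricG \<phi> x)) \<partial>lebesgue)"

definition inf_energy :: "(real^3^3 \<Rightarrow> ennreal) \<Rightarrow> (real \<Rightarrow> real) \<Rightarrow> (real^2) set \<Rightarrow> real \<Rightarrow> ennreal" where
  "inf_energy W \<phi> \<omega> h = (INF (u, Du) \<in> {(u, Du). sobolev12 (Omega \<omega> h) u Du}. energy W \<phi> \<omega> h Du)"

end

theory Submission
  imports Defs "HOL-Computational_Algebra.Polynomial"
begin

text \<open>
The upper bound is the energy of the dilation \<open>u x = exp (\<phi> 0) x\<close>.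

For the lower bound, tile a compact part of \<open>\<Omega>\<close> by boxes of width comparable to \<open>h\<close>, rescale each box
to unit height and put \<open>\<epsilon> = h ^ n\<close>. Either the energy of a box already exceeds a multiple of \<open>\<epsilon>\<^sup>2\<close>,
or a quantitative rigidity estimate in the interior of the box gives a rotation \<open>R\<close> with
\<open>\<nabla>u = R + O(\<epsilon>)\<close> in \<open>L\<^sup>2\<close>. In the latter case test the strain against a symmetric divergence free
stress supported in the box: it annihilates gradients, so only the incompatible part
\<open>\<phi>\<^sup>(\<^sup>n\<^sup>)(0) x\<^sub>3 ^ n / n!\<close> of the metric contributes, and by duality with the quadratic form \<open>D\<^sup>2 W(Id)\<close>
this bounds the energy of the box from below. Boxes that are wide compared with their height make the
constant proportional to \<open>Q\<^sub>2(Id)\<close>.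

The rigidity estimate is proved for \<open>C\<^sup>1\<close> maps by hand: cofactors are divergence free, so \<open>F - cof F\<close>, which
is controlled by the distance to the rotations, bounds the oscillation of \<open>F\<close>; maps with unbounded
gradient are first truncated by mollification at a variable scale.
\<close>

section \<open>Continuously differentiable functions\<close>

definition has_grad :: "(real^'n \<Rightarrow> real) \<Rightarrow> (real^'n \<Rightarrow> real^'n) \<Rightarrow> bool" where
  "has_grad f g \<longleftrightarrow> continuous_on UNIV g \<and> (\<forall>x. (f has_derivative (\<lambda>h. g x \<bullet> h)) (at x))"

lemma has_gradD: "has_grad f g \<Longrightarrow> (f has_derivative (\<lambda>h. g x \<bullet> h)) (at x)"
  by (simp add: has_grad_def)

lemma has_grad_continuous_grad: "has_grad f g \<Longrightarrow> continuous_on S g"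
  unfolding has_grad_def using continuous_on_subset by blast

lemma has_grad_continuous: "has_grad f g \<Longrightarrow> continuous_on S f"
  unfolding has_grad_def
  by (metis continuous_at_imp_continuous_on has_derivative_continuous)

lemma continuous_on_UNIV_compose:
  "continuous_on UNIV f \<Longrightarrow> continuous_on S p \<Longrightarrow> continuous_on S (\<lambda>x. f (p x))"
  by (rule continuous_on_compose2) auto

lemma continuous_on_UNIV_subset: "continuous_on UNIV f \<Longrightarrow> continuous_on S f"
  by (rule continuous_on_subset) auto

lemma has_grad_const: "has_grad (\<lambda>x. c) (\<lambda>x. 0)"
  by (auto simp: has_grad_def)

lemma has_grad_add:
  "has_grad f f' \<Longrightarrow> has_grad g g' \<Longrightarrow> has_grad (\<lambda>x. f x + g x) (\<lambda>x. f' x + g' x)"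
  unfolding has_grad_def
  by (auto intro!: continuous_intros derivative_eq_intros simp: inner_simps)

lemma has_grad_diff:
  "has_grad f f' \<Longrightarrow> has_grad g g' \<Longrightarrow> has_grad (\<lambda>x. f x - g x) (\<lambda>x. f' x - g' x)"
  unfolding has_grad_def
  by (auto intro!: continuous_intros derivative_eq_intros simp: inner_simps)

lemma has_grad_cmult: "has_grad f f' \<Longrightarrow> has_grad (\<lambda>x. c * f x) (\<lambda>x. c *\<^sub>R f' x)"
  unfolding has_grad_def
  by (auto intro!: continuous_intros derivative_eq_intros simp: inner_simps)

lemma has_grad_mult:
  assumes "has_grad f f'" "has_grad g g'"
  shows "has_grad (\<lambda>x. f x * g x) (\<lambda>x. f x *\<^sub>R g' x + g x *\<^sub>R f' x)"
  using assms has_grad_continuous[OF assms(1)] has_grad_continuous[OF assms(2)]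
  unfolding has_grad_def
  by (auto intro!: continuous_intros derivative_eq_intros simp: inner_simps algebra_simps)

lemma has_grad_sum:
  assumes "\<And>i. i \<in> I \<Longrightarrow> has_grad (f i) (g i)"
  shows "has_grad (\<lambda>x. \<Sum>i\<in>I. f i x) (\<lambda>x. \<Sum>i\<in>I. g i x)"
  using assms
  by (induction I rule: infinite_finite_induct) (auto intro: has_grad_add has_grad_const)

lemma has_grad_affine:
  assumes "has_grad f g"
  shows "has_grad (\<lambda>x. f (c + r *\<^sub>R x)) (\<lambda>x. r *\<^sub>R g (c + r *\<^sub>R x))"
  unfolding has_grad_def
proof (intro conjI allI)
  show "continuous_on UNIV (\<lambda>x. r *\<^sub>R g (c + r *\<^sub>R x))"
    by (intro continuous_intros continuous_on_UNIV_compose[OF has_grad_continuous_grad[OF assms]])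
  fix x
  have "((\<lambda>x. f (c + r *\<^sub>R x)) has_derivative (\<lambda>h. g (c + r *\<^sub>R x) \<bullet> (r *\<^sub>R h))) (at x)"
    by (rule has_derivative_compose[OF _ has_gradD[OF assms], of "\<lambda>x. c + r *\<^sub>R x" "\<lambda>h. r *\<^sub>R h"])
      (auto intro!: derivative_eq_intros)
  then show "((\<lambda>x. f (c + r *\<^sub>R x)) has_derivative (\<lambda>h. (r *\<^sub>R g (c + r *\<^sub>R x)) \<bullet> h)) (at x)"
    by simp
qed

lemma has_grad_real_compose:
  assumes "has_grad f g" "\<And>s. (p has_real_derivative p' s) (at s)" "continuous_on UNIV p'"
  shows "has_grad (\<lambda>x. p (f x)) (\<lambda>x. p' (f x) *\<^sub>R g x)"
  unfolding has_grad_def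
proof (intro conjI allI)
  show "continuous_on UNIV (\<lambda>x. p' (f x) *\<^sub>R g x)"
    by (intro continuous_intros has_grad_continuous_grad[OF assms(1)]
        continuous_on_UNIV_compose[OF assms(3)] has_grad_continuous[OF assms(1)])
  fix x
  have "(p has_derivative (\<lambda>h. p' (f x) * h)) (at (f x))"
    using assms(2) by (simp add: has_field_derivative_def)
  from has_derivative_compose[OF has_gradD[OF assms(1)] this]
  show "((\<lambda>x. p (f x)) has_derivative (\<lambda>h. (p' (f x) *\<^sub>R g x) \<bullet> h)) (at x)"
    by simp
qed

lemma has_grad_coord: "has_grad (\<lambda>x::real^'n. x $ i) (\<lambda>x. axis i 1)"
proof -
  have "((\<lambda>x. axis i 1 \<bullet> x) has_derivative (\<lambda>h. axis i 1 \<bullet> h)) (at x)" for x :: "real^'n"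
    by (intro derivative_intros)
  then show ?thesis
    by (auto simp: has_grad_def inner_axis')
qed

lemma has_grad_cong:
  assumes "has_grad f g" "\<And>x. f x = f' x" "\<And>x. g x = g' x"
  shows "has_grad f' g'"
proof -
  have "f' = f" "g' = g" using assms by auto
  with assms(1) show ?thesis by simp
qed

lemma has_grad_zero_outside:
  assumes "has_grad f g" "closed C" "\<And>x. x \<notin> C \<Longrightarrow> f x = 0" "x \<notin> C"
  shows "g x = 0"
proof -
  have "((\<lambda>x. 0) has_derivative (\<lambda>h. g x \<bullet> h)) (at x)"
    using has_derivative_transform_within_open[OF has_gradD[OF assms(1)], of "- C" x "\<lambda>x. 0"]
      assms(2-4) by (simp add: open_Compl)
  from has_derivative_unique[OF this has_derivative_const] have "g x \<bullet> g x = 0" by metis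
  then show ?thesis by simp
qed

section \<open>Integration by parts on boxes\<close>

lemma integral_cbox_superset:
  fixes f :: "'a::euclidean_space \<Rightarrow> 'b::euclidean_space"
  assumes "continuous_on (cbox a b) f" "\<And>x. x \<notin> cbox a b \<Longrightarrow> f x = 0" "cbox a b \<subseteq> T"
  shows "integral T f = integral (cbox a b) f"
  using has_integral_on_superset[OF integrable_integral[OF integrable_continuous[OF assms(1)]]
      assms(2,3)] by (simp add: integral_unique)

lemma integral_cbox_shift:
  fixes f :: "'a::euclidean_space \<Rightarrow> 'b::euclidean_space"
  assumes "continuous_on UNIV f" "\<And>x. x \<notin> cbox a b \<Longrightarrow> f x = 0"
    "cbox a b \<subseteq> cbox a' b'" "cbox a b \<subseteq> cbox (a' + c) (b' + c)"
  shows "integral (cbox a' b') (\<lambda>x. f (x + c)) = integral (cbox a' b') f"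
proof -
  have "integral (cbox a' b') (\<lambda>x. f (x + c)) = integral (cbox (a' + c) (b' + c)) f"
    using integral_shift_cbox_plus[of a' b' f c] by (simp add: o_def add.commute)
  also have "\<dots> = integral (cbox a b) f"
    by (rule integral_cbox_superset[OF continuous_on_UNIV_subset[OF assms(1)] assms(2,4)])
  also have "\<dots> = integral (cbox a' b') f"
    by (rule integral_cbox_superset[OF continuous_on_UNIV_subset[OF assms(1)] assms(2,3), symmetric])
  finally show ?thesis .
qed

lemma blinfun_apply_integral_inner:
  fixes g :: "'a::euclidean_space \<Rightarrow> 'b::euclidean_space"
  assumes "continuous_on (cbox a b) g"
  shows "blinfun_apply (integral (cbox a b) (\<lambda>t. blinfun_inner_right (g t)))
    = (\<lambda>h. integral (cbox a b) g \<bullet> h)"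
proof
  fix h
  have "(\<lambda>t. blinfun_inner_right (g t)) integrable_on cbox a b"
    by (intro integrable_continuous bounded_linear.continuous_on[OF bounded_linear_blinfun_inner_right] assms)
  then have "blinfun_apply (integral (cbox a b) (\<lambda>t. blinfun_inner_right (g t))) h
      = integral (cbox a b) (\<lambda>t. g t \<bullet> h)"
    using blinfun_apply_integral by fastforce
  also have "\<dots> = integral (cbox a b) g \<bullet> h"
    using integral_linear[OF integrable_continuous[OF assms], of "\<lambda>y. y \<bullet> h"]
    by (simp add: o_def bounded_linear_inner_left)
  finally show "blinfun_apply (integral (cbox a b) (\<lambda>t. blinfun_inner_right (g t))) h
      = integral (cbox a b) g \<bullet> h" .
qed

lemma has_grad_integral:
  fixes f :: "real^'n \<Rightarrow> 'a::euclidean_space \<Rightarrow> real"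
  assumes der: "\<And>x t. t \<in> cbox a b \<Longrightarrow> ((\<lambda>x. f x t) has_derivative (\<lambda>h. g x t \<bullet> h)) (at x)"
    and cont_f: "\<And>x. continuous_on (cbox a b) (f x)"
    and cont_g: "continuous_on (UNIV \<times> cbox a b) (\<lambda>(x,t). g x t)"
  shows "has_grad (\<lambda>x. integral (cbox a b) (f x)) (\<lambda>x. integral (cbox a b) (g x))"
  unfolding has_grad_def
proof (intro conjI allI)
  show "continuous_on UNIV (\<lambda>x. integral (cbox a b) (g x))"
    by (rule integral_continuous_on_param[OF cont_g])
  fix x
  have "continuous_on (cbox a b) (\<lambda>t. (\<lambda>(x,t). g x t) (x,t))"
    by (rule continuous_on_compose2[OF cont_g]) (auto intro!: continuous_intros)
  then have cont_gx: "continuous_on (cbox a b) (g x)" by simp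
  have "((\<lambda>x. integral (cbox a b) (f x)) has_derivative
      blinfun_apply (integral (cbox a b) (\<lambda>t. blinfun_inner_right (g x t)))) (at x within UNIV)"
  proof (rule leibniz_rule)
    show "continuous_on (UNIV \<times> cbox a b) (\<lambda>(x, t). blinfun_inner_right (g x t))"
      unfolding split_beta
      by (intro bounded_linear.continuous_on[OF bounded_linear_blinfun_inner_right])
        (use cont_g in \<open>simp add: split_beta\<close>)
  qed (use der cont_f in \<open>auto intro!: integrable_continuous\<close>)
  then show "((\<lambda>x. integral (cbox a b) (f x)) has_derivative (\<lambda>h. integral (cbox a b) (g x) \<bullet> h)) (at x)"
    by (simp add: blinfun_apply_integral_inner[OF cont_gx])
qed

lemma cbox_mono_cart:
  fixes a b :: "real^'n"
  assumes "\<And>i. c $ i \<le> a $ i" "\<And>i. b $ i \<le> d $ i"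
  shows "cbox a b \<subseteq> cbox c d"
  unfolding subset_iff mem_box_cart by (meson assms order_trans)

lemma cbox_subset_margin: "cbox a b \<subseteq> cbox (a - 1) (b + 1)" for a b :: "real^'n"
  by (rule cbox_mono_cart) auto

text \<open>Differentiate the constant function \<open>t \<mapsto> \<integral> f (x + t) dx\<close> at \<open>t = 0\<close>.\<close>

lemma integral_grad_eq_0:
  fixes f :: "real^'n \<Rightarrow> real"
  assumes f: "has_grad f g" and zero: "\<And>x. x \<notin> cbox a b \<Longrightarrow> f x = 0"
  shows "integral (cbox a b) g = 0"
proof -
  let ?P = "cbox (a - 1) (b + 1)"
  have cont: "continuous_on UNIV f" "continuous_on UNIV g"
    using has_grad_continuous[OF f] has_grad_continuous_grad[OF f] .
  have "has_grad (\<lambda>t. integral ?P (\<lambda>x. f (x + t))) (\<lambda>t. integral ?P (\<lambda>x. g (x + t)))"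
  proof (rule has_grad_integral)
    fix x t :: "real^'n"
    from has_gradD[OF has_grad_affine[OF f, of t 1], of x]
    show "((\<lambda>x. f (t + x)) has_derivative (\<lambda>h. g (t + x) \<bullet> h)) (at x)" by simp
  qed (auto intro!: continuous_intros continuous_on_UNIV_compose[OF cont(1)]
      continuous_on_UNIV_compose[OF cont(2)] simp: split_beta)
  from has_gradD[OF this, of 0]
  have deriv: "((\<lambda>t. integral ?P (\<lambda>x. f (x + t))) has_derivative (\<lambda>h. integral ?P g \<bullet> h)) (at 0)"
    by simp
  have const: "integral ?P (\<lambda>x. f (x + t)) = integral ?P f" if t: "t \<in> box (-1) 1" for t
  proof (rule integral_cbox_shift[OF cont(1) zero])
    have "-1 < t $ i \<and> t $ i < 1" for i using t by (simp add: mem_box_cart)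
    then have "0 \<le> 1 + t $ i" "t $ i \<le> 1" for i by (smt (verit))+
    then show "cbox a b \<subseteq> cbox (a - 1 + t) (b + 1 + t)" by (intro cbox_mono_cart) simp_all
  qed (use cbox_subset_margin in auto)
  have "((\<lambda>t. integral ?P f) has_derivative (\<lambda>h. integral ?P g \<bullet> h)) (at 0)"
    by (rule has_derivative_transform_within_open[OF deriv, of "box (-1) 1"])
      (use const in \<open>auto simp: mem_box_cart\<close>)
  from has_derivative_unique[OF this has_derivative_const]
  have "integral ?P g \<bullet> integral ?P g = 0" by metis
  moreover have "integral ?P g = integral (cbox a b) g"
    by (rule integral_cbox_superset[OF has_grad_continuous_grad[OF f]
        has_grad_zero_outside[OF f closed_cbox zero] cbox_subset_margin])
  ultimately show ?thesis by simp
qed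

lemma integral_component:
  fixes g :: "'a::euclidean_space \<Rightarrow> 'b::euclidean_space^'n"
  shows "continuous_on (cbox a b) g \<Longrightarrow> integral (cbox a b) (\<lambda>x. g x $ j) = integral (cbox a b) g $ j"
  using integral_linear[OF integrable_continuous bounded_linear_vec_nth] by (simp add: o_def)

lemma integral_by_parts:
  fixes f :: "real^'n \<Rightarrow> real"
  assumes f: "has_grad f f'" and z: "has_grad z z'" and zero: "\<And>x. x \<notin> cbox a b \<Longrightarrow> z x = 0"
  shows "integral (cbox a b) (\<lambda>x. f' x $ j * z x) = - integral (cbox a b) (\<lambda>x. f x * z' x $ j)"
proof -
  note cont = has_grad_continuous[OF f] has_grad_continuous[OF z]
    has_grad_continuous_grad[OF f] has_grad_continuous_grad[OF z]
  have "integral (cbox a b) (\<lambda>x. f x *\<^sub>R z' x + z x *\<^sub>R f' x) = 0"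
    by (rule integral_grad_eq_0[OF has_grad_mult[OF f z]]) (use zero in auto)
  then have "integral (cbox a b) (\<lambda>x. (f x *\<^sub>R z' x + z x *\<^sub>R f' x) $ j) = 0"
    by (subst integral_component) (auto intro!: continuous_intros cont)
  moreover have "integral (cbox a b) (\<lambda>x. f x * z' x $ j + f' x $ j * z x)
      = integral (cbox a b) (\<lambda>x. f x * z' x $ j) + integral (cbox a b) (\<lambda>x. f' x $ j * z x)"
    by (intro integral_add integrable_continuous continuous_intros cont)
  ultimately show ?thesis by (simp add: mult.commute)
qed

lemma integral_inner_divergence_free:
  fixes a :: "real^'n \<Rightarrow> real"
  assumes a: "has_grad a a'" and X: "\<And>i. has_grad (\<lambda>x. X x $ i) (G i)"
    and div: "\<And>x. (\<Sum>i\<in>UNIV. G i x $ i) = 0" and zero: "\<And>x. x \<notin> cbox p q \<Longrightarrow> X x = 0"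
  shows "integral (cbox p q) (\<lambda>x. a' x \<bullet> X x) = 0"
proof -
  note cont = has_grad_continuous[OF a] has_grad_continuous_grad[OF a]
    has_grad_continuous[OF X] has_grad_continuous_grad[OF X]
  have "integral (cbox p q) (\<lambda>x. a' x \<bullet> X x) = (\<Sum>i\<in>UNIV. integral (cbox p q) (\<lambda>x. a' x $ i * X x $ i))"
    unfolding inner_vec_def inner_real_def
    by (intro integral_sum integrable_continuous continuous_intros cont) auto
  also have "\<dots> = - (\<Sum>i\<in>UNIV. integral (cbox p q) (\<lambda>x. a x * G i x $ i))"
    unfolding sum_negf[symmetric] by (intro sum.cong integral_by_parts[OF a X] refl) (simp add: zero)
  also have "(\<Sum>i\<in>UNIV. integral (cbox p q) (\<lambda>x. a x * G i x $ i))
      = integral (cbox p q) (\<lambda>x. \<Sum>i\<in>UNIV. a x * G i x $ i)"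
    by (intro integral_sum[symmetric] integrable_continuous continuous_intros cont) auto
  finally show ?thesis by (simp add: div flip: sum_distrib_left)
qed

section \<open>A radial smooth kernel\<close>

definition flat_exp :: "real poly \<Rightarrow> real \<Rightarrow> real" where
  "flat_exp p t = (if t > 0 then poly p (1 / t) * exp (- 1 / t) else 0)"

definition flat_deriv :: "real poly \<Rightarrow> real poly" where
  "flat_deriv p = [:0, 0, 1:] * (p - pderiv p)"

lemma poly_times_exp_minus_tendsto_0: "((\<lambda>x. poly p x * exp (- x)) \<longlongrightarrow> (0::real)) at_top"
proof -
  have "((\<lambda>x. (\<Sum>i\<le>degree p. coeff p i * (x^i / exp x))) \<longlongrightarrow> (\<Sum>i\<le>degree p. coeff p i * 0)) at_top"
    by (intro tendsto_sum tendsto_mult tendsto_const tendsto_power_div_exp_0)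
  moreover have "(\<lambda>x. (\<Sum>i\<le>degree p. coeff p i * (x^i / exp x))) = (\<lambda>x. poly p x * exp (- x))"
    by (auto simp: poly_altdef sum_distrib_right sum_divide_distrib exp_minus field_simps)
  ultimately show ?thesis by simp
qed

lemma flat_exp_deriv_0: "(flat_exp p has_real_derivative 0) (at 0)"
proof -
  have "((\<lambda>h. poly (pCons 0 p) (inverse h) * exp (- inverse h)) \<longlongrightarrow> 0) (at_right (0::real))"
    by (rule filterlim_compose[OF poly_times_exp_minus_tendsto_0 filterlim_inverse_at_top_right])
  then have right: "((\<lambda>h. flat_exp p h / h) \<longlongrightarrow> 0) (at_right 0)"
    by (rule Lim_transform_eventually, intro eventually_at_right_less[THEN eventually_mono])
      (simp add: flat_exp_def divide_inverse)
  have left: "((\<lambda>h. flat_exp p h / h) \<longlongrightarrow> 0) (at_left 0)"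
    by (rule Lim_transform_eventually[OF tendsto_const], rule eventually_at_leftI[of "-1"])
      (simp_all add: flat_exp_def)
  have "((\<lambda>h. flat_exp p h / h) \<longlongrightarrow> 0) (at 0)"
    using left right filterlim_split_at by blast
  then show ?thesis by (simp add: DERIV_def flat_exp_def)
qed

lemma flat_exp_deriv: "(flat_exp p has_real_derivative flat_exp (flat_deriv p) t) (at t)"
proof -
  consider (neg) "t < 0" | (pos) "t > 0" | (zero) "t = 0" by linarith
  then show ?thesis
  proof cases
    case neg
    have "(flat_exp p has_real_derivative 0) (at t)"
      by (rule DERIV_cong_ev[THEN iffD1, OF refl _ refl DERIV_const[of 0]])
        (use neg in \<open>auto simp: flat_exp_def intro!: eventually_mono[OF eventually_nhds_in_open[of "{..<0}"]]\<close>)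
    then show ?thesis using neg by (simp add: flat_exp_def)
  next
    case pos
    have "((\<lambda>t. poly p (1 / t) * exp (- 1 / t)) has_real_derivative
        (poly (pderiv p) (1 / t) * (- 1 / t^2)) * exp (- 1 / t) + (exp (- 1 / t) * (1 / t^2)) * poly p (1 / t)) (at t)"
      using pos by (auto intro!: derivative_eq_intros DERIV_chain'[OF _ poly_DERIV] simp: power2_eq_square field_simps)
    then have "((\<lambda>t. poly p (1 / t) * exp (- 1 / t)) has_real_derivative flat_exp (flat_deriv p) t) (at t)"
      using pos by (simp add: flat_exp_def flat_deriv_def power2_eq_square field_simps)
    then show ?thesis
      by (rule DERIV_cong_ev[THEN iffD1, rotated -1])
        (use pos in \<open>auto simp: flat_exp_def intro!: eventually_mono[OF eventually_nhds_in_open[of "{0<..}"]]\<close>)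
  next
    case zero
    then show ?thesis using flat_exp_deriv_0 by (simp add: flat_exp_def)
  qed
qed

lemma continuous_on_flat_exp: "continuous_on UNIV (flat_exp p)"
  using flat_exp_deriv by (metis DERIV_isCont continuous_at_imp_continuous_on)

lemma flat_exp_sq_le:
  assumes "t \<le> 1"
  shows "(flat_exp (flat_deriv (flat_deriv 1)) t)^2 \<le> 720 * flat_exp (flat_deriv 1) t"
proof (cases "t > 0")
  case True
  define x where "x = 1 / t"
  have x: "x \<ge> 1" using True assms by (simp add: x_def)
  have poly: "poly (flat_deriv (flat_deriv 1)) x = x^2 * (x^2 - 2 * x)" "poly (flat_deriv 1) x = x^2"
    by (simp_all add: flat_deriv_def pderiv_pCons power2_eq_square algebra_simps)
  have "\<bar>x^2 - 2 * x\<bar> \<le> x^2"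
    using x mult_left_mono[of 1 x x] by (simp add: abs_le_iff power2_eq_square)
  then have "(x^2 - 2 * x)^2 \<le> (x^2)^2" using abs_le_square_iff[of "x^2 - 2 * x" "x^2"] by simp
  then have "x^2 * (x^2 - 2 * x)^2 \<le> x^2 * (x^2)^2" by (rule mult_left_mono) simp
  also have "\<dots> \<le> 720 * exp x"
  proof -
    have "(\<Sum>k\<in>{6}. x^k /\<^sub>R fact k) \<le> (\<Sum>k. x^k /\<^sub>R fact k)"
      using x summable_exp_generic[of x] by (intro sum_le_suminf) (auto intro!: divide_nonneg_nonneg)
    then show ?thesis by (simp add: exp_def fact_numeral flip: power_mult power_add)
  qed
  finally have "x^2 * (x^2 * (x^2 - 2 * x)^2) * (exp (- x))^2 \<le> x^2 * (720 * exp x) * (exp (- x))^2"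
    by (intro mult_right_mono mult_left_mono) auto
  also have "\<dots> = 720 * (x^2 * exp (- x))" by (simp add: power2_eq_square exp_minus)
  finally have "(x^2 * (x^2 - 2 * x) * exp (- x))^2 \<le> 720 * (x^2 * exp (- x))"
    by (simp add: power2_eq_square mult_ac)
  then show ?thesis
    using True poly[unfolded x_def] by (simp add: flat_exp_def x_def)
qed (simp add: flat_exp_def)

lemma flat_exp_le_2: "flat_exp (flat_deriv 1) t \<le> 2"
proof (cases "t > 0")
  case True
  define x where "x = 1 / t"
  have x: "x \<ge> 0" using True by (simp add: x_def)
  have "x^2 \<le> 2 * exp x" using exp_lower_Taylor_quadratic[OF x] x by simp
  then have "x^2 * exp (- x) \<le> 2" by (simp add: exp_minus field_simps)
  then show ?thesis using True by (simp add: flat_exp_def flat_deriv_def x_def power2_eq_square)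
qed (simp add: flat_exp_def)

abbreviation unit_cube :: "(real^3) set" where "unit_cube \<equiv> cbox (-1) 1"

definition bump_mass :: real where
  "bump_mass = integral unit_cube (\<lambda>y. flat_exp (flat_deriv 1) (1 - y \<bullet> y))"

definition bump :: "real^3 \<Rightarrow> real" where
  "bump y = flat_exp (flat_deriv 1) (1 - y \<bullet> y) / bump_mass"

definition grad_bump :: "real^3 \<Rightarrow> real^3" where
  "grad_bump y = (- 2 * flat_exp (flat_deriv (flat_deriv 1)) (1 - y \<bullet> y) / bump_mass) *\<^sub>R y"

definition hess_bump :: "3 \<Rightarrow> real^3 \<Rightarrow> real^3" where
  "hess_bump i y = (- 2 / bump_mass) *\<^sub>R (flat_exp (flat_deriv (flat_deriv 1)) (1 - y \<bullet> y) *\<^sub>R axis i 1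
    - (2 * flat_exp (flat_deriv (flat_deriv (flat_deriv 1))) (1 - y \<bullet> y) * y $ i) *\<^sub>R y)"

definition bump_potential :: "real^3 \<Rightarrow> real" where
  "bump_potential y = flat_exp 1 (1 - y \<bullet> y) / (2 * bump_mass)"

definition bump_max :: real where "bump_max = 2 / bump_mass"

definition bump_slope :: real where "bump_slope = 2880 / bump_mass"

lemma has_grad_flat_exp_ball:
  "has_grad (\<lambda>y. flat_exp p (1 - y \<bullet> y)) (\<lambda>y. (- 2 * flat_exp (flat_deriv p) (1 - y \<bullet> y)) *\<^sub>R y)"
proof -
  have "has_grad (\<lambda>y. 1 - y \<bullet> y) (\<lambda>y. - 2 *\<^sub>R y)"
    unfolding has_grad_def
    by (auto intro!: continuous_intros derivative_eq_intros simp: inner_commute)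
  from has_grad_real_compose[OF this flat_exp_deriv continuous_on_flat_exp]
  show ?thesis by (rule has_grad_cong) (auto simp: mult.commute)
qed

lemma bump_mass_pos: "bump_mass > 0"
proof -
  let ?f = "\<lambda>y::real^3. flat_exp (flat_deriv 1) (1 - y \<bullet> y)"
  have cont: "continuous_on unit_cube ?f"
    by (rule has_grad_continuous[OF has_grad_flat_exp_ball])
  have nonneg: "?f y \<ge> 0" for y by (simp add: flat_exp_def flat_deriv_def)
  have "bump_mass \<noteq> 0"
  proof
    assume "bump_mass = 0"
    then have "(?f has_integral 0) unit_cube"
      using integrable_integral[OF integrable_continuous[OF cont]] by (simp add: bump_mass_def)
    then have "?f 0 = 0"
      by (intro has_integral_0_cbox_imp_0[OF cont])
        (auto simp: mem_box_cart interval_ne_empty_cart nonneg)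
    then show False by (simp add: flat_exp_def flat_deriv_def)
  qed
  moreover have "bump_mass \<ge> 0"
    unfolding bump_mass_def by (intro integral_nonneg integrable_continuous cont nonneg)
  ultimately show ?thesis by simp
qed

lemma bump_max_pos: "bump_max > 0" and bump_slope_pos: "bump_slope > 0"
  using bump_mass_pos by (simp_all add: bump_max_def bump_slope_def)

lemma has_grad_bump: "has_grad bump grad_bump"
  using has_grad_cmult[OF has_grad_flat_exp_ball, of "1 / bump_mass"]
  by (rule has_grad_cong) (auto simp: bump_def grad_bump_def)

lemma has_grad_bump_potential: "has_grad bump_potential (\<lambda>y. - bump y *\<^sub>R y)"
  using has_grad_cmult[OF has_grad_flat_exp_ball, of "1 / (2 * bump_mass)"]
  by (rule has_grad_cong) (auto simp: bump_def bump_potential_def)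

lemma has_grad_grad_bump: "has_grad (\<lambda>y. grad_bump y $ i) (hess_bump i)"
  using has_grad_cmult[OF has_grad_mult[OF has_grad_flat_exp_ball has_grad_coord[of i]], of "- 2 / bump_mass"]
  by (rule has_grad_cong) (auto simp: grad_bump_def hess_bump_def algebra_simps)

lemma hess_bump_sym: "hess_bump i y $ j = hess_bump j y $ i"
  by (auto simp: hess_bump_def axis_def)

lemma continuous_on_bump:
  "continuous_on S bump" "continuous_on S grad_bump"
  using has_grad_continuous[OF has_grad_bump] has_grad_continuous_grad[OF has_grad_bump] .

lemma bump_nonneg: "bump y \<ge> 0"
  using bump_mass_pos by (simp add: bump_def flat_exp_def flat_deriv_def)

lemma bump_le_max: "bump y \<le> bump_max"
  using bump_mass_pos flat_exp_le_2 by (simp add: bump_def bump_max_def divide_right_mono)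

lemma norm_le_1_if_bump_nonzero:
  assumes "bump y \<noteq> 0 \<or> grad_bump y \<noteq> 0"
  shows "norm y \<le> 1"
proof -
  have "0 < 1 - y \<bullet> y"
    using assms by (auto simp: bump_def grad_bump_def flat_exp_def split: if_splits)
  then have "(norm y)^2 \<le> 1^2" by (simp add: dot_square_norm)
  then show ?thesis by (rule power2_le_imp_le) simp
qed

lemma norm_le_1_imp_unit_cube: "norm y \<le> 1 \<Longrightarrow> y \<in> unit_cube"
  using component_le_norm_cart[of y] unfolding mem_box_cart abs_le_iff
  by (auto intro: order_trans) (smt (verit))

lemma bump_outside_cube:
  assumes "y \<notin> unit_cube"
  shows "bump y = 0" "grad_bump y = 0" "bump_potential y = 0"
proof -
  have "norm y > 1" using assms norm_le_1_imp_unit_cube[of y] by linarith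
  then have "1 - y \<bullet> y \<le> 0" by (simp add: dot_square_norm)
  then show "bump y = 0" "grad_bump y = 0" "bump_potential y = 0"
    by (auto simp: bump_def grad_bump_def bump_potential_def flat_exp_def)
qed

lemma norm_bump_scaleR_le: "norm (bump y *\<^sub>R y) \<le> bump y"
proof (cases "bump y = 0")
  case False
  then have "norm y \<le> 1" using norm_le_1_if_bump_nonzero by blast
  then show ?thesis using bump_nonneg[of y] by (simp add: mult_left_le)
qed simp

lemma norm_grad_bump_sq_le: "(norm (grad_bump y))^2 \<le> bump_slope * bump y"
proof (cases "grad_bump y = 0")
  case True
  then show ?thesis using bump_slope_pos bump_nonneg[of y] by simp
next
  case False
  define t where "t = 1 - y \<bullet> y"
  let ?e = "flat_exp (flat_deriv (flat_deriv 1)) t"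
  have "(norm y)^2 \<le> 1" using norm_le_1_if_bump_nonzero[of y] False by (simp add: power_le_one)
  moreover have "(norm (grad_bump y))^2 = 4 * ?e^2 / bump_mass^2 * (norm y)^2"
    unfolding grad_bump_def t_def norm_scaleR power_mult_distrib real_norm_def power2_abs
    by (simp add: power_divide power_mult_distrib)
  ultimately have "(norm (grad_bump y))^2 \<le> 4 * ?e^2 / bump_mass^2"
    by (simp add: mult_left_le divide_right_mono)
  also have "\<dots> \<le> 4 * (720 * flat_exp (flat_deriv 1) t) / bump_mass^2"
    using flat_exp_sq_le[of t] by (intro divide_right_mono) (auto simp: t_def)
  finally show ?thesis by (simp add: bump_slope_def bump_def t_def power2_eq_square)
qed

lemma has_integral_bump: "(bump has_integral 1) unit_cube"
proof -
  have "integral unit_cube bump = 1"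
    using bump_mass_pos unfolding bump_def by (simp add: integral_divide bump_mass_def[symmetric])
  then show ?thesis
    using integrable_integral[OF integrable_continuous[OF continuous_on_bump(1)]] by metis
qed

lemma integral_bump: "integral unit_cube bump = 1"
  using has_integral_bump by (rule integral_unique)

lemma integral_grad_bump: "integral unit_cube grad_bump = 0"
  by (rule integral_grad_eq_0[OF has_grad_bump]) (simp add: bump_outside_cube)

lemma has_integral_bump_moment: "((\<lambda>y. bump y *\<^sub>R y) has_integral 0) unit_cube"
proof -
  have "integral unit_cube (\<lambda>y. - bump y *\<^sub>R y) = 0"
    by (rule integral_grad_eq_0[OF has_grad_bump_potential]) (simp add: bump_outside_cube)
  then show ?thesis
    using integrable_integral[OF integrable_continuous, of "-1" 1 "\<lambda>y. bump y *\<^sub>R y"]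
    by (simp add: continuous_intros continuous_on_bump)
qed

section \<open>Mollification\<close>

lemma Cauchy_Schwarz_of_nonneg_quadratic:
  fixes a b c :: real
  assumes "\<And>t. 0 \<le> a + 2 * t * b + t^2 * c" "0 \<le> c"
  shows "b^2 \<le> a * c"
proof (cases "c = 0")
  case True
  have "b = 0"
  proof (rule ccontr)
    assume "b \<noteq> 0"
    then show False using assms(1)[of "- (a + 1) / (2 * b)"] True by (simp add: field_simps)
  qed
  then show ?thesis using True by simp
next
  case False
  then have "c > 0" using assms(2) by simp
  then have "0 \<le> (a + 2 * (- b / c) * b + (- b / c)^2 * c) * c"
    by (intro mult_nonneg_nonneg assms(1)) simp
  also have "\<dots> = a * c - b^2" using False by (simp add: field_simps power2_eq_square)
  finally show ?thesis by simp
qed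

lemma integral_Cauchy_Schwarz_cbox:
  fixes f g :: "'a::euclidean_space \<Rightarrow> real"
  assumes f: "continuous_on (cbox a b) f" and g: "continuous_on (cbox a b) g"
  shows "(integral (cbox a b) (\<lambda>x. f x * g x))^2
    \<le> integral (cbox a b) (\<lambda>x. (f x)^2) * integral (cbox a b) (\<lambda>x. (g x)^2)"
proof (rule Cauchy_Schwarz_of_nonneg_quadratic)
  fix t :: real
  have "integral (cbox a b) (\<lambda>x. (f x + t * g x)^2)
      = integral (cbox a b) (\<lambda>x. (f x)^2 + (2 * t * (f x * g x) + t^2 * (g x)^2))"
    by (simp add: power2_sum power_mult_distrib mult_ac add_ac)
  also have "\<dots> = integral (cbox a b) (\<lambda>x. (f x)^2)
      + (2 * t * integral (cbox a b) (\<lambda>x. f x * g x) + t^2 * integral (cbox a b) (\<lambda>x. (g x)^2))"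
    by (subst integral_add integral_add; (intro integrable_continuous continuous_intros f g)?)+ simp
  finally show "0 \<le> integral (cbox a b) (\<lambda>x. (f x)^2) + 2 * t * integral (cbox a b) (\<lambda>x. f x * g x)
      + t^2 * integral (cbox a b) (\<lambda>x. (g x)^2)"
    using integral_nonneg[of "\<lambda>x. (f x + t * g x)^2" "cbox a b"] f g
    by (simp add: integrable_continuous continuous_intros add_ac)
qed (auto intro!: integral_nonneg integrable_continuous continuous_intros g)

lemma integral_sq_le:
  fixes f :: "'a::euclidean_space \<Rightarrow> real"
  assumes "continuous_on (cbox a b) f"
  shows "(integral (cbox a b) f)^2 \<le> measure lborel (cbox a b) * integral (cbox a b) (\<lambda>x. (f x)^2)"
  using integral_Cauchy_Schwarz_cbox[OF continuous_on_const assms, of 1] by simp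

definition mollify :: "real \<Rightarrow> (real^3 \<Rightarrow> 'b::euclidean_space) \<Rightarrow> real^3 \<Rightarrow> 'b" where
  "mollify r f x = integral unit_cube (\<lambda>y. bump y *\<^sub>R f (x + r *\<^sub>R y))"

lemma mollify_integrable:
  fixes f :: "real^3 \<Rightarrow> 'b::euclidean_space"
  assumes "continuous_on UNIV f"
  shows "(\<lambda>y. bump y *\<^sub>R f (x + r *\<^sub>R y)) integrable_on unit_cube"
  by (intro integrable_continuous continuous_intros continuous_on_UNIV_compose[OF assms] continuous_on_bump)

lemma continuous_on_mollify_joint:
  assumes "continuous_on UNIV f" "continuous_on S p" "continuous_on S q"
  shows "continuous_on S (\<lambda>x. mollify (p x) f (q x))"
proof -
  have "continuous_on UNIV (\<lambda>z. mollify (fst z) f (snd z))"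
    unfolding mollify_def
    by (rule integral_continuous_on_param)
      (auto simp: split_beta intro!: continuous_intros continuous_on_UNIV_compose[OF assms(1)]
        continuous_on_UNIV_compose[OF continuous_on_bump(1)])
  from continuous_on_UNIV_compose[OF this continuous_on_Pair[OF assms(2,3)]] show ?thesis by simp
qed

lemma continuous_on_mollify: "continuous_on UNIV f \<Longrightarrow> continuous_on S (mollify r f)"
  by (rule continuous_on_mollify_joint[OF _ continuous_on_const continuous_on_id, unfolded id_def])

lemma mollify_linear:
  fixes f :: "real^3 \<Rightarrow> 'b::euclidean_space" and L :: "'b \<Rightarrow> 'c::euclidean_space"
  assumes "continuous_on UNIV f" "bounded_linear L"
  shows "L (mollify r f x) = mollify r (\<lambda>x. L (f x)) x"
  using integral_linear[OF mollify_integrable[OF assms(1)] assms(2), of x r]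
    linear_cmul[OF bounded_linear.linear[OF assms(2)]]
  by (simp add: mollify_def o_def)

lemma mollify_nth: "continuous_on UNIV f \<Longrightarrow> mollify r f x $ j = mollify r (\<lambda>x. f x $ j) x"
  by (rule mollify_linear[OF _ bounded_linear_vec_nth])

lemma mollify_diff:
  assumes "continuous_on UNIV f" "continuous_on UNIV g"
  shows "mollify r (\<lambda>x. f x - g x) x = mollify r f x - mollify r g x"
  using integral_diff[OF mollify_integrable[OF assms(1)] mollify_integrable[OF assms(2)]]
  by (simp add: mollify_def scaleR_diff_right)

lemma mollify_const: "mollify r (\<lambda>x. c) x = c"
  using has_integral_scaleR_left[OF has_integral_bump, of c] by (simp add: mollify_def integral_unique)

lemma mollify_cong: "(\<And>y. y \<in> unit_cube \<Longrightarrow> f (x + r *\<^sub>R y) = g (x + r *\<^sub>R y)) \<Longrightarrow> mollify r f x = mollify r g x"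
  unfolding mollify_def by (intro integral_cong) simp

lemma mollify_0: "mollify 0 f x = f x"
  using mollify_const[of 0 "f x" x] by (simp add: mollify_def)

lemma mollify_mono:
  fixes f g :: "real^3 \<Rightarrow> real"
  assumes "continuous_on UNIV f" "continuous_on UNIV g" "\<And>y. y \<in> unit_cube \<Longrightarrow> f (x + r *\<^sub>R y) \<le> g (x + r *\<^sub>R y)"
  shows "mollify r f x \<le> mollify r g x"
  unfolding mollify_def
  by (rule integral_le[OF mollify_integrable[OF assms(1)] mollify_integrable[OF assms(2)]])
    (auto intro!: mult_left_mono assms bump_nonneg)

lemma norm_mollify_le:
  assumes "continuous_on UNIV f"
  shows "norm (mollify r f x) \<le> mollify r (\<lambda>x. norm (f x)) x"
  unfolding mollify_def
  by (rule integral_norm_bound_integral[OF mollify_integrable[OF assms]])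
    (use mollify_integrable[OF continuous_on_norm[OF assms]] bump_nonneg in auto)

lemma norm_mollify_diff_le:
  assumes "continuous_on UNIV f" "\<And>y. y \<in> unit_cube \<Longrightarrow> norm (f (x + r *\<^sub>R y) - c) \<le> e"
  shows "norm (mollify r f x - c) \<le> e"
proof -
  have "mollify r f x - c = mollify r (\<lambda>x. f x - c) x"
    by (simp add: mollify_diff[OF assms(1)] mollify_const)
  also have "norm \<dots> \<le> mollify r (\<lambda>x. norm (f x - c)) x"
    by (intro norm_mollify_le continuous_intros assms)
  also have "\<dots> \<le> mollify r (\<lambda>x. e) x"
    by (intro mollify_mono continuous_intros assms)
  finally show ?thesis by (simp add: mollify_const)
qed

text \<open>Jensen's inequality, from the nonnegativity of the variance.\<close>

lemma norm_mollify_sq_le: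
  assumes f: "continuous_on UNIV f"
  shows "(norm (mollify r f x))^2 \<le> mollify r (\<lambda>x. (norm (f x))^2) x"
proof -
  define m where "m = mollify r (\<lambda>x. norm (f x)) x"
  have cont: "continuous_on UNIV (\<lambda>x. norm (f x))" by (intro continuous_intros f)
  have "mollify r (\<lambda>x. 0) x \<le> mollify r (\<lambda>x. (norm (f x) - m)^2) x"
    by (intro mollify_mono continuous_intros f) auto
  also have "(\<lambda>x. (norm (f x) - m)^2) = (\<lambda>x. (norm (f x))^2 - ((2 * m) *\<^sub>R norm (f x) - m^2))"
    by (auto simp: power2_eq_square algebra_simps)
  also have "mollify r \<dots> x = mollify r (\<lambda>x. (norm (f x))^2) x - ((2 * m) *\<^sub>R m - m^2)"
    using mollify_linear[OF cont bounded_linear_scaleR_right, of "2 * m" r x]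
    by (subst mollify_diff mollify_diff; (intro continuous_intros f)?)+ (simp add: mollify_const m_def)
  finally have "m^2 \<le> mollify r (\<lambda>x. (norm (f x))^2) x"
    by (simp add: mollify_const power2_eq_square)
  moreover have "(norm (mollify r f x))^2 \<le> m^2"
    unfolding m_def by (intro power_mono norm_mollify_le f) auto
  ultimately show ?thesis by simp
qed

lemma mollify_outside:
  assumes "\<And>x. x \<notin> cbox p q \<Longrightarrow> f x = 0" "x \<notin> cbox (p - 1) (q + 1)" "0 \<le> r" "r \<le> 1"
  shows "mollify r f x = 0"
proof -
  have "f (x + r *\<^sub>R y) = 0" if y: "y \<in> unit_cube" for y
  proof (rule assms(1))
    obtain i where i: "\<not> (p $ i - 1 \<le> x $ i \<and> x $ i \<le> q $ i + 1)"
      using assms(2) by (auto simp: mem_box_cart)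
    have "\<bar>y $ i\<bar> \<le> 1" using y by (auto simp: mem_box_cart abs_le_iff minus_le_iff)
    then have "\<bar>r * y $ i\<bar> \<le> 1" using assms(3,4) by (simp add: abs_mult mult_le_one)
    then have "\<not> (p $ i \<le> x $ i + r * y $ i \<and> x $ i + r * y $ i \<le> q $ i)" using i by linarith
    then show "x + r *\<^sub>R y \<notin> cbox p q" by (auto simp: mem_box_cart intro!: exI[of _ i])
  qed
  then have "mollify r f x = mollify r (\<lambda>x. 0) x" by (intro mollify_cong) auto
  then show ?thesis by (simp add: mollify_const)
qed

lemma has_grad_mollify:
  assumes "has_grad f g"
  shows "has_grad (mollify r f) (mollify r g)"
proof -
  note cont = has_grad_continuous[OF assms, of UNIV] has_grad_continuous_grad[OF assms, of UNIV]
  have "has_grad (\<lambda>x. integral unit_cube (\<lambda>y. bump y * f (x + r *\<^sub>R y)))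
      (\<lambda>x. integral unit_cube (\<lambda>y. bump y *\<^sub>R g (x + r *\<^sub>R y)))"
  proof (rule has_grad_integral)
    fix x y
    show "((\<lambda>x. bump y * f (x + r *\<^sub>R y)) has_derivative (\<lambda>h. (bump y *\<^sub>R g (x + r *\<^sub>R y)) \<bullet> h)) (at x)"
      using has_gradD[OF has_grad_cmult[OF has_grad_affine[OF assms, of "r *\<^sub>R y" 1]], of "bump y" x]
      by (simp add: add.commute)
  qed (auto simp: split_beta intro!: continuous_intros continuous_on_UNIV_compose[OF cont(1)]
      continuous_on_UNIV_compose[OF cont(2)] continuous_on_UNIV_compose[OF continuous_on_bump(1)])
  then show ?thesis by (rule has_grad_cong) (auto simp: mollify_def)
qed

definition grad_mollify :: "real \<Rightarrow> (real^3 \<Rightarrow> real) \<Rightarrow> real^3 \<Rightarrow> real^3" where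
  "grad_mollify r f x = (- 1 / r) *\<^sub>R integral unit_cube (\<lambda>y. f (x + r *\<^sub>R y) *\<^sub>R grad_bump y)"

lemma mollify_translate:
  assumes f: "continuous_on UNIV f" and r: "r > 0" and h: "norm h < r"
  shows "mollify r f (x + h) = integral (cbox (-2) 2) (\<lambda>y. bump (y - (1 / r) *\<^sub>R h) *\<^sub>R f (x + r *\<^sub>R y))"
proof -
  let ?w = "\<lambda>y. bump y *\<^sub>R f (x + h + r *\<^sub>R y)"
  have cont: "continuous_on UNIV ?w"
    by (intro continuous_intros continuous_on_UNIV_compose[OF f] continuous_on_bump)
  have sub: "unit_cube \<subseteq> cbox (-2) 2" by (rule cbox_mono_cart) auto
  have hr: "-1 < h $ i / r \<and> h $ i / r < 1" for i
    using h component_le_norm_cart[of h i] r by (simp add: field_simps) linarith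
  have "integral (cbox (-2) 2) (\<lambda>y. ?w (y + (- (1 / r) *\<^sub>R h))) = integral (cbox (-2) 2) ?w"
  proof (rule integral_cbox_shift[OF cont])
    show "unit_cube \<subseteq> cbox (- 2 + - (1 / r) *\<^sub>R h) (2 + - (1 / r) *\<^sub>R h)"
    proof (rule cbox_mono_cart)
      fix i show "(- 2 + - (1 / r) *\<^sub>R h) $ i \<le> (-1) $ i" "1 $ i \<le> (2 + - (1 / r) *\<^sub>R h) $ i"
        using hr[of i] by auto
    qed
  qed (simp_all add: bump_outside_cube sub)
  also have "\<dots> = integral unit_cube ?w"
    by (rule integral_cbox_superset[OF continuous_on_UNIV_subset[OF cont]])
      (simp_all add: bump_outside_cube sub)
  finally show ?thesis using r by (simp add: mollify_def algebra_simps)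
qed

lemma has_grad_mollify_continuous:
  assumes f: "continuous_on UNIV f" and r: "r > 0"
  shows "has_grad (mollify r f) (grad_mollify r f)"
  unfolding has_grad_def
proof (intro conjI allI)
  have "continuous_on UNIV (\<lambda>x. integral unit_cube (\<lambda>y. f (x + r *\<^sub>R y) *\<^sub>R grad_bump y))"
    by (intro integral_continuous_on_param)
      (auto simp: split_beta intro!: continuous_intros continuous_on_UNIV_compose[OF f]
        continuous_on_UNIV_compose[OF continuous_on_bump(2)])
  then show "continuous_on UNIV (grad_mollify r f)"
    unfolding grad_mollify_def by (intro continuous_intros)
  fix x
  let ?G = "\<lambda>h y. (- 1 / r * f (x + r *\<^sub>R y)) *\<^sub>R grad_bump (y - (1 / r) *\<^sub>R h)"
  have "has_grad (\<lambda>h. integral (cbox (-2) 2) (\<lambda>y. bump (y - (1 / r) *\<^sub>R h) * f (x + r *\<^sub>R y)))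
      (\<lambda>h. integral (cbox (-2) 2) (?G h))"
  proof (rule has_grad_integral)
    fix h y
    show "((\<lambda>h. bump (y - (1 / r) *\<^sub>R h) * f (x + r *\<^sub>R y)) has_derivative (\<lambda>w. ?G h y \<bullet> w)) (at h)"
      using has_gradD[OF has_grad_cmult[OF has_grad_affine[OF has_grad_bump, of y "- 1 / r"], of "f (x + r *\<^sub>R y)"], of h]
      by (simp add: mult_ac)
  qed (use r in \<open>auto simp: split_beta intro!: continuous_intros continuous_on_UNIV_compose[OF f]
      continuous_on_UNIV_compose[OF continuous_on_bump(1)] continuous_on_UNIV_compose[OF continuous_on_bump(2)]\<close>)
  from has_gradD[OF this, of 0]
  have "((\<lambda>h. mollify r f (x + h)) has_derivative (\<lambda>w. integral (cbox (-2) 2) (?G 0) \<bullet> w)) (at 0)"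
    by (rule has_derivative_transform_within_open[of _ _ _ _ "ball 0 r"])
      (use r in \<open>auto simp: mollify_translate[OF f r]\<close>)
  also have "integral (cbox (-2) 2) (?G 0) = integral unit_cube (?G 0)"
    by (rule integral_cbox_superset[OF _ _ cbox_mono_cart])
      (auto simp: bump_outside_cube r[THEN less_imp_neq, symmetric]
        intro!: continuous_intros continuous_on_UNIV_compose[OF f] continuous_on_bump)
  also have "\<dots> = grad_mollify r f x"
    unfolding grad_mollify_def integral_cmul[symmetric] by simp
  finally have "((\<lambda>h. mollify r f (x + h)) has_derivative (\<lambda>w. grad_mollify r f x \<bullet> w)) (at 0)" .
  moreover have "((\<lambda>z. z - x) has_derivative (\<lambda>w. w)) (at x)"
    by (auto intro!: derivative_eq_intros)
  ultimately show "(mollify r f has_derivative (\<lambda>h. grad_mollify r f x \<bullet> h)) (at x)"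
    using has_derivative_compose[of "\<lambda>z. z - x" "\<lambda>w. w" x UNIV "\<lambda>h. mollify r f (x + h)"] by simp
qed

lemma grad_mollify_nth:
  assumes "continuous_on UNIV f"
  shows "grad_mollify r f x $ i = (- 1 / r) * integral unit_cube (\<lambda>y. f (x + r *\<^sub>R y) * grad_bump y $ i)"
  using integral_component[of "-1" 1 "\<lambda>y. f (x + r *\<^sub>R y) *\<^sub>R grad_bump y" i]
  by (simp add: grad_mollify_def continuous_intros continuous_on_UNIV_compose[OF assms] continuous_on_bump)

lemma grad_mollify_affine_combination:
  assumes f: "continuous_on UNIV f" and g: "continuous_on UNIV g"
  shows "grad_mollify r (\<lambda>x. a * f x + b * g x - c) x = a *\<^sub>R grad_mollify r f x + b *\<^sub>R grad_mollify r g x"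
proof -
  have h: "((\<lambda>y. u (x + r *\<^sub>R y) *\<^sub>R grad_bump y) has_integral
      integral unit_cube (\<lambda>y. u (x + r *\<^sub>R y) *\<^sub>R grad_bump y)) unit_cube" if "continuous_on UNIV u" for u
    by (intro integrable_integral integrable_continuous continuous_intros
        continuous_on_UNIV_compose[OF that] continuous_on_bump)
  have "((\<lambda>y. a *\<^sub>R (f (x + r *\<^sub>R y) *\<^sub>R grad_bump y) + b *\<^sub>R (g (x + r *\<^sub>R y) *\<^sub>R grad_bump y) - c *\<^sub>R grad_bump y)
      has_integral (a *\<^sub>R integral unit_cube (\<lambda>y. f (x + r *\<^sub>R y) *\<^sub>R grad_bump y)
        + b *\<^sub>R integral unit_cube (\<lambda>y. g (x + r *\<^sub>R y) *\<^sub>R grad_bump y) - c *\<^sub>R 0)) unit_cube"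
    using h[OF continuous_on_const, of 1] integral_grad_bump
    by (intro has_integral_add has_integral_diff has_integral_cmul h f g) simp
  from integral_unique[OF this] show ?thesis
    unfolding grad_mollify_def scaleR_scaleR[symmetric]
    by (simp add: scaleR_add_right scaleR_add_left scaleR_diff_left)
qed

lemma grad_mollify_sym:
  assumes f: "has_grad f g" and r: "r > 0"
  shows "grad_mollify r (\<lambda>x. g x $ j) x $ i = grad_mollify r (\<lambda>x. g x $ i) x $ j"
proof -
  have cont: "continuous_on UNIV (\<lambda>x. g x $ j)" for j
    by (intro continuous_intros has_grad_continuous_grad[OF f])
  have "r * integral unit_cube (\<lambda>y. g (x + r *\<^sub>R y) $ j * grad_bump y $ i)
      = - integral unit_cube (\<lambda>y. f (x + r *\<^sub>R y) * hess_bump i y $ j)" for i j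
    using integral_by_parts[OF has_grad_affine[OF f, of x r] has_grad_grad_bump[of i], of "-1" 1 j]
    by (simp add: bump_outside_cube mult.assoc)
  then have "r * integral unit_cube (\<lambda>y. g (x + r *\<^sub>R y) $ j * grad_bump y $ i)
      = r * integral unit_cube (\<lambda>y. g (x + r *\<^sub>R y) $ i * grad_bump y $ j)"
    by (simp add: hess_bump_sym[of i _ j])
  then show ?thesis using r by (simp add: grad_mollify_nth[OF cont])
qed

text \<open>The bump function satisfies \<open>\<bar>\<nabla>\<eta>\<bar>\<^sup>2 \<le> C \<eta>\<close>, so the gradient of a mollification is controlled
  by an average with the same kernel.\<close>

lemma norm_grad_mollify_sq_le:
  assumes f: "continuous_on UNIV f" and r: "r > 0"
  shows "(norm (grad_mollify r f x))^2 \<le> 8 * bump_slope / r^2 * mollify r (\<lambda>z. (f z - c)^2) x"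
proof -
  let ?w = "\<lambda>y. f (x + r *\<^sub>R y) - c"
  let ?v = "integral unit_cube (\<lambda>y. ?w y *\<^sub>R grad_bump y)"
  have cont: "continuous_on S ?w" for S by (intro continuous_on_UNIV_compose[OF f] continuous_intros)
  have vol: "measure lborel unit_cube = 8"
    by (subst content_cbox_cart) (auto simp: interval_ne_empty_cart prod_constant)
  have v: "grad_mollify r f x = (- 1 / r) *\<^sub>R ?v"
    using grad_mollify_affine_combination[OF f f, of r 1 0 c x] r by (simp add: grad_mollify_def)
  have "norm ?v \<le> integral unit_cube (\<lambda>y. \<bar>?w y\<bar> * norm (grad_bump y))"
    by (rule integral_norm_bound_integral) (auto intro!: integrable_continuous continuous_intros cont continuous_on_bump)
  then have "(norm ?v)^2 \<le> (integral unit_cube (\<lambda>y. \<bar>?w y\<bar> * norm (grad_bump y)))^2"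
    by (intro power_mono) auto
  also have "\<dots> \<le> 8 * integral unit_cube (\<lambda>y. (\<bar>?w y\<bar> * norm (grad_bump y))^2)"
    using integral_sq_le[of "-1" 1 "\<lambda>y. \<bar>?w y\<bar> * norm (grad_bump y)"]
    by (simp add: vol continuous_intros cont continuous_on_bump)
  also have "integral unit_cube (\<lambda>y. (\<bar>?w y\<bar> * norm (grad_bump y))^2)
      \<le> integral unit_cube (\<lambda>y. bump_slope * (bump y * (?w y)^2))"
  proof (intro integral_le integrable_continuous continuous_intros cont continuous_on_bump)
    fix y
    have "(?w y)^2 * (norm (grad_bump y))^2 \<le> (?w y)^2 * (bump_slope * bump y)"
      by (intro mult_left_mono norm_grad_bump_sq_le) auto
    then show "(\<bar>?w y\<bar> * norm (grad_bump y))^2 \<le> bump_slope * (bump y * (?w y)^2)"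
      by (simp add: power_mult_distrib mult_ac)
  qed (intro continuous_on_UNIV_compose[OF f] continuous_intros)+
  finally have "(norm ?v)^2 \<le> 8 * bump_slope * mollify r (\<lambda>z. (f z - c)^2) x"
    by (simp add: mollify_def)
  then have "(norm ?v)^2 / r^2 \<le> 8 * bump_slope * mollify r (\<lambda>z. (f z - c)^2) x / r^2"
    by (intro divide_right_mono) auto
  then show ?thesis unfolding v by (simp add: power_divide)
qed

section \<open>The cofactor of a gradient is divergence free\<close>

lemmas [continuous_intros] = continuous_on_cross

lemma integral_triple_product_grad_C2:
  assumes a: "has_grad a a'"
    and b: "\<And>j. has_grad (\<lambda>x. b' x $ j) (b'' j)" and b_sym: "\<And>i j x. b'' i x $ j = b'' j x $ i"
    and z: "\<And>j. has_grad (\<lambda>x. z' x $ j) (z'' j)" and z_sym: "\<And>i j x. z'' i x $ j = z'' j x $ i"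
    and zero: "\<And>x. x \<notin> cbox p q \<Longrightarrow> z' x = 0"
  shows "integral (cbox p q) (\<lambda>x. a' x \<bullet> cross3 (b' x) (z' x)) = 0"
proof (rule integral_inner_divergence_free[OF a])
  define H where "H i j = (\<lambda>x. (b' x $ i *\<^sub>R z'' j x + z' x $ j *\<^sub>R b'' i x)
    - (b' x $ j *\<^sub>R z'' i x + z' x $ i *\<^sub>R b'' j x))" for i j
  define G where "G i = (if i = 1 then H 2 3 else if i = 2 then H 3 1 else H 1 2)" for i :: 3
  have H: "has_grad (\<lambda>x. b' x $ i * z' x $ j - b' x $ j * z' x $ i) (H i j)" for i j
    unfolding H_def by (intro has_grad_diff has_grad_mult b z)
  show "has_grad (\<lambda>x. cross3 (b' x) (z' x) $ i) (G i)" for i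
    using exhaust_3[of i] H[of 2 3] H[of 3 1] H[of 1 2] by (auto simp: cross3_def G_def)
  show "(\<Sum>i\<in>UNIV. G i x $ i) = 0" for x
    using b_sym[of 1 x 2] b_sym[of 1 x 3] b_sym[of 2 x 3] z_sym[of 1 x 2] z_sym[of 1 x 3] z_sym[of 2 x 3]
    by (simp add: sum_3 G_def H_def)
qed (simp add: zero cross_zero_right)

text \<open>Mollify \<open>\<nabla>b\<close> and \<open>\<nabla>z\<close> to reduce to the twice differentiable case.\<close>

lemma integral_triple_product_grad:
  assumes a: "has_grad a a'" and b: "has_grad b b'" and z: "has_grad z z'"
    and zero: "\<And>x. x \<notin> cbox p q \<Longrightarrow> z x = 0"
  shows "integral (cbox p q) (\<lambda>x. a' x \<bullet> cross3 (b' x) (z' x)) = 0"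
proof -
  let ?P = "cbox (p - 1) (q + 1)"
  define I where "I s = integral ?P (\<lambda>x. a' x \<bullet> cross3 (mollify s b' x) (mollify s z' x))" for s
  note cont = has_grad_continuous_grad[OF a] has_grad_continuous_grad[OF b] has_grad_continuous_grad[OF z]
  have zero': "z' x = 0" if "x \<notin> cbox p q" for x
    by (rule has_grad_zero_outside[OF z closed_cbox zero that])
  have "I s = 0" if s: "s \<in> {0<..1}" for s
    unfolding I_def
  proof (rule integral_triple_product_grad_C2[OF a])
    have grad: "has_grad (\<lambda>x. mollify s c' x $ j) (grad_mollify s (\<lambda>x. c' x $ j))"
      if "has_grad c c'" for c c' j
      using s by (intro has_grad_cong[OF has_grad_mollify_continuous, of "\<lambda>x. c' x $ j" s])
        (auto simp: mollify_nth continuous_intros has_grad_continuous_grad[OF that])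
    show "has_grad (\<lambda>x. mollify s b' x $ j) (grad_mollify s (\<lambda>x. b' x $ j))"
      "has_grad (\<lambda>x. mollify s z' x $ j) (grad_mollify s (\<lambda>x. z' x $ j))" for j
      by (rule grad[OF b] grad[OF z])+
    show "grad_mollify s (\<lambda>x. b' x $ i) x $ j = grad_mollify s (\<lambda>x. b' x $ j) x $ i"
      "grad_mollify s (\<lambda>x. z' x $ i) x $ j = grad_mollify s (\<lambda>x. z' x $ j) x $ i" for i j x
      using s by (auto intro: grad_mollify_sym[OF b] grad_mollify_sym[OF z])
    show "mollify s z' x = 0" if "x \<notin> ?P" for x
      by (rule mollify_outside[OF zero' that]) (use s in auto)
  qed
  then have "(\<lambda>n. I (1 / real (Suc n))) = (\<lambda>n. 0)" by auto
  moreover have "continuous_on {0..1} I"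
    unfolding I_def
    by (rule integral_continuous_on_param)
      (auto simp: split_beta intro!: continuous_intros continuous_on_mollify_joint
        continuous_on_UNIV_compose[OF cont(1)] cont)
  then have "(\<lambda>n. I (1 / real (Suc n))) \<longlonglongrightarrow> I 0"
    by (rule continuous_on_tendsto_compose[OF _ LIMSEQ_inverse_real_of_nat[unfolded inverse_eq_divide]])
      (auto intro!: eventuallyI)
  ultimately have "I 0 = 0" by (simp add: LIMSEQ_const_iff)
  then have "integral ?P (\<lambda>x. a' x \<bullet> cross3 (b' x) (z' x)) = 0" by (simp add: I_def mollify_0)
  moreover have "integral ?P (\<lambda>x. a' x \<bullet> cross3 (b' x) (z' x)) = integral (cbox p q) (\<lambda>x. a' x \<bullet> cross3 (b' x) (z' x))"
    by (rule integral_cbox_superset)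
      (auto intro!: continuous_intros cont cbox_subset_margin simp: zero' cross_zero_right)
  ultimately show ?thesis by simp
qed

definition cof :: "real^3^3 \<Rightarrow> real^3^3" where
  "cof A = vector [cross3 (A $ 2) (A $ 3), cross3 (A $ 3) (A $ 1), cross3 (A $ 1) (A $ 2)]"

lemma cof_nth:
  "cof A $ 1 = cross3 (A $ 2) (A $ 3)" "cof A $ 2 = cross3 (A $ 3) (A $ 1)" "cof A $ 3 = cross3 (A $ 1) (A $ 2)"
  by (auto simp: cof_def)

lemma continuous_on_cof [continuous_intros]:
  fixes S :: "'a::t2_space set"
  assumes "continuous_on S f"
  shows "continuous_on S (\<lambda>x. cof (f x))"
proof -
  have "continuous_on S (\<lambda>x. cross3 (f x $ j) (f x $ k))" for j k
    by (intro continuous_intros assms)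
  then have "continuous_on S (\<lambda>x. cof (f x) $ i)" for i
    using exhaust_3[of i] by (auto simp: cof_nth)
  then have "continuous_on S (\<lambda>x. \<chi> i. cof (f x) $ i)" by (intro continuous_on_vec_lambda)
  then show ?thesis by simp
qed

definition has_jac :: "(real^'n \<Rightarrow> real^'m) \<Rightarrow> (real^'n \<Rightarrow> real^'n^'m) \<Rightarrow> bool" where
  "has_jac v F \<longleftrightarrow> (\<forall>i. has_grad (\<lambda>x. v x $ i) (\<lambda>x. F x $ i))"

lemma has_jac_nth: "has_jac v F \<Longrightarrow> has_grad (\<lambda>x. v x $ i) (\<lambda>x. F x $ i)"
  by (simp add: has_jac_def)

lemma has_jac_continuous:
  assumes "has_jac v F"
  shows "continuous_on S F" "continuous_on S v"
proof -
  have "continuous_on S (\<lambda>x. \<chi> i. F x $ i)" "continuous_on S (\<lambda>x. \<chi> i. v x $ i)"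
    by (intro continuous_on_vec_lambda has_grad_continuous_grad[OF has_jac_nth[OF assms]]
        has_grad_continuous[OF has_jac_nth[OF assms]])+
  then show "continuous_on S F" "continuous_on S v" by simp_all
qed

lemma has_jac_affine:
  "has_jac v F \<Longrightarrow> has_jac (\<lambda>x. v (c + r *\<^sub>R x)) (\<lambda>x. r *\<^sub>R F (c + r *\<^sub>R x))"
  using has_grad_affine by (fastforce simp: has_jac_def)

lemma has_jac_left_mult:
  assumes "has_jac v F"
  shows "has_jac (\<lambda>x. A *v v x) (\<lambda>x. A ** F x)"
  unfolding has_jac_def
proof
  fix i
  have "has_grad (\<lambda>x. \<Sum>k\<in>UNIV. A $ i $ k * v x $ k) (\<lambda>x. \<Sum>k\<in>UNIV. A $ i $ k *\<^sub>R F x $ k)"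
    by (intro has_grad_sum has_grad_cmult has_jac_nth[OF assms])
  then show "has_grad (\<lambda>x. (A *v v x) $ i) (\<lambda>x. (A ** F x) $ i)"
    by (rule has_grad_cong) (auto simp: matrix_vector_mult_def matrix_matrix_mult_def vec_eq_iff)
qed

lemma has_jac_mollify:
  assumes "has_jac v F"
  shows "has_jac (mollify r v) (mollify r F)"
  unfolding has_jac_def
proof
  fix i
  show "has_grad (\<lambda>x. mollify r v x $ i) (\<lambda>x. mollify r F x $ i)"
    using has_grad_mollify[OF has_jac_nth[OF assms], of r i]
    by (rule has_grad_cong) (simp_all add: mollify_nth has_jac_continuous[OF assms])
qed

lemma integral_cof_inner_grad:
  assumes v: "has_jac v F" and z: "has_grad z z'" and zero: "\<And>x. x \<notin> cbox p q \<Longrightarrow> z x = 0"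
  shows "integral (cbox p q) (\<lambda>x. cof (F x) $ i \<bullet> z' x) = 0"
proof -
  have "cross3 (F x $ j) (F x $ k) \<bullet> z' x = F x $ j \<bullet> cross3 (F x $ k) (z' x)" for j k x
    by (simp add: cross3_def inner_vec_def sum_3 algebra_simps)
  then have "integral (cbox p q) (\<lambda>x. cross3 (F x $ j) (F x $ k) \<bullet> z' x) = 0" for j k
    using integral_triple_product_grad[OF has_jac_nth[OF v, of j] has_jac_nth[OF v, of k] z zero] by simp
  then show ?thesis using exhaust_3[of i] by (auto simp: cof_nth)
qed

section \<open>Rotations\<close>

lemma norm_sq_rows: "(norm (A::real^'n^'m))^2 = (\<Sum>i\<in>UNIV. (norm (A $ i))^2)"
  by (simp add: norm_vec_def[of A] L2_set_def sum_nonneg)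

lemma norm_sq_entries: "(norm (A::real^'n^'m))^2 = (\<Sum>i\<in>UNIV. \<Sum>j\<in>UNIV. (A $ i $ j)^2)"
  by (simp add: norm_vec_def L2_set_def sum_nonneg real_sqrt_pow2)

lemma norm_sq_columns: "(norm (A::real^'n^'m))^2 = (\<Sum>j\<in>UNIV. (norm (column j A))^2)"
  unfolding norm_sq_entries by (subst sum.swap) (simp add: norm_vec_def L2_set_def sum_nonneg column_def)

lemma norm_row_le: "norm ((A::real^'n^'m) $ i) \<le> norm A"
  by (rule Finite_Cartesian_Product.norm_nth_le)

lemma abs_entry_le_norm: "\<bar>(A::real^'n^'m) $ i $ j\<bar> \<le> norm A"
  using component_le_norm_cart[of "A $ i" j] norm_row_le[of A i] by linarith

lemma norm_le_rows: "norm (A::real^3^3) \<le> norm (A $ 1) + norm (A $ 2) + norm (A $ 3)"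
  unfolding norm_vec_def[of A] using L2_set_le_sum[of UNIV "\<lambda>i. norm (A $ i)"] by (simp add: sum_3)

lemma norm_le_entries:
  fixes A :: "real^3^3"
  assumes "\<And>i j. \<bar>A $ i $ j\<bar> \<le> K"
  shows "norm A \<le> 9 * K"
proof -
  have "norm (A $ i) \<le> 3 * K" for i
    using norm_le_l1_cart[of "A $ i"] assms[of i 1] assms[of i 2] assms[of i 3] by (simp add: sum_3)
  then show ?thesis using norm_le_rows[of A] by (smt (verit))
qed

lemma norm_transpose: "norm (transpose A) = norm (A::real^'n^'m)"
proof -
  have "(norm (transpose A))^2 = (norm A)^2"
    unfolding norm_sq_entries by (subst sum.swap) (simp add: transpose_def)
  then show ?thesis by (simp add: power2_eq_iff_nonneg)
qed

lemma norm_matrix_mult_le: "norm ((A::real^'n^'m) ** (B::real^'p^'n)) \<le> norm A * norm B"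
proof -
  have "((A ** B) $ i $ j)^2 \<le> (norm (A $ i))^2 * (norm (column j B))^2" for i j
  proof -
    have "(A ** B) $ i $ j = A $ i \<bullet> column j B"
      by (simp add: matrix_matrix_mult_def inner_vec_def column_def)
    then have "\<bar>(A ** B) $ i $ j\<bar> \<le> norm (A $ i) * norm (column j B)" using Cauchy_Schwarz_ineq2 by metis
    from power_mono[OF this, of 2] show ?thesis by (simp add: power_mult_distrib)
  qed
  then have "(norm (A ** B))^2 \<le> (\<Sum>i\<in>UNIV. \<Sum>j\<in>UNIV. (norm (A $ i))^2 * (norm (column j B))^2)"
    unfolding norm_sq_entries[of "A ** B"] by (intro sum_mono)
  also have "\<dots> = (norm A * norm B)^2"
    unfolding power_mult_distrib norm_sq_rows[of A] norm_sq_columns[of B] by (simp add: sum_product)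
  finally show ?thesis by (rule power2_le_imp_le) simp
qed

lemma matrix_diff_mult:
  fixes A B :: "real^'n^'m"
  shows "(A - B) ** C = A ** C - B ** C" "D ** (A - B) = D ** A - D ** B"
  by (simp_all add: matrix_matrix_mult_def vec_eq_iff sum_subtractf algebra_simps)

lemma bounded_linear_matrix_mult: "bounded_linear (\<lambda>A::real^'p^'n. (R::real^'n^'m) ** A)"
proof (rule bounded_linear_intro[where K="norm R"])
  show "R ** (A + B) = R ** A + R ** B" for A B :: "real^'p^'n" by (rule matrix_add_ldistrib)
  show "R ** (c *\<^sub>R A) = c *\<^sub>R (R ** A)" for c and A :: "real^'p^'n"
    by (simp add: matrix_matrix_mult_def vec_eq_iff sum_distrib_left mult_ac)
  show "norm (R ** A) \<le> norm A * norm R" for A :: "real^'p^'n"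
    using norm_matrix_mult_le[of R A] by (simp add: mult.commute)
qed

lemma norm_orthogonal_mult:
  fixes A :: "real^'p^'n"
  assumes "orthogonal_matrix R"
  shows "norm (R ** A) = norm A"
proof -
  have "column j (R ** A) = R *v column j A" for j
    by (simp add: column_def matrix_matrix_mult_def matrix_vector_mult_def vec_eq_iff)
  moreover have "norm (R *v x) = norm x" for x
    by (rule orthogonal_transformation_norm)
      (use assms in \<open>simp add: matrix_of_matrix_vector_mul orthogonal_transformation_matrix\<close>)
  ultimately have "(norm (R ** A))^2 = (norm A)^2" by (simp only: norm_sq_columns)
  then show ?thesis by (simp add: power2_eq_iff_nonneg)
qed

lemma SO3_D:
  assumes "S \<in> SO3"
  shows "transpose S ** S = mat 1" "S ** transpose S = mat 1" "det S = 1" "orthogonal_matrix S"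
  using assms by (auto simp: SO3_def orthogonal_matrix_def)

lemma mat1_SO3: "mat 1 \<in> SO3"
  by (simp add: SO3_def orthogonal_matrix_id)

lemma SO3_mult: "R \<in> SO3 \<Longrightarrow> S \<in> SO3 \<Longrightarrow> R ** S \<in> SO3"
  by (simp add: SO3_def orthogonal_matrix_mul det_mul)

lemma SO3_transpose: "R \<in> SO3 \<Longrightarrow> transpose R \<in> SO3"
  by (simp add: SO3_def orthogonal_matrix_transpose)

lemma SO3_rows: "S \<in> SO3 \<Longrightarrow> S $ i \<bullet> S $ j = (if i = j then 1 else 0)"
  using SO3_D(2)[of S] by (simp add: matrix_mult_transpose_dot_row row_def vec_nth_inverse mat_def vec_eq_iff)

lemma norm_SO3_mult: "R \<in> SO3 \<Longrightarrow> norm (R ** A) = norm A" for A :: "real^3^3"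
  by (rule norm_orthogonal_mult[OF SO3_D(4)])

lemma norm_SO3:
  assumes "S \<in> SO3"
  shows "(norm S)^2 = 3" "norm S \<le> 2"
proof -
  show sq: "(norm S)^2 = 3"
    using SO3_rows[OF assms] by (simp add: norm_sq_rows power2_norm_eq_inner)
  have "(norm S)^2 \<le> 2^2" using sq by simp
  then show "norm S \<le> 2" by (rule power2_le_imp_le) simp
qed

lemma closed_SO3: "closed SO3"
proof -
  have "closed {A::real^3^3. transpose A ** A = mat 1}"
    by (intro closed_Collect_eq continuous_intros)
      (auto simp: transpose_def matrix_matrix_mult_def intro!: continuous_on_vec_lambda continuous_intros)
  moreover have "closed {A::real^3^3. det A = 1}"
    by (intro closed_Collect_eq) (auto simp: det_3 intro!: continuous_intros)
  ultimately have "closed ({A::real^3^3. transpose A ** A = mat 1} \<inter> {A. det A = 1})"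
    by (rule closed_Int)
  then show ?thesis by (simp add: SO3_def orthogonal_matrix Int_def)
qed

abbreviation rot_defect :: "('a \<Rightarrow> real^3^3) \<Rightarrow> 'a \<Rightarrow> real" where
  "rot_defect F \<equiv> (\<lambda>x. infdist (F x) SO3)"

lemma SO3_nearest:
  obtains S where "S \<in> SO3" "infdist F SO3 = norm (F - S)"
  using infdist_attains_inf[OF closed_SO3, of F] mat1_SO3 by (metis dist_norm empty_iff)

lemma infdist_SO3_le: "S \<in> SO3 \<Longrightarrow> infdist F SO3 \<le> norm (F - S)"
  by (metis dist_norm infdist_le)

lemma infdist_SO3_diff: "infdist A SO3 \<le> infdist B SO3 + norm (A - B)"
  using infdist_triangle[of A SO3 B] by (simp add: dist_norm)

lemma norm_le_infdist_SO3: "norm F \<le> infdist F SO3 + 2"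
  using SO3_nearest[of F] norm_SO3(2) norm_triangle_sub by (smt (verit))

lemma infdist_SO3_mult:
  assumes "R \<in> SO3"
  shows "infdist (R ** A) SO3 = infdist A SO3"
proof -
  have mult_le: "infdist (R ** A) SO3 \<le> infdist A SO3" if R: "R \<in> SO3" for R A
  proof -
    obtain S where S: "S \<in> SO3" "infdist A SO3 = norm (A - S)" by (rule SO3_nearest)
    have "infdist (R ** A) SO3 \<le> norm (R ** A - R ** S)"
      by (rule infdist_SO3_le[OF SO3_mult[OF R S(1)]])
    then show ?thesis using norm_SO3_mult[OF R, of "A - S"] S by (simp add: matrix_diff_mult)
  qed
  have "infdist A SO3 = infdist (transpose R ** (R ** A)) SO3"
    by (simp add: matrix_mul_assoc SO3_D(1)[OF assms])
  also have "\<dots> \<le> infdist (R ** A) SO3" by (rule mult_le[OF SO3_transpose[OF assms]])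
  finally show ?thesis using mult_le[OF assms, of A] by simp
qed

lemma norm_cross_le: "norm (cross3 x y) \<le> norm x * norm y"
proof -
  have "(norm (cross3 x y))^2 \<le> (norm x * norm y)^2"
    using norm_cross_dot[of x y] by (smt (verit) zero_le_power2)
  then show ?thesis by (rule power2_le_imp_le) simp
qed

lemma cof_scaleR: "cof (c *\<^sub>R A) = c^2 *\<^sub>R cof A"
  by (simp add: vec_eq_iff[of "cof (c *\<^sub>R A)"] forall_3 cof_nth cross_mult_left cross_mult_right power2_eq_square)

lemma cof_SO3:
  assumes S: "S \<in> SO3"
  shows "cof S = S"
proof -
  have row: "cross3 (S $ j) (S $ k) = S $ i"
    if "j \<noteq> k" and triple: "S $ i \<bullet> cross3 (S $ j) (S $ k) = 1" for i j k
  proof -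
    let ?c = "cross3 (S $ j) (S $ k)"
    have "(norm ?c)^2 = 1"
      using norm_cross_dot[of "S $ j" "S $ k"] SO3_rows[OF S] that(1)
      by (simp add: power_mult_distrib power2_norm_eq_inner)
    then have "(norm (?c - S $ i))^2 = 0"
      using triple SO3_rows[OF S, of i i]
      by (simp add: power2_norm_eq_inner inner_diff_left inner_diff_right inner_commute)
    then show ?thesis by simp
  qed
  have triple: "S $ 1 \<bullet> cross3 (S $ 2) (S $ 3) = 1" "S $ 2 \<bullet> cross3 (S $ 3) (S $ 1) = 1"
    "S $ 3 \<bullet> cross3 (S $ 1) (S $ 2) = 1"
    using SO3_D(3)[OF S] by (simp_all add: det_3 cross3_def inner_vec_def sum_3 algebra_simps)
  show ?thesis
    unfolding vec_eq_iff[of "cof S"] forall_3 cof_nth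
    by (intro conjI row triple) simp_all
qed

lemma norm_cof_diff_le: "norm (cof (S + K) - cof S) \<le> 3 * (2 * norm S * norm K + (norm K)^2)"
proof -
  have row: "norm (cross3 ((S + K) $ i) ((S + K) $ j) - cross3 (S $ i) (S $ j))
      \<le> 2 * norm S * norm K + (norm K)^2" for i j
  proof -
    have "cross3 ((S + K) $ i) ((S + K) $ j) - cross3 (S $ i) (S $ j)
        = cross3 (S $ i) (K $ j) + cross3 (K $ i) (S $ j) + cross3 (K $ i) (K $ j)"
      by (simp add: cross_add_left cross_add_right)
    also have "norm \<dots> \<le> norm (S $ i) * norm (K $ j) + norm (K $ i) * norm (S $ j) + norm (K $ i) * norm (K $ j)"
      by (intro norm_triangle_le add_mono norm_cross_le)
    also have "\<dots> \<le> norm S * norm K + norm K * norm S + norm K * norm K"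
      by (intro add_mono mult_mono norm_row_le) auto
    finally show ?thesis by (simp add: power2_eq_square mult_ac)
  qed
  show ?thesis
    using norm_le_rows[of "cof (S + K) - cof S"] row[of 2 3] row[of 3 1] row[of 1 2] by (simp add: cof_nth)
qed

lemma norm_minus_cof_le:
  fixes F :: "real^3^3"
  assumes "norm F \<le> M"
  shows "norm (F - cof F) \<le> (19 + 3 * M) * infdist F SO3"
proof -
  obtain S where S: "S \<in> SO3" and d: "infdist F SO3 = norm (F - S)" by (rule SO3_nearest)
  define d where "d = norm (F - S)"
  have dM: "d \<le> M + 2"
    unfolding d_def using norm_triangle_ineq4[of F S] assms norm_SO3(2)[OF S] by linarith
  have "norm (F - cof F) \<le> d + norm (cof (S + (F - S)) - cof S)"
    using norm_triangle_ineq4[of "F - S" "cof F - cof S"] by (simp add: cof_SO3[OF S] d_def algebra_simps)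
  also have "\<dots> \<le> d + 3 * (2 * norm S * d + d^2)"
    using norm_cof_diff_le[of S "F - S"] by (simp add: d_def)
  also have "\<dots> \<le> d + 3 * (2 * 2 * d + (M + 2) * d)"
    using norm_SO3(2)[OF S] dM
    by (intro add_left_mono mult_left_mono add_mono mult_mono) (auto simp: power2_eq_square mult_right_mono d_def)
  finally show ?thesis unfolding d d_def by (simp add: algebra_simps)
qed

lemma abs_norm_sq_minus_3_le:
  fixes F :: "real^3^3"
  assumes "norm F \<le> M"
  shows "\<bar>(norm F)^2 - 3\<bar> \<le> (M + 2) * infdist F SO3"
proof -
  obtain S where S: "S \<in> SO3" and d: "infdist F SO3 = norm (F - S)" by (rule SO3_nearest)
  have "(norm F)^2 - 3 = (norm F - norm S) * (norm F + norm S)"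
    using norm_SO3(1)[OF S] by (simp add: power2_eq_square algebra_simps)
  then have "\<bar>(norm F)^2 - 3\<bar> = \<bar>norm F - norm S\<bar> * (norm F + norm S)"
    by (simp add: abs_mult)
  also have "\<dots> \<le> norm (F - S) * (M + 2)"
    using norm_triangle_ineq3[of F S] assms norm_SO3(2)[OF S] by (intro mult_mono) auto
  finally show ?thesis by (simp add: d mult.commute)
qed

lemma sum_sq_le: "(a + b)^2 \<le> 2 * a^2 + 2 * (b::real)^2"
  using sum_squares_bound[of a b] by (simp add: power2_sum)

lemma norm_sq_le_infdist_SO3: "(norm F)^2 \<le> 6 + 2 * (infdist F SO3)^2"
proof -
  obtain S where S: "S \<in> SO3" "infdist F SO3 = norm (F - S)" by (rule SO3_nearest)
  have "(norm F)^2 \<le> (norm S + infdist F SO3)^2"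
    using norm_triangle_ineq[of S "F - S"] S(2) by (intro power_mono) auto
  also have "\<dots> \<le> 2 * (norm S)^2 + 2 * (infdist F SO3)^2" by (rule sum_sq_le)
  finally show ?thesis using norm_SO3(1)[OF S(1)] by simp
qed

definition sym_part :: "real^'n^'n \<Rightarrow> real^'n^'n" where
  "sym_part A = (1 / 2) *\<^sub>R (A + transpose A)"

lemma sym_part_nth: "sym_part A $ i $ j = (A $ i $ j + A $ j $ i) / 2"
  by (simp add: sym_part_def transpose_def)

lemma norm_sym_part_le: "norm (sym_part A) \<le> norm A"
  using norm_triangle_ineq[of A "transpose A"] by (simp add: sym_part_def norm_transpose)

lemma norm_sym_part_minus_id_le:
  fixes B :: "real^3^3"
  defines "d \<equiv> infdist B SO3"
  shows "norm (sym_part B - mat 1) \<le> d + (d + norm (B - mat 1))^2"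
proof -
  obtain S where S: "S \<in> SO3" and d: "d = norm (B - S)" unfolding d_def by (rule SO3_nearest)
  let ?T = "transpose (S - mat 1)"
  have "?T = transpose S - mat 1" by (simp add: transpose_def vec_eq_iff mat_def)
  then have "?T ** (S - mat 1) = mat 1 - transpose S - S + mat 1"
    by (simp add: matrix_diff_mult SO3_D(1)[OF S])
  moreover have "sym_part S - mat 1 = (- 1 / 2) *\<^sub>R (mat 1 - transpose S - S + mat 1)"
    by (simp add: sym_part_def vec_eq_iff field_simps)
  ultimately have "norm (sym_part S - mat 1) = 1 / 2 * norm (?T ** (S - mat 1))"
    by simp
  also have "\<dots> \<le> (norm (S - mat 1))^2"
    using norm_matrix_mult_le[of ?T "S - mat 1", unfolded norm_transpose]
      zero_le_power2[of "norm (S - mat 1)"] unfolding power2_eq_square by linarith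
  also have "\<dots> \<le> (d + norm (B - mat 1))^2"
    using norm_triangle_ineq[of "S - B" "B - mat 1"] d
    by (intro power_mono) (simp_all add: norm_minus_commute)
  finally have S_bound: "norm (sym_part S - mat 1) \<le> (d + norm (B - mat 1))^2" .
  have "sym_part B - mat 1 = sym_part (B - S) + (sym_part S - mat 1)"
    by (simp add: sym_part_def vec_eq_iff transpose_def algebra_simps)
  then have "norm (sym_part B - mat 1) \<le> norm (sym_part (B - S)) + norm (sym_part S - mat 1)"
    using norm_triangle_ineq by metis
  then show ?thesis using norm_sym_part_le[of "B - S"] S_bound d by linarith
qed

section \<open>Square integrals on cuboids\<close>

definition cuboid :: "real^'n \<Rightarrow> real \<Rightarrow> (real^'n) set" where
  "cuboid l t = cbox (- (l + vec t)) (l + vec t)"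

lemma mem_cuboid: "x \<in> cuboid l t \<longleftrightarrow> (\<forall>i. \<bar>x $ i\<bar> \<le> l $ i + t)"
  by (auto simp: cuboid_def mem_box_cart abs_le_iff) (smt (verit))+

lemma zero_in_cuboid: "(\<And>i. l $ i > 0) \<Longrightarrow> t \<ge> 0 \<Longrightarrow> 0 \<in> cuboid l t"
  by (simp add: mem_cuboid add_nonneg_nonneg less_imp_le)

lemma cuboid_mono: "s \<le> t \<Longrightarrow> cuboid l s \<subseteq> cuboid l t"
  unfolding subset_iff mem_cuboid by (meson add_left_mono order_trans)

lemma cuboid_borel [measurable]: "cuboid l t \<in> sets borel"
  by (simp add: cuboid_def)

lemma compact_cuboid: "compact (cuboid l t)"
  by (simp add: cuboid_def compact_cbox)

lemma content_cuboid_pos: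
  assumes "\<And>i. l $ i > 0" "t \<ge> 0"
  shows "measure lborel (cuboid l t) > 0"
proof -
  have "0 \<in> cuboid l t" using assms by (rule zero_in_cuboid)
  then have "cbox (- (l + vec t)) (l + vec t) \<noteq> {}" unfolding cuboid_def by blast
  moreover have "0 < (l + vec t) $ i - (- (l + vec t)) $ i" for i
    using assms(1)[of i] assms(2) by simp
  ultimately show ?thesis unfolding cuboid_def by (subst content_cbox_cart) (auto intro: prod_pos)
qed

lemma emeasure_cuboid: "emeasure lborel (cuboid l t) = ennreal (measure lborel (cuboid l t))"
  unfolding cuboid_def by (rule emeasure_eq_measure2[OF fmeasurable_cbox])

lemma cuboid_shift:
  assumes "x \<in> cuboid l s" "y \<in> unit_cube" "0 \<le> r" "s + r \<le> t"
  shows "x + r *\<^sub>R y \<in> cuboid l t"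
  unfolding mem_cuboid
proof
  fix i
  have "\<bar>y $ i\<bar> \<le> 1" using assms(2) by (auto simp: mem_box_cart abs_le_iff minus_le_iff)
  then have "\<bar>r * y $ i\<bar> \<le> r" using assms(3) by (simp add: abs_mult mult_left_le)
  moreover have "\<bar>x $ i\<bar> \<le> l $ i + s" using assms(1) by (simp add: mem_cuboid)
  ultimately show "\<bar>(x + r *\<^sub>R y) $ i\<bar> \<le> l $ i + t" using assms(4) by simp
qed

lemma cball_subset_cuboid:
  assumes x: "x \<in> cuboid l s" and "s + t \<le> u"
  shows "cball x t \<subseteq> cuboid l u"
proof
  fix w assume "w \<in> cball x t"
  then have "\<bar>w $ i - x $ i\<bar> \<le> t" for i
    using component_le_norm_cart[of "w - x" i] by (simp add: dist_norm norm_minus_commute)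
  moreover have "\<bar>x $ i\<bar> \<le> l $ i + s" for i using x by (simp add: mem_cuboid)
  ultimately have "\<bar>w $ i\<bar> \<le> l $ i + u" for i using assms(2) by (smt (verit))
  then show "w \<in> cuboid l u" by (simp add: mem_cuboid)
qed

lemma integrable_on_cuboid:
  fixes f :: "real^'n \<Rightarrow> 'b::euclidean_space"
  shows "continuous_on UNIV f \<Longrightarrow> f integrable_on cuboid l t"
  unfolding cuboid_def by (rule integrable_continuous[OF continuous_on_UNIV_subset])

lemma integral_cuboid_mono:
  fixes f :: "real^'n \<Rightarrow> real"
  assumes "continuous_on UNIV f" "\<And>x. 0 \<le> f x" "s \<le> t"
  shows "integral (cuboid l s) f \<le> integral (cuboid l t) f"
  using cuboid_mono[OF assms(3)] assms(2)
  by (intro integral_subset_le integrable_on_cuboid assms(1)) auto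

lemma integral_cuboid_shift_le:
  fixes f :: "real^3 \<Rightarrow> real"
  assumes f: "continuous_on UNIV f" "\<And>x. 0 \<le> f x" and "y \<in> unit_cube" "0 \<le> r" "s + r \<le> t"
  shows "integral (cuboid l s) (\<lambda>x. f (x + r *\<^sub>R y)) \<le> integral (cuboid l t) f"
proof -
  let ?C = "cbox (- (l + vec s) + r *\<^sub>R y) (l + vec s + r *\<^sub>R y)"
  have "integral (cuboid l s) (\<lambda>x. f (x + r *\<^sub>R y)) = integral ?C f"
    using integral_shift_cbox_plus[of "- (l + vec s)" "l + vec s" f "r *\<^sub>R y"]
    by (simp add: cuboid_def o_def add.commute)
  also have "\<dots> \<le> integral (cuboid l t) f"
  proof (intro integral_subset_le integrable_on_cuboid f integrable_continuous continuous_on_UNIV_subset[OF f(1)])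
    show "?C \<subseteq> cuboid l t"
    proof
      fix x assume "x \<in> ?C"
      then have "x - r *\<^sub>R y \<in> cuboid l s"
        by (auto simp: mem_cuboid mem_box_cart abs_le_iff) (smt (verit))+
      from cuboid_shift[OF this assms(3-5)] show "x \<in> cuboid l t" by simp
    qed
  qed (simp add: f(2))
  finally show ?thesis .
qed

lemma integral_mollify_le:
  fixes f :: "real^3 \<Rightarrow> real"
  assumes f: "continuous_on UNIV f" "\<And>x. 0 \<le> f x" and r: "0 \<le> r" "s + r \<le> t"
  shows "integral (cuboid l s) (mollify r f) \<le> integral (cuboid l t) f"
proof -
  have "integral (cuboid l s) (mollify r f)
      = integral unit_cube (\<lambda>y. integral (cuboid l s) (\<lambda>x. bump y * f (x + r *\<^sub>R y)))"
    unfolding mollify_def[abs_def] cuboid_def real_scaleR_def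
    by (rule integral_swap_continuous)
      (auto simp: split_beta intro!: continuous_intros continuous_on_UNIV_compose[OF f(1)]
        continuous_on_UNIV_compose[OF continuous_on_bump(1)])
  also have "\<dots> = integral unit_cube (\<lambda>y. bump y * integral (cuboid l s) (\<lambda>x. f (x + r *\<^sub>R y)))"
    by simp
  also have "\<dots> \<le> integral unit_cube (\<lambda>y. bump y * integral (cuboid l t) f)"
  proof (rule integral_le)
    have "continuous_on unit_cube (\<lambda>y. integral (cuboid l s) (\<lambda>x. f (x + r *\<^sub>R y)))"
      unfolding cuboid_def by (rule integral_continuous_on_param)
        (auto simp: split_beta intro!: continuous_intros continuous_on_UNIV_compose[OF f(1)])
    then show "(\<lambda>y. bump y * integral (cuboid l s) (\<lambda>x. f (x + r *\<^sub>R y))) integrable_on unit_cube"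
      by (intro integrable_continuous continuous_intros continuous_on_bump)
    show "(\<lambda>y. bump y * integral (cuboid l t) f) integrable_on unit_cube"
      by (intro integrable_continuous continuous_intros continuous_on_bump)
  qed (auto intro!: mult_left_mono bump_nonneg integral_cuboid_shift_le f r)
  also have "\<dots> = integral (cuboid l t) f" by (simp add: integral_bump)
  finally show ?thesis .
qed

lemma mollify_le_integral:
  fixes f :: "real^3 \<Rightarrow> real"
  assumes f: "continuous_on UNIV f" "\<And>x. 0 \<le> f x" and r: "0 < r"
  shows "mollify r f x \<le> bump_max / r^3 * integral (cbox (x - vec r) (x + vec r)) f"
proof -
  let ?C = "cbox (x - vec r) (x + vec r)"
  have "(f has_integral integral ?C f) ?C"
    by (intro integrable_integral integrable_continuous continuous_on_UNIV_subset[OF f(1)])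
  moreover have "(x - vec r - x) /\<^sub>R r = -1" "(x + vec r - x) /\<^sub>R r = 1"
    using r by (simp_all add: vec_eq_iff)
  ultimately have scaled: "((\<lambda>y. f (x + r *\<^sub>R y)) has_integral integral ?C f / r^3) unit_cube"
    using has_integral_affinity'[of f "integral ?C f" "x - vec r" "x + vec r" r x] r
    by (simp add: add.commute divide_inverse mult.commute power3_eq_cube)
  have "mollify r f x \<le> integral unit_cube (\<lambda>y. bump_max * f (x + r *\<^sub>R y))"
    unfolding mollify_def real_scaleR_def
    by (intro integral_le integrable_continuous continuous_intros continuous_on_bump
        continuous_on_UNIV_compose[OF f(1)] mult_right_mono bump_le_max f)
  also have "\<dots> = bump_max / r^3 * integral ?C f"
    using integral_unique[OF scaled] by simp
  finally show ?thesis .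
qed

lemma mollify_le_integral_cuboid:
  fixes f :: "real^3 \<Rightarrow> real"
  assumes f: "continuous_on UNIV f" "\<And>x. 0 \<le> f x" and r: "0 < r" and x: "x \<in> cuboid l s" "s + r \<le> t"
  shows "mollify r f x \<le> bump_max / r^3 * integral (cuboid l t) f"
proof -
  have "cbox (x - vec r) (x + vec r) \<subseteq> cuboid l t"
  proof
    fix w assume "w \<in> cbox (x - vec r) (x + vec r)"
    then have w: "x $ i - r \<le> w $ i \<and> w $ i \<le> x $ i + r" for i by (simp add: mem_box_cart)
    have "\<bar>w $ i\<bar> \<le> l $ i + t" for i
      using x(1)[unfolded mem_cuboid, rule_format, of i] w[of i] x(2) by linarith
    then show "w \<in> cuboid l t" by (simp add: mem_cuboid)
  qed
  then have "integral (cbox (x - vec r) (x + vec r)) f \<le> integral (cuboid l t) f"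
    using f(2) by (intro integral_subset_le integrable_on_cuboid f(1)
        integrable_continuous continuous_on_UNIV_subset[OF f(1)]) auto
  then have "bump_max / r^3 * integral (cbox (x - vec r) (x + vec r)) f \<le> bump_max / r^3 * integral (cuboid l t) f"
    using bump_max_pos r by (intro mult_left_mono) auto
  then show ?thesis using mollify_le_integral[OF f r, of x] by linarith
qed

definition L2sq :: "real^'n \<Rightarrow> real \<Rightarrow> (real^'n \<Rightarrow> 'b::euclidean_space) \<Rightarrow> real" where
  "L2sq l t f = integral (cuboid l t) (\<lambda>x. (norm (f x))^2)"

lemma L2sq_mono:
  assumes "continuous_on UNIV f" "s \<le> t"
  shows "L2sq l s f \<le> L2sq l t f"
  unfolding L2sq_def by (intro integral_cuboid_mono continuous_intros assms) auto

lemma L2sq_const: "L2sq l t (\<lambda>x. c) = measure lborel (cuboid l t) * (norm c)^2"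
  by (simp add: L2sq_def cuboid_def)

lemma L2sq_le:
  assumes f: "continuous_on UNIV f" "continuous_on UNIV g"
    and bound: "\<And>x. x \<in> cuboid l t \<Longrightarrow> norm (f x) \<le> c * norm (g x)"
  shows "L2sq l t f \<le> c^2 * L2sq l t g"
proof -
  have "L2sq l t f \<le> integral (cuboid l t) (\<lambda>x. c^2 * (norm (g x))^2)"
    unfolding L2sq_def
  proof (intro integral_le integrable_on_cuboid continuous_intros f)
    fix x assume "x \<in> cuboid l t"
    from power_mono[OF bound[OF this] norm_ge_zero, of 2]
    show "(norm (f x))^2 \<le> c^2 * (norm (g x))^2" by (simp add: power_mult_distrib)
  qed
  then show ?thesis by (simp add: L2sq_def)
qed

lemma L2sq_le_sup:
  assumes "continuous_on UNIV f" "\<And>x. x \<in> cuboid l t \<Longrightarrow> norm (f x) \<le> c"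
  shows "L2sq l t f \<le> measure lborel (cuboid l t) * c^2"
  using L2sq_le[OF assms(1) continuous_on_const, of l t c "1::real"] assms(2) by (simp add: L2sq_const mult.commute)

lemma L2sq_le_sum:
  assumes f: "continuous_on UNIV f" "continuous_on UNIV g" "continuous_on UNIV h"
    and bound: "\<And>x. x \<in> cuboid l t \<Longrightarrow> norm (f x) \<le> norm (g x) + norm (h x)"
  shows "L2sq l t f \<le> 2 * L2sq l t g + 2 * L2sq l t h"
proof -
  have "L2sq l t f \<le> integral (cuboid l t) (\<lambda>x. 2 * (norm (g x))^2 + 2 * (norm (h x))^2)"
    unfolding L2sq_def
  proof (intro integral_le integrable_on_cuboid continuous_intros f)
    fix x assume "x \<in> cuboid l t"
    from power_mono[OF bound[OF this] norm_ge_zero, of 2]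
    show "(norm (f x))^2 \<le> 2 * (norm (g x))^2 + 2 * (norm (h x))^2"
      using sum_sq_le[of "norm (g x)" "norm (h x)"] by linarith
  qed
  also have "\<dots> = 2 * L2sq l t g + 2 * L2sq l t h"
    unfolding L2sq_def by (subst integral_add) (auto intro!: integrable_on_cuboid continuous_intros f)
  finally show ?thesis .
qed

lemma L2sq_triangle:
  assumes "continuous_on UNIV f" "continuous_on UNIV g" "continuous_on UNIV h"
  shows "L2sq l t (\<lambda>x. f x - h x) \<le> 2 * L2sq l t (\<lambda>x. f x - g x) + 2 * L2sq l t (\<lambda>x. g x - h x)"
proof (intro L2sq_le_sum continuous_intros assms)
  fix x show "norm (f x - h x) \<le> norm (f x - g x) + norm (g x - h x)"
    using norm_triangle_ineq[of "f x - g x" "g x - h x"] by simp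
qed

lemma L2sq_infdist_triangle:
  assumes "continuous_on UNIV F" "continuous_on UNIV G"
  shows "L2sq l t (rot_defect G) \<le> 2 * L2sq l t (rot_defect F) + 2 * L2sq l t (\<lambda>x. F x - G x)"
proof (intro L2sq_le_sum continuous_intros assms)
  fix x show "norm (infdist (G x) SO3) \<le> norm (infdist (F x) SO3) + norm (F x - G x)"
    using infdist_SO3_diff[of "G x" "F x"] by (simp add: norm_minus_commute infdist_nonneg)
qed

lemma L2sq_mollify_le:
  assumes f: "continuous_on UNIV f" and r: "0 \<le> r" "s + r \<le> t"
  shows "L2sq l s (mollify r f) \<le> L2sq l t f"
proof -
  have cont: "continuous_on UNIV (\<lambda>x. (norm (f x))^2)" by (intro continuous_intros f)
  have "L2sq l s (mollify r f) \<le> integral (cuboid l s) (mollify r (\<lambda>x. (norm (f x))^2))"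
    unfolding L2sq_def
    by (intro integral_le integrable_on_cuboid continuous_intros continuous_on_mollify f norm_mollify_sq_le cont)
  also have "\<dots> \<le> L2sq l t f"
    unfolding L2sq_def by (intro integral_mollify_le cont r) auto
  finally show ?thesis .
qed

lemma L2sq_rows:
  fixes F :: "real^'n \<Rightarrow> real^'k^'m"
  assumes "continuous_on UNIV F"
  shows "L2sq l t F = (\<Sum>i\<in>UNIV. L2sq l t (\<lambda>x. F x $ i))"
  unfolding L2sq_def norm_sq_rows
  by (subst integral_sum[symmetric]) (auto intro!: integrable_on_cuboid continuous_intros assms)

lemma integral_norm_le_sqrt_L2sq:
  assumes f: "continuous_on UNIV f"
  shows "integral (cuboid l t) (\<lambda>x. norm (f x)) \<le> sqrt (measure lborel (cuboid l t) * L2sq l t f)"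
proof (rule real_le_rsqrt)
  show "(integral (cuboid l t) (\<lambda>x. norm (f x)))^2 \<le> measure lborel (cuboid l t) * L2sq l t f"
    unfolding cuboid_def L2sq_def by (intro integral_sq_le continuous_intros continuous_on_UNIV_subset[OF f])
qed

lemma infdist_const_le:
  assumes "continuous_on UNIV F" "\<And>i. l $ i > 0" "t \<ge> 0"
    and "L2sq l t (rot_defect F) \<le> a" "L2sq l t (\<lambda>x. F x - A) \<le> b"
  shows "(infdist A SO3)^2 \<le> (2 * a + 2 * b) / measure lborel (cuboid l t)"
  using L2sq_infdist_triangle[OF assms(1) continuous_on_const, of l t A] content_cuboid_pos[OF assms(2,3)] assms(4,5)
  by (simp add: L2sq_const pos_le_divide_eq mult.commute)

lemma has_grad_lipschitz_cuboid:
  assumes f: "has_grad f g" and g: "\<And>x. x \<in> cuboid l s \<Longrightarrow> norm (g x) \<le> K"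
    and x: "x \<in> cuboid l s" "0 \<in> cuboid l s"
  shows "\<bar>f x - f 0\<bar> \<le> K * (\<Sum>i\<in>UNIV. l $ i + s)"
proof -
  have K: "K \<ge> 0" using g[OF x(1)] norm_ge_zero order_trans by blast
  have "norm (f x - f 0) \<le> K * norm (x - 0)"
  proof (rule differentiable_bound[of "cuboid l s" f "\<lambda>x h. g x \<bullet> h"])
    show "convex (cuboid l s)" by (simp add: cuboid_def)
    fix w assume w: "w \<in> cuboid l s"
    show "(f has_derivative (\<bullet>) (g w)) (at w within cuboid l s)"
      using has_gradD[OF f] has_derivative_at_withinI by blast
    have "norm (g w \<bullet> h) \<le> K * norm h" for h
      using Cauchy_Schwarz_ineq2[of "g w" h] mult_right_mono[OF g[OF w] norm_ge_zero[of h]] by simp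
    then show "onorm ((\<bullet>) (g w)) \<le> K" by (rule onorm_bound[OF K])
  qed (use x in auto)
  moreover have "norm x \<le> (\<Sum>i\<in>UNIV. l $ i + s)"
    using norm_le_l1_cart[of x] sum_mono[of UNIV "\<lambda>i. \<bar>x $ i\<bar>" "\<lambda>i. l $ i + s"] x(1)
    by (auto simp: mem_cuboid)
  ultimately show ?thesis using mult_left_mono[OF _ K, of "norm x"] by fastforce
qed

section \<open>Interior estimates for gradients close to their cofactor\<close>

lemma has_grad_line_integral:
  fixes f :: "real^'n \<Rightarrow> real"
  assumes f: "has_grad f g"
  shows "f (x + h) - f x = integral {0..1} (\<lambda>t. g (x + t *\<^sub>R h) \<bullet> h)"
proof -
  have "((\<lambda>t. g (x + t *\<^sub>R h) \<bullet> h) has_integral (f (x + 1 *\<^sub>R h) - f (x + 0 *\<^sub>R h))) {0..1}"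
  proof (rule fundamental_theorem_of_calculus)
    fix t :: real
    have "((\<lambda>t. f (x + t *\<^sub>R h)) has_derivative (\<lambda>s. g (x + t *\<^sub>R h) \<bullet> (s *\<^sub>R h))) (at t within {0..1})"
      by (rule has_derivative_compose[OF _ has_gradD[OF f], of "\<lambda>t. x + t *\<^sub>R h" "\<lambda>s. s *\<^sub>R h"])
        (auto intro!: derivative_eq_intros)
    then show "((\<lambda>t. f (x + t *\<^sub>R h)) has_vector_derivative g (x + t *\<^sub>R h) \<bullet> h) (at t within {0..1})"
      by (simp add: has_vector_derivative_def mult_ac)
  qed simp
  from integral_unique[OF this] show ?thesis by simp
qed

text \<open>\<open>y \<mapsto> bump y *\<^sub>R y\<close> is a gradient and cofactors are divergence free.\<close>

lemma integral_cof_bump_moment: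
  assumes "has_jac v F"
  shows "integral unit_cube (\<lambda>y. cof (F (x + t *\<^sub>R y)) $ i \<bullet> (bump y *\<^sub>R y)) = 0"
proof (cases "t = 0")
  case True
  have "((\<lambda>y. cof (F x) $ i \<bullet> (bump y *\<^sub>R y)) has_integral cof (F x) $ i \<bullet> 0) unit_cube"
    using has_integral_linear[OF has_integral_bump_moment bounded_linear_inner_right] by (simp add: o_def)
  then show ?thesis using True by (simp add: integral_unique)
next
  case False
  have "integral unit_cube (\<lambda>y. cof (t *\<^sub>R F (x + t *\<^sub>R y)) $ i \<bullet> (- bump y *\<^sub>R y)) = 0"
    by (rule integral_cof_inner_grad[OF has_jac_affine[OF assms] has_grad_bump_potential])
      (simp add: bump_outside_cube)
  then have "- (t^2 * integral unit_cube (\<lambda>y. cof (F (x + t *\<^sub>R y)) $ i \<bullet> (bump y *\<^sub>R y))) = 0"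
    by (simp add: cof_scaleR mult_ac flip: integral_mult_right)
  then show ?thesis using False by simp
qed

lemma mollify_minus_id_eq:
  assumes v: "has_jac v F"
  shows "mollify r (\<lambda>x. v x $ i) x - v x $ i = r * integral {0..1} (\<lambda>t.
    integral unit_cube (\<lambda>y. (F (x + (t * r) *\<^sub>R y) - cof (F (x + (t * r) *\<^sub>R y))) $ i \<bullet> (bump y *\<^sub>R y)))"
proof -
  let ?w = "\<lambda>x. v x $ i" and ?g = "\<lambda>x. F x $ i"
  have w: "has_grad ?w ?g" by (rule has_jac_nth[OF v])
  note cont = has_grad_continuous[OF w] has_grad_continuous_grad[OF w] has_jac_continuous(1)[OF v]
  have "mollify r ?w x - ?w x = mollify r (\<lambda>z. ?w z - ?w x) x"
    by (simp add: mollify_diff[OF cont(1)] mollify_const)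
  also have "\<dots> = integral unit_cube (\<lambda>y. integral {0..1} (\<lambda>t. r * (?g (x + (t * r) *\<^sub>R y) \<bullet> (bump y *\<^sub>R y))))"
    unfolding mollify_def has_grad_line_integral[OF w] by (simp flip: integral_mult_right add: mult_ac)
  also have "\<dots> = integral {0..1} (\<lambda>t. integral unit_cube (\<lambda>y. r * (?g (x + (t * r) *\<^sub>R y) \<bullet> (bump y *\<^sub>R y))))"
    unfolding cbox_interval[symmetric]
    by (rule integral_swap_continuous)
      (auto simp: split_beta intro!: continuous_intros continuous_on_UNIV_compose[OF cont(2)]
        continuous_on_UNIV_compose[OF continuous_on_bump(1)])
  also have "\<dots> = r * integral {0..1} (\<lambda>t. integral unit_cube (\<lambda>y. ?g (x + (t * r) *\<^sub>R y) \<bullet> (bump y *\<^sub>R y)))"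
    by simp
  also have "(\<lambda>t. integral unit_cube (\<lambda>y. ?g (x + (t * r) *\<^sub>R y) \<bullet> (bump y *\<^sub>R y)))
      = (\<lambda>t. integral unit_cube (\<lambda>y. (F (x + (t * r) *\<^sub>R y) - cof (F (x + (t * r) *\<^sub>R y))) $ i \<bullet> (bump y *\<^sub>R y)))"
  proof
    fix t
    have "integral unit_cube (\<lambda>y. ?g (x + (t * r) *\<^sub>R y) \<bullet> (bump y *\<^sub>R y) - cof (F (x + (t * r) *\<^sub>R y)) $ i \<bullet> (bump y *\<^sub>R y))
        = integral unit_cube (\<lambda>y. ?g (x + (t * r) *\<^sub>R y) \<bullet> (bump y *\<^sub>R y)) - 0"
      unfolding integral_cof_bump_moment[OF v, of x "t * r" i, symmetric]
      by (intro integral_diff integrable_continuous continuous_intros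
          continuous_on_UNIV_compose[OF cont(2)] continuous_on_UNIV_compose[OF cont(3)] continuous_on_bump)
    then show "integral unit_cube (\<lambda>y. ?g (x + (t * r) *\<^sub>R y) \<bullet> (bump y *\<^sub>R y))
        = integral unit_cube (\<lambda>y. (F (x + (t * r) *\<^sub>R y) - cof (F (x + (t * r) *\<^sub>R y))) $ i \<bullet> (bump y *\<^sub>R y))"
      by (simp add: inner_diff_left right_diff_distrib)
  qed
  finally show ?thesis .
qed

lemma bump_moment_sq_le:
  fixes g :: "real^3 \<Rightarrow> real^3^3"
  assumes g: "continuous_on UNIV g"
  shows "(integral unit_cube (\<lambda>y. g (x + r *\<^sub>R y) $ i \<bullet> (bump y *\<^sub>R y)))^2 \<le> mollify r (\<lambda>x. (norm (g x))^2) x"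
proof -
  let ?m = "integral unit_cube (\<lambda>y. g (x + r *\<^sub>R y) $ i \<bullet> (bump y *\<^sub>R y))"
  have "norm ?m \<le> mollify r (\<lambda>x. norm (g x)) x"
    unfolding mollify_def
  proof (rule integral_norm_bound_integral)
    fix y
    have "norm (g (x + r *\<^sub>R y) $ i \<bullet> (bump y *\<^sub>R y)) \<le> norm (g (x + r *\<^sub>R y) $ i) * norm (bump y *\<^sub>R y)"
      unfolding real_norm_def by (rule Cauchy_Schwarz_ineq2)
    also have "\<dots> \<le> norm (g (x + r *\<^sub>R y)) * bump y"
      by (intro mult_mono norm_row_le norm_bump_scaleR_le) auto
    finally show "norm (g (x + r *\<^sub>R y) $ i \<bullet> (bump y *\<^sub>R y)) \<le> bump y *\<^sub>R norm (g (x + r *\<^sub>R y))"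
      by (simp add: mult.commute)
  qed (intro integrable_continuous continuous_intros continuous_on_UNIV_compose[OF g] continuous_on_bump)+
  then have "?m^2 \<le> (mollify r (\<lambda>x. norm (g x)) x)^2"
    using power_mono[of "norm ?m" _ 2] by simp
  also have "\<dots> \<le> mollify r (\<lambda>x. (norm (g x))^2) x"
    using norm_mollify_sq_le[OF continuous_on_norm[OF g], of r x] by simp
  finally show ?thesis .
qed

lemma mollify_minus_id_sq_le:
  assumes v: "has_jac v F"
  shows "(mollify r (\<lambda>x. v x $ i) x - v x $ i)^2 \<le> r^2 * integral {0..1} (\<lambda>t. mollify (t * r) (\<lambda>x. (norm (F x - cof (F x)))^2) x)"
proof -
  let ?g = "\<lambda>x. F x - cof (F x)"
  let ?m = "\<lambda>t. integral unit_cube (\<lambda>y. ?g (x + (t * r) *\<^sub>R y) $ i \<bullet> (bump y *\<^sub>R y))"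
  have cont: "continuous_on UNIV ?g" by (intro continuous_intros has_jac_continuous[OF v])
  have cont_m: "continuous_on {0..1} ?m"
    by (rule integral_continuous_on_param)
      (auto simp: split_beta intro!: continuous_intros continuous_on_UNIV_compose[OF cont]
        continuous_on_UNIV_compose[OF continuous_on_bump(1)] continuous_on_UNIV_compose[OF has_jac_continuous(1)[OF v]])
  have "(mollify r (\<lambda>x. v x $ i) x - v x $ i)^2 = r^2 * (integral {0..1} ?m)^2"
    unfolding mollify_minus_id_eq[OF v] by (simp add: power_mult_distrib)
  also have "\<dots> \<le> r^2 * integral {0..1} (\<lambda>t. (?m t)^2)"
    using integral_sq_le[of 0 1 ?m] cont_m by (intro mult_left_mono) auto
  also have "\<dots> \<le> r^2 * integral {0..1} (\<lambda>t. mollify (t * r) (\<lambda>x. (norm (?g x))^2) x)"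
    by (intro mult_left_mono integral_le integrable_continuous_real continuous_intros cont_m
        bump_moment_sq_le cont continuous_on_mollify_joint) auto
  finally show ?thesis .
qed

lemma L2sq_mollify_minus_id_le:
  assumes v: "has_jac v F" and r: "0 \<le> r"
  shows "L2sq l s (\<lambda>x. mollify r (\<lambda>x. v x $ i) x - v x $ i) \<le> r^2 * L2sq l (s + r) (\<lambda>x. F x - cof (F x))"
proof -
  let ?g = "\<lambda>x. F x - cof (F x)"
  define G where "G = (\<lambda>x. (norm (?g x))^2)"
  have cont: "continuous_on UNIV (\<lambda>x. v x $ i)" "continuous_on UNIV ?g" "continuous_on UNIV G"
    unfolding G_def by (intro continuous_intros has_jac_continuous[OF v])+
  have cont_I: "continuous_on UNIV (\<lambda>x. integral {0..1} (\<lambda>t. mollify (t * r) G x))"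
    unfolding cbox_interval[symmetric]
    by (rule integral_continuous_on_param)
      (auto simp: split_beta intro!: continuous_intros continuous_on_mollify_joint[OF cont(3)])
  have "L2sq l s (\<lambda>x. mollify r (\<lambda>x. v x $ i) x - v x $ i)
      \<le> integral (cuboid l s) (\<lambda>x. r^2 * integral {0..1} (\<lambda>t. mollify (t * r) G x))"
    unfolding L2sq_def
    by (intro integral_le integrable_on_cuboid continuous_intros continuous_on_mollify cont cont_I)
      (use mollify_minus_id_sq_le[OF v] in \<open>simp add: G_def\<close>)
  also have "\<dots> = r^2 * integral {0..1} (\<lambda>t. integral (cuboid l s) (\<lambda>x. mollify (t * r) G x))"
    unfolding integral_mult_right cbox_interval[symmetric] cuboid_def
    by (subst integral_swap_continuous)
      (auto simp: split_beta intro!: continuous_intros continuous_on_mollify_joint[OF cont(3)])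
  also have "\<dots> \<le> r^2 * integral {0..1} (\<lambda>t::real. L2sq l (s + r) ?g)"
  proof (intro mult_left_mono integral_le integrable_continuous_real)
    show "continuous_on {0..1} (\<lambda>t. integral (cuboid l s) (\<lambda>x. mollify (t * r) G x))"
      unfolding cuboid_def by (rule integral_continuous_on_param)
        (auto simp: split_beta intro!: continuous_intros continuous_on_mollify_joint[OF cont(3)])
    fix t :: real assume "t \<in> {0..1}"
    then show "integral (cuboid l s) (\<lambda>x. mollify (t * r) G x) \<le> L2sq l (s + r) ?g"
      using integral_mollify_le[OF cont(3), of "t * r" s "s + r" l] r
      by (simp add: L2sq_def G_def mult_left_le_one_le)
  qed auto
  finally show ?thesis by simp
qed

lemma cuboid_separation:
  fixes l :: "real^'n"
  assumes "s < t"
  obtains f :: "real^'n \<Rightarrow> real" where "continuous_on UNIV f" "\<And>x. 0 \<le> f x" "\<And>x. f x \<le> 1"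
    "\<And>x. x \<in> cuboid l s \<Longrightarrow> f x = 1" "\<And>x i. l $ i + t \<le> \<bar>x $ i\<bar> \<Longrightarrow> f x = 0"
proof -
  let ?T = "\<Union>i. {x::real^'n. l $ i + t \<le> \<bar>x $ i\<bar>}"
  have T: "closed ?T" by (intro closed_UN finite ballI closed_Collect_le continuous_intros)
  have cuboid: "closed (cuboid l s)" by (simp add: cuboid_def closed_cbox)
  have False if "\<bar>x $ i\<bar> \<le> l $ i + s" "l $ i + t \<le> \<bar>x $ i\<bar>" for x :: "real^'n" and i
    using that assms by linarith
  then have disjoint: "cuboid l s \<inter> ?T = {}" unfolding mem_cuboid disjoint_iff by blast
  obtain f :: "real^'n \<Rightarrow> real" where f: "continuous_on UNIV f" "\<And>x. f x \<in> closed_segment 1 0"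
    "\<And>x. x \<in> cuboid l s \<Longrightarrow> f x = 1" "\<And>x. x \<in> ?T \<Longrightarrow> f x = 0"
    by (rule Urysohn[OF cuboid T disjoint, of 1 0]) (rule that)
  have "0 \<le> f x" "f x \<le> 1" for x using f(2)[of x] by (auto simp: closed_segment_eq_real_ivl)
  moreover have "f x = 0" if "l $ i + t \<le> \<bar>x $ i\<bar>" for x i using f(4) that by blast
  ultimately show ?thesis using f(1,3) that by blast
qed

lemma cutoff_exists:
  fixes l :: "real^3"
  assumes "s < t"
  obtains p p' where "has_grad p p'" "\<And>x. 0 \<le> p x" "\<And>x. p x \<le> 1" "\<And>x. x \<in> cuboid l s \<Longrightarrow> p x = 1"
    "\<And>x. x \<notin> cuboid l t \<Longrightarrow> p x = 0" "\<And>x. (norm (p' x))^2 \<le> 72 * bump_slope / (t - s)^2"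
proof -
  define d where "d = (t - s) / 3"
  have d: "d > 0" "3 * d = t - s" using assms by (simp_all add: d_def)
  then have "s + d < t - d" by linarith
  then obtain f :: "real^3 \<Rightarrow> real" where f: "continuous_on UNIV f" and f01: "\<And>x. 0 \<le> f x" "\<And>x. f x \<le> 1"
    and f_eq: "\<And>x. x \<in> cuboid l (s + d) \<Longrightarrow> f x = 1" "\<And>x i. l $ i + (t - d) \<le> \<bar>x $ i\<bar> \<Longrightarrow> f x = 0"
    using cuboid_separation[of "s + d" "t - d" l] by blast
  show thesis
  proof
    show "has_grad (mollify d f) (grad_mollify d f)" by (rule has_grad_mollify_continuous[OF f d(1)])
    show "0 \<le> mollify d f x" for x
      using mollify_mono[of "\<lambda>x. 0" f x d] f f01 by (simp add: mollify_const)
    show "mollify d f x \<le> 1" for x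
      using mollify_mono[of f "\<lambda>x. 1" x d] f f01 by (simp add: mollify_const)
    show "mollify d f x = 1" if "x \<in> cuboid l s" for x
    proof -
      have "mollify d f x = mollify d (\<lambda>x. 1) x"
        by (intro mollify_cong f_eq(1) cuboid_shift[OF that]) (use d in auto)
      then show ?thesis by (simp add: mollify_const)
    qed
    show "mollify d f x = 0" if x: "x \<notin> cuboid l t" for x
    proof -
      obtain i where i: "\<not> \<bar>x $ i\<bar> \<le> l $ i + t" using x by (auto simp: mem_cuboid)
      have "l $ i + (t - d) \<le> \<bar>(x + d *\<^sub>R y) $ i\<bar>" if "y \<in> unit_cube" for y
      proof -
        have "\<bar>y $ i\<bar> \<le> 1" using that by (auto simp: mem_box_cart abs_le_iff minus_le_iff)
        then have "\<bar>d * y $ i\<bar> \<le> d" using d by (simp add: abs_mult mult_left_le)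
        then show ?thesis using i by simp
      qed
      then have "mollify d f x = mollify d (\<lambda>x. 0) x" by (intro mollify_cong f_eq(2))
      then show ?thesis by (simp add: mollify_const)
    qed
    show "(norm (grad_mollify d f x))^2 \<le> 72 * bump_slope / (t - s)^2" for x
    proof -
      have "(norm (grad_mollify d f x))^2 \<le> 8 * bump_slope / d^2 * mollify d (\<lambda>z. (f z - 0)^2) x"
        by (rule norm_grad_mollify_sq_le[OF f d(1)])
      also have "\<dots> \<le> 8 * bump_slope / d^2 * mollify d (\<lambda>z. 1) x"
        using f01 bump_slope_pos
        by (intro mult_left_mono mollify_mono continuous_intros f) (auto simp: power_le_one)
      finally show ?thesis by (simp add: mollify_const d_def power_divide)
    qed
  qed
qed

text \<open>The test field is \<open>\<nabla> (p\<^sup>2 z)\<close>, and the mixed terms are absorbed by Young's inequality.\<close>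

lemma Caccioppoli_pointwise:
  fixes Z g p' :: "'a::real_inner"
  assumes p: "0 \<le> p" "p \<le> (1::real)" and c: "norm p' \<le> c"
  shows "(p * norm Z)^2 \<le> 2 * ((Z - g) \<bullet> ((p * p) *\<^sub>R Z + z *\<^sub>R (p *\<^sub>R p' + p *\<^sub>R p')))
    + (4 * (norm g)^2 + 10 * c^2 * z^2)"
proof -
  define q where "q = p *\<^sub>R Z"
  have young: "2 * a * b \<le> a^2 / 4 + 4 * b^2" for a b :: real
    using zero_le_power2[of "a - 4 * b"] by (simp add: power2_eq_square algebra_simps)
  have "2 * \<bar>z * (q \<bullet> p')\<bar> \<le> 2 * (norm q * (c * \<bar>z\<bar>))"
    using Cauchy_Schwarz_ineq2[of q p'] mult_left_mono[OF c norm_ge_zero[of q]]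
      mult_left_mono[of "\<bar>q \<bullet> p'\<bar>" "norm q * c" "\<bar>z\<bar>"] by (simp add: abs_mult mult_ac)
  also have "\<dots> \<le> (norm q)^2 / 4 + 4 * (c^2 * z^2)"
    using young[of "norm q" "c * \<bar>z\<bar>"] by (simp add: power_mult_distrib mult.assoc)
  finally have mixed: "- (2 * (z * (q \<bullet> p'))) \<le> (norm q)^2 / 4 + 4 * (c^2 * z^2)" by linarith
  have damp: "\<bar>p * x\<bar> \<le> \<bar>x\<bar>" for x
    using p by (simp add: abs_mult mult_left_le_one_le)
  have "norm g * norm q \<le> (norm q)^2 / 4 + (norm g)^2"
    using young[of "norm q" "norm g / 2"] by (simp add: power_divide mult.commute)
  then have first: "p * (g \<bullet> q) \<le> (norm q)^2 / 4 + (norm g)^2"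
    using damp[of "g \<bullet> q"] Cauchy_Schwarz_ineq2[of g q] by linarith
  have "\<bar>z * (g \<bullet> p')\<bar> \<le> \<bar>z\<bar> * (norm g * c)"
    unfolding abs_mult using Cauchy_Schwarz_ineq2[of g p'] mult_left_mono[OF c norm_ge_zero[of g]]
    by (intro mult_left_mono) auto
  moreover have "2 * (\<bar>z\<bar> * (norm g * c)) \<le> (norm g)^2 + c^2 * z^2"
    using sum_squares_bound[of "norm g" "c * \<bar>z\<bar>"] by (simp add: power_mult_distrib mult_ac)
  ultimately have last: "2 * (p * (z * (g \<bullet> p'))) \<le> (norm g)^2 + c^2 * z^2"
    using damp[of "z * (g \<bullet> p')"] by linarith
  have "(Z - g) \<bullet> ((p * p) *\<^sub>R Z + z *\<^sub>R (p *\<^sub>R p' + p *\<^sub>R p'))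
      = (norm q)^2 - p * (g \<bullet> q) + 2 * (z * (q \<bullet> p')) - 2 * (p * (z * (g \<bullet> p')))"
    unfolding q_def power2_norm_eq_inner inner_add_right inner_scaleR_right
    by (simp add: inner_diff_left algebra_simps)
  moreover have "(p * norm Z)^2 = (norm q)^2" using p by (simp add: q_def)
  ultimately show ?thesis using mixed first last by linarith
qed

lemma Caccioppoli:
  fixes z :: "real^3 \<Rightarrow> real"
  assumes z: "has_grad z Z" and g: "continuous_on UNIV g" and st: "s < t"
    and weak: "\<And>p p'. has_grad p p' \<Longrightarrow> (\<And>x. x \<notin> cuboid l t \<Longrightarrow> p x = 0) \<Longrightarrow>
      integral (cuboid l t) (\<lambda>x. (Z x - g x) \<bullet> p' x) = 0"
  shows "L2sq l s Z \<le> 4 * L2sq l t g + 720 * bump_slope / (t - s)^2 * L2sq l t z"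
proof -
  obtain p p' where p: "has_grad p p'" "\<And>x. 0 \<le> p x" "\<And>x. p x \<le> 1" "\<And>x. x \<in> cuboid l s \<Longrightarrow> p x = 1"
    "\<And>x. x \<notin> cuboid l t \<Longrightarrow> p x = 0" and p': "\<And>x. (norm (p' x))^2 \<le> 72 * bump_slope / (t - s)^2"
    using cutoff_exists[OF st, of l] by metis
  define c where "c = sqrt (72 * bump_slope / (t - s)^2)"
  have c: "norm (p' x) \<le> c" for x unfolding c_def by (rule real_le_rsqrt[OF p'])
  have c_sq: "c^2 = 72 * bump_slope / (t - s)^2" using bump_slope_pos by (simp add: c_def)
  define w' where "w' x = (p x * p x) *\<^sub>R Z x + z x *\<^sub>R (p x *\<^sub>R p' x + p x *\<^sub>R p' x)" for x
  have w: "has_grad (\<lambda>x. (p x * p x) * z x) w'"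
    unfolding w'_def by (rule has_grad_mult[OF has_grad_mult[OF p(1) p(1)] z])
  note cont = has_grad_continuous[OF z] has_grad_continuous_grad[OF z] has_grad_continuous[OF p(1)]
    has_grad_continuous_grad[OF w]
  have "L2sq l s Z = integral (cuboid l s) (\<lambda>x. (p x * norm (Z x))^2)"
    unfolding L2sq_def using p(4) by (intro integral_cong) simp
  also have "\<dots> \<le> integral (cuboid l t) (\<lambda>x. (p x * norm (Z x))^2)"
    using st by (intro integral_cuboid_mono continuous_intros cont) auto
  also have "\<dots> \<le> integral (cuboid l t) (\<lambda>x. 2 * ((Z x - g x) \<bullet> w' x) + (4 * (norm (g x))^2 + 10 * c^2 * (z x)^2))"
    unfolding w'_def
    by (intro integral_le integrable_on_cuboid continuous_intros cont g Caccioppoli_pointwise p c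
        has_grad_continuous_grad[OF p(1)])
  also have "\<dots> = 2 * integral (cuboid l t) (\<lambda>x. (Z x - g x) \<bullet> w' x) + (4 * L2sq l t g + 10 * c^2 * L2sq l t z)"
    unfolding L2sq_def
    by (subst integral_add integral_add; (intro integrable_on_cuboid continuous_intros cont g)?)+ simp
  also have "integral (cuboid l t) (\<lambda>x. (Z x - g x) \<bullet> w' x) = 0"
    by (rule weak[OF w]) (simp add: p(5))
  finally show ?thesis by (simp add: c_sq)
qed

lemma integral_mollify_cof_inner_grad:
  assumes v: "has_jac v F" and z: "has_grad z z'" and zero: "\<And>x. x \<notin> cbox p q \<Longrightarrow> z x = 0"
  shows "integral (cbox p q) (\<lambda>x. mollify r (\<lambda>x. cof (F x)) x $ i \<bullet> z' x) = 0"
proof -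
  note cont = has_jac_continuous(1)[OF v] has_grad_continuous_grad[OF z]
  have row: "bounded_linear (\<lambda>A::real^3^3. A $ i \<bullet> w)" for w
    by (rule bounded_linear_compose[OF bounded_linear_inner_left bounded_linear_vec_nth])
  have "integral (cbox p q) (\<lambda>x. mollify r (\<lambda>x. cof (F x)) x $ i \<bullet> z' x)
      = integral (cbox p q) (\<lambda>x. integral unit_cube (\<lambda>y. bump y * (cof (F (x + r *\<^sub>R y)) $ i \<bullet> z' x)))"
    unfolding mollify_linear[OF continuous_on_cof[OF cont(1)] row] by (simp add: mollify_def)
  also have "\<dots> = integral unit_cube (\<lambda>y. integral (cbox p q) (\<lambda>x. bump y * (cof (F (x + r *\<^sub>R y)) $ i \<bullet> z' x)))"
    by (rule integral_swap_continuous)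
      (auto simp: split_beta intro!: continuous_intros continuous_on_UNIV_compose[OF cont(1)]
        continuous_on_UNIV_compose[OF cont(2)] continuous_on_UNIV_compose[OF continuous_on_bump(1)])
  also have "\<dots> = integral unit_cube (\<lambda>y. 0)"
  proof (rule integral_cong)
    fix y
    from integral_cof_inner_grad[OF has_jac_affine[OF v, of "r *\<^sub>R y" 1] z zero, where i=i]
    show "integral (cbox p q) (\<lambda>x. bump y * (cof (F (x + r *\<^sub>R y)) $ i \<bullet> z' x)) = 0" by (simp add: add.commute)
  qed
  finally show ?thesis by simp
qed

definition Caccioppoli_const :: real where "Caccioppoli_const = 48 + 2160 * bump_slope"

lemma integral_cof_minus_mollify_inner_grad:
  assumes v: "has_jac v F" and p: "has_grad p p'" "\<And>x. x \<notin> cuboid l (s + r) \<Longrightarrow> p x = 0"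
  shows "integral (cuboid l (s + r)) (\<lambda>x. (cof (F x) - mollify r (\<lambda>x. cof (F x)) x) $ i \<bullet> p' x) = 0"
proof -
  have cont: "continuous_on UNIV (\<lambda>x. cof (F x))" by (intro continuous_intros has_jac_continuous(1)[OF v])
  have "integral (cuboid l (s + r)) (\<lambda>x. cof (F x) $ i \<bullet> p' x) = 0"
    "integral (cuboid l (s + r)) (\<lambda>x. mollify r (\<lambda>x. cof (F x)) x $ i \<bullet> p' x) = 0"
    using p unfolding cuboid_def by (auto intro: integral_cof_inner_grad[OF v] integral_mollify_cof_inner_grad[OF v])
  then have "integral (cuboid l (s + r)) (\<lambda>x. cof (F x) $ i \<bullet> p' x - mollify r (\<lambda>x. cof (F x)) x $ i \<bullet> p' x) = 0"
    by (subst integral_diff) (auto intro!: integrable_on_cuboid continuous_intros cont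
        has_grad_continuous_grad[OF p(1)] continuous_on_mollify)
  then show ?thesis by (simp add: inner_diff_left)
qed

text \<open>Each row \<open>z\<close> of \<open>v - mollify r v\<close> solves \<open>div (\<nabla>z - g) = 0\<close>, where \<open>g\<close> is built from \<open>F - cof F\<close>.\<close>

lemma L2sq_row_minus_mollify_le:
  assumes v: "has_jac v F" and r: "r > 0"
  shows "L2sq l s (\<lambda>x. (F x - mollify r F x) $ i) \<le> (16 + 720 * bump_slope) * L2sq l (s + 2 * r) (\<lambda>x. F x - cof (F x))"
proof -
  define g where "g = (\<lambda>x. F x - cof (F x))"
  let ?D = "L2sq l (s + 2 * r) g"
  have cont_F: "continuous_on UNIV F" by (rule has_jac_continuous(1)[OF v])
  have cont: "continuous_on UNIV (\<lambda>x. cof (F x))" "continuous_on UNIV g"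
    unfolding g_def by (intro continuous_intros cont_F)+
  let ?z = "\<lambda>x. v x $ i - mollify r (\<lambda>x. v x $ i) x" and ?h = "\<lambda>x. (g x - mollify r g x) $ i"
  have z: "has_grad ?z (\<lambda>x. (F x - mollify r F x) $ i)"
    by (rule has_grad_cong[OF has_grad_diff[OF has_jac_nth[OF v, of i] has_grad_mollify[OF has_jac_nth[OF v, of i]]]])
      (simp_all add: mollify_nth[OF cont_F])
  have "L2sq l (s + r) ?h \<le> 2 * L2sq l (s + r) g + 2 * L2sq l (s + r) (mollify r g)"
    using order_trans[OF norm_row_le norm_triangle_ineq4]
    by (intro L2sq_le_sum continuous_intros cont continuous_on_mollify)
  also have "\<dots> \<le> 4 * ?D"
    using L2sq_mollify_le[OF cont(2), of r "s + r" "s + 2 * r" l] L2sq_mono[OF cont(2), of "s + r" "s + 2 * r" l] r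
    by simp
  finally have h: "L2sq l (s + r) ?h \<le> 4 * ?D" .
  have "L2sq l (s + r) ?z = L2sq l (s + r) (\<lambda>x. mollify r (\<lambda>x. v x $ i) x - v x $ i)"
    unfolding L2sq_def by (simp add: norm_minus_commute abs_minus_commute)
  also have "\<dots> \<le> r^2 * L2sq l (s + r + r) g"
    unfolding g_def by (rule L2sq_mollify_minus_id_le[OF v]) (use r in simp)
  finally have "L2sq l (s + r) ?z / r^2 \<le> ?D" using r by (simp add: field_simps)
  then have "720 * bump_slope * (L2sq l (s + r) ?z / r^2) \<le> 720 * bump_slope * ?D"
    using bump_slope_pos by (intro mult_left_mono) auto
  moreover have "L2sq l s (\<lambda>x. (F x - mollify r F x) $ i)
      \<le> 4 * L2sq l (s + r) ?h + 720 * bump_slope / (s + r - s)^2 * L2sq l (s + r) ?z"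
  proof (rule Caccioppoli[OF z])
    show "continuous_on UNIV ?h" by (intro continuous_intros cont continuous_on_mollify)
    have residual: "(F x - mollify r F x) $ i - ?h x = (cof (F x) - mollify r (\<lambda>x. cof (F x)) x) $ i" for x
      unfolding g_def mollify_diff[OF cont_F cont(1)] by simp
    show "integral (cuboid l (s + r)) (\<lambda>x. ((F x - mollify r F x) $ i - ?h x) \<bullet> p' x) = 0"
      if "has_grad p p'" "\<And>x. x \<notin> cuboid l (s + r) \<Longrightarrow> p x = 0" for p p'
      unfolding residual by (rule integral_cof_minus_mollify_inner_grad[OF v that])
  qed (use r in simp)
  ultimately have "L2sq l s (\<lambda>x. (F x - mollify r F x) $ i) \<le> (16 + 720 * bump_slope) * ?D"
    using h by (simp add: algebra_simps)
  then show ?thesis by (simp only: g_def)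
qed

lemma L2sq_jac_minus_mollify_le:
  assumes v: "has_jac v F" and r: "r > 0"
  shows "L2sq l s (\<lambda>x. F x - mollify r F x) \<le> Caccioppoli_const * L2sq l (s + 2 * r) (\<lambda>x. F x - cof (F x))"
proof -
  have "L2sq l s (\<lambda>x. F x - mollify r F x) = (\<Sum>i\<in>UNIV. L2sq l s (\<lambda>x. (F x - mollify r F x) $ i))"
    by (intro L2sq_rows continuous_intros has_jac_continuous[OF v] continuous_on_mollify)
  also have "\<dots> \<le> (\<Sum>i\<in>(UNIV::3 set). (16 + 720 * bump_slope) * L2sq l (s + 2 * r) (\<lambda>x. F x - cof (F x)))"
    by (intro sum_mono L2sq_row_minus_mollify_le[OF v r])
  finally show ?thesis by (simp add: Caccioppoli_const_def algebra_simps)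
qed

section \<open>Rigidity for bounded gradients\<close>

locale rigidity_box =
  fixes l :: "real^3" and r M :: real
  assumes half_width_pos: "l $ i > 0" and r_pos: "r > 0" and M_nonneg: "M \<ge> 0"
begin

abbreviation "vol t \<equiv> measure lborel (cuboid l t)"

definition "l1_radius t = (\<Sum>i\<in>UNIV. l $ i + t)"

definition "near_const = Caccioppoli_const * (19 + 3 * M)^2"

definition "osc_const = 2 * ((M + 2) * sqrt (vol (8 * r))) + 2 * M * sqrt (vol (6 * r) * near_const)"

definition "sup_const = bump_max / r^3"

definition "slope_const = 8 * bump_slope / r^2"

definition "lipschitz_const = 9 * (sqrt (sup_const * (slope_const * osc_const)) * l1_radius (5 * r))"

definition "defect_const = 2 + 8 * near_const"

definition "rotation_const = lipschitz_const
  + sqrt ((2 * defect_const + 2 * (vol (5 * r) * lipschitz_const^2)) / vol (5 * r))"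

definition "strain_const = 2 * defect_const + 2 * (vol (5 * r) * (4 * rotation_const^2)^2)"

definition "strain_grad_const = sqrt (slope_const * (sup_const * strain_const))"

definition "lip_B_const = 9 * (9 * strain_grad_const * l1_radius (4 * r))"

definition "matrix_const = 2 * (4 * near_const) + 2 * (2 * near_const + 2 * (vol (4 * r) * lip_B_const^2))"

definition "rigidity_const = 2 * matrix_const + 2 * (2 + 2 * matrix_const)"

lemma vol_pos: "t \<ge> 0 \<Longrightarrow> vol t > 0"
  using half_width_pos by (rule content_cuboid_pos)

lemma l1_radius_nonneg: "t \<ge> 0 \<Longrightarrow> l1_radius t \<ge> 0"
  unfolding l1_radius_def using half_width_pos by (intro sum_nonneg add_nonneg_nonneg) (auto intro: less_imp_le)

lemma consts_nonneg:
  "near_const \<ge> 0" "osc_const \<ge> 0" "sup_const \<ge> 0" "slope_const \<ge> 0" "lipschitz_const \<ge> 0"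
  "defect_const \<ge> 0" "rotation_const \<ge> 0" "strain_const \<ge> 0" "strain_grad_const \<ge> 0"
  "lip_B_const \<ge> 0" "matrix_const \<ge> 0" "rigidity_const \<ge> 0"
proof -
  show near: "near_const \<ge> 0"
    using bump_slope_pos by (simp add: near_const_def Caccioppoli_const_def)
  show osc: "osc_const \<ge> 0" using M_nonneg near by (simp add: osc_const_def)
  show sup: "sup_const \<ge> 0" "slope_const \<ge> 0"
    using r_pos bump_max_pos bump_slope_pos by (simp_all add: sup_const_def slope_const_def)
  show lip: "lipschitz_const \<ge> 0"
    using osc sup r_pos l1_radius_nonneg by (simp add: lipschitz_const_def)
  show defect: "defect_const \<ge> 0" using near by (simp add: defect_const_def)
  show "rotation_const \<ge> 0" using lip defect vol_pos r_pos by (simp add: rotation_const_def)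
  show strain: "strain_const \<ge> 0" using defect by (simp add: strain_const_def)
  show sg: "strain_grad_const \<ge> 0" using sup strain by (simp add: strain_grad_const_def)
  show "lip_B_const \<ge> 0" using sg r_pos l1_radius_nonneg by (simp add: lip_B_const_def)
  show "matrix_const \<ge> 0" "rigidity_const \<ge> 0"
    using near by (simp_all add: matrix_const_def rigidity_const_def)
qed

lemma zero_in_box: "t \<ge> 0 \<Longrightarrow> 0 \<in> cuboid l t"
  using half_width_pos by (rule zero_in_cuboid)

end

lemma sqrt_mult_le: "a^2 \<le> c * e \<Longrightarrow> 0 \<le> c \<Longrightarrow> 0 \<le> e \<Longrightarrow> a \<le> sqrt c * sqrt e"
  by (metis real_le_rsqrt real_sqrt_mult)

lemma sqrt_mult_sq_le: "a^2 \<le> c * e^2 \<Longrightarrow> 0 \<le> c \<Longrightarrow> 0 \<le> e \<Longrightarrow> a \<le> sqrt c * e"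
  using sqrt_mult_le[of a c "e^2"] by simp

text \<open>The \<open>L\<^sup>2\<close> distance of the gradient to the rotations is at most \<open>e\<close>. Mollifying twice, on scale \<open>r\<close>,
  gives a field \<open>F2\<close> which is pointwise \<open>O(sqrt e)\<close>-close to one rotation.\<close>

locale bounded_jacobian = rigidity_box +
  fixes v F and e :: real
  assumes jac: "has_jac v F" and F_le: "x \<in> cuboid l (8 * r) \<Longrightarrow> norm (F x) \<le> M"
    and e_pos: "0 < e" and e_le_1: "e \<le> 1"
    and defect: "L2sq l (8 * r) (rot_defect F) \<le> e^2"
begin

definition "F1 = mollify r F"

definition "F2 = mollify r F1"

definition "osc x = mollify r (\<lambda>z. (norm (F z - F x))^2) x"

lemma cont: "continuous_on S F" "continuous_on S F1" "continuous_on S F2" "continuous_on S (mollify r F2)"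
proof -
  have "continuous_on UNIV F" by (rule has_jac_continuous(1)[OF jac])
  then have "continuous_on UNIV F" "continuous_on UNIV F1" "continuous_on UNIV F2" "continuous_on UNIV (mollify r F2)"
    unfolding F1_def F2_def by (simp_all add: continuous_on_mollify)
  then show "continuous_on S F" "continuous_on S F1" "continuous_on S F2" "continuous_on S (mollify r F2)"
    by (auto intro: continuous_on_subset)
qed

lemma L2sq_F_minus_F1: "L2sq l (6 * r) (\<lambda>x. F x - F1 x) \<le> near_const * e^2"
proof -
  have "L2sq l (8 * r) (\<lambda>x. F x - cof (F x)) \<le> (19 + 3 * M)^2 * L2sq l (8 * r) (rot_defect F)"
    using norm_minus_cof_le[OF F_le]
    by (intro L2sq_le continuous_intros cont) (simp add: infdist_nonneg)
  also have "\<dots> \<le> (19 + 3 * M)^2 * e^2" using defect by (intro mult_left_mono) auto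
  finally have "Caccioppoli_const * L2sq l (8 * r) (\<lambda>x. F x - cof (F x)) \<le> near_const * e^2"
    using bump_slope_pos by (simp add: near_const_def Caccioppoli_const_def mult_left_mono mult.assoc)
  then show ?thesis
    using L2sq_jac_minus_mollify_le[OF jac r_pos, of l "6 * r"] by (simp add: F1_def)
qed

lemma osc_eq: "osc x = mollify r (\<lambda>x. (norm (F x))^2) x - (norm (F x))^2 + 2 * (F x \<bullet> (F x - F1 x))"
proof -
  have "(\<lambda>z. (norm (F z - F x))^2) = (\<lambda>z. (norm (F z))^2 - ((F z \<bullet> (2 *\<^sub>R F x)) - (norm (F x))^2))"
    by (auto simp: power2_norm_eq_inner inner_diff_left inner_diff_right inner_commute algebra_simps)
  moreover have "mollify r (\<lambda>z. F z \<bullet> (2 *\<^sub>R F x)) x = F1 x \<bullet> (2 *\<^sub>R F x)"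
    using mollify_linear[OF cont(1) bounded_linear_inner_left, where r=r and x=x] unfolding F1_def by metis
  ultimately have "osc x = mollify r (\<lambda>x. (norm (F x))^2) x - (F1 x \<bullet> (2 *\<^sub>R F x) - (norm (F x))^2)"
    by (simp add: osc_def mollify_diff mollify_const continuous_intros cont)
  then show ?thesis by (simp add: power2_norm_eq_inner inner_diff_right inner_commute)
qed

lemma continuous_on_osc: "continuous_on UNIV osc"
  unfolding osc_eq[abs_def] by (intro continuous_intros cont continuous_on_mollify)

lemma osc_le:
  assumes x: "x \<in> cuboid l (6 * r)"
  shows "osc x \<le> mollify r (\<lambda>x. \<bar>(norm (F x))^2 - 3\<bar>) x + \<bar>(norm (F x))^2 - 3\<bar> + 2 * M * norm (F x - F1 x)"
proof -
  have "norm (F x) \<le> M" using x cuboid_mono[of "6 * r" "8 * r" l] r_pos F_le by auto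
  then have "F x \<bullet> (F x - F1 x) \<le> M * norm (F x - F1 x)"
    using norm_cauchy_schwarz[of "F x" "F x - F1 x"] mult_right_mono[of "norm (F x)" M "norm (F x - F1 x)"] by simp
  moreover have "mollify r (\<lambda>x. (norm (F x))^2) x - 3 = mollify r (\<lambda>x. (norm (F x))^2 - 3) x"
    by (simp add: mollify_diff mollify_const continuous_intros cont)
  moreover have "mollify r (\<lambda>x. (norm (F x))^2 - 3) x \<le> mollify r (\<lambda>x. \<bar>(norm (F x))^2 - 3\<bar>) x"
    by (intro mollify_mono continuous_intros cont) simp
  ultimately show ?thesis unfolding osc_eq by linarith
qed

lemma integral_abs_norm_sq_minus_3: "integral (cuboid l (8 * r)) (\<lambda>x. \<bar>(norm (F x))^2 - 3\<bar>) \<le> (M + 2) * sqrt (vol (8 * r)) * e"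
proof -
  have "integral (cuboid l (8 * r)) (\<lambda>x. \<bar>(norm (F x))^2 - 3\<bar>)
      \<le> integral (cuboid l (8 * r)) (\<lambda>x. (M + 2) * norm (rot_defect F x))"
    using abs_norm_sq_minus_3_le[OF F_le]
    by (intro integral_le integrable_on_cuboid continuous_intros cont) (simp add: infdist_nonneg)
  also have "\<dots> = (M + 2) * integral (cuboid l (8 * r)) (\<lambda>x. norm (rot_defect F x))" by simp
  also have "\<dots> \<le> (M + 2) * sqrt (vol (8 * r) * L2sq l (8 * r) (rot_defect F))"
    using M_nonneg by (intro mult_left_mono integral_norm_le_sqrt_L2sq continuous_intros cont) auto
  also have "\<dots> \<le> (M + 2) * sqrt (vol (8 * r) * e^2)"
    using M_nonneg defect by (intro mult_left_mono real_sqrt_le_mono) auto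
  finally show ?thesis using e_pos by (simp add: real_sqrt_mult mult.assoc)
qed

lemma integral_osc_le: "integral (cuboid l (6 * r)) osc \<le> osc_const * e"
proof -
  let ?q = "\<lambda>x. \<bar>(norm (F x))^2 - 3\<bar>"
  have cont_q: "continuous_on UNIV ?q" by (intro continuous_intros cont)
  have "integral (cuboid l (6 * r)) osc
      \<le> integral (cuboid l (6 * r)) (\<lambda>x. (mollify r ?q x + ?q x) + 2 * M * norm (F x - F1 x))"
    by (intro integral_le integrable_on_cuboid continuous_on_osc continuous_on_add continuous_on_mollify
        cont_q continuous_on_mult continuous_on_const continuous_on_norm continuous_on_diff cont osc_le)
  also have "\<dots> = integral (cuboid l (6 * r)) (mollify r ?q) + integral (cuboid l (6 * r)) ?q
      + 2 * M * integral (cuboid l (6 * r)) (\<lambda>x. norm (F x - F1 x))"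
    by (subst integral_add integral_add; (intro integrable_on_cuboid continuous_intros cont continuous_on_mollify)?)+ simp
  also have "\<dots> \<le> integral (cuboid l (8 * r)) ?q + integral (cuboid l (8 * r)) ?q
      + 2 * M * sqrt (vol (6 * r) * L2sq l (6 * r) (\<lambda>x. F x - F1 x))"
    using r_pos M_nonneg by (intro add_mono mult_left_mono integral_mollify_le integral_cuboid_mono cont_q
        integral_norm_le_sqrt_L2sq continuous_intros cont) auto
  also have "\<dots> \<le> 2 * ((M + 2) * sqrt (vol (8 * r)) * e) + 2 * M * sqrt (vol (6 * r) * (near_const * e^2))"
    using integral_abs_norm_sq_minus_3 L2sq_F_minus_F1 M_nonneg
    by (simp add: add_mono mult_left_mono real_sqrt_le_mono)
  also have "\<dots> = osc_const * e"
    using e_pos by (simp add: osc_const_def real_sqrt_mult algebra_simps)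
  finally show ?thesis .
qed

lemma norm_mollify_grad_entry_le:
  assumes x: "x \<in> cuboid l (5 * r)"
  shows "norm (mollify r (grad_mollify r (\<lambda>x. F x $ i $ j)) x) \<le> sqrt (sup_const * (slope_const * osc_const)) * sqrt e"
proof (rule sqrt_mult_le)
  let ?f = "\<lambda>x. F x $ i $ j"
  have f: "continuous_on UNIV ?f" by (intro continuous_intros cont)
  have grad: "continuous_on UNIV (grad_mollify r ?f)"
    by (rule has_grad_continuous_grad[OF has_grad_mollify_continuous[OF f r_pos]])
  have le_osc: "(norm (grad_mollify r ?f x))^2 \<le> slope_const * osc x" for x
  proof -
    have "(norm (grad_mollify r ?f x))^2 \<le> slope_const * mollify r (\<lambda>z. (?f z - ?f x)^2) x"
      unfolding slope_const_def by (rule norm_grad_mollify_sq_le[OF f r_pos])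
    also have "\<dots> \<le> slope_const * osc x"
      unfolding osc_def
    proof (intro mult_left_mono[OF _ consts_nonneg(4)] mollify_mono continuous_intros cont)
      show "(F z $ i $ j - F x $ i $ j)^2 \<le> (norm (F z - F x))^2" for z
        using power_mono[OF abs_entry_le_norm[of "F z - F x" i j] abs_ge_zero, of 2] by simp
    qed
    finally show ?thesis .
  qed
  have "(norm (mollify r (grad_mollify r ?f) x))^2 \<le> mollify r (\<lambda>x. (norm (grad_mollify r ?f x))^2) x"
    by (rule norm_mollify_sq_le[OF grad])
  also have "\<dots> \<le> sup_const * integral (cuboid l (6 * r)) (\<lambda>x. (norm (grad_mollify r ?f x))^2)"
    unfolding sup_const_def
    by (rule mollify_le_integral_cuboid[OF _ _ r_pos x]) (auto intro!: continuous_intros grad)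
  also have "\<dots> \<le> sup_const * integral (cuboid l (6 * r)) (\<lambda>x. slope_const * osc x)"
    by (intro mult_left_mono consts_nonneg integral_le integrable_on_cuboid continuous_intros grad continuous_on_osc le_osc)
  also have "\<dots> \<le> sup_const * (slope_const * (osc_const * e))"
    by (simp add: mult_left_mono consts_nonneg integral_osc_le)
  finally show "(norm (mollify r (grad_mollify r ?f) x))^2 \<le> sup_const * (slope_const * osc_const) * e"
    by (simp add: mult.assoc)
qed (use consts_nonneg e_pos in auto)

lemma norm_F2_minus_F2_0_le:
  assumes x: "x \<in> cuboid l (5 * r)"
  shows "norm (F2 x - F2 0) \<le> lipschitz_const * sqrt e"
proof -
  have "\<bar>(F2 x - F2 0) $ i $ j\<bar> \<le> sqrt (sup_const * (slope_const * osc_const)) * sqrt e * l1_radius (5 * r)" for i j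
  proof -
    let ?f = "\<lambda>x. F x $ i $ j"
    have F2_entry: "F2 y $ i $ j = mollify r (mollify r ?f) y" for y
      unfolding F2_def F1_def by (simp add: mollify_nth continuous_intros continuous_on_mollify cont)
    have "has_grad (mollify r (mollify r ?f)) (mollify r (grad_mollify r ?f))"
      by (intro has_grad_mollify has_grad_mollify_continuous r_pos continuous_intros cont)
    from has_grad_lipschitz_cuboid[OF this norm_mollify_grad_entry_le x zero_in_box]
    show ?thesis using r_pos by (simp add: F2_entry l1_radius_def)
  qed
  from norm_le_entries[OF this] show ?thesis by (simp add: lipschitz_const_def mult_ac)
qed

lemma L2sq_F_minus_F2: "L2sq l (5 * r) (\<lambda>x. F x - F2 x) \<le> 4 * near_const * e^2"
proof -
  have "(\<lambda>x. F1 x - F2 x) = mollify r (\<lambda>x. F x - F1 x)"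
    by (rule ext) (simp add: mollify_diff cont F2_def, simp add: F1_def)
  then have "L2sq l (5 * r) (\<lambda>x. F1 x - F2 x) \<le> L2sq l (6 * r) (\<lambda>x. F x - F1 x)"
    using r_pos by (simp add: L2sq_mollify_le continuous_intros cont)
  moreover have "L2sq l (5 * r) (\<lambda>x. F x - F1 x) \<le> L2sq l (6 * r) (\<lambda>x. F x - F1 x)"
    using r_pos by (intro L2sq_mono continuous_intros cont) auto
  ultimately show ?thesis
    using L2sq_triangle[OF cont(1-3), of l "5 * r"] L2sq_F_minus_F1 by linarith
qed

lemma L2sq_defect_F2: "L2sq l (5 * r) (rot_defect F2) \<le> defect_const * e^2"
proof -
  have "L2sq l (5 * r) (rot_defect F) \<le> L2sq l (8 * r) (rot_defect F)"
    using r_pos by (intro L2sq_mono continuous_intros cont) auto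
  then show ?thesis
    using L2sq_infdist_triangle[OF cont(1,3), of l "5 * r"] defect L2sq_F_minus_F2
    by (simp add: defect_const_def algebra_simps)
qed

lemma F2_near_rotation:
  obtains R where "R \<in> SO3" "\<And>x. x \<in> cuboid l (5 * r) \<Longrightarrow> norm (F2 x - R) \<le> rotation_const * sqrt e"
proof -
  let ?m = "vol (5 * r)"
  have m: "?m > 0" using vol_pos r_pos by simp
  have "L2sq l (5 * r) (\<lambda>x. F2 x - F2 0) \<le> ?m * (lipschitz_const * sqrt e)^2"
    by (intro L2sq_le_sup continuous_intros cont norm_F2_minus_F2_0_le)
  then have "L2sq l (5 * r) (\<lambda>x. F2 x - F2 0) \<le> ?m * lipschitz_const^2 * e"
    using e_pos by (simp add: power_mult_distrib)
  from infdist_const_le[OF cont(3) half_width_pos _ L2sq_defect_F2 this]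
  have "(infdist (F2 0) SO3)^2 \<le> (2 * (defect_const * e^2) + 2 * (?m * lipschitz_const^2 * e)) / ?m"
    using r_pos by simp
  also have "\<dots> \<le> (2 * (defect_const * e) + 2 * (?m * lipschitz_const^2 * e)) / ?m"
    using m consts_nonneg e_pos e_le_1
    by (intro divide_right_mono add_right_mono mult_left_mono) (auto simp: power2_eq_square mult_left_le)
  also have "\<dots> = (2 * defect_const + 2 * (?m * lipschitz_const^2)) / ?m * e" by (simp add: algebra_simps)
  finally have dist: "infdist (F2 0) SO3 \<le> sqrt ((2 * defect_const + 2 * (?m * lipschitz_const^2)) / ?m) * sqrt e"
    using consts_nonneg m e_pos by (intro sqrt_mult_le) auto
  obtain R where R: "R \<in> SO3" "infdist (F2 0) SO3 = norm (F2 0 - R)" by (rule SO3_nearest)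
  have "norm (F2 x - R) \<le> rotation_const * sqrt e" if "x \<in> cuboid l (5 * r)" for x
    using norm_triangle_ineq[of "F2 x - F2 0" "F2 0 - R"] norm_F2_minus_F2_0_le[OF that] dist R(2)
    by (simp add: rotation_const_def algebra_simps)
  then show thesis using R(1) by (intro that)
qed

end

lemma gradient_from_symmetrized_gradient:
  fixes D E :: "3 \<Rightarrow> 3 \<Rightarrow> 3 \<Rightarrow> real"
  assumes "\<And>i j k. D i j k = D i k j" "\<And>i j k. E i j k = (D i j k + D j i k) / 2"
  shows "D i j k = E i j k + E i k j - E j k i"
  using assms(1)[of i j k] assms(1)[of j i k] assms(1)[of k i j] by (simp add: assms(2) field_simps)

text \<open>Near one rotation the symmetric part \<open>S\<close> of \<open>transpose R ** F2 - mat 1\<close> is \<open>O(e)\<close> in \<open>L\<^sup>2\<close>, and it controls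
  the full gradient of \<open>transpose R ** F2\<close>.\<close>

locale near_rotation = bounded_jacobian +
  fixes R
  assumes rotation: "R \<in> SO3"
    and F2_near: "x \<in> cuboid l (5 * r) \<Longrightarrow> norm (F2 x - R) \<le> rotation_const * sqrt e"
begin

definition "B x = transpose R ** F2 x"

definition "S x = sym_part (B x) - mat 1"

lemma has_jac_B: "has_jac (\<lambda>x. transpose R *v mollify r (mollify r v) x) B"
  unfolding B_def F2_def F1_def by (intro has_jac_left_mult has_jac_mollify jac)

lemma cont_B: "continuous_on T B"
  by (rule has_jac_continuous(1)[OF has_jac_B])

lemma S_nth: "S x $ i $ j = (B x $ i $ j + B x $ j $ i) / 2 - mat 1 $ i $ j"
  by (simp add: S_def sym_part_nth)

lemma cont_S: "continuous_on T S"
  unfolding S_def sym_part_def transpose_def by (intro continuous_intros cont_B continuous_on_vec_lambda)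

lemma norm_S_le:
  assumes x: "x \<in> cuboid l (5 * r)"
  shows "norm (S x) \<le> rot_defect F2 x + 4 * rotation_const^2 * e"
proof -
  have R': "transpose R \<in> SO3" by (rule SO3_transpose[OF rotation])
  have "norm (B x - mat 1) = norm (F2 x - R)"
    using norm_SO3_mult[OF R', of "F2 x - R"] by (simp add: B_def matrix_diff_mult SO3_D(1)[OF rotation])
  moreover have "infdist (B x) SO3 = infdist (F2 x) SO3" unfolding B_def by (rule infdist_SO3_mult[OF R'])
  ultimately have "norm (S x) \<le> rot_defect F2 x + (rot_defect F2 x + norm (F2 x - R))^2"
    using norm_sym_part_minus_id_le[of "B x"] by (simp add: S_def)
  also have "\<dots> \<le> rot_defect F2 x + (rotation_const * sqrt e + rotation_const * sqrt e)^2"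
    using infdist_SO3_le[OF rotation, of "F2 x"] F2_near[OF x]
    by (intro add_left_mono power_mono add_mono) (auto simp: infdist_nonneg)
  also have "(rotation_const * sqrt e + rotation_const * sqrt e)^2 = 4 * rotation_const^2 * e"
    using e_pos by (simp add: power2_eq_square algebra_simps)
  finally show ?thesis .
qed

lemma L2sq_S: "L2sq l (5 * r) S \<le> strain_const * e^2"
proof -
  have "L2sq l (5 * r) S \<le> 2 * L2sq l (5 * r) (rot_defect F2) + 2 * L2sq l (5 * r) (\<lambda>x. 4 * rotation_const^2 * e)"
    using norm_S_le e_pos by (intro L2sq_le_sum continuous_intros cont_S cont) (auto simp: infdist_nonneg)
  then show ?thesis
    using L2sq_defect_F2 by (simp add: L2sq_const strain_const_def power_mult_distrib algebra_simps)
qed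

lemma norm_grad_mollify_S_le:
  assumes x: "x \<in> cuboid l (4 * r)"
  shows "norm (grad_mollify r (\<lambda>x. S x $ i $ j) x) \<le> strain_grad_const * e"
  unfolding strain_grad_const_def
proof (rule sqrt_mult_sq_le)
  have "(norm (grad_mollify r (\<lambda>x. S x $ i $ j) x))^2 \<le> slope_const * mollify r (\<lambda>z. (S z $ i $ j - 0)^2) x"
    unfolding slope_const_def by (rule norm_grad_mollify_sq_le) (intro continuous_intros cont_S r_pos)+
  also have "mollify r (\<lambda>z. (S z $ i $ j - 0)^2) x \<le> mollify r (\<lambda>z. (norm (S z))^2) x"
    by (intro mollify_mono continuous_intros cont_S)
      (use power_mono[OF abs_entry_le_norm abs_ge_zero, of _ _ _ 2] in simp)
  also have "\<dots> \<le> sup_const * L2sq l (5 * r) S"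
    unfolding sup_const_def L2sq_def
    by (rule mollify_le_integral_cuboid[OF _ _ r_pos x]) (auto intro!: continuous_intros cont_S)
  also have "\<dots> \<le> sup_const * (strain_const * e^2)"
    by (intro mult_left_mono consts_nonneg L2sq_S)
  finally show "(norm (grad_mollify r (\<lambda>x. S x $ i $ j) x))^2 \<le> slope_const * (sup_const * strain_const) * e^2"
    using consts_nonneg by (simp add: mult_left_mono mult.assoc)
qed (use consts_nonneg e_pos in auto)

lemma norm_grad_mollify_B_le:
  assumes x: "x \<in> cuboid l (4 * r)"
  shows "norm (grad_mollify r (\<lambda>x. B x $ i $ j) x) \<le> 9 * strain_grad_const * e"
proof -
  let ?D = "\<lambda>i j k. grad_mollify r (\<lambda>x. B x $ i $ j) x $ k"
  let ?E = "\<lambda>i j k. grad_mollify r (\<lambda>x. S x $ i $ j) x $ k"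
  have sym: "?D i j k = ?D i k j" for i j k by (rule grad_mollify_sym[OF has_jac_nth[OF has_jac_B] r_pos])
  have strain: "?E i j k = (?D i j k + ?D j i k) / 2" for i j k
    using grad_mollify_affine_combination[of "\<lambda>x. B x $ i $ j" "\<lambda>x. B x $ j $ i" r "1/2" "1/2" "mat 1 $ i $ j" x]
    by (simp add: S_nth add_divide_distrib continuous_intros cont_B)
  have E: "\<bar>?E a b c\<bar> \<le> strain_grad_const * e" for a b c
    using component_le_norm_cart[of "grad_mollify r (\<lambda>x. S x $ a $ b) x" c] norm_grad_mollify_S_le[OF x, of a b]
    by linarith
  have "\<bar>?D i j k\<bar> \<le> 3 * strain_grad_const * e" for k
    unfolding gradient_from_symmetrized_gradient[of ?D ?E, OF sym strain, of i j k]
    using E[of i j k] E[of i k j] E[of j k i] by linarith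
  from this[of 1] this[of 2] this[of 3] show ?thesis
    using norm_le_l1_cart[of "grad_mollify r (\<lambda>x. B x $ i $ j) x"] by (simp add: sum_3)
qed

lemma norm_mollify_B_minus_const_le:
  assumes x: "x \<in> cuboid l (4 * r)"
  shows "norm (mollify r B x - mollify r B 0) \<le> lip_B_const * e"
proof -
  have "\<bar>(mollify r B x - mollify r B 0) $ i $ j\<bar> \<le> 9 * strain_grad_const * e * l1_radius (4 * r)" for i j
    using has_grad_lipschitz_cuboid[OF has_grad_mollify_continuous norm_grad_mollify_B_le x zero_in_box, of i j] r_pos
    by (simp add: mollify_nth continuous_intros cont_B l1_radius_def)
  from norm_le_entries[OF this] show ?thesis by (simp add: lip_B_const_def mult_ac)
qed

definition "A = R ** mollify r B 0"

lemma norm_mollify_F2_minus_A_le: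
  assumes "x \<in> cuboid l (4 * r)"
  shows "norm (mollify r F2 x - A) \<le> lip_B_const * e"
proof -
  have "R ** mollify r B x = mollify r F2 x" for x
    unfolding B_def mollify_linear[OF cont(3) bounded_linear_matrix_mult, symmetric]
    by (simp add: matrix_mul_assoc SO3_D(2)[OF rotation])
  then show ?thesis
    using norm_mollify_B_minus_const_le[OF assms] norm_SO3_mult[OF rotation, of "mollify r B x - mollify r B 0"]
    by (simp add: A_def matrix_diff_mult)
qed

lemma L2sq_F_minus_A: "L2sq l (4 * r) (\<lambda>x. F x - A) \<le> matrix_const * e^2"
proof -
  have "L2sq l (4 * r) (\<lambda>x. mollify r F2 x - A) \<le> vol (4 * r) * (lip_B_const * e)^2"
    by (intro L2sq_le_sup continuous_intros cont norm_mollify_F2_minus_A_le)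
  moreover have "L2sq l (4 * r) (\<lambda>x. F2 x - mollify r F2 x) \<le> near_const * e^2"
  proof -
    have F1_F2: "mollify r (\<lambda>x. F x - F1 x) = (\<lambda>x. F1 x - F2 x)"
      by (rule ext) (simp add: mollify_diff cont F2_def, simp add: F1_def)
    have "(\<lambda>x. F2 x - mollify r F2 x) = mollify r (mollify r (\<lambda>x. F x - F1 x))"
      unfolding F1_F2 by (rule ext) (simp add: mollify_diff cont, simp add: F2_def)
    then have "L2sq l (4 * r) (\<lambda>x. F2 x - mollify r F2 x) \<le> L2sq l (5 * r) (mollify r (\<lambda>x. F x - F1 x))"
      using r_pos by (simp add: L2sq_mollify_le continuous_on_mollify continuous_intros cont)
    also have "\<dots> \<le> L2sq l (6 * r) (\<lambda>x. F x - F1 x)"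
      using r_pos by (simp add: L2sq_mollify_le continuous_intros cont)
    finally show ?thesis using L2sq_F_minus_F1 by linarith
  qed
  moreover have "L2sq l (4 * r) (\<lambda>x. F x - F2 x) \<le> 4 * near_const * e^2"
    using L2sq_mono[of "\<lambda>x. F x - F2 x" "4 * r" "5 * r" l] L2sq_F_minus_F2 r_pos
    by (simp add: continuous_intros cont)
  ultimately show ?thesis
    using L2sq_triangle[OF cont(3,4) continuous_on_const, of l "4 * r" A]
      L2sq_triangle[OF cont(1,3) continuous_on_const, of l "4 * r" A]
    by (simp add: matrix_const_def power_mult_distrib algebra_simps)
qed

lemma L2sq_F_minus_rotation: "\<exists>Q\<in>SO3. L2sq l 0 (\<lambda>x. F x - Q) \<le> rigidity_const * e^2"
proof -
  have m: "vol (4 * r) > 0" using vol_pos r_pos by simp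
  have "L2sq l (4 * r) (rot_defect F) \<le> L2sq l (8 * r) (rot_defect F)"
    using r_pos by (intro L2sq_mono continuous_intros cont) auto
  then have "L2sq l (4 * r) (rot_defect F) \<le> e^2" using defect by simp
  from infdist_const_le[OF cont(1) half_width_pos _ this L2sq_F_minus_A]
  have "(infdist A SO3)^2 \<le> (2 * e^2 + 2 * (matrix_const * e^2)) / vol (4 * r)" using r_pos by simp
  then have "vol (4 * r) * (infdist A SO3)^2 \<le> (2 + 2 * matrix_const) * e^2"
    using m by (simp add: pos_le_divide_eq algebra_simps)
  moreover obtain Q where Q: "Q \<in> SO3" "infdist A SO3 = norm (A - Q)" by (rule SO3_nearest)
  ultimately have "L2sq l (4 * r) (\<lambda>x. A - Q) \<le> (2 + 2 * matrix_const) * e^2" by (simp add: L2sq_const)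
  then have "L2sq l (4 * r) (\<lambda>x. F x - Q) \<le> rigidity_const * e^2"
    using L2sq_triangle[OF cont(1) continuous_on_const continuous_on_const, of l "4 * r" Q A] L2sq_F_minus_A
    by (simp add: rigidity_const_def algebra_simps)
  moreover have "L2sq l 0 (\<lambda>x. F x - Q) \<le> L2sq l (4 * r) (\<lambda>x. F x - Q)"
    using r_pos by (intro L2sq_mono continuous_intros cont) auto
  ultimately show ?thesis using Q(1) by (intro bexI[of _ Q]) auto
qed

end

theorem (in rigidity_box) bounded_rigidity:
  assumes "has_jac v F" "\<And>x. x \<in> cuboid l (8 * r) \<Longrightarrow> norm (F x) \<le> M" "0 < e" "e \<le> 1"
    "L2sq l (8 * r) (rot_defect F) \<le> e^2"
  shows "\<exists>R\<in>SO3. L2sq l 0 (\<lambda>x. F x - R) \<le> rigidity_const * e^2"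
proof -
  interpret bounded_jacobian l r M v F e using assms by unfold_locales
  obtain R where "R \<in> SO3" "\<And>x. x \<in> cuboid l (5 * r) \<Longrightarrow> norm (F2 x - R) \<le> rotation_const * sqrt e"
    by (rule F2_near_rotation) (rule that)
  then interpret near_rotation l r M v F e R by unfold_locales
  show ?thesis by (rule L2sq_F_minus_rotation)
qed

section \<open>Truncation and interior rigidity\<close>

lemma emeasure_ball_5_le:
  fixes x :: "'a::euclidean_space"
  assumes "t \<ge> 0"
  shows "emeasure lborel (ball x (5 * t)) \<le> 5^DIM('a) * emeasure lborel (cball x t)"
  using assms by (simp add: emeasure_ball emeasure_cball power_mult_distrib ennreal_mult' mult_ac
    flip: ennreal_power)

lemma emeasure_UN_balls_le:
  fixes C :: "'a::euclidean_space set"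
  assumes C: "countable C" "disjoint_family_on (\<lambda>j. cball j (t j)) C" and sets: "sets \<mu> = sets borel"
    and ball: "\<And>j. j \<in> C \<Longrightarrow> 0 \<le> t j" "\<And>j. j \<in> C \<Longrightarrow> cball j (t j) \<subseteq> Y"
      "\<And>j. j \<in> C \<Longrightarrow> emeasure lborel (cball j (t j)) \<le> emeasure \<mu> (cball j (t j))"
    and Y: "Y \<in> sets borel"
  shows "emeasure lborel (\<Union>j\<in>C. ball j (5 * t j)) \<le> 5^DIM('a) * emeasure \<mu> Y"
proof -
  let ?G = "\<Union>j\<in>C. ball j (5 * t j)"
  have "emeasure lborel ?G = (\<integral>\<^sup>+x. indicator ?G x \<partial>lborel)"
    by (rule nn_integral_indicator[symmetric]) (auto intro!: borel_open)
  also have "\<dots> \<le> (\<integral>\<^sup>+x. (\<integral>\<^sup>+j. indicator (ball j (5 * t j)) x \<partial>count_space C) \<partial>lborel)"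
  proof (rule nn_integral_mono)
    fix x
    show "indicator ?G x \<le> (\<integral>\<^sup>+j. indicator (ball j (5 * t j)) x \<partial>count_space C)"
    proof (cases "x \<in> ?G")
      case True
      then obtain j where "j \<in> C" "x \<in> ball j (5 * t j)" by blast
      then show ?thesis
        using nn_integral_ge_point[of j C "\<lambda>j. indicator (ball j (5 * t j)) x"] True by simp
    qed simp
  qed
  also have "\<dots> = (\<integral>\<^sup>+j. emeasure lborel (ball j (5 * t j)) \<partial>count_space C)"
    by (subst nn_integral_count_space_nn_integral[OF C(1)]) (auto intro!: borel_measurable_indicator borel_open)
  also have "\<dots> \<le> (\<integral>\<^sup>+j. 5^DIM('a) * emeasure \<mu> (cball j (t j)) \<partial>count_space C)"
    using ball by (intro nn_integral_mono order_trans[OF emeasure_ball_5_le] mult_left_mono) auto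
  also have "\<dots> = 5^DIM('a) * (\<integral>\<^sup>+j. emeasure \<mu> (cball j (t j)) \<partial>count_space C)"
    by (rule nn_integral_cmult) simp
  also have "(\<integral>\<^sup>+j. emeasure \<mu> (cball j (t j)) \<partial>count_space C) = emeasure \<mu> (\<Union>j\<in>C. cball j (t j))"
    by (rule emeasure_UN_countable[symmetric]) (use C sets in auto)
  also have "\<dots> \<le> emeasure \<mu> Y"
    using ball Y sets by (intro emeasure_mono) auto
  finally show ?thesis by (simp add: mult_left_mono)
qed

text \<open>The weak type estimate for the maximal function of \<open>\<mu>\<close> on radii up to \<open>t0\<close>.\<close>

lemma exceptional_set:
  fixes X :: "'a::euclidean_space set"
  assumes sets: "sets \<mu> = sets borel" and Y: "\<And>x. x \<in> X \<Longrightarrow> cball x t0 \<subseteq> Y" "Y \<in> sets borel"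
  obtains G where "open G" "emeasure lborel G \<le> 5^DIM('a) * emeasure \<mu> Y"
    "\<And>x t. x \<in> X - G \<Longrightarrow> 0 < t \<Longrightarrow> t \<le> t0 \<Longrightarrow> emeasure \<mu> (cball x t) \<le> emeasure lborel (cball x t)"
proof -
  define heavy where "heavy x t \<longleftrightarrow> 0 < t \<and> t \<le> t0 \<and> emeasure \<mu> (cball x t) > emeasure lborel (cball x t)" for x t
  define K where "K = {x\<in>X. \<exists>t. heavy x t}"
  define radius where "radius x = (SOME t. heavy x t)" for x
  have radius: "heavy x (radius x)" if "x \<in> K" for x
    using that someI_ex[of "heavy x"] unfolding K_def radius_def by auto
  then have radius_bounds: "0 < radius x \<and> radius x \<le> t0" if "x \<in> K" for x
    using that unfolding heavy_def by auto
  then obtain C where C: "countable C" "C \<subseteq> K"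
    and disjoint: "pairwise (\<lambda>i j. disjnt (cball i (radius i)) (cball j (radius j))) C"
    and covers: "\<And>i. i \<in> K \<Longrightarrow> \<exists>j. j \<in> C \<and> \<not> disjnt (cball i (radius i)) (cball j (radius j)) &
      cball i (radius i) \<subseteq> ball j (5 * radius j)"
    by (rule Vitali_covering_lemma_cballs_balls[of K radius t0 "\<lambda>x. x"]) auto
  show thesis
  proof
    show "open (\<Union>j\<in>C. ball j (5 * radius j))" by blast
    show "emeasure lborel (\<Union>j\<in>C. ball j (5 * radius j)) \<le> 5^DIM('a) * emeasure \<mu> Y"
    proof (rule emeasure_UN_balls_le[OF C(1) _ sets _ _ _ Y(2)])
      show "disjoint_family_on (\<lambda>j. cball j (radius j)) C"
        using disjoint unfolding disjoint_family_on_def pairwise_def disjnt_def by blast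
      fix j assume "j \<in> C"
      then have j: "j \<in> K" "j \<in> X" using C(2) unfolding K_def by auto
      show "0 \<le> radius j" using radius_bounds[OF j(1)] by simp
      show "cball j (radius j) \<subseteq> Y"
        using radius_bounds[OF j(1)] Y(1)[OF j(2)] subset_cball[of "radius j" t0 j] by blast
      show "emeasure lborel (cball j (radius j)) \<le> emeasure \<mu> (cball j (radius j))"
        using radius[OF j(1)] unfolding heavy_def by (blast intro: less_imp_le)
    qed
    fix x t assume x: "x \<in> X - (\<Union>j\<in>C. ball j (5 * radius j))" "0 < t" "t \<le> t0"
    have "x \<notin> K"
    proof
      assume "x \<in> K"
      then have "x \<in> cball x (radius x)" using radius_bounds[of x] by simp
      then show False using covers[OF \<open>x \<in> K\<close>] x(1) by blast
    qed
    then show "emeasure \<mu> (cball x t) \<le> emeasure lborel (cball x t)"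
      using x unfolding K_def heavy_def by (auto simp: not_less)
  qed
qed

definition defect_measure :: "(real^3 \<Rightarrow> real^3^3) \<Rightarrow> (real^3) measure" where
  "defect_measure F = density lborel (\<lambda>x. ennreal ((rot_defect F x)^2))"

lemma nn_integral_compact_continuous:
  fixes f :: "'a::euclidean_space \<Rightarrow> real"
  assumes "compact S" "continuous_on S f" "\<And>x. 0 \<le> f x"
  shows "(\<integral>\<^sup>+x\<in>S. ennreal (f x) \<partial>lborel) = ennreal (integral S f)"
proof -
  have "set_integrable lborel S f"
    unfolding set_integrable_def by (rule borel_integrable_compact[OF assms(1,2)])
  then have "(f has_integral integral S f) S"
    by (intro integrable_integral set_borel_integral_eq_integral)
  then have "(\<integral>\<^sup>+x. ennreal (indicator S x * f x) \<partial>lborel) = ennreal (integral S f)"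
    by (intro nn_integral_has_integral_lebesgue assms(3))
  moreover have "ennreal (indicator S x * f x) = ennreal (f x) * indicator S x" for x
    by (simp add: indicator_def)
  ultimately show ?thesis by simp
qed

lemma emeasure_defect_measure:
  assumes F: "continuous_on UNIV F" and S: "compact S"
  shows "emeasure (defect_measure F) S = ennreal (integral S (\<lambda>x. (rot_defect F x)^2))"
proof -
  have cont: "continuous_on T (\<lambda>x. (rot_defect F x)^2)" for T
    by (intro continuous_intros continuous_on_UNIV_subset[OF F])
  have "emeasure (defect_measure F) S = (\<integral>\<^sup>+x\<in>S. ennreal ((rot_defect F x)^2) \<partial>lborel)"
    unfolding defect_measure_def
    by (rule emeasure_density) (use borel_measurable_continuous_onI[OF cont] S in \<open>auto intro: borel_compact\<close>)
  then show ?thesis by (simp add: nn_integral_compact_continuous[OF S cont])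
qed

definition var_mollify_jac :: "(real^3 \<Rightarrow> real) \<Rightarrow> (real^3 \<Rightarrow> real^3) \<Rightarrow> (real^3 \<Rightarrow> real^3^3) \<Rightarrow> real^3 \<Rightarrow> real^3^3" where
  "var_mollify_jac \<rho> \<rho>' F x = (\<chi> i. integral unit_cube
    (\<lambda>y. bump y *\<^sub>R (F (x + \<rho> x *\<^sub>R y) $ i + (F (x + \<rho> x *\<^sub>R y) $ i \<bullet> y) *\<^sub>R \<rho>' x)))"

lemma has_jac_var_mollify:
  assumes v: "has_jac v F" and \<rho>: "has_grad \<rho> \<rho>'"
  shows "has_jac (\<lambda>x. mollify (\<rho> x) v x) (var_mollify_jac \<rho> \<rho>' F)"
  unfolding has_jac_def
proof
  fix i
  note [continuous_intros] = continuous_on_UNIV_compose[OF has_jac_continuous(1)[OF v]]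
    continuous_on_UNIV_compose[OF has_jac_continuous(2)[OF v]] continuous_on_UNIV_compose[OF has_grad_continuous[OF \<rho>]]
    continuous_on_UNIV_compose[OF has_grad_continuous_grad[OF \<rho>]] continuous_on_UNIV_compose[OF continuous_on_bump(1)]
  have "has_grad (\<lambda>x. integral unit_cube (\<lambda>y. bump y * v (x + \<rho> x *\<^sub>R y) $ i))
    (\<lambda>x. integral unit_cube (\<lambda>y. bump y *\<^sub>R (F (x + \<rho> x *\<^sub>R y) $ i + (F (x + \<rho> x *\<^sub>R y) $ i \<bullet> y) *\<^sub>R \<rho>' x)))"
  proof (rule has_grad_integral)
    fix x y
    have "((\<lambda>x. x + \<rho> x *\<^sub>R y) has_derivative (\<lambda>h. h + (\<rho>' x \<bullet> h) *\<^sub>R y)) (at x)"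
      by (auto intro!: derivative_eq_intros has_gradD[OF \<rho>])
    from has_derivative_compose[OF this has_gradD[OF has_jac_nth[OF v, of i]]]
    have "((\<lambda>x. v (x + \<rho> x *\<^sub>R y) $ i) has_derivative (\<lambda>h. F (x + \<rho> x *\<^sub>R y) $ i \<bullet> (h + (\<rho>' x \<bullet> h) *\<^sub>R y))) (at x)" .
    from has_derivative_mult_right[OF this, of "bump y"]
    show "((\<lambda>x. bump y * v (x + \<rho> x *\<^sub>R y) $ i) has_derivative
      (\<lambda>h. (bump y *\<^sub>R (F (x + \<rho> x *\<^sub>R y) $ i + (F (x + \<rho> x *\<^sub>R y) $ i \<bullet> y) *\<^sub>R \<rho>' x)) \<bullet> h)) (at x)"
      by (simp add: inner_add_right inner_add_left mult_ac)
  qed (auto simp: split_beta intro!: continuous_intros)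
  then show "has_grad (\<lambda>x. mollify (\<rho> x) v x $ i) (\<lambda>x. var_mollify_jac \<rho> \<rho>' F x $ i)"
    unfolding mollify_nth[OF has_jac_continuous(2)[OF v]]
    by (rule has_grad_cong) (simp_all add: var_mollify_jac_def mollify_def)
qed

lemma norm_var_mollify_jac_diff_le:
  assumes F: "continuous_on UNIV F" and K: "norm (\<rho>' x) \<le> K"
  shows "norm (var_mollify_jac \<rho> \<rho>' F x - A) \<le> 3 * (1 + K) * mollify (\<rho> x) (\<lambda>z. norm (F z - A)) x"
proof -
  let ?G = "\<lambda>y. F (x + \<rho> x *\<^sub>R y) - A"
  have K_nonneg: "K \<ge> 0" using K norm_ge_zero order_trans by blast
  note [continuous_intros] = continuous_on_UNIV_compose[OF F] continuous_on_bump
  have row: "norm ((var_mollify_jac \<rho> \<rho>' F x - A) $ i) \<le> (1 + K) * mollify (\<rho> x) (\<lambda>z. norm (F z - A)) x" for i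
  proof -
    have "((\<lambda>y. bump y *\<^sub>R A $ i + (A $ i \<bullet> (bump y *\<^sub>R y)) *\<^sub>R \<rho>' x) has_integral (1 *\<^sub>R A $ i + (A $ i \<bullet> 0) *\<^sub>R \<rho>' x)) unit_cube"
      using has_integral_linear[OF has_integral_bump_moment bounded_linear_inner_right[of "A $ i"]]
      by (intro has_integral_add has_integral_scaleR_left has_integral_bump) (simp add: o_def)
    moreover have "((\<lambda>y. bump y *\<^sub>R (F (x + \<rho> x *\<^sub>R y) $ i + (F (x + \<rho> x *\<^sub>R y) $ i \<bullet> y) *\<^sub>R \<rho>' x))
      has_integral var_mollify_jac \<rho> \<rho>' F x $ i) unit_cube"
      unfolding var_mollify_jac_def vec_lambda_beta
      by (intro integrable_integral integrable_continuous continuous_intros)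
    ultimately have difference: "((\<lambda>y. bump y *\<^sub>R ?G y $ i + (?G y $ i \<bullet> (bump y *\<^sub>R y)) *\<^sub>R \<rho>' x)
      has_integral (var_mollify_jac \<rho> \<rho>' F x - A) $ i) unit_cube"
      by (auto dest: has_integral_diff simp: algebra_simps)
    have "norm ((var_mollify_jac \<rho> \<rho>' F x - A) $ i) \<le> integral unit_cube (\<lambda>y. (1 + K) * (bump y * norm (?G y)))"
      unfolding integral_unique[OF difference, symmetric]
    proof (rule integral_norm_bound_integral)
      fix y
      have "norm (bump y *\<^sub>R ?G y $ i + (?G y $ i \<bullet> (bump y *\<^sub>R y)) *\<^sub>R \<rho>' x)
        \<le> bump y * norm (?G y $ i) + \<bar>?G y $ i \<bullet> (bump y *\<^sub>R y)\<bar> * norm (\<rho>' x)"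
        using norm_triangle_ineq[of "bump y *\<^sub>R ?G y $ i" "(?G y $ i \<bullet> (bump y *\<^sub>R y)) *\<^sub>R \<rho>' x"] bump_nonneg[of y]
        by simp
      also have "\<bar>?G y $ i \<bullet> (bump y *\<^sub>R y)\<bar> \<le> norm (?G y $ i) * bump y"
        using Cauchy_Schwarz_ineq2[of "?G y $ i" "bump y *\<^sub>R y"]
          mult_left_mono[OF norm_bump_scaleR_le[of y] norm_ge_zero[of "?G y $ i"]] by linarith
      also have "bump y * norm (?G y $ i) + norm (?G y $ i) * bump y * norm (\<rho>' x)
        = (1 + norm (\<rho>' x)) * (bump y * norm (?G y $ i))" by (simp add: algebra_simps)
      also have "\<dots> \<le> (1 + K) * (bump y * norm (?G y))"
        using K bump_nonneg[of y] K_nonneg by (intro mult_mono norm_row_le) auto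
      finally show "norm (bump y *\<^sub>R ?G y $ i + (?G y $ i \<bullet> (bump y *\<^sub>R y)) *\<^sub>R \<rho>' x) \<le> (1 + K) * (bump y * norm (?G y))"
        by (simp add: mult_right_mono)
    qed (use difference in \<open>auto intro!: integrable_continuous continuous_intros\<close>)
    then show ?thesis by (simp add: mollify_def)
  qed
  show ?thesis
    using norm_le_rows[of "var_mollify_jac \<rho> \<rho>' F x - A"] row[of 1] row[of 2] row[of 3]
    unfolding mult.assoc by linarith
qed

lemma norm_unit_cube_le:
  assumes "y \<in> unit_cube"
  shows "norm y \<le> 2"
proof -
  have "\<bar>y $ i\<bar> \<le> 1" for i using assms by (auto simp: mem_box_cart abs_le_iff minus_le_iff)
  then have "(y $ i)^2 \<le> 1" for i using abs_square_le_1 by blast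
  from this[of 1] this[of 2] this[of 3] have "(norm y)^2 \<le> 2^2"
    by (simp add: norm_vec_def L2_set_def sum_3)
  then show ?thesis by (rule power2_le_imp_le) simp
qed

lemma cube_subset_cball:
  fixes x :: "real^3"
  assumes t: "t > 0" and xp: "dist x p \<le> t"
  shows "cbox (x - vec t) (x + vec t) \<subseteq> cball p (3 * t)"
proof
  fix w assume w: "w \<in> cbox (x - vec t) (x + vec t)"
  have "- 1 \<le> (w $ i - x $ i) / t \<and> (w $ i - x $ i) / t \<le> 1" for i
    using w t by (simp add: mem_box_cart field_simps)
  then have "(1 / t) *\<^sub>R (w - x) \<in> unit_cube" by (simp add: mem_box_cart)
  from norm_unit_cube_le[OF this] have "norm (w - x) / t \<le> 2" using t by (simp only: norm_scaleR) simp
  then have "dist w x \<le> 2 * t" using t by (simp add: dist_norm field_simps)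
  then show "w \<in> cball p (3 * t)" using xp dist_triangle[of p w x] by (simp add: dist_commute)
qed

lemma mollify_norm_sq_le_near_good_point:
  assumes F: "continuous_on UNIV F" and t: "t > 0" and xp: "dist x p \<le> t"
    and good: "emeasure (defect_measure F) (cball p (3 * t)) \<le> emeasure lborel (cball p (3 * t))"
  shows "mollify t (\<lambda>z. (norm (F z))^2) x \<le> 216 * unit_ball_vol 3 * bump_max"
proof -
  note [continuous_intros] = continuous_on_UNIV_subset[OF F]
  have integrable: "f integrable_on cball p (3 * t)" if "continuous_on UNIV f" for f :: "real^3 \<Rightarrow> real"
    by (intro set_borel_integral_eq_integral, unfold set_integrable_def)
      (intro borel_integrable_compact compact_cball continuous_on_UNIV_subset[OF that])
  have defect: "integral (cball p (3 * t)) (\<lambda>z. (rot_defect F z)^2) \<le> 27 * unit_ball_vol 3 * t^3"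
    using good t by (simp add: emeasure_defect_measure[OF F] emeasure_cball power_mult_distrib mult_ac)
  have const: "integral (cball p (3 * t)) (\<lambda>z. 6) = (6::real) * measure lborel (cball p (3 * t))"
    using has_integral_mult_right[OF has_integral_measure_lborel[OF borel_closed[OF closed_cball]
      emeasure_lborel_cball_finite], of 6 p "3 * t"]
    by (simp add: integral_unique)
  have "integral (cbox (x - vec t) (x + vec t)) (\<lambda>z. (norm (F z))^2)
    \<le> integral (cball p (3 * t)) (\<lambda>z. 6 + 2 * (rot_defect F z)^2)"
    using norm_sq_le_infdist_SO3 cube_subset_cball[OF t xp]
    by (intro order_trans[OF integral_subset_le[of _ "cball p (3 * t)"] integral_le] integrable continuous_intros)
      (auto intro!: integrable_continuous continuous_intros)
  also have "\<dots> = 6 * measure lborel (cball p (3 * t)) + 2 * integral (cball p (3 * t)) (\<lambda>z. (rot_defect F z)^2)"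
    by (subst integral_add) (auto intro!: integrable continuous_intros simp: const)
  also have "\<dots> \<le> 216 * unit_ball_vol 3 * t^3"
    using defect t by (simp add: content_cball power_mult_distrib)
  finally have mean: "integral (cbox (x - vec t) (x + vec t)) (\<lambda>z. (norm (F z))^2) \<le> 216 * unit_ball_vol 3 * t^3" .
  have "mollify t (\<lambda>z. (norm (F z))^2) x
    \<le> bump_max / t^3 * integral (cbox (x - vec t) (x + vec t)) (\<lambda>z. (norm (F z))^2)"
    by (rule mollify_le_integral) (auto intro!: continuous_intros t)
  also have "\<dots> \<le> bump_max / t^3 * (216 * unit_ball_vol 3 * t^3)"
    using mean bump_max_pos t by (intro mult_left_mono) auto
  finally show ?thesis using t by (simp add: field_simps)
qed

definition trunc_slope :: real where "trunc_slope = sqrt (32 * bump_slope)"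

definition trunc_bound :: real where
  "trunc_bound = 3 * (1 + trunc_slope) * sqrt (216 * unit_ball_vol 3 * bump_max)"

lemma trunc_slope_nonneg: "trunc_slope \<ge> 0" and trunc_bound_nonneg: "trunc_bound \<ge> 0"
  using bump_max_pos bump_slope_pos by (simp_all add: trunc_slope_def trunc_bound_def)

text \<open>Mollify \<open>v\<close> at a scale comparable to the distance to the good set, plus a tiny \<open>s\<close>: off the
  exceptional set the gradient hardly changes, and everywhere it is bounded by its mean on a good ball.\<close>

locale truncation = rigidity_box l r trunc_bound for l r +
  fixes v F e G s
  assumes jac: "has_jac v F" and e_pos: "e > 0" and e_small: "250 * e^2 \<le> unit_ball_vol 3 * r^3"
    and G: "open G" "emeasure lborel G \<le> ennreal (125 * e^2)"
    and good: "x \<in> cuboid l (12 * r) - G \<Longrightarrow> 0 < t \<Longrightarrow> t \<le> 4 * r \<Longrightarrow>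
      emeasure (defect_measure F) (cball x t) \<le> emeasure lborel (cball x t)"
    and s: "s > 0" "20 * s \<le> r"
    and modulus: "x \<in> cuboid l (9 * r) \<Longrightarrow> y \<in> cuboid l (9 * r) \<Longrightarrow> dist y x < 20 * s \<Longrightarrow>
      norm (F y - F x) \<le> e / (3 * (1 + trunc_slope))"
begin

definition "good_set = cuboid l (12 * r) - G"
definition "raw_radius z = infdist z good_set + 3 * s"
definition "radius = mollify s raw_radius"
definition "grad_radius = grad_mollify s raw_radius"

lemma cont_F: "continuous_on S F"
  by (rule has_jac_continuous[OF jac])

lemma good_set_near:
  assumes x: "x \<in> cuboid l (8 * r)"
  shows "\<exists>p\<in>good_set. dist x p < r"
proof (rule ccontr)
  assume "\<not> ?thesis"
  moreover have "cball x r \<subseteq> cuboid l (12 * r)" by (rule cball_subset_cuboid[OF x]) (use r_pos in simp)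
  then have "ball x r \<subseteq> cuboid l (12 * r)" using ball_subset_cball by blast
  ultimately have "ball x r \<subseteq> G" unfolding good_set_def by auto
  then have "emeasure lborel (ball x r) \<le> ennreal (125 * e^2)"
    using G by (intro order_trans[OF emeasure_mono G(2)]) auto
  then have "unit_ball_vol 3 * r^3 \<le> 125 * e^2"
    using r_pos by (simp add: emeasure_ball)
  then show False using e_small zero_less_power[OF e_pos, of 2] by linarith
qed

lemma good_set_nonempty: "good_set \<noteq> {}"
  using good_set_near[OF zero_in_box] r_pos by auto

lemma continuous_on_raw_radius: "continuous_on S raw_radius"
  unfolding raw_radius_def by (intro continuous_intros)

lemma raw_radius_oscillation:
  assumes "y \<in> unit_cube"
  shows "\<bar>raw_radius (x + s *\<^sub>R y) - raw_radius x\<bar> \<le> 2 * s"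
proof -
  have "\<bar>raw_radius (x + s *\<^sub>R y) - raw_radius x\<bar> \<le> dist (x + s *\<^sub>R y) x"
    unfolding raw_radius_def using infdist_triangle_abs[of "x + s *\<^sub>R y" good_set x] by simp
  also have "\<dots> = s * norm y" using s by (simp add: dist_norm)
  also have "\<dots> \<le> s * 2" using norm_unit_cube_le[OF assms] s by (intro mult_left_mono) auto
  finally show ?thesis by simp
qed

lemma radius_bounds: "infdist x good_set + s \<le> radius x" "radius x \<le> infdist x good_set + 5 * s"
proof -
  have "norm (radius x - raw_radius x) \<le> 2 * s"
    unfolding radius_def
    by (rule norm_mollify_diff_le[OF continuous_on_raw_radius]) (use raw_radius_oscillation in auto)
  then show "infdist x good_set + s \<le> radius x" "radius x \<le> infdist x good_set + 5 * s"
    unfolding raw_radius_def real_norm_def by linarith+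
qed

lemma radius_pos: "radius x > 0"
  using radius_bounds(1)[of x] infdist_nonneg[of x good_set] s by linarith

lemma norm_grad_radius_le: "norm (grad_radius x) \<le> trunc_slope"
proof -
  note [continuous_intros] = continuous_on_raw_radius
  have "(norm (grad_radius x))^2 \<le> 8 * bump_slope / s^2 * mollify s (\<lambda>z. (raw_radius z - raw_radius x)^2) x"
    unfolding grad_radius_def by (rule norm_grad_mollify_sq_le[OF continuous_on_raw_radius s(1)])
  also have "\<dots> \<le> 8 * bump_slope / s^2 * mollify s (\<lambda>z. (2 * s)^2) x"
  proof (intro mult_left_mono mollify_mono continuous_intros)
    fix y :: "real^3" assume "y \<in> unit_cube"
    from power_mono[OF raw_radius_oscillation[OF this, of x] abs_ge_zero, of 2]
    show "(raw_radius (x + s *\<^sub>R y) - raw_radius x)^2 \<le> (2 * s)^2" by simp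
  qed (use bump_slope_pos in auto)
  also have "\<dots> = 32 * bump_slope" using s by (simp add: mollify_const power2_eq_square)
  finally show ?thesis unfolding trunc_slope_def by (rule real_le_rsqrt)
qed

definition "truncated_jac = var_mollify_jac radius grad_radius F"

lemma has_jac_truncated: "has_jac (\<lambda>x. mollify (radius x) v x) truncated_jac"
  unfolding truncated_jac_def radius_def grad_radius_def
  by (intro has_jac_var_mollify[OF jac] has_grad_mollify_continuous[OF continuous_on_raw_radius s(1)])

lemma norm_truncated_jac_diff_le:
  assumes "mollify (radius x) (\<lambda>z. norm (F z - A)) x \<le> a"
  shows "norm (truncated_jac x - A) \<le> 3 * (1 + trunc_slope) * a"
proof -
  have "norm (truncated_jac x - A) \<le> 3 * (1 + trunc_slope) * mollify (radius x) (\<lambda>z. norm (F z - A)) x"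
    unfolding truncated_jac_def by (intro norm_var_mollify_jac_diff_le cont_F norm_grad_radius_le)
  also have "\<dots> \<le> 3 * (1 + trunc_slope) * a"
    using assms trunc_slope_nonneg by (intro mult_left_mono) auto
  finally show ?thesis .
qed

lemma norm_truncated_jac_le:
  assumes x: "x \<in> cuboid l (8 * r)"
  shows "norm (truncated_jac x) \<le> trunc_bound"
proof -
  note [continuous_intros] = cont_F
  obtain q where q: "q \<in> good_set" "dist x q < r" using good_set_near[OF x] by blast
  have infdist_less: "infdist x good_set < r" using infdist_le[OF q(1), of x] q(2) by simp
  have "infdist x good_set < infdist x good_set + s" using s by simp
  then obtain p where p: "p \<in> good_set" "dist x p < infdist x good_set + s"
    unfolding infdist_notempty[OF good_set_nonempty]
    using cINF_less_iff[OF good_set_nonempty, of "dist x"] by (meson bdd_below.I2 zero_le_dist)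
  have "3 * radius x \<le> 4 * r" using radius_bounds(2)[of x] infdist_less s by linarith
  then have "emeasure (defect_measure F) (cball p (3 * radius x)) \<le> emeasure lborel (cball p (3 * radius x))"
    using p(1) radius_pos[of x] by (intro good) (auto simp: good_set_def)
  moreover have "dist x p \<le> radius x" using p(2) radius_bounds(1)[of x] by linarith
  ultimately have "mollify (radius x) (\<lambda>z. (norm (F z))^2) x \<le> 216 * unit_ball_vol 3 * bump_max"
    by (intro mollify_norm_sq_le_near_good_point[OF cont_F radius_pos])
  moreover have "(norm (mollify (radius x) (\<lambda>z. norm (F z)) x))^2 \<le> mollify (radius x) (\<lambda>z. (norm (norm (F z)))^2) x"
    by (intro norm_mollify_sq_le continuous_intros)
  ultimately have "mollify (radius x) (\<lambda>z. norm (F z - 0)) x \<le> sqrt (216 * unit_ball_vol 3 * bump_max)"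
    by (intro real_le_rsqrt) simp
  from norm_truncated_jac_diff_le[OF this] show ?thesis by (simp add: trunc_bound_def)
qed

lemma norm_truncated_jac_minus_le:
  assumes x: "x \<in> cuboid l (8 * r) - G"
  shows "norm (truncated_jac x - F x) \<le> e"
proof -
  note [continuous_intros] = cont_F
  have "x \<in> good_set" using x cuboid_mono[of "8 * r" "12 * r" l] r_pos unfolding good_set_def by auto
  then have radius_le: "radius x \<le> 5 * s" using radius_bounds(2)[of x] by simp
  have "mollify (radius x) (\<lambda>z. norm (F z - F x)) x \<le> mollify (radius x) (\<lambda>z. e / (3 * (1 + trunc_slope))) x"
  proof (intro mollify_mono continuous_intros modulus)
    fix y :: "real^3" assume y: "y \<in> unit_cube"
    have "dist (x + radius x *\<^sub>R y) x = radius x * norm y" using radius_pos[of x] by (simp add: dist_norm)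
    also have "\<dots> \<le> (5 * s) * 2" using radius_le norm_unit_cube_le[OF y] s by (intro mult_mono) auto
    finally show "dist (x + radius x *\<^sub>R y) x < 20 * s" using s by simp
    show "x + radius x *\<^sub>R y \<in> cuboid l (9 * r)"
      by (rule cuboid_shift[of _ _ "8 * r"]) (use x y radius_le radius_pos[of x] s in auto)
    show "x \<in> cuboid l (9 * r)" using x cuboid_mono[of "8 * r" "9 * r" l] r_pos by auto
  qed
  then have "norm (truncated_jac x - F x) \<le> 3 * (1 + trunc_slope) * (e / (3 * (1 + trunc_slope)))"
    by (intro norm_truncated_jac_diff_le) (simp add: mollify_const)
  also have "\<dots> = e" using trunc_slope_nonneg by simp
  finally show ?thesis .
qed

end

lemma integral_cuboid_le_exceptional:
  assumes f: "f integrable_on cuboid l t" and g: "g integrable_on cuboid l t"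
    and G: "G \<in> sets borel" "emeasure lborel G \<le> ennreal m" and nonneg: "0 \<le> a" "0 \<le> m"
    and f_le: "\<And>x. x \<in> cuboid l t \<Longrightarrow> f x \<le> g x + a * indicator G x"
  shows "integral (cuboid l t) f \<le> integral (cuboid l t) g + a * m"
proof -
  have lmeasurable: "G \<inter> cuboid l t \<in> lmeasurable"
    using G(1) compact_cuboid[of l t] by (intro bounded_set_imp_lmeasurable) (auto simp: compact_imp_bounded bounded_Int)
  then have integrable: "(\<lambda>x. a * indicator G x) integrable_on cuboid l t"
    by (intro integrable_on_mult_right) (simp add: integrable_on_indicator)
  have "measure lebesgue (G \<inter> cuboid l t) \<le> m"
    using G(2) emeasure_mono[of "G \<inter> cuboid l t" G lborel] G(1) nonneg
    by (simp add: measure_def enn2real_leI)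
  then have "integral (cuboid l t) (\<lambda>x. a * indicator G x) \<le> a * m"
    using nonneg by (simp add: integral_indicator[OF lmeasurable] mult_left_mono)
  moreover have "integral (cuboid l t) f \<le> integral (cuboid l t) (\<lambda>x. g x + a * indicator G x)"
    by (intro integral_le f integrable_add g integrable f_le)
  ultimately show ?thesis using integral_add[OF g integrable] by simp
qed

locale trunc_box = rigidity_box l r trunc_bound for l r
begin

definition "trunc_const = 4 + vol (8 * r) + (12 + 2 * trunc_bound^2) * 125"
definition "interior_const = 2 * trunc_const + 2 * (rigidity_const * (2 + 2 * trunc_const))"

lemma trunc_const_pos: "trunc_const > 0" and interior_const_nonneg: "interior_const \<ge> 0"
proof -
  have "trunc_const > 0" unfolding trunc_const_def by (simp add: add_pos_nonneg)
  then show "trunc_const > 0" "interior_const \<ge> 0"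
    using consts_nonneg(12) by (simp_all add: interior_const_def)
qed

lemma truncation_exists:
  assumes v: "has_jac v F" and e: "e > 0" "250 * e^2 \<le> unit_ball_vol 3 * r^3"
    and defect: "L2sq l (16 * r) (rot_defect F) \<le> e^2"
  obtains G s where "truncation l r v F e G s"
proof -
  note F = has_jac_continuous(1)[OF v]
  obtain G where G: "open G" "emeasure lborel G \<le> 5^DIM(real^3) * emeasure (defect_measure F) (cuboid l (16 * r))"
    "\<And>x t. x \<in> cuboid l (12 * r) - G \<Longrightarrow> 0 < t \<Longrightarrow> t \<le> 4 * r \<Longrightarrow>
      emeasure (defect_measure F) (cball x t) \<le> emeasure lborel (cball x t)"
  proof (rule exceptional_set[of "defect_measure F" "cuboid l (12 * r)" "4 * r" "cuboid l (16 * r)"])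
    show "cball x (4 * r) \<subseteq> cuboid l (16 * r)" if "x \<in> cuboid l (12 * r)" for x
      by (rule cball_subset_cuboid[OF that]) simp
  qed (auto simp: defect_measure_def)
  have "emeasure (defect_measure F) (cuboid l (16 * r)) \<le> ennreal (e^2)"
    using defect by (simp add: emeasure_defect_measure[OF F compact_cuboid] L2sq_def ennreal_leI)
  then have "5^DIM(real^3) * emeasure (defect_measure F) (cuboid l (16 * r)) \<le> 125 * ennreal (e^2)"
    by (intro mult_mono) auto
  then have small: "emeasure lborel G \<le> ennreal (125 * e^2)" using G(2) by (simp add: ennreal_mult)
  have "uniformly_continuous_on (cuboid l (9 * r)) F"
    by (intro compact_uniformly_continuous F compact_cuboid)
  moreover have "e / (3 * (1 + trunc_slope)) > 0" using e trunc_slope_nonneg by simp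
  ultimately obtain d where d: "d > 0" "\<And>x y. x \<in> cuboid l (9 * r) \<Longrightarrow> y \<in> cuboid l (9 * r) \<Longrightarrow>
    dist y x < d \<Longrightarrow> dist (F y) (F x) < e / (3 * (1 + trunc_slope))"
    unfolding uniformly_continuous_on_def by blast
  have "truncation l r v F e G (min (r / 20) (d / 20))"
    by unfold_locales (use v e G small d r_pos in \<open>auto simp: less_imp_le simp flip: dist_norm\<close>)
  then show thesis by (rule that)
qed

theorem bounded_jacobian_approximation:
  assumes v: "has_jac v F" and e: "e > 0" "250 * e^2 \<le> unit_ball_vol 3 * r^3"
    and defect: "L2sq l (16 * r) (rot_defect F) \<le> e^2"
  obtains v' F' where "has_jac v' F'" "\<And>x. x \<in> cuboid l (8 * r) \<Longrightarrow> norm (F' x) \<le> trunc_bound"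
    "L2sq l (8 * r) (\<lambda>x. F x - F' x) \<le> trunc_const * e^2"
proof -
  obtain G s where "truncation l r v F e G s" using truncation_exists[OF assms] .
  then interpret truncation l r v F e G s .
  note cont = has_jac_continuous(1)[OF v] has_jac_continuous(1)[OF has_jac_truncated]
  note [continuous_intros] = cont
  have pointwise: "(norm (F x - truncated_jac x))^2
    \<le> 4 * (norm (rot_defect F x))^2 + e^2 + (12 + 2 * trunc_bound^2) * indicator G x"
    if x: "x \<in> cuboid l (8 * r)" for x
  proof (cases "x \<in> G")
    case True
    have "(norm (F x - truncated_jac x))^2 \<le> (norm (F x) + norm (truncated_jac x))^2"
      by (intro power_mono norm_triangle_ineq4) auto
    also have "\<dots> \<le> 2 * (norm (F x))^2 + 2 * (norm (truncated_jac x))^2" by (rule sum_sq_le)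
    also have "\<dots> \<le> 2 * (6 + 2 * (rot_defect F x)^2) + 2 * trunc_bound^2"
      using norm_sq_le_infdist_SO3[of "F x"] power_mono[OF norm_truncated_jac_le[OF x], of 2] by simp
    finally show ?thesis using True by simp (smt (verit) zero_le_power2)
  next
    case False
    then show ?thesis
      using power_mono[OF norm_truncated_jac_minus_le[of x], of 2] x
      by (simp add: norm_minus_commute add_increasing)
  qed
  have "L2sq l (8 * r) (\<lambda>x. F x - truncated_jac x)
    \<le> integral (cuboid l (8 * r)) (\<lambda>x. 4 * (norm (rot_defect F x))^2 + e^2) + (12 + 2 * trunc_bound^2) * (125 * e^2)"
    unfolding L2sq_def using G pointwise
    by (intro integral_cuboid_le_exceptional[of _ _ _ _ G] integrable_on_cuboid continuous_intros) auto
  also have "integral (cuboid l (8 * r)) (\<lambda>x. 4 * (norm (rot_defect F x))^2 + e^2)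
    = 4 * L2sq l (8 * r) (rot_defect F) + vol (8 * r) * e^2"
    unfolding L2sq_def
    by (subst integral_add, (intro integrable_on_cuboid continuous_intros)+) (simp add: cuboid_def)
  also have "L2sq l (8 * r) (rot_defect F) \<le> L2sq l (16 * r) (rot_defect F)"
    using r_pos by (intro L2sq_mono continuous_intros) auto
  finally have "L2sq l (8 * r) (\<lambda>x. F x - truncated_jac x) \<le> trunc_const * e^2"
    using defect by (simp add: trunc_const_def algebra_simps)
  then show thesis using that has_jac_truncated norm_truncated_jac_le by blast
qed

lemma small_defect_rigidity:
  assumes v: "has_jac v F" and e: "e > 0" "250 * e^2 \<le> unit_ball_vol 3 * r^3" "(2 + 2 * trunc_const) * e^2 \<le> 1"
    and defect: "L2sq l (16 * r) (rot_defect F) \<le> e^2"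
  shows "\<exists>R\<in>SO3. L2sq l 0 (\<lambda>x. F x - R) \<le> interior_const * e^2"
proof -
  define e' where "e' = sqrt (2 + 2 * trunc_const) * e"
  have e'_sq: "e'^2 = (2 + 2 * trunc_const) * e^2"
    using trunc_const_pos by (simp add: e'_def power_mult_distrib)
  have e': "e' > 0" "e' \<le> 1"
    using e trunc_const_pos power2_le_imp_le[of e' 1] e'_sq by (auto simp: e'_def)
  obtain v' F' where v': "has_jac v' F'" "\<And>x. x \<in> cuboid l (8 * r) \<Longrightarrow> norm (F' x) \<le> trunc_bound"
    and close: "L2sq l (8 * r) (\<lambda>x. F x - F' x) \<le> trunc_const * e^2"
    by (rule bounded_jacobian_approximation[OF v e(1,2) defect]) blast
  note cont = has_jac_continuous(1)[OF v] has_jac_continuous(1)[OF v'(1)]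
  have mono: "L2sq l (8 * r) (rot_defect F) \<le> L2sq l (16 * r) (rot_defect F)"
    "L2sq l 0 (\<lambda>x. F x - F' x) \<le> L2sq l (8 * r) (\<lambda>x. F x - F' x)"
    using r_pos by (auto intro!: L2sq_mono continuous_intros cont)
  have "L2sq l (8 * r) (rot_defect F') \<le> e'^2"
    using L2sq_infdist_triangle[OF cont, of l "8 * r"] mono(1) close defect unfolding e'_sq by (simp add: algebra_simps)
  then obtain R where R: "R \<in> SO3" "L2sq l 0 (\<lambda>x. F' x - R) \<le> rigidity_const * e'^2"
    using bounded_rigidity[OF v' e'] by blast
  have "L2sq l 0 (\<lambda>x. F x - R) \<le> 2 * L2sq l 0 (\<lambda>x. F x - F' x) + 2 * L2sq l 0 (\<lambda>x. F' x - R)"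
    by (intro L2sq_triangle cont continuous_intros)
  also have "\<dots> \<le> 2 * (trunc_const * e^2) + 2 * (rigidity_const * e'^2)"
    using mono(2) close R(2) by linarith
  also have "\<dots> = interior_const * e^2"
    by (simp add: interior_const_def e'_sq algebra_simps)
  finally show ?thesis using R(1) by blast
qed

end

theorem interior_rigidity:
  assumes "\<And>i. l $ i > 0" "r > 0"
  shows "\<exists>C\<ge>0. \<exists>e0>0. \<forall>v F e. has_jac v F \<longrightarrow> 0 < e \<longrightarrow> e \<le> e0 \<longrightarrow> L2sq l (16 * r) (rot_defect F) \<le> e^2 \<longrightarrow>
    (\<exists>R\<in>SO3. L2sq l 0 (\<lambda>x. F x - R) \<le> C * e^2)"
proof -
  interpret trunc_box l r
    by unfold_locales (use assms trunc_bound_nonneg in auto)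
  define e0 where "e0 = min (sqrt (unit_ball_vol 3 * r^3 / 250)) (sqrt (1 / (2 + 2 * trunc_const)))"
  have "e0 > 0" using r_pos trunc_const_pos by (simp add: e0_def)
  moreover have "250 * e^2 \<le> unit_ball_vol 3 * r^3 \<and> (2 + 2 * trunc_const) * e^2 \<le> 1" if "0 < e" "e \<le> e0" for e
  proof -
    have "e^2 \<le> (sqrt (unit_ball_vol 3 * r^3 / 250))^2" "e^2 \<le> (sqrt (1 / (2 + 2 * trunc_const)))^2"
      using that by (auto intro!: power_mono simp: e0_def)
    then show ?thesis using r_pos trunc_const_pos by (simp add: field_simps)
  qed
  ultimately show ?thesis using small_defect_rigidity interior_const_nonneg by blast
qed

section \<open>Approximation of Sobolev maps\<close>

lemma Ck_on_Suc_imp: "Ck_on (Suc k) S f \<Longrightarrow> Ck_on k S f"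
proof (induction k arbitrary: f)
  case 0
  then show ?case
    by (auto intro!: continuous_at_imp_continuous_on differentiable_imp_continuous_within)
qed simp

lemma Ck_on_add: "Ck_on k UNIV f \<Longrightarrow> Ck_on k UNIV g \<Longrightarrow> Ck_on k UNIV (\<lambda>x. f x + g x)"
proof (induction k arbitrary: f g)
  case (Suc k)
  have "frechet_derivative (\<lambda>x. f x + g x) (at x)
    = (\<lambda>h. frechet_derivative f (at x) h + frechet_derivative g (at x) h)" for x
    by (rule frechet_derivative_at[symmetric])
      (use Suc.prems in \<open>auto intro!: derivative_eq_intros simp: frechet_derivative_works[symmetric]\<close>)
  then show ?case using Suc by (auto intro!: derivative_intros)
qed (auto intro!: continuous_intros)

lemma Ck_on_mult: "Ck_on k UNIV f \<Longrightarrow> Ck_on k UNIV g \<Longrightarrow> Ck_on k UNIV (\<lambda>x. f x * g x)"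
proof (induction k arbitrary: f g)
  case (Suc k)
  have "frechet_derivative (\<lambda>x. f x * g x) (at x)
    = (\<lambda>h. f x * frechet_derivative g (at x) h + frechet_derivative f (at x) h * g x)" for x
    by (rule frechet_derivative_at[symmetric])
      (use Suc.prems in \<open>auto intro!: derivative_eq_intros simp: frechet_derivative_works[symmetric]\<close>)
  moreover have "Ck_on k UNIV f" "Ck_on k UNIV g" using Suc.prems Ck_on_Suc_imp by blast+
  ultimately show ?case using Suc by (auto intro!: derivative_intros Ck_on_add)
qed (auto intro!: continuous_intros)

lemma Ck_on_const: "Ck_on k UNIV (\<lambda>x. c)"
  by (induction k arbitrary: c) auto

lemma Ck_on_affine: "Ck_on k UNIV (\<lambda>z. a * ((c + r *\<^sub>R z) \<bullet> b))"
proof (cases k)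
  case (Suc m)
  have deriv: "((\<lambda>z. a * ((c + r *\<^sub>R z) \<bullet> b)) has_derivative (\<lambda>h. a * (r *\<^sub>R h \<bullet> b))) (at z)" for z
    by (auto intro!: derivative_eq_intros)
  show ?thesis
    using differentiableI[OF deriv] frechet_derivative_at[OF deriv, symmetric] Suc Ck_on_const by auto
qed (auto intro!: continuous_intros)

lemma Ck_on_flat_exp_ball: "Ck_on k UNIV (\<lambda>z::real^'n. flat_exp p (1 - (c + r *\<^sub>R z) \<bullet> (c + r *\<^sub>R z)))"
proof (induction k arbitrary: p)
  case 0
  show ?case by (auto intro!: continuous_intros continuous_on_UNIV_compose[OF continuous_on_flat_exp])
next
  case (Suc k)
  let ?f = "\<lambda>p z. flat_exp p (1 - (c + r *\<^sub>R z) \<bullet> (c + r *\<^sub>R z))"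
  have deriv: "(?f p has_derivative
    (\<lambda>h. (r *\<^sub>R ((- 2 * ?f (flat_deriv p) z) *\<^sub>R (c + r *\<^sub>R z))) \<bullet> h)) (at z)" for z
    by (rule has_gradD[OF has_grad_affine[OF has_grad_flat_exp_ball]])
  have "(\<lambda>z. frechet_derivative (?f p) (at z) b) = (\<lambda>z. (- 2 * r) * ((c + r *\<^sub>R z) \<bullet> b) * ?f (flat_deriv p) z)" for b
    by (simp add: frechet_derivative_at[OF deriv, symmetric] mult_ac fun_eq_iff)
  then have "Ck_on k UNIV (\<lambda>z. frechet_derivative (?f p) (at z) b)" for b
    by (simp only: Ck_on_mult[OF Ck_on_affine Suc.IH])
  then show ?case using differentiableI[OF deriv] by simp
qed

lemma test_fn_bump:
  assumes s: "s > 0" and sub: "cball x s \<subseteq> \<Omega>"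
  shows "test_fn \<Omega> (\<lambda>z. bump ((1 / s) *\<^sub>R (z - x)))"
    "frechet_derivative (\<lambda>z. bump ((1 / s) *\<^sub>R (z - x))) (at z) (axis j 1)
      = grad_bump ((1 / s) *\<^sub>R (z - x)) $ j / s"
proof -
  have affine: "(1 / s) *\<^sub>R (z - x) = - (1 / s) *\<^sub>R x + (1 / s) *\<^sub>R z" for z by (simp add: algebra_simps)
  have "Ck_on k UNIV (\<lambda>z. bump ((1 / s) *\<^sub>R (z - x)))" for k
    unfolding affine bump_def divide_inverse[of _ bump_mass] by (rule Ck_on_mult[OF Ck_on_flat_exp_ball Ck_on_const])
  then have smooth: "smooth_on UNIV (\<lambda>z. bump ((1 / s) *\<^sub>R (z - x)))" by (simp add: smooth_on_def)
  have "z \<in> cball x s" if "bump ((1 / s) *\<^sub>R (z - x)) \<noteq> 0" for z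
    using norm_le_1_if_bump_nonzero[of "(1 / s) *\<^sub>R (z - x)"] that s
    by (simp add: dist_norm norm_minus_commute divide_simps flip: scaleR_diff_right)
  then have support: "closure {z. bump ((1 / s) *\<^sub>R (z - x)) \<noteq> 0} \<subseteq> cball x s"
    by (intro closure_minimal) auto
  then have "compact (closure {z. bump ((1 / s) *\<^sub>R (z - x)) \<noteq> 0})"
    using bounded_subset[OF bounded_cball support] by (simp add: compact_eq_bounded_closed)
  then show "test_fn \<Omega> (\<lambda>z. bump ((1 / s) *\<^sub>R (z - x)))"
    using smooth support sub unfolding test_fn_def by blast
  have "((\<lambda>z. bump ((1 / s) *\<^sub>R (z - x))) has_derivative (\<lambda>h. ((1 / s) *\<^sub>R grad_bump ((1 / s) *\<^sub>R (z - x))) \<bullet> h)) (at z)"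
    unfolding affine by (rule has_gradD[OF has_grad_affine[OF has_grad_bump]])
  from frechet_derivative_at[OF this, symmetric]
  show "frechet_derivative (\<lambda>z. bump ((1 / s) *\<^sub>R (z - x))) (at z) (axis j 1)
    = grad_bump ((1 / s) *\<^sub>R (z - x)) $ j / s"
    by (simp add: inner_axis)
qed

lemma nn_integral_lborel_affine:
  fixes f :: "'a::euclidean_space \<Rightarrow> ennreal"
  assumes [measurable]: "f \<in> borel_measurable borel" and h: "h > 0"
  shows "(\<integral>\<^sup>+x. f x \<partial>lborel) = ennreal (h ^ DIM('a)) * (\<integral>\<^sup>+y. f (p + h *\<^sub>R y) \<partial>lborel)"
  using h by (subst lborel_affine[of h p])
    (simp_all add: nn_integral_density nn_integral_distr nn_integral_cmult)

lemma integral_lborel_affine: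
  fixes f :: "'a::euclidean_space \<Rightarrow> real"
  assumes [measurable]: "f \<in> borel_measurable borel" and h: "h > 0"
  shows "(\<integral>x. f x \<partial>lborel) = h ^ DIM('a) * (\<integral>y. f (p + h *\<^sub>R y) \<partial>lborel)"
  using h by (subst lborel_affine[of h p]) (simp_all add: integral_density integral_distr)

lemma integrable_of_Cauchy_Schwarz:
  fixes f :: "'a \<Rightarrow> 'b::{banach, second_countable_topology}" and k h :: "'a \<Rightarrow> real"
  assumes [measurable]: "f \<in> borel_measurable M" "k \<in> borel_measurable M" "h \<in> borel_measurable M"
    and bound: "\<And>x. norm (f x) \<le> k x * h x" "\<And>x. 0 \<le> k x" "\<And>x. 0 \<le> h x"
    and finite: "(\<integral>\<^sup>+x. ennreal ((k x)^2) \<partial>M) * (\<integral>\<^sup>+x. ennreal ((h x)^2) \<partial>M) < \<infinity>"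
  shows "integrable M f"
    "ennreal ((norm (\<integral>x. f x \<partial>M))^2) \<le> (\<integral>\<^sup>+x. ennreal ((k x)^2) \<partial>M) * (\<integral>\<^sup>+x. ennreal ((h x)^2) \<partial>M)"
proof -
  have "(\<integral>\<^sup>+x. ennreal (norm (f x)) \<partial>M) \<le> (\<integral>\<^sup>+x. ennreal (k x) * ennreal (h x) \<partial>M)"
    using bound by (intro nn_integral_mono) (simp add: ennreal_leI flip: ennreal_mult)
  then have "(\<integral>\<^sup>+x. ennreal (norm (f x)) \<partial>M)^2 \<le> (\<integral>\<^sup>+x. ennreal (k x) * ennreal (h x) \<partial>M)^2"
    by (rule power_mono) simp
  also have "\<dots> \<le> (\<integral>\<^sup>+x. (ennreal (k x))^2 \<partial>M) * (\<integral>\<^sup>+x. (ennreal (h x))^2 \<partial>M)"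
    by (rule Cauchy_Schwarz_nn_integral) measurable
  finally have sq_le: "(\<integral>\<^sup>+x. ennreal (norm (f x)) \<partial>M)^2
    \<le> (\<integral>\<^sup>+x. ennreal ((k x)^2) \<partial>M) * (\<integral>\<^sup>+x. ennreal ((h x)^2) \<partial>M)"
    using bound by (simp add: ennreal_power)
  then have "(\<integral>\<^sup>+x. ennreal (norm (f x)) \<partial>M)^2 < \<infinity>" using finite by (rule le_less_trans)
  then have "(\<integral>\<^sup>+x. ennreal (norm (f x)) \<partial>M) < \<infinity>"
    by (cases "(\<integral>\<^sup>+x. ennreal (norm (f x)) \<partial>M)") (auto simp: power2_eq_square ennreal_top_mult)
  then show integrable: "integrable M f" by (intro integrableI_bounded) auto
  have "ennreal ((norm (\<integral>x. f x \<partial>M))^2) = (ennreal (norm (\<integral>x. f x \<partial>M)))^2" by (simp add: ennreal_power)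
  also have "\<dots> \<le> (\<integral>\<^sup>+x. ennreal (norm (f x)) \<partial>M)^2"
    by (intro power_mono integral_norm_bound_ennreal[OF integrable]) simp
  finally show "ennreal ((norm (\<integral>x. f x \<partial>M))^2)
    \<le> (\<integral>\<^sup>+x. ennreal ((k x)^2) \<partial>M) * (\<integral>\<^sup>+x. ennreal ((h x)^2) \<partial>M)"
    using sq_le by (rule order_trans)
qed

abbreviation nn_L2sq :: "'a::euclidean_space set \<Rightarrow> ('a \<Rightarrow> 'b::real_normed_vector) \<Rightarrow> ennreal" where
  "nn_L2sq S f \<equiv> (\<integral>\<^sup>+x\<in>S. ennreal ((norm (f x))^2) \<partial>lborel)"

lemma nn_L2sq_triangle:
  fixes f g h :: "'a::euclidean_space \<Rightarrow> 'b::euclidean_space"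
  assumes [measurable]: "f \<in> borel_measurable borel" "g \<in> borel_measurable borel" "h \<in> borel_measurable borel"
    "S \<in> sets borel"
  shows "nn_L2sq S (\<lambda>x. f x - h x) \<le> 2 * nn_L2sq S (\<lambda>x. f x - g x) + 2 * nn_L2sq S (\<lambda>x. g x - h x)"
proof -
  have "ennreal ((norm (f x - h x))^2)
    \<le> 2 * ennreal ((norm (f x - g x))^2) + 2 * ennreal ((norm (g x - h x))^2)" for x
  proof -
    have "(norm (f x - h x))^2 \<le> (norm (f x - g x) + norm (g x - h x))^2"
      using norm_triangle_ineq[of "f x - g x" "g x - h x"] by (intro power_mono) auto
    also have "\<dots> \<le> 2 * (norm (f x - g x))^2 + 2 * (norm (g x - h x))^2" by (rule sum_sq_le)
    finally have "ennreal ((norm (f x - h x))^2)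
      \<le> ennreal (2 * (norm (f x - g x))^2 + 2 * (norm (g x - h x))^2)" by (rule ennreal_leI)
    then show ?thesis by (simp add: ennreal_mult)
  qed
  then have "nn_L2sq S (\<lambda>x. f x - h x) \<le> (\<integral>\<^sup>+x. 2 * (ennreal ((norm (f x - g x))^2) * indicator S x)
    + 2 * (ennreal ((norm (g x - h x))^2) * indicator S x) \<partial>lborel)"
    by (intro nn_integral_mono) (auto simp: indicator_def)
  also have "\<dots> = 2 * nn_L2sq S (\<lambda>x. f x - g x) + 2 * nn_L2sq S (\<lambda>x. g x - h x)"
    by (subst nn_integral_add) (auto simp: nn_integral_cmult)
  finally show ?thesis .
qed

lemma nn_L2sq_tendsto_0:
  fixes f :: "nat \<Rightarrow> 'a::euclidean_space \<Rightarrow> 'b::euclidean_space" and w :: "'a \<Rightarrow> real"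
  assumes [measurable]: "\<And>n. f n \<in> borel_measurable borel" "w \<in> borel_measurable borel" "S \<in> sets borel"
    and finite: "nn_L2sq S w < \<infinity>" and bound: "\<And>n x. norm (f n x) \<le> w x"
    and lim: "AE x in lborel. (\<lambda>n. f n x) \<longlonglongrightarrow> 0" and e: "e > 0"
  obtains n where "nn_L2sq S (f n) < ennreal e"
proof -
  have "(\<lambda>n. nn_L2sq S (f n)) \<longlonglongrightarrow> integral\<^sup>N lborel (\<lambda>x::'a. 0)"
  proof (rule nn_integral_dominated_convergence[where w="\<lambda>x. ennreal ((norm (w x))^2) * indicator S x"])
    show "AE x in lborel. (\<lambda>n. ennreal ((norm (f n x))^2) * indicator S x) \<longlonglongrightarrow> 0"
      using lim
    proof eventually_elim
      case (elim x)
      from tendsto_power[OF tendsto_norm[OF elim], of 2] have "(\<lambda>n. (norm (f n x))^2) \<longlonglongrightarrow> 0" by simp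
      from tendsto_ennrealI[OF this] show ?case by (cases "x \<in> S") auto
    qed
    show "AE x in lborel. ennreal ((norm (f n x))^2) * indicator S x \<le> ennreal ((norm (w x))^2) * indicator S x" for n
        using order_trans[OF bound abs_ge_self] by (intro AE_I2 mult_right_mono ennreal_leI power_mono) auto
  qed (use finite in \<open>auto simp: less_top\<close>)
  then have "\<forall>\<^sub>F n in sequentially. nn_L2sq S (f n) < ennreal e"
    using e by (intro order_tendstoD(2)) auto
  then show thesis using that eventually_happens by fastforce
qed

lemma AE_continuous_limit:
  fixes f :: "'a::euclidean_space \<Rightarrow> 'b::euclidean_space"
  assumes "f \<in> borel_measurable borel"
  obtains g where "\<And>n. continuous_on UNIV (g n)" "AE x in lborel. (\<lambda>n. g n x) \<longlonglongrightarrow> f x"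
proof -
  have "f \<in> borel_measurable lebesgue" using assms by (simp add: measurable_completion)
  then have "f \<in> borel_measurable (lebesgue_on UNIV)" by (rule measurable_restrict_space1)
  then have "f measurable_on UNIV" by (simp add: measurable_on_iff_borel_measurable)
  then obtain N g where N: "negligible N"
    and g: "\<And>n. continuous_on UNIV (g n)" "\<And>x. x \<notin> N \<Longrightarrow> (\<lambda>n. g n x) \<longlonglongrightarrow> f x"
    unfolding measurable_on_def by auto
  have "AE x in lebesgue. x \<notin> N" using N by (intro AE_not_in) (simp add: negligible_iff_null_sets)
  then have "AE x in lborel. (\<lambda>n. g n x) \<longlonglongrightarrow> f x" unfolding AE_completion_iff by eventually_elim (rule g(2))
  then show thesis using that g(1) by blast
qed

definition ball_proj :: "nat \<Rightarrow> 'b::euclidean_space \<Rightarrow> 'b" where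
  "ball_proj k = closest_point (cball 0 (real k))"

lemma continuous_on_ball_proj: "continuous_on S (ball_proj k)"
  unfolding ball_proj_def by (rule continuous_on_closest_point) auto

lemma ball_proj_measurable [measurable]: "ball_proj k \<in> borel_measurable borel"
  by (rule borel_measurable_continuous_onI[OF continuous_on_ball_proj])

lemma norm_ball_proj_le: "norm (ball_proj k y) \<le> real k"
  using closest_point_in_set[of "cball 0 (real k)" y] by (simp add: ball_proj_def)

lemma ball_proj_approximation:
  fixes f :: "'a::euclidean_space \<Rightarrow> 'b::euclidean_space"
  assumes [measurable]: "f \<in> borel_measurable borel" "S \<in> sets borel" and f_finite: "nn_L2sq S f < \<infinity>" and e: "e > 0"
  obtains k where "nn_L2sq S (\<lambda>x. f x - ball_proj k (f x)) < ennreal e"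
proof -
  have "(\<lambda>k. f x - ball_proj k (f x)) \<longlonglongrightarrow> 0" for x
  proof (rule tendsto_eventually)
    obtain k0 :: nat where "norm (f x) \<le> real k0" using real_arch_simple by blast
    then show "\<forall>\<^sub>F k in sequentially. f x - ball_proj k (f x) = 0"
      by (intro eventually_sequentiallyI[of k0]) (simp add: ball_proj_def closest_point_self)
  qed
  moreover have "norm (f x - ball_proj k (f x)) \<le> norm (f x)" for k x
    using closest_point_le[of "cball 0 (real k)" 0 "f x"] by (simp add: ball_proj_def dist_norm)
  ultimately show ?thesis
    using nn_L2sq_tendsto_0[of "\<lambda>k x. f x - ball_proj k (f x)" "\<lambda>x. norm (f x)" S e] f_finite e that by auto
qed

text \<open>Truncate \<open>f\<close> by projecting onto a large ball, then approximate by continuous functions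
  projected onto the same ball.\<close>

lemma L2_continuous_dense:
  fixes f :: "'a::euclidean_space \<Rightarrow> 'b::euclidean_space"
  assumes f [measurable]: "f \<in> borel_measurable borel"
    and S [measurable]: "S \<in> sets borel" and S_finite: "emeasure lborel S < \<infinity>"
    and f_finite: "nn_L2sq S f < \<infinity>" and e: "e > 0"
  obtains g where "continuous_on UNIV g" "nn_L2sq S (\<lambda>x. f x - g x) < ennreal e"
proof -
  have "e / 4 > 0" using e by simp
  obtain k where k: "nn_L2sq S (\<lambda>x. f x - ball_proj k (f x)) < ennreal (e / 4)"
    by (rule ball_proj_approximation[OF f S f_finite \<open>e / 4 > 0\<close>])
  obtain g where g: "\<And>n. continuous_on UNIV (g n)" "AE x in lborel. (\<lambda>n. g n x) \<longlonglongrightarrow> f x"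
    using AE_continuous_limit[OF f] by blast
  have [measurable]: "g n \<in> borel_measurable borel" for n by (rule borel_measurable_continuous_onI[OF g(1)])
  have "nn_L2sq S (\<lambda>x. 2 * real k) < \<infinity>"
    using S_finite by (simp add: nn_integral_cmult_indicator ennreal_mult_less_top)
  moreover have "AE x in lborel. (\<lambda>n. ball_proj k (f x) - ball_proj k (g n x)) \<longlonglongrightarrow> 0"
    using g(2)
  proof eventually_elim
    case (elim x)
    have "(\<lambda>n. ball_proj k (g n x)) \<longlonglongrightarrow> ball_proj k (f x)"
      by (rule continuous_on_tendsto_compose[OF continuous_on_ball_proj[of UNIV] elim]) auto
    from tendsto_diff[OF tendsto_const this, of "ball_proj k (f x)"] show ?case by simp
  qed
  moreover have "norm (ball_proj k (f x) - ball_proj k (g n x)) \<le> 2 * real k" for n x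
    using norm_triangle_ineq4[of "ball_proj k (f x)" "ball_proj k (g n x)"]
      norm_ball_proj_le[of k "f x"] norm_ball_proj_le[of k "g n x"] by simp
  ultimately obtain n where n: "nn_L2sq S (\<lambda>x. ball_proj k (f x) - ball_proj k (g n x)) < ennreal (e / 4)"
    using nn_L2sq_tendsto_0[of "\<lambda>n x. ball_proj k (f x) - ball_proj k (g n x)" "\<lambda>x. 2 * real k" S "e / 4"] e by auto
  have "nn_L2sq S (\<lambda>x. f x - ball_proj k (g n x)) \<le> 2 * nn_L2sq S (\<lambda>x. f x - ball_proj k (f x))
    + 2 * nn_L2sq S (\<lambda>x. ball_proj k (f x) - ball_proj k (g n x))"
    by (rule nn_L2sq_triangle) measurable
  also have "\<dots> < 2 * ennreal (e / 4) + 2 * ennreal (e / 4)"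
    using k n by (intro add_strict_mono ennreal_mult_strict_left_mono) auto
  also have "\<dots> = ennreal e"
    using e by (simp flip: ennreal_numeral ennreal_mult' ennreal_plus)
  finally show thesis using that continuous_on_UNIV_compose[OF continuous_on_ball_proj g(1)] by blast
qed

definition bump_average :: "real \<Rightarrow> (real^3 \<Rightarrow> ennreal) \<Rightarrow> real^3 \<Rightarrow> ennreal" where
  "bump_average s f x = (\<integral>\<^sup>+y. ennreal (bump y) * f (x + s *\<^sub>R y) \<partial>lborel)"

lemma measurable_vec_nth [measurable]:
  fixes f :: "'a \<Rightarrow> 'b::topological_space^'n"
  shows "f \<in> borel_measurable M \<Longrightarrow> (\<lambda>x. f x $ j) \<in> borel_measurable M"
  by (rule measurable_compose[OF _ borel_measurable_continuous_onI[of "\<lambda>v. v $ j"]]) (auto intro!: continuous_intros)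

lemma bump_measurable [measurable]: "bump \<in> borel_measurable borel"
  and grad_bump_measurable [measurable]: "grad_bump \<in> borel_measurable borel"
  by (rule borel_measurable_continuous_onI[OF continuous_on_bump(1)])
    (rule borel_measurable_continuous_onI[OF continuous_on_bump(2)])

lemma integral_lborel_unit_cube:
  fixes f :: "real^3 \<Rightarrow> 'b::euclidean_space"
  assumes "continuous_on UNIV f" "\<And>y. y \<notin> unit_cube \<Longrightarrow> f y = 0"
  shows "integrable lborel f" "(\<integral>y. f y \<partial>lborel) = integral unit_cube f"
proof -
  have integrable: "set_integrable lborel unit_cube f"
    unfolding set_integrable_def
    by (rule borel_integrable_compact[OF compact_cbox continuous_on_UNIV_subset[OF assms(1)]])
  moreover have "indicator unit_cube y *\<^sub>R f y = f y" for y using assms(2) by (simp add: indicator_def)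
  ultimately show "integrable lborel f" "(\<integral>y. f y \<partial>lborel) = integral unit_cube f"
    using set_borel_integral_eq_integral(2)[OF integrable]
    by (simp_all add: set_integrable_def set_lebesgue_integral_def)
qed

lemma nn_integral_bump: "(\<integral>\<^sup>+y. ennreal (bump y) \<partial>lborel) = 1"
  using nn_integral_eq_integral[OF integral_lborel_unit_cube(1)[of bump]] integral_lborel_unit_cube(2)[of bump]
  by (simp add: continuous_on_bump bump_outside_cube bump_nonneg integral_bump)

lemma nn_integral_bump_average_le:
  assumes [measurable]: "f \<in> borel_measurable borel" "K \<in> sets borel" "\<Omega> \<in> sets borel"
    and sub: "\<And>x. x \<in> K \<Longrightarrow> cball x s \<subseteq> \<Omega>" and s: "s \<ge> 0"
  shows "(\<integral>\<^sup>+x\<in>K. bump_average s f x \<partial>lborel) \<le> (\<integral>\<^sup>+x\<in>\<Omega>. f x \<partial>lborel)"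
proof -
  have "(\<integral>\<^sup>+x\<in>K. bump_average s f x \<partial>lborel)
    \<le> (\<integral>\<^sup>+x. (\<integral>\<^sup>+y. ennreal (bump y) * (f (x + s *\<^sub>R y) * indicator \<Omega> (x + s *\<^sub>R y)) \<partial>lborel) \<partial>lborel)"
  proof (rule nn_integral_mono)
    fix x :: "real^3"
    have "x + s *\<^sub>R y \<in> \<Omega>" if "x \<in> K" "bump y \<noteq> 0" for y
      using sub[OF that(1)] norm_le_1_if_bump_nonzero[of y] that(2) s mult_left_mono[of "norm y" 1 s]
      by (auto simp: subset_iff dist_norm)
    then have "bump_average s f x \<le> (\<integral>\<^sup>+y. ennreal (bump y) * (f (x + s *\<^sub>R y) * indicator \<Omega> (x + s *\<^sub>R y)) \<partial>lborel)"
      if "x \<in> K" using that unfolding bump_average_def by (intro nn_integral_mono) (force simp: indicator_def)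
    then show "bump_average s f x * indicator K x
      \<le> (\<integral>\<^sup>+y. ennreal (bump y) * (f (x + s *\<^sub>R y) * indicator \<Omega> (x + s *\<^sub>R y)) \<partial>lborel)"
      by (cases "x \<in> K") auto
  qed
  also have "\<dots> = (\<integral>\<^sup>+y. (\<integral>\<^sup>+x. ennreal (bump y) * (f (x + s *\<^sub>R y) * indicator \<Omega> (x + s *\<^sub>R y)) \<partial>lborel) \<partial>lborel)"
    by (rule lborel_pair.Fubini') measurable
  also have "\<dots> = (\<integral>\<^sup>+y. ennreal (bump y) * (\<integral>\<^sup>+x\<in>\<Omega>. f x \<partial>lborel) \<partial>lborel)"
  proof (rule nn_integral_cong)
    fix y :: "real^3"
    have "(\<integral>\<^sup>+x\<in>\<Omega>. f x \<partial>lborel) = (\<integral>\<^sup>+x. f (x + s *\<^sub>R y) * indicator \<Omega> (x + s *\<^sub>R y) \<partial>lborel)"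
      using nn_integral_lborel_affine[of "\<lambda>x. f x * indicator \<Omega> x" 1 "s *\<^sub>R y"] by (simp add: add.commute)
    then show "(\<integral>\<^sup>+x. ennreal (bump y) * (f (x + s *\<^sub>R y) * indicator \<Omega> (x + s *\<^sub>R y)) \<partial>lborel)
      = ennreal (bump y) * (\<integral>\<^sup>+x\<in>\<Omega>. f x \<partial>lborel)"
      by (simp add: nn_integral_cmult)
  qed
  also have "\<dots> = (\<integral>\<^sup>+x\<in>\<Omega>. f x \<partial>lborel)"
    by (simp add: nn_integral_multc nn_integral_bump)
  finally show ?thesis .
qed

lemma bump_average_finite:
  assumes [measurable]: "f \<in> borel_measurable borel" "\<Omega> \<in> sets borel"
    and finite: "(\<integral>\<^sup>+x\<in>\<Omega>. f x \<partial>lborel) < \<infinity>" and sub: "cball x s \<subseteq> \<Omega>" and s: "s > 0"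
  shows "bump_average s f x < \<infinity>"
proof -
  have "bump_average s f x \<le> (\<integral>\<^sup>+y. ennreal bump_max * (f (x + s *\<^sub>R y) * indicator \<Omega> (x + s *\<^sub>R y)) \<partial>lborel)"
    unfolding bump_average_def
  proof (rule nn_integral_mono)
    fix y
    have "x + s *\<^sub>R y \<in> \<Omega>" if "bump y \<noteq> 0"
      using sub norm_le_1_if_bump_nonzero[of y] that s by (auto simp: subset_iff dist_norm)
    then show "ennreal (bump y) * f (x + s *\<^sub>R y) \<le> ennreal bump_max * (f (x + s *\<^sub>R y) * indicator \<Omega> (x + s *\<^sub>R y))"
      using bump_le_max[of y] by (cases "bump y = 0") (auto intro!: mult_right_mono ennreal_leI)
  qed
  also have "\<dots> = ennreal bump_max * (\<integral>\<^sup>+y. f (x + s *\<^sub>R y) * indicator \<Omega> (x + s *\<^sub>R y) \<partial>lborel)"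
    by (rule nn_integral_cmult) measurable
  also have "\<dots> < \<infinity>"
    using nn_integral_lborel_affine[of "\<lambda>x. f x * indicator \<Omega> x" s x] finite s
    by (auto simp: ennreal_mult_less_top)
  finally show ?thesis .
qed

lemma norm_integral_bump_scaleR_sq_le:
  fixes f :: "real^3 \<Rightarrow> 'b::euclidean_space"
  assumes [measurable]: "f \<in> borel_measurable borel"
    and finite: "bump_average s (\<lambda>z. ennreal ((norm (f z))^2)) x < \<infinity>"
  shows "integrable lborel (\<lambda>y. bump y *\<^sub>R f (x + s *\<^sub>R y))"
    "ennreal ((norm (\<integral>y. bump y *\<^sub>R f (x + s *\<^sub>R y) \<partial>lborel))^2) \<le> bump_average s (\<lambda>z. ennreal ((norm (f z))^2)) x"
proof -
  have bound: "norm (bump y *\<^sub>R f (x + s *\<^sub>R y)) \<le> (sqrt (bump y) * norm (f (x + s *\<^sub>R y))) * sqrt (bump y)" for y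
  proof -
    have "norm (bump y *\<^sub>R f (x + s *\<^sub>R y)) = (sqrt (bump y) * sqrt (bump y)) * norm (f (x + s *\<^sub>R y))"
      using bump_nonneg[of y] by simp
    then show ?thesis by (simp only: mult_ac order_refl)
  qed
  have "(\<integral>\<^sup>+y. ennreal ((sqrt (bump y) * norm (f (x + s *\<^sub>R y)))^2) \<partial>lborel)
    = bump_average s (\<lambda>z. ennreal ((norm (f z))^2)) x"
    unfolding bump_average_def using bump_nonneg by (simp add: power_mult_distrib ennreal_mult)
  moreover have "(\<integral>\<^sup>+y. ennreal ((sqrt (bump y))^2) \<partial>lborel) = 1"
    using bump_nonneg nn_integral_bump by simp
  ultimately show "integrable lborel (\<lambda>y. bump y *\<^sub>R f (x + s *\<^sub>R y))"
    "ennreal ((norm (\<integral>y. bump y *\<^sub>R f (x + s *\<^sub>R y) \<partial>lborel))^2) \<le> bump_average s (\<lambda>z. ennreal ((norm (f z))^2)) x"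
    using integrable_of_Cauchy_Schwarz[where M=lborel and f="\<lambda>y. bump y *\<^sub>R f (x + s *\<^sub>R y)"
      and k="\<lambda>y. sqrt (bump y) * norm (f (x + s *\<^sub>R y))" and h="\<lambda>y. sqrt (bump y)", OF _ _ _ bound] finite bump_nonneg
    by (simp_all only: mult_1_right) auto
qed

lemma emeasure_unit_cube: "emeasure lborel unit_cube = 8"
proof -
  have "measure lborel unit_cube = 8"
    by (subst content_cbox_cart) (auto simp: interval_ne_empty_cart prod_constant)
  moreover have "cuboid 0 1 = unit_cube" by (simp add: cuboid_def vec_def one_vec_def)
  ultimately show ?thesis using emeasure_cuboid[of "0 :: real^3" 1] by simp
qed

lemma norm_integral_scaleR_grad_bump_sq_le:
  fixes f :: "real^3 \<Rightarrow> real"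
  assumes [measurable]: "f \<in> borel_measurable borel"
    and finite: "bump_average s (\<lambda>z. ennreal ((f z)^2)) x < \<infinity>"
  shows "integrable lborel (\<lambda>y. f (x + s *\<^sub>R y) *\<^sub>R grad_bump y)"
    "ennreal ((norm (\<integral>y. f (x + s *\<^sub>R y) *\<^sub>R grad_bump y \<partial>lborel))^2)
      \<le> ennreal (8 * bump_slope) * bump_average s (\<lambda>z. ennreal ((f z)^2)) x"
proof -
  have bound: "norm (f (x + s *\<^sub>R y) *\<^sub>R grad_bump y)
    \<le> (sqrt (bump y) * \<bar>f (x + s *\<^sub>R y)\<bar>) * (sqrt bump_slope * indicator unit_cube y)" for y
  proof (cases "y \<in> unit_cube")
    case True
    have "norm (grad_bump y) \<le> sqrt (bump_slope * bump y)" by (rule real_le_rsqrt[OF norm_grad_bump_sq_le])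
    then have "\<bar>f (x + s *\<^sub>R y)\<bar> * norm (grad_bump y) \<le> \<bar>f (x + s *\<^sub>R y)\<bar> * sqrt (bump_slope * bump y)"
      by (rule mult_left_mono) simp
    then show ?thesis using True by (simp add: real_sqrt_mult mult_ac)
  qed (simp add: bump_outside_cube)
  have average: "(\<integral>\<^sup>+y. ennreal ((sqrt (bump y) * \<bar>f (x + s *\<^sub>R y)\<bar>)^2) \<partial>lborel)
    = bump_average s (\<lambda>z. ennreal ((f z)^2)) x"
    unfolding bump_average_def using bump_nonneg by (simp add: power_mult_distrib ennreal_mult)
  have "(\<integral>\<^sup>+y. ennreal ((sqrt bump_slope * indicator unit_cube y)^2) \<partial>lborel)
    = (\<integral>\<^sup>+y\<in>unit_cube. ennreal bump_slope \<partial>lborel)"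
    using bump_slope_pos by (intro nn_integral_cong) (auto simp: indicator_def)
  also have "\<dots> = ennreal (8 * bump_slope)"
    using bump_slope_pos emeasure_unit_cube by (simp add: nn_integral_cmult_indicator ennreal_mult' mult.commute)
  finally have slope: "(\<integral>\<^sup>+y. ennreal ((sqrt bump_slope * indicator unit_cube y)^2) \<partial>lborel) = ennreal (8 * bump_slope)" .
  show "integrable lborel (\<lambda>y. f (x + s *\<^sub>R y) *\<^sub>R grad_bump y)"
    "ennreal ((norm (\<integral>y. f (x + s *\<^sub>R y) *\<^sub>R grad_bump y \<partial>lborel))^2)
      \<le> ennreal (8 * bump_slope) * bump_average s (\<lambda>z. ennreal ((f z)^2)) x"
    using integrable_of_Cauchy_Schwarz[where M=lborel and f="\<lambda>y. f (x + s *\<^sub>R y) *\<^sub>R grad_bump y"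
      and k="\<lambda>y. sqrt (bump y) * \<bar>f (x + s *\<^sub>R y)\<bar>" and h="\<lambda>y. sqrt bump_slope * indicator unit_cube y", OF _ _ _ bound]
      finite bump_nonneg bump_slope_pos
    unfolding average slope by (auto simp: ennreal_mult_less_top mult.commute)
qed

lemma mollify_uniform_approx:
  fixes f :: "real^3 \<Rightarrow> 'b::euclidean_space"
  assumes f: "continuous_on UNIV f" and K: "compact K" and e: "e > 0" and r: "r > 0"
  obtains s where "s > 0" "s < r" "\<And>x. x \<in> K \<Longrightarrow> norm (mollify s f x - f x) \<le> e"
proof -
  define N where "N = {x + y |x y. x \<in> K \<and> y \<in> cball 0 2}"
  have in_N: "x + y \<in> N" if "x \<in> K" "norm y \<le> 2" for x y using that by (auto simp: N_def)
  have "compact N" unfolding N_def by (intro compact_sums K compact_cball)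
  then have "uniformly_continuous_on N f"
    by (intro compact_uniformly_continuous continuous_on_UNIV_subset[OF f])
  then obtain \<delta> where \<delta>: "\<delta> > 0" "\<And>x z. x \<in> N \<Longrightarrow> z \<in> N \<Longrightarrow> dist z x < \<delta> \<Longrightarrow> dist (f z) (f x) < e"
    using e unfolding uniformly_continuous_on_def by blast
  define s where "s = min 1 (min (r / 2) (\<delta> / 4))"
  have s: "s > 0" "s < r" "s \<le> 1" "2 * s < \<delta>" using r \<delta>(1) by (auto simp: s_def min_def)
  have "norm (mollify s f x - f x) \<le> e" if x: "x \<in> K" for x
  proof (rule norm_mollify_diff_le[OF f])
    fix y assume y: "y \<in> unit_cube"
    have "norm (s *\<^sub>R y) \<le> 2 * s" using norm_unit_cube_le[OF y] s(1) by simp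
    then have "dist (x + s *\<^sub>R y) x < \<delta>" "x + s *\<^sub>R y \<in> N" using s x by (auto simp: dist_norm intro!: in_N simp del: norm_scaleR)
    then have "dist (f (x + s *\<^sub>R y)) (f x) < e" using in_N[OF x, of 0] by (intro \<delta>(2)) auto
    then show "norm (f (x + s *\<^sub>R y) - f x) \<le> e" by (simp add: dist_norm)
  qed
  then show thesis using that s by blast
qed

locale weak_gradient =
  fixes \<Omega> :: "(real^3) set" and u :: "real^3 \<Rightarrow> real" and d :: "real^3 \<Rightarrow> real^3"
  assumes open_domain: "open \<Omega>" and bounded_domain: "bounded \<Omega>"
    and u_measurable [measurable]: "u \<in> borel_measurable borel"
    and d_measurable [measurable]: "d \<in> borel_measurable borel"
    and u_finite: "nn_L2sq \<Omega> u < \<infinity>" and d_finite: "nn_L2sq \<Omega> d < \<infinity>"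
    and weak: "test_fn \<Omega> \<psi> \<Longrightarrow> (\<integral>x. u x * frechet_derivative \<psi> (at x) (axis j 1) \<partial>lborel)
      = - (\<integral>x. d x $ j * \<psi> x \<partial>lborel)"
begin

lemma domain_measurable [measurable]: "\<Omega> \<in> sets borel"
  using open_domain by simp

lemma weak_bump:
  assumes s: "s > 0" and sub: "cball x s \<subseteq> \<Omega>"
  shows "(1 / s) *\<^sub>R (\<integral>y. u (x + s *\<^sub>R y) *\<^sub>R grad_bump y \<partial>lborel) = - (\<integral>y. bump y *\<^sub>R d (x + s *\<^sub>R y) \<partial>lborel)"
proof (rule vec_eq_iff[THEN iffD2, rule_format])
  fix j :: 3
  have rescale: "(1 / s) *\<^sub>R (x + s *\<^sub>R y - x) = y" for y using s by simp
  have "integrable lborel (\<lambda>y. u (x + s *\<^sub>R y) *\<^sub>R grad_bump y)"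
    by (rule norm_integral_scaleR_grad_bump_sq_le(1)[OF u_measurable])
      (use bump_average_finite[OF _ _ _ sub s] u_finite in simp)
  from integral_bounded_linear[OF bounded_linear_vec_nth this, of j]
  have left: "(\<integral>y. u (x + s *\<^sub>R y) *\<^sub>R grad_bump y \<partial>lborel) $ j = (\<integral>y. u (x + s *\<^sub>R y) * grad_bump y $ j \<partial>lborel)"
    by simp
  have "integrable lborel (\<lambda>y. bump y *\<^sub>R d (x + s *\<^sub>R y))"
    by (rule norm_integral_bump_scaleR_sq_le(1)[OF d_measurable])
      (use bump_average_finite[OF _ _ _ sub s] d_finite in simp)
  from integral_bounded_linear[OF bounded_linear_vec_nth this, of j]
  have right: "(\<integral>y. bump y *\<^sub>R d (x + s *\<^sub>R y) \<partial>lborel) $ j = (\<integral>y. bump y * d (x + s *\<^sub>R y) $ j \<partial>lborel)"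
    by simp
  have "s^3 * (\<integral>y. u (x + s *\<^sub>R y) * (grad_bump y $ j / s) \<partial>lborel)
    = (\<integral>z. u z * (grad_bump ((1 / s) *\<^sub>R (z - x)) $ j / s) \<partial>lborel)"
    using integral_lborel_affine[of "\<lambda>z. u z * (grad_bump ((1 / s) *\<^sub>R (z - x)) $ j / s)" s x] s
    unfolding rescale by simp
  also have "\<dots> = - (\<integral>z. d z $ j * bump ((1 / s) *\<^sub>R (z - x)) \<partial>lborel)"
    using weak[OF test_fn_bump(1)[OF s sub]] unfolding test_fn_bump(2)[OF s sub] .
  also have "\<dots> = - (s^3 * (\<integral>y. bump y * d (x + s *\<^sub>R y) $ j \<partial>lborel))"
    using integral_lborel_affine[of "\<lambda>z. d z $ j * bump ((1 / s) *\<^sub>R (z - x))" s x] s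
    unfolding rescale by (simp add: mult.commute)
  finally have "(\<integral>y. u (x + s *\<^sub>R y) * (grad_bump y $ j / s) \<partial>lborel) = - (\<integral>y. bump y * d (x + s *\<^sub>R y) $ j \<partial>lborel)"
    using s unfolding mult_minus_right[symmetric] mult_cancel_left by simp
  then show "((1 / s) *\<^sub>R (\<integral>y. u (x + s *\<^sub>R y) *\<^sub>R grad_bump y \<partial>lborel)) $ j
    = (- (\<integral>y. bump y *\<^sub>R d (x + s *\<^sub>R y) \<partial>lborel)) $ j"
    by (simp add: left right)
qed

lemma mollify_eq_bump_integral:
  assumes g: "continuous_on UNIV g" "nn_L2sq \<Omega> (\<lambda>x. g x - d x) < \<infinity>" and s: "s > 0" and sub: "cball x s \<subseteq> \<Omega>"
  shows "mollify s g x = (\<integral>y. bump y *\<^sub>R (g (x + s *\<^sub>R y) - d (x + s *\<^sub>R y)) \<partial>lborel) + (\<integral>y. bump y *\<^sub>R d (x + s *\<^sub>R y) \<partial>lborel)"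
proof -
  have [measurable]: "g \<in> borel_measurable borel" by (rule borel_measurable_continuous_onI[OF g(1)])
  note [continuous_intros] = continuous_on_UNIV_compose[OF g(1)] continuous_on_bump
  have finite: "bump_average s (\<lambda>z. ennreal ((norm (g z - d z))^2)) x < \<infinity>" "bump_average s (\<lambda>z. ennreal ((norm (d z))^2)) x < \<infinity>"
    using bump_average_finite[OF _ _ _ sub s] g d_finite by simp_all
  have "mollify s g x = (\<integral>y. bump y *\<^sub>R g (x + s *\<^sub>R y) \<partial>lborel)"
    unfolding mollify_def
    by (rule integral_lborel_unit_cube(2)[symmetric]) (auto intro!: continuous_intros simp: bump_outside_cube)
  also have "\<dots> = (\<integral>y. bump y *\<^sub>R (g (x + s *\<^sub>R y) - d (x + s *\<^sub>R y)) + bump y *\<^sub>R d (x + s *\<^sub>R y) \<partial>lborel)"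
    by (simp add: algebra_simps)
  finally show ?thesis
    by (simp add: Bochner_Integration.integral_add norm_integral_bump_scaleR_sq_le(1)[OF _ finite(1)]
      norm_integral_bump_scaleR_sq_le(1)[OF _ finite(2)])
qed

lemma grad_mollify_eq_bump_integral:
  assumes w: "continuous_on UNIV w" "nn_L2sq \<Omega> (\<lambda>x. w x - u x) < \<infinity>" and s: "s > 0" and sub: "cball x s \<subseteq> \<Omega>"
  shows "grad_mollify s w x = - (1 / s) *\<^sub>R (\<integral>y. (w (x + s *\<^sub>R y) - u (x + s *\<^sub>R y)) *\<^sub>R grad_bump y \<partial>lborel)
    + (\<integral>y. bump y *\<^sub>R d (x + s *\<^sub>R y) \<partial>lborel)"
proof -
  have [measurable]: "w \<in> borel_measurable borel" by (rule borel_measurable_continuous_onI[OF w(1)])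
  note [continuous_intros] = continuous_on_UNIV_compose[OF w(1)] continuous_on_bump
  have finite: "bump_average s (\<lambda>z. ennreal ((w z - u z)^2)) x < \<infinity>" "bump_average s (\<lambda>z. ennreal ((u z)^2)) x < \<infinity>"
    using bump_average_finite[OF _ _ _ sub s] w u_finite by simp_all
  have "grad_mollify s w x = - (1 / s) *\<^sub>R (\<integral>y. w (x + s *\<^sub>R y) *\<^sub>R grad_bump y \<partial>lborel)"
    unfolding grad_mollify_def
    by (subst integral_lborel_unit_cube(2)) (auto intro!: continuous_intros simp: bump_outside_cube)
  also have "(\<integral>y. w (x + s *\<^sub>R y) *\<^sub>R grad_bump y \<partial>lborel)
    = (\<integral>y. (w (x + s *\<^sub>R y) - u (x + s *\<^sub>R y)) *\<^sub>R grad_bump y + u (x + s *\<^sub>R y) *\<^sub>R grad_bump y \<partial>lborel)"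
    by (simp add: algebra_simps)
  also have "\<dots> = (\<integral>y. (w (x + s *\<^sub>R y) - u (x + s *\<^sub>R y)) *\<^sub>R grad_bump y \<partial>lborel) + (\<integral>y. u (x + s *\<^sub>R y) *\<^sub>R grad_bump y \<partial>lborel)"
    by (simp add: Bochner_Integration.integral_add norm_integral_scaleR_grad_bump_sq_le(1)[OF _ finite(1)]
      norm_integral_scaleR_grad_bump_sq_le(1)[OF _ finite(2)])
  finally show ?thesis using weak_bump[OF s sub] by (simp add: scaleR_add_right)
qed

lemma norm_mollify_minus_grad_mollify_sq_le:
  assumes g: "continuous_on UNIV g" "nn_L2sq \<Omega> (\<lambda>x. g x - d x) < \<infinity>"
    and w: "continuous_on UNIV w" "nn_L2sq \<Omega> (\<lambda>x. w x - u x) < \<infinity>"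
    and s: "s > 0" and sub: "cball x s \<subseteq> \<Omega>"
  shows "ennreal ((norm (mollify s g x - grad_mollify s w x))^2)
    \<le> 2 * bump_average s (\<lambda>z. ennreal ((norm (g z - d z))^2)) x
      + ennreal (16 * bump_slope / s^2) * bump_average s (\<lambda>z. ennreal ((w z - u z)^2)) x"
proof -
  have [measurable]: "g \<in> borel_measurable borel" "w \<in> borel_measurable borel"
    by (rule borel_measurable_continuous_onI, fact)+
  let ?p = "\<integral>y. bump y *\<^sub>R (g (x + s *\<^sub>R y) - d (x + s *\<^sub>R y)) \<partial>lborel"
  let ?q = "\<integral>y. (w (x + s *\<^sub>R y) - u (x + s *\<^sub>R y)) *\<^sub>R grad_bump y \<partial>lborel"
  have finite: "bump_average s (\<lambda>z. ennreal ((norm (g z - d z))^2)) x < \<infinity>" "bump_average s (\<lambda>z. ennreal ((w z - u z)^2)) x < \<infinity>"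
    using bump_average_finite[OF _ _ _ sub s] g w by simp_all
  note p = norm_integral_bump_scaleR_sq_le[OF _ finite(1)]
  note q = norm_integral_scaleR_grad_bump_sq_le[OF _ finite(2)]
  have "norm (mollify s g x - grad_mollify s w x) \<le> norm ?p + norm ?q / s"
    using norm_triangle_ineq[of ?p "(1 / s) *\<^sub>R ?q"] s
    unfolding mollify_eq_bump_integral[OF g s sub] grad_mollify_eq_bump_integral[OF w s sub] by simp
  then have "(norm (mollify s g x - grad_mollify s w x))^2 \<le> (norm ?p + norm ?q / s)^2"
    by (intro power_mono) auto
  also have "\<dots> \<le> 2 * (norm ?p)^2 + 2 / s^2 * (norm ?q)^2"
    using sum_sq_le[of "norm ?p" "norm ?q / s"] by (simp add: power_divide)
  finally have "ennreal ((norm (mollify s g x - grad_mollify s w x))^2)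
    \<le> ennreal (2 * (norm ?p)^2 + 2 / s^2 * (norm ?q)^2)" by (rule ennreal_leI)
  also have "\<dots> = 2 * ennreal ((norm ?p)^2) + ennreal (2 / s^2) * ennreal ((norm ?q)^2)"
    by (simp only: ennreal_plus ennreal_mult ennreal_numeral zero_le_power2 zero_le_divide_iff zero_le_numeral
      mult_nonneg_nonneg simp_thms)
  also have "\<dots> \<le> 2 * bump_average s (\<lambda>z. ennreal ((norm (g z - d z))^2)) x
    + ennreal (2 / s^2) * (ennreal (8 * bump_slope) * bump_average s (\<lambda>z. ennreal ((w z - u z)^2)) x)"
    by (intro add_mono mult_left_mono p(2) q(2)) auto
  also have "ennreal (2 / s^2) * (ennreal (8 * bump_slope) * bump_average s (\<lambda>z. ennreal ((w z - u z)^2)) x)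
    = ennreal (16 * bump_slope / s^2) * bump_average s (\<lambda>z. ennreal ((w z - u z)^2)) x"
    using bump_slope_pos by (simp add: mult.assoc[symmetric] flip: ennreal_mult')
  finally show ?thesis .
qed

lemma nn_L2sq_grad_mollify_minus_mollify_le:
  assumes g: "continuous_on UNIV g" "nn_L2sq \<Omega> (\<lambda>x. g x - d x) < \<infinity>"
    and w: "continuous_on UNIV w" "nn_L2sq \<Omega> (\<lambda>x. w x - u x) < \<infinity>"
    and s: "s > 0" and sub: "\<And>x. x \<in> K \<Longrightarrow> cball x s \<subseteq> \<Omega>" and [measurable]: "K \<in> sets borel"
  shows "nn_L2sq K (\<lambda>x. grad_mollify s w x - mollify s g x)
    \<le> 2 * nn_L2sq \<Omega> (\<lambda>x. g x - d x) + ennreal (16 * bump_slope / s^2) * nn_L2sq \<Omega> (\<lambda>x. w x - u x)"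
proof -
  let ?c = "ennreal (16 * bump_slope / s^2)"
  have [measurable]: "g \<in> borel_measurable borel" "w \<in> borel_measurable borel"
    by (rule borel_measurable_continuous_onI, fact)+
  have "nn_L2sq K (\<lambda>x. grad_mollify s w x - mollify s g x)
    \<le> (\<integral>\<^sup>+x\<in>K. 2 * bump_average s (\<lambda>z. ennreal ((norm (g z - d z))^2)) x
      + ?c * bump_average s (\<lambda>z. ennreal ((w z - u z)^2)) x \<partial>lborel)"
  proof (rule nn_integral_mono)
    fix x
    show "ennreal ((norm (grad_mollify s w x - mollify s g x))^2) * indicator K x
      \<le> (2 * bump_average s (\<lambda>z. ennreal ((norm (g z - d z))^2)) x
        + ?c * bump_average s (\<lambda>z. ennreal ((w z - u z)^2)) x) * indicator K x"
      using norm_mollify_minus_grad_mollify_sq_le[OF g w s sub, of x]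
      by (cases "x \<in> K") (simp_all add: norm_minus_commute)
  qed
  also have "\<dots> = 2 * (\<integral>\<^sup>+x\<in>K. bump_average s (\<lambda>z. ennreal ((norm (g z - d z))^2)) x \<partial>lborel)
    + ?c * (\<integral>\<^sup>+x\<in>K. bump_average s (\<lambda>z. ennreal ((w z - u z)^2)) x \<partial>lborel)"
    unfolding bump_average_def distrib_right mult.assoc
    by (subst nn_integral_add) (auto simp: nn_integral_cmult)
  also have "\<dots> \<le> 2 * nn_L2sq \<Omega> (\<lambda>x. g x - d x) + ?c * nn_L2sq \<Omega> (\<lambda>x. w x - u x)"
    using s sub unfolding real_norm_def power2_abs
    by (intro add_mono mult_left_mono nn_integral_bump_average_le) auto
  finally show ?thesis .
qed

lemma nn_L2sq_grad_mollify_minus_grad_le: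
  assumes g: "continuous_on UNIV g" "nn_L2sq \<Omega> (\<lambda>x. g x - d x) < \<infinity>"
    and w: "continuous_on UNIV w" "nn_L2sq \<Omega> (\<lambda>x. w x - u x) < \<infinity>"
    and s: "s > 0" and sub: "\<And>x. x \<in> K \<Longrightarrow> cball x s \<subseteq> \<Omega>"
    and K [measurable]: "K \<in> sets borel" and K_sub: "K \<subseteq> \<Omega>"
  shows "nn_L2sq K (\<lambda>x. grad_mollify s w x - d x)
    \<le> 2 * (2 * nn_L2sq \<Omega> (\<lambda>x. g x - d x) + ennreal (16 * bump_slope / s^2) * nn_L2sq \<Omega> (\<lambda>x. w x - u x))
      + 2 * (2 * nn_L2sq K (\<lambda>x. mollify s g x - g x) + 2 * nn_L2sq \<Omega> (\<lambda>x. g x - d x))"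
proof -
  have [measurable]: "g \<in> borel_measurable borel" "mollify s g \<in> borel_measurable borel"
    "grad_mollify s w \<in> borel_measurable borel"
    by (auto intro!: borel_measurable_continuous_onI g continuous_on_mollify
      has_grad_continuous_grad[OF has_grad_mollify_continuous[OF w(1) s]])
  have "nn_L2sq K (\<lambda>x. g x - d x) \<le> nn_L2sq \<Omega> (\<lambda>x. g x - d x)"
    using K_sub by (intro nn_integral_mono) (auto simp: indicator_def)
  then have "2 * nn_L2sq K (\<lambda>x. mollify s g x - g x) + 2 * nn_L2sq K (\<lambda>x. g x - d x)
    \<le> 2 * nn_L2sq K (\<lambda>x. mollify s g x - g x) + 2 * nn_L2sq \<Omega> (\<lambda>x. g x - d x)"
    by (intro add_mono mult_left_mono) auto
  moreover have "nn_L2sq K (\<lambda>x. mollify s g x - d x)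
    \<le> 2 * nn_L2sq K (\<lambda>x. mollify s g x - g x) + 2 * nn_L2sq K (\<lambda>x. g x - d x)"
    by (rule nn_L2sq_triangle) measurable
  ultimately have mollify_minus_d: "nn_L2sq K (\<lambda>x. mollify s g x - d x)
    \<le> 2 * nn_L2sq K (\<lambda>x. mollify s g x - g x) + 2 * nn_L2sq \<Omega> (\<lambda>x. g x - d x)" by (rule order_trans[rotated])
  have "nn_L2sq K (\<lambda>x. grad_mollify s w x - d x)
    \<le> 2 * nn_L2sq K (\<lambda>x. grad_mollify s w x - mollify s g x) + 2 * nn_L2sq K (\<lambda>x. mollify s g x - d x)"
    by (rule nn_L2sq_triangle) measurable
  also note add_mono[OF mult_left_mono[OF nn_L2sq_grad_mollify_minus_mollify_le[OF g w s sub K]]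
    mult_left_mono[OF mollify_minus_d]]
  finally show ?thesis by simp
qed

lemma ex_has_grad_nn_L2sq_le:
  assumes K: "compact K" "K \<subseteq> \<Omega>" and e: "e > 0"
  shows "\<exists>v V. has_grad v V \<and> nn_L2sq K (\<lambda>x. V x - d x) \<le> ennreal e"
proof -
  define m where "m = measure lborel K"
  have K_measure: "emeasure lborel K = ennreal m" "m \<ge> 0"
    using emeasure_compact_finite[OF K(1)] by (simp_all add: m_def emeasure_eq_ennreal_measure less_top)
  have finite_domain: "emeasure lborel \<Omega> < \<infinity>" using emeasure_bounded_finite[OF bounded_domain] by simp
  have K_borel: "K \<in> sets borel" using K(1) by (simp add: borel_compact)
  obtain g where g: "continuous_on UNIV g" and "nn_L2sq \<Omega> (\<lambda>x. d x - g x) < ennreal (e / 16)"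
    using L2_continuous_dense[OF d_measurable domain_measurable finite_domain d_finite, of "e / 16"] e by auto
  then have close_g: "nn_L2sq \<Omega> (\<lambda>x. g x - d x) \<le> ennreal (e / 16)" by (simp add: norm_minus_commute)
  obtain r where r: "r > 0" "(\<Union>x\<in>K. ball x r) \<subseteq> \<Omega>"
    using compact_subset_open_imp_ball_epsilon_subset[OF K(1) open_domain K(2)] .
  define \<delta> where "\<delta> = sqrt (e / (16 * (m + 1)))"
  have \<delta>: "\<delta> > 0" "16 * (m + 1) * \<delta>^2 = e" using e K_measure by (simp_all add: \<delta>_def)
  obtain s where s: "s > 0" "s < r" and close: "\<And>x. x \<in> K \<Longrightarrow> norm (mollify s g x - g x) \<le> \<delta>"
    by (rule mollify_uniform_approx[OF g K(1) \<delta>(1) r(1)]) blast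
  have sub: "cball x s \<subseteq> \<Omega>" if "x \<in> K" for x using r(2) s(2) that by (force simp: subset_iff)
  define c where "c = 16 * bump_slope / s^2"
  have c: "c > 0" using bump_slope_pos s by (simp add: c_def)
  obtain w where w: "continuous_on UNIV w" and "nn_L2sq \<Omega> (\<lambda>x. u x - w x) < ennreal (e / (8 * c))"
    using L2_continuous_dense[OF u_measurable domain_measurable finite_domain u_finite, of "e / (8 * c)"] e c by auto
  then have close_w: "nn_L2sq \<Omega> (\<lambda>x. w x - u x) \<le> ennreal (e / (8 * c))" by (simp add: power2_commute)
  have "nn_L2sq K (\<lambda>x. mollify s g x - g x) \<le> (\<integral>\<^sup>+x\<in>K. ennreal (\<delta>^2) \<partial>lborel)"
    using close by (intro nn_integral_mono) (auto simp: indicator_def intro!: ennreal_leI power_mono)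
  also have "\<dots> = ennreal (\<delta>^2 * m)" using K_borel by (simp add: nn_integral_cmult_indicator K_measure ennreal_mult)
  also have "\<dots> \<le> ennreal (e / 16)" unfolding \<delta>(2)[symmetric] by (intro ennreal_leI) (simp add: algebra_simps)
  finally have mollify_minus_g: "nn_L2sq K (\<lambda>x. mollify s g x - g x) \<le> ennreal (e / 16)" .
  have "nn_L2sq K (\<lambda>x. grad_mollify s w x - d x)
    \<le> 2 * (2 * nn_L2sq \<Omega> (\<lambda>x. g x - d x) + ennreal c * nn_L2sq \<Omega> (\<lambda>x. w x - u x))
      + 2 * (2 * nn_L2sq K (\<lambda>x. mollify s g x - g x) + 2 * nn_L2sq \<Omega> (\<lambda>x. g x - d x))"
    unfolding c_def using le_less_trans[OF close_g] le_less_trans[OF close_w]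
    by (intro nn_L2sq_grad_mollify_minus_grad_le g w s(1) sub K_borel K(2)) auto
  also have "\<dots> \<le> 2 * (2 * ennreal (e / 16) + ennreal c * ennreal (e / (8 * c)))
    + 2 * (2 * ennreal (e / 16) + 2 * ennreal (e / 16))"
    using close_g close_w mollify_minus_g by (intro add_mono mult_left_mono) auto
  also have "\<dots> = ennreal e" using e c by (simp flip: ennreal_numeral ennreal_mult' ennreal_plus)
  finally show ?thesis using has_grad_mollify_continuous[OF w s(1)] by blast
qed

end

lemma borel_version:
  fixes w :: "'a::euclidean_space \<Rightarrow> 'b::euclidean_space"
  assumes w: "w \<in> borel_measurable (lebesgue_on \<Omega>)" and \<Omega>: "\<Omega> \<in> sets borel"
  obtains w0 where "w0 \<in> borel_measurable borel" "\<And>x. x \<notin> \<Omega> \<Longrightarrow> w0 x = 0" "AE x in lborel. x \<in> \<Omega> \<longrightarrow> w0 x = w x"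
proof -
  have "(\<lambda>x. if x \<in> \<Omega> then w x else 0) \<in> borel_measurable lebesgue"
    using borel_measurable_if_I[OF w] \<Omega> by simp
  then have "\<forall>i\<in>Basis. \<exists>g\<in>borel_measurable lborel. AE x in lborel. (if x \<in> \<Omega> then w x else 0) \<bullet> i = g x"
    by (intro ballI completion_ex_borel_measurable_real) (simp add: borel_measurable_euclidean_space[of "\<lambda>x. if x \<in> \<Omega> then w x else 0"])
  then obtain g where g: "\<And>i. i \<in> Basis \<Longrightarrow> g i \<in> borel_measurable lborel"
    "\<And>i. i \<in> Basis \<Longrightarrow> AE x in lborel. (if x \<in> \<Omega> then w x else 0) \<bullet> i = g i x"
    by metis
  define w0 where "w0 x = indicator \<Omega> x *\<^sub>R (\<Sum>i\<in>Basis. g i x *\<^sub>R i)" for x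
  have [measurable]: "(\<lambda>x. \<Sum>i\<in>Basis. g i x *\<^sub>R i) \<in> borel_measurable borel" "\<Omega> \<in> sets borel"
    using g(1) \<Omega> by (auto intro!: borel_measurable_sum borel_measurable_scaleR)
  have "AE x in lborel. \<forall>i\<in>Basis. (if x \<in> \<Omega> then w x else 0) \<bullet> i = g i x"
    by (rule AE_finite_allI) (use g(2) in auto)
  then have "AE x in lborel. x \<in> \<Omega> \<longrightarrow> w0 x = w x"
    by eventually_elim (rule impI, rule euclidean_eqI, simp add: w0_def)
  moreover have "w0 \<in> borel_measurable borel" unfolding w0_def by measurable
  moreover have "w0 x = 0" if "x \<notin> \<Omega>" for x using that by (simp add: w0_def)
  ultimately show thesis using that by blast
qed

lemma integral_lebesgue_on_borel_version:
  fixes w w0 \<psi> :: "'a::euclidean_space \<Rightarrow> real"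
  assumes w: "w \<in> borel_measurable (lebesgue_on \<Omega>)" and \<Omega>: "\<Omega> \<in> sets borel" and \<psi>: "\<psi> \<in> borel_measurable borel"
    and w0: "w0 \<in> borel_measurable borel" "\<And>x. x \<notin> \<Omega> \<Longrightarrow> w0 x = 0" "AE x in lborel. x \<in> \<Omega> \<longrightarrow> w0 x = w x"
  shows "(\<integral>x. w x * \<psi> x \<partial>(lebesgue_on \<Omega>)) = (\<integral>x. w0 x * \<psi> x \<partial>lborel)"
proof -
  have [measurable]: "(\<lambda>x. if x \<in> \<Omega> then w x else 0) \<in> borel_measurable lebesgue"
    using borel_measurable_if_I[OF w] \<Omega> by simp
  have [measurable]: "w0 \<in> borel_measurable lebesgue" "\<psi> \<in> borel_measurable lebesgue"
    using w0(1) \<psi> by (auto intro: measurable_completion)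
  have "(\<integral>x. w x * \<psi> x \<partial>(lebesgue_on \<Omega>)) = (\<integral>x. indicator \<Omega> x *\<^sub>R (w x * \<psi> x) \<partial>lebesgue)"
    using \<Omega> by (subst integral_restrict_space) auto
  also have "\<dots> = (\<integral>x. (if x \<in> \<Omega> then w x else 0) * \<psi> x \<partial>lebesgue)"
    by (intro Bochner_Integration.integral_cong) auto
  also have "\<dots> = (\<integral>x. w0 x * \<psi> x \<partial>lebesgue)"
  proof (rule integral_cong_AE)
    show "AE x in lebesgue. (if x \<in> \<Omega> then w x else 0) * \<psi> x = w0 x * \<psi> x"
      using AE_completion[OF w0(3)] by eventually_elim (auto simp: w0(2))
  qed auto
  also have "\<dots> = (\<integral>x. w0 x * \<psi> x \<partial>lborel)"
    by (rule integral_completion) (use w0 \<psi> in auto)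
  finally show ?thesis .
qed

lemma nn_integral_sq_borel_version:
  fixes w w0 :: "'a::euclidean_space \<Rightarrow> real"
  assumes w: "integrable (lebesgue_on \<Omega>) (\<lambda>x. (w x)^2)" and \<Omega>: "\<Omega> \<in> sets borel"
    and w0: "AE x in lborel. x \<in> \<Omega> \<longrightarrow> w0 x = w x"
  shows "(\<integral>\<^sup>+x\<in>\<Omega>. ennreal ((w0 x)^2) \<partial>lborel) < \<infinity>"
proof -
  have "(\<integral>\<^sup>+x\<in>\<Omega>. ennreal ((w0 x)^2) \<partial>lborel) = (\<integral>\<^sup>+x\<in>\<Omega>. ennreal ((w0 x)^2) \<partial>lebesgue)"
    by (simp add: nn_integral_completion)
  also have "\<dots> = (\<integral>\<^sup>+x\<in>\<Omega>. ennreal ((w x)^2) \<partial>lebesgue)"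
  proof (rule nn_integral_cong_AE)
    show "AE x in lebesgue. ennreal ((w0 x)^2) * indicator \<Omega> x = ennreal ((w x)^2) * indicator \<Omega> x"
      using AE_completion[OF w0] by eventually_elim (auto simp: indicator_def)
  qed
  also have "\<dots> = (\<integral>\<^sup>+x. ennreal ((w x)^2) \<partial>(lebesgue_on \<Omega>))"
    using \<Omega> by (subst nn_integral_restrict_space) auto
  also have "\<dots> < \<infinity>" using w by (simp add: integrable_iff_bounded)
  finally show ?thesis .
qed

definition jac_limit :: "(real^3) set \<Rightarrow> (real^3 \<Rightarrow> real^3^3) \<Rightarrow> bool" where
  "jac_limit K D \<longleftrightarrow> (\<forall>e>0. \<exists>v V. has_jac v V \<and> nn_L2sq K (\<lambda>x. V x - D x) \<le> ennreal e)"

lemma nn_L2sq_rows: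
  fixes F :: "'a::euclidean_space \<Rightarrow> real^'n^'m"
  assumes [measurable]: "F \<in> borel_measurable borel" "S \<in> sets borel"
  shows "nn_L2sq S F = (\<Sum>i\<in>UNIV. nn_L2sq S (\<lambda>x. F x $ i))"
  by (subst nn_integral_sum[symmetric]) (auto simp: norm_sq_rows sum_distrib_right simp flip: sum_ennreal)

lemma jac_limit_if_weak_gradient_rows:
  assumes [measurable]: "D \<in> borel_measurable borel" and K: "compact K" "K \<subseteq> \<Omega>"
    and rows: "\<And>i. weak_gradient \<Omega> (u i) (\<lambda>x. D x $ i)"
  shows "jac_limit K D"
  unfolding jac_limit_def
proof (intro allI impI)
  fix e :: real assume e: "e > 0"
  have [measurable]: "K \<in> sets borel" using K(1) by (simp add: borel_compact)
  have "\<forall>i. \<exists>v V. has_grad v V \<and> nn_L2sq K (\<lambda>x. V x - D x $ i) \<le> ennreal (e / 3)"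
    using weak_gradient.ex_has_grad_nn_L2sq_le[OF rows K, of "e / 3"] e by simp
  then obtain v V where grad: "\<And>i. has_grad (v i) (V i)" and close: "\<And>i. nn_L2sq K (\<lambda>x. V i x - D x $ i) \<le> ennreal (e / 3)"
    unfolding choice_iff by blast
  have jac: "has_jac (\<lambda>x. \<chi> i. v i x) (\<lambda>x. \<chi> i. V i x)" using grad by (simp add: has_jac_def)
  then have [measurable]: "(\<lambda>x. \<chi> i. V i x) \<in> borel_measurable borel"
    by (intro borel_measurable_continuous_onI has_jac_continuous)
  have "nn_L2sq K (\<lambda>x. (\<chi> i. V i x) - D x) = (\<Sum>i\<in>UNIV. nn_L2sq K (\<lambda>x. V i x - D x $ i))"
    by (subst nn_L2sq_rows) auto
  also have "\<dots> \<le> (\<Sum>i\<in>(UNIV::3 set). ennreal (e / 3))" by (intro sum_mono close)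
  also have "\<dots> = ennreal e" using e by (simp flip: ennreal_numeral ennreal_mult')
  finally show "\<exists>v V. has_jac v V \<and> nn_L2sq K (\<lambda>x. V x - D x) \<le> ennreal e" using jac by blast
qed

theorem sobolev12_jac_limit:
  assumes \<Omega>: "open \<Omega>" "bounded \<Omega>" and sobolev: "sobolev12 \<Omega> u Du"
  obtains D where "D \<in> borel_measurable borel" "AE x in lborel. x \<in> \<Omega> \<longrightarrow> D x = Du x"
    "\<And>K. compact K \<Longrightarrow> K \<subseteq> \<Omega> \<Longrightarrow> jac_limit K D"
proof -
  have borel: "\<Omega> \<in> sets borel" using \<Omega>(1) by simp
  have u: "u \<in> borel_measurable (lebesgue_on \<Omega>)" "\<And>i. integrable (lebesgue_on \<Omega>) (\<lambda>x. (u x $ i)^2)"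
    and Du: "Du \<in> borel_measurable (lebesgue_on \<Omega>)" "\<And>i j. integrable (lebesgue_on \<Omega>) (\<lambda>x. (Du x $ i $ j)^2)"
    and weak: "\<And>\<psi> i j. test_fn \<Omega> \<psi> \<Longrightarrow> (\<integral>x. u x $ i * frechet_derivative \<psi> (at x) (axis j 1) \<partial>(lebesgue_on \<Omega>))
      = - (\<integral>x. Du x $ i $ j * \<psi> x \<partial>(lebesgue_on \<Omega>))"
    using sobolev unfolding sobolev12_def by blast+
  obtain U where [measurable]: "U \<in> borel_measurable borel" and U': "\<And>x. x \<notin> \<Omega> \<Longrightarrow> U x = 0"
    "AE x in lborel. x \<in> \<Omega> \<longrightarrow> U x = u x" using borel_version[OF u(1) borel] by blast
  obtain D where D [measurable]: "D \<in> borel_measurable borel" and D': "\<And>x. x \<notin> \<Omega> \<Longrightarrow> D x = 0"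
    "AE x in lborel. x \<in> \<Omega> \<longrightarrow> D x = Du x" using borel_version[OF Du(1) borel] by blast
  have U_nth: "AE x in lborel. x \<in> \<Omega> \<longrightarrow> U x $ i = u x $ i" for i using U'(2) by eventually_elim simp
  have D_nth: "AE x in lborel. x \<in> \<Omega> \<longrightarrow> D x $ i $ j = Du x $ i $ j" for i j using D'(2) by eventually_elim simp
  have "weak_gradient \<Omega> (\<lambda>x. U x $ i) (\<lambda>x. D x $ i)" for i
  proof
    show "nn_L2sq \<Omega> (\<lambda>x. U x $ i) < \<infinity>"
      using nn_integral_sq_borel_version[OF u(2) borel U_nth] by simp
    have "nn_L2sq \<Omega> (\<lambda>x. D x $ i) = (\<Sum>j\<in>UNIV. \<integral>\<^sup>+x\<in>\<Omega>. ennreal ((D x $ i $ j)^2) \<partial>lborel)"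
      using borel by (subst nn_integral_sum[symmetric])
        (auto simp: norm_vec_def L2_set_def sum_nonneg sum_distrib_right simp flip: sum_ennreal)
    also have "\<dots> < \<infinity>"
      using nn_integral_sq_borel_version[OF Du(2) borel D_nth] by (simp add: sum_3)
    finally show "nn_L2sq \<Omega> (\<lambda>x. D x $ i) < \<infinity>" .
    fix \<psi> j assume test: "test_fn \<Omega> \<psi>"
    then have "Ck_on 0 UNIV \<psi>" "Ck_on (Suc 0) UNIV \<psi>" unfolding test_fn_def smooth_on_def by blast+
    then have [measurable]: "\<psi> \<in> borel_measurable borel"
      "(\<lambda>x. frechet_derivative \<psi> (at x) (axis j 1)) \<in> borel_measurable borel"
      by (auto intro: borel_measurable_continuous_onI)
    have "(\<integral>x. U x $ i * frechet_derivative \<psi> (at x) (axis j 1) \<partial>lborel)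
      = (\<integral>x. u x $ i * frechet_derivative \<psi> (at x) (axis j 1) \<partial>(lebesgue_on \<Omega>))"
      using u(1) U'(1) U_nth borel by (intro integral_lebesgue_on_borel_version[symmetric]) auto
    also have "\<dots> = - (\<integral>x. Du x $ i $ j * \<psi> x \<partial>(lebesgue_on \<Omega>))" by (rule weak[OF test])
    also have "(\<integral>x. Du x $ i $ j * \<psi> x \<partial>(lebesgue_on \<Omega>)) = (\<integral>x. D x $ i $ j * \<psi> x \<partial>lborel)"
      using Du(1) D'(1) D_nth borel by (intro integral_lebesgue_on_borel_version) auto
    finally show "(\<integral>x. U x $ i * frechet_derivative \<psi> (at x) (axis j 1) \<partial>lborel) = - (\<integral>x. D x $ i $ j * \<psi> x \<partial>lborel)" .
  qed (use \<Omega> in auto)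
  then have "jac_limit K D" if "compact K" "K \<subseteq> \<Omega>" for K
    using jac_limit_if_weak_gradient_rows[OF D that, of "\<lambda>i x. U x $ i"] by blast
  then show thesis using that D D'(2) by blast
qed

section \<open>Linearization of the energy density\<close>

lemma scaleR_mat_1_mult_vec: "(c *\<^sub>R mat 1) *v x = c *\<^sub>R x" for x :: "real^3"
  by (simp add: scaleR_matrix_vector_assoc[symmetric])

lemma scaleR_mat_1_mult: "(a *\<^sub>R mat 1) ** (b *\<^sub>R mat 1) = (a * b) *\<^sub>R (mat 1 :: real^3^3)"
  by (simp add: matrix_eq matrix_vector_mul_assoc[symmetric] scaleR_mat_1_mult_vec)

lemma pos_def_scaleR_mat_1:
  assumes "c > 0"
  shows "pos_def (c *\<^sub>R mat 1)"
proof -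
  have "transpose (c *\<^sub>R mat 1) = c *\<^sub>R (mat 1 :: real^3^3)" by (simp add: transpose_def mat_def vec_eq_iff)
  then show ?thesis using assms by (simp add: pos_def_def scaleR_mat_1_mult_vec)
qed

lemma pos_def_sqrt_scalar:
  fixes S :: "real^3^3"
  assumes S: "pos_def S" "S ** S = (c * c) *\<^sub>R mat 1" and c: "c > 0"
  shows "S = c *\<^sub>R mat 1"
proof -
  have "S *v x = c *\<^sub>R x" for x
  proof -
    define w where "w = S *v x - c *\<^sub>R x"
    have "S *v w = (S ** S) *v x - c *\<^sub>R (S *v x)"
      unfolding w_def by (simp add: matrix_vector_mult_diff_distrib matrix_vector_mul_assoc matrix_vector_mult_scaleR)
    also have "(S ** S) *v x = (c * c) *\<^sub>R x"
      unfolding S(2) by (rule scaleR_mat_1_mult_vec)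
    finally have "S *v w = - c *\<^sub>R w" by (simp add: w_def scaleR_diff_right algebra_simps)
    then have "w \<bullet> (S *v w) = - c * (w \<bullet> w)" by simp
    moreover have "0 \<le> c * (w \<bullet> w)" using c by simp
    ultimately have "\<not> w \<bullet> (S *v w) > 0" by linarith
    then have "w = 0" using S(1) by (auto simp: pos_def_def)
    then show ?thesis by (simp add: w_def)
  qed
  then show ?thesis by (simp add: matrix_eq scaleR_mat_1_mult_vec)
qed

lemma matrix_inv_unique:
  fixes A :: "real^'n^'n"
  assumes "A ** B = mat 1" "B ** A = mat 1"
  shows "matrix_inv A = B"
proof -
  have "A ** matrix_inv A = mat 1"
    unfolding matrix_inv_def using someI[of "\<lambda>A'. A ** A' = mat 1 \<and> A' ** A = mat 1" B] assms by auto
  then have "B ** (A ** matrix_inv A) = B" by simp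
  then show ?thesis using assms(2) by (simp add: matrix_mul_assoc)
qed

lemma inv_sqrt_metricG: "inv_sqrt (metricG \<phi> x) = exp (- \<phi> (x $ 3)) *\<^sub>R mat 1"
proof -
  let ?c = "exp (- \<phi> (x $ 3))"
  have "exp (2 * \<phi> (x $ 3)) * (?c * ?c) = 1" by (simp add: mult_exp_exp)
  then have inverse: "matrix_inv (metricG \<phi> x) = (?c * ?c) *\<^sub>R mat 1"
    by (intro matrix_inv_unique) (simp_all add: metricG_def scaleR_mat_1_mult mult.commute)
  show ?thesis
    unfolding inv_sqrt_def inverse
    by (rule the_equality) (auto simp: scaleR_mat_1_mult pos_def_scaleR_mat_1 intro: pos_def_sqrt_scalar)
qed

definition hess :: "('a::euclidean_space \<Rightarrow> real) \<Rightarrow> 'a \<Rightarrow> 'a \<Rightarrow> 'a \<Rightarrow> real" where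
  "hess f x F G = frechet_derivative (\<lambda>y. frechet_derivative f (at y) F) (at x) G"

lemma linear_Basis_expansion:
  fixes f :: "'a::euclidean_space \<Rightarrow> real"
  assumes "linear f"
  shows "f x = (\<Sum>i\<in>Basis. (x \<bullet> i) * f i)"
proof -
  have "f x = f (\<Sum>i\<in>Basis. (x \<bullet> i) *\<^sub>R i)" by (simp add: euclidean_representation)
  also have "\<dots> = (\<Sum>i\<in>Basis. (x \<bullet> i) * f i)"
    by (simp add: linear_sum[OF assms] linear_cmul[OF assms])
  finally show ?thesis .
qed

context
  fixes f :: "'a::euclidean_space \<Rightarrow> real" and U x
  assumes U: "open U" "x \<in> U" and C2: "Ck_on 2 U f"
begin

lemma C2_has_derivative: "y \<in> U \<Longrightarrow> (f has_derivative frechet_derivative f (at y)) (at y)"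
  using C2 by (simp add: numeral_2_eq_2 frechet_derivative_works)

lemma C2_has_derivative_hess_Basis:
  "i \<in> Basis \<Longrightarrow> ((\<lambda>y. frechet_derivative f (at y) i) has_derivative hess f x i) (at x)"
  using C2 U(2) unfolding hess_def by (simp add: numeral_2_eq_2 frechet_derivative_works[symmetric])

lemma C2_has_derivative_hess_expansion:
  "((\<lambda>y. frechet_derivative f (at y) F) has_derivative (\<lambda>G. \<Sum>i\<in>Basis. (F \<bullet> i) * hess f x i G)) (at x)"
proof (rule has_derivative_transform_within_open[OF _ U])
  show "((\<lambda>y. \<Sum>i\<in>Basis. (F \<bullet> i) * frechet_derivative f (at y) i)
    has_derivative (\<lambda>G. \<Sum>i\<in>Basis. (F \<bullet> i) * hess f x i G)) (at x)"
    by (intro has_derivative_sum has_derivative_mult_right C2_has_derivative_hess_Basis)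
  show "(\<Sum>i\<in>Basis. (F \<bullet> i) * frechet_derivative f (at y) i) = frechet_derivative f (at y) F" if "y \<in> U" for y
    by (rule linear_Basis_expansion[OF has_derivative_linear[OF C2_has_derivative[OF that]], symmetric])
qed

lemma C2_hess_expansion: "hess f x F G = (\<Sum>i\<in>Basis. (F \<bullet> i) * hess f x i G)"
  unfolding hess_def[of f x F] frechet_derivative_at[OF C2_has_derivative_hess_expansion[of F], symmetric] ..

lemma C2_bilinear_hess: "bilinear (hess f x)"
  unfolding bilinear_def
proof (intro conjI allI linearI)
  have right: "linear (hess f x F)" for F
    unfolding C2_hess_expansion[of F, abs_def] by (rule has_derivative_linear[OF C2_has_derivative_hess_expansion])
  show "hess f x F (G + H) = hess f x F G + hess f x F H" "hess f x F (c *\<^sub>R G) = c *\<^sub>R hess f x F G" for F G H c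
    by (rule linear_add[OF right] linear_cmul[OF right])+
  show "hess f x (F + H) G = hess f x F G + hess f x H G" for F G H
    by (subst (1 2 3) C2_hess_expansion) (simp add: inner_add_left distrib_right sum.distrib)
  show "hess f x (c *\<^sub>R F) G = c *\<^sub>R hess f x F G" for F G c
    by (subst (1 2) C2_hess_expansion) (simp add: sum_distrib_left mult.assoc)
qed

lemma C2_gradient_expansion:
  assumes e: "e > 0"
  shows "\<exists>\<delta>>0. \<forall>h. norm h < \<delta> \<longrightarrow> x + h \<in> U \<and> (\<forall>F.
    \<bar>frechet_derivative f (at (x + h)) F - frechet_derivative f (at x) F - hess f x F h\<bar> \<le> e * norm h * norm F)"
proof -
  define e' where "e' = e / real DIM('a)"
  have e': "e' > 0" using e by (simp add: e'_def)
  let ?R = "\<lambda>h F. \<bar>frechet_derivative f (at (x + h)) F - frechet_derivative f (at x) F - hess f x F h\<bar>"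
  have "\<forall>i\<in>Basis. \<exists>\<delta>>0. \<forall>h. norm h < \<delta> \<longrightarrow> ?R h i \<le> e' * norm h"
  proof
    fix i :: 'a assume "i \<in> Basis"
    then obtain \<delta> where "\<delta> > 0" "\<forall>y. norm (y - x) < \<delta> \<longrightarrow>
      norm (frechet_derivative f (at y) i - frechet_derivative f (at x) i - hess f x i (y - x)) \<le> e' * norm (y - x)"
      using C2_has_derivative_hess_Basis e' unfolding has_derivative_at_alt by blast
    then show "\<exists>\<delta>>0. \<forall>h. norm h < \<delta> \<longrightarrow> ?R h i \<le> e' * norm h"
      by (intro exI[of _ \<delta>]) (metis add_diff_cancel_left' real_norm_def)
  qed
  then obtain \<delta> where \<delta>: "\<And>i. i \<in> Basis \<Longrightarrow> \<delta> i > 0"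
    "\<And>i h. i \<in> Basis \<Longrightarrow> norm h < \<delta> i \<Longrightarrow> ?R h i \<le> e' * norm h" by metis
  obtain r where r: "r > 0" "ball x r \<subseteq> U" using U open_contains_ball by blast
  have "x + h \<in> U \<and> (\<forall>F. ?R h F \<le> e * norm h * norm F)" if h: "norm h < min r (Min (\<delta> ` Basis))" for h
  proof (intro conjI allI)
    show in_U: "x + h \<in> U" using r(2) h by (auto simp: dist_norm)
    fix F
    have "frechet_derivative f (at (x + h)) F - frechet_derivative f (at x) F - hess f x F h
      = (\<Sum>i\<in>Basis. (F \<bullet> i) * (frechet_derivative f (at (x + h)) i - frechet_derivative f (at x) i - hess f x i h))"
      using linear_Basis_expansion[OF has_derivative_linear[OF C2_has_derivative[OF in_U]], of F]
        linear_Basis_expansion[OF has_derivative_linear[OF C2_has_derivative[OF U(2)]], of F] C2_hess_expansion[of F h]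
      by (simp add: right_diff_distrib sum_subtractf)
    then have "?R h F \<le> (\<Sum>i\<in>Basis. \<bar>F \<bullet> i\<bar> * ?R h i)"
      by (simp only:) (rule order_trans[OF sum_abs], simp add: abs_mult)
    also have "\<dots> \<le> (\<Sum>i\<in>(Basis :: 'a set). norm F * (e' * norm h))"
    proof (rule sum_mono)
      fix i :: 'a assume i: "i \<in> Basis"
      have "norm h < Min (\<delta> ` Basis)" using h unfolding min_less_iff_conj ..
      also have "\<dots> \<le> \<delta> i" using i by (intro Min_le) auto
      finally have "norm h < \<delta> i" .
      then show "\<bar>F \<bullet> i\<bar> * ?R h i \<le> norm F * (e' * norm h)"
        using \<delta>(2)[OF i] i by (intro mult_mono Basis_le_norm) auto
    qed
    also have "\<dots> = e * norm h * norm F" by (simp add: e'_def)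
    finally show "?R h F \<le> e * norm h * norm F" .
  qed
  moreover have "min r (Min (\<delta> ` Basis)) > 0" using r(1) \<delta>(1) by simp
  ultimately show ?thesis by blast
qed

theorem second_order_Taylor:
  assumes e: "e > 0"
  shows "\<exists>\<delta>>0. \<forall>F. norm F < \<delta> \<longrightarrow> x + F \<in> U &
    \<bar>f (x + F) - f x - frechet_derivative f (at x) F - hess f x F F / 2\<bar> \<le> e * (norm F)^2"
proof -
  interpret hess: bounded_bilinear "hess f x"
    using C2_bilinear_hess by (simp add: bilinear_conv_bounded_bilinear)
  obtain \<delta> where \<delta>: "\<delta> > 0" "\<And>h. norm h < \<delta> \<Longrightarrow> x + h \<in> U"
    "\<And>h F. norm h < \<delta> \<Longrightarrow> \<bar>frechet_derivative f (at (x + h)) F - frechet_derivative f (at x) F - hess f x F h\<bar> \<le> e * norm h * norm F"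
    using C2_gradient_expansion[OF e] by blast
  have "\<bar>f (x + F) - f x - frechet_derivative f (at x) F - hess f x F F / 2\<bar> \<le> e * (norm F)^2" if F: "norm F < \<delta>" for F
  proof -
    have segment: "norm (t *\<^sub>R F) < \<delta>" "norm (t *\<^sub>R F) \<le> norm F" if "0 \<le> t" "t \<le> 1" for t
      using F mult_right_mono[OF that(2) norm_ge_zero[of F]] that(1) by auto
    define \<psi> where "\<psi> t = f (x + t *\<^sub>R F) - t * frechet_derivative f (at x) F - t^2 * (hess f x F F / 2)" for t
    define \<psi>' where "\<psi>' t = frechet_derivative f (at (x + t *\<^sub>R F)) F - frechet_derivative f (at x) F - hess f x F (t *\<^sub>R F)" for t
    have "(\<psi> has_real_derivative \<psi>' t) (at t)" if t: "0 \<le> t" "t \<le> 1" for t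
    proof -
      note deriv = C2_has_derivative[OF \<delta>(2)[OF segment(1)[OF t]]]
      have "((\<lambda>t. x + t *\<^sub>R F) has_derivative (\<lambda>h. h *\<^sub>R F)) (at t)" by (auto intro!: derivative_eq_intros)
      from has_derivative_compose[OF this deriv]
      have "((\<lambda>t. f (x + t *\<^sub>R F)) has_real_derivative frechet_derivative f (at (x + t *\<^sub>R F)) F) (at t)"
        by (simp add: has_field_derivative_def linear_cmul[OF has_derivative_linear[OF deriv]] mult_commute_abs)
      then show ?thesis
        unfolding \<psi>_def \<psi>'_def by (auto intro!: derivative_eq_intros simp: hess.scaleR_right)
    qed
    then obtain t where t: "0 < t" "t < 1" "\<psi> 1 - \<psi> 0 = (1 - 0) * \<psi>' t"
      using MVT2[of 0 1 \<psi> \<psi>'] by auto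
    then have "\<bar>\<psi> 1 - \<psi> 0\<bar> \<le> e * norm (t *\<^sub>R F) * norm F"
      using \<delta>(3)[OF segment(1)[of t], of F] by (simp add: \<psi>'_def)
    also have "\<dots> \<le> e * norm F * norm F" using segment(2)[of t] t e by (intro mult_right_mono mult_left_mono) auto
    finally show ?thesis by (simp add: \<psi>_def power2_eq_square algebra_simps)
  qed
  then show ?thesis using \<delta>(1,2) by blast
qed

end

locale admissible =
  fixes W :: "real^3^3 \<Rightarrow> ennreal"
  assumes admissible: "admissible_density W"
begin

abbreviation "Wr \<equiv> Wreal W"

definition "finite_nhd = (SOME U. open U \<and> SO3 \<subseteq> U \<and> (\<forall>F\<in>U. W F \<noteq> \<infinity>) \<and> Ck_on 2 U Wr)"

lemma finite_nhd:
  "open finite_nhd" "SO3 \<subseteq> finite_nhd" "F \<in> finite_nhd \<Longrightarrow> W F \<noteq> \<infinity>" "Ck_on 2 finite_nhd Wr"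
proof -
  have "\<exists>U. open U \<and> SO3 \<subseteq> U \<and> (\<forall>F\<in>U. W F \<noteq> \<infinity>) \<and> Ck_on 2 U Wr"
    using admissible by (simp add: admissible_density_def)
  from someI_ex[OF this]
  show "open finite_nhd" "SO3 \<subseteq> finite_nhd" "F \<in> finite_nhd \<Longrightarrow> W F \<noteq> \<infinity>" "Ck_on 2 finite_nhd Wr"
    unfolding finite_nhd_def[symmetric] by auto
qed

lemma mat_1_in_finite_nhd: "mat 1 \<in> finite_nhd"
  using finite_nhd(2) mat1_SO3 by blast

lemma W_measurable [measurable]: "W \<in> borel_measurable borel"
  using admissible by (simp add: admissible_density_def)

lemma W_SO3_mult: "R \<in> SO3 \<Longrightarrow> W (R ** F) = W F"
  using admissible by (simp add: admissible_density_def)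

lemma W_eq_Wr: "F \<in> finite_nhd \<Longrightarrow> W F = ennreal (Wr F)"
  using finite_nhd(3)[of F] by (simp add: Wreal_def less_top)

lemma Wr_nonneg: "Wr F \<ge> 0"
  by (simp add: Wreal_def)

lemma Wr_SO3: "R \<in> SO3 \<Longrightarrow> Wr R = 0"
  using admissible by (simp add: admissible_density_def Wreal_def)

lemma W_ge_infdist:
  obtains c where "c > 0" "\<And>F. W F \<ge> ennreal (c * (infdist F SO3)^2)"
  using admissible unfolding admissible_density_def by blast

text \<open>Symmetrized, which avoids the symmetry of second derivatives.\<close>

definition "B F G = (D2W W (mat 1) F G + D2W W (mat 1) G F) / 2"

lemma D2W_eq_hess: "D2W W = hess Wr"
  by (simp add: D2W_def hess_def fun_eq_iff)

lemma bounded_bilinear_B: "bounded_bilinear B"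
proof -
  have "bilinear (D2W W (mat 1))"
    unfolding D2W_eq_hess by (rule C2_bilinear_hess[OF finite_nhd(1) mat_1_in_finite_nhd finite_nhd(4)])
  then have "bilinear B"
    by (simp add: bilinear_def linear_iff B_def algebra_simps add_divide_distrib)
  then show ?thesis by (simp add: bilinear_conv_bounded_bilinear)
qed

sublocale B: bounded_bilinear B
  by (rule bounded_bilinear_B)

lemma B_commute: "B F G = B G F"
  by (simp add: B_def)

lemma D2W_eq_B: "D2W W (mat 1) F F = B F F"
  by (simp add: B_def)

lemma B_quadratic: "B (F + t *\<^sub>R G) (F + t *\<^sub>R G) = B F F + 2 * t * B F G + t^2 * B G G"
  using B_commute[of G F] by (simp add: B.add_left B.add_right B.scaleR_left B.scaleR_right power2_eq_square algebra_simps)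

lemma Wr_Taylor:
  assumes "e > 0"
  shows "\<exists>\<delta>>0. \<forall>F. norm F < \<delta> \<longrightarrow> mat 1 + F \<in> finite_nhd \<and> \<bar>Wr (mat 1 + F) - B F F / 2\<bar> \<le> e * (norm F)^2"
proof -
  have "frechet_derivative Wr (at (mat 1)) = (\<lambda>F. 0)"
    by (rule differential_zero_maxmin[OF mat_1_in_finite_nhd finite_nhd(1)
      C2_has_derivative[OF finite_nhd(1) mat_1_in_finite_nhd finite_nhd(4) mat_1_in_finite_nhd]])
      (simp add: Wr_SO3[OF mat1_SO3] Wr_nonneg)
  then show ?thesis
    using second_order_Taylor[OF finite_nhd(1) mat_1_in_finite_nhd finite_nhd(4) assms]
    by (simp add: Wr_SO3[OF mat1_SO3] flip: D2W_eq_hess D2W_eq_B)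
qed

lemma Wr_second_order_limit:
  assumes lim: "(Y \<longlongrightarrow> S) (at_right 0)"
  shows "((\<lambda>t. Wr (mat 1 + t *\<^sub>R Y t) / t^2) \<longlongrightarrow> B S S / 2) (at_right 0)"
proof -
  have bounded: "\<forall>\<^sub>F t in at_right 0. (norm (Y t))^2 < (norm S)^2 + 1"
    by (rule order_tendstoD(2)[OF tendsto_power[OF tendsto_norm[OF lim]]]) simp
  have "((\<lambda>t. t *\<^sub>R Y t) \<longlongrightarrow> 0 *\<^sub>R S) (at_right 0)"
    by (intro tendsto_intros lim)
  then have small: "\<forall>\<^sub>F t in at_right 0. norm (t *\<^sub>R Y t) < \<delta>" if "\<delta> > 0" for \<delta>
    using order_tendstoD(2)[OF tendsto_norm, of "\<lambda>t. t *\<^sub>R Y t" 0 "at_right 0" \<delta>] that by simp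
  have "((\<lambda>t. Wr (mat 1 + t *\<^sub>R Y t) / t^2 - B (Y t) (Y t) / 2) \<longlongrightarrow> 0) (at_right 0)"
  proof (rule tendstoI)
    fix e :: real assume e: "e > 0"
    define e' where "e' = e / ((norm S)^2 + 1)"
    have e': "e' > 0" "e' * ((norm S)^2 + 1) = e" using e add_nonneg_pos[of "(norm S)^2" 1] by (simp_all add: e'_def)
    obtain \<delta> where "\<delta> > 0" and Taylor: "\<And>F. norm F < \<delta> \<Longrightarrow> \<bar>Wr (mat 1 + F) - B F F / 2\<bar> \<le> e' * (norm F)^2"
      using Wr_Taylor[OF e'(1)] by blast
    from bounded small[OF this(1)] eventually_at_right_less[of 0]
    show "\<forall>\<^sub>F t in at_right 0. dist (Wr (mat 1 + t *\<^sub>R Y t) / t^2 - B (Y t) (Y t) / 2) 0 < e"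
    proof eventually_elim
      case (elim t)
      have "\<bar>Wr (mat 1 + t *\<^sub>R Y t) - t^2 * (B (Y t) (Y t) / 2)\<bar> \<le> t^2 * (e' * (norm (Y t))^2)"
        using Taylor[OF elim(2)] by (simp add: B.scaleR_left B.scaleR_right power_mult_distrib power2_eq_square mult_ac)
      moreover have "Wr (mat 1 + t *\<^sub>R Y t) - t^2 * (B (Y t) (Y t) / 2)
        = t^2 * (Wr (mat 1 + t *\<^sub>R Y t) / t^2 - B (Y t) (Y t) / 2)" using elim(3) by (simp add: right_diff_distrib)
      ultimately have "\<bar>Wr (mat 1 + t *\<^sub>R Y t) / t^2 - B (Y t) (Y t) / 2\<bar> \<le> e' * (norm (Y t))^2"
        using elim(3) by (simp add: abs_mult)
      also have "\<dots> < e' * ((norm S)^2 + 1)" using elim(1) e'(1) by (intro mult_strict_left_mono)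
      finally show ?case using e'(2) by simp
    qed
  qed
  from tendsto_add[OF this tendsto_divide[OF B.tendsto[OF lim lim] tendsto_const[of 2]]] show ?thesis by simp
qed

lemma B_coercive: "\<exists>c>0. \<forall>F. c * (norm (sym_part F))^2 \<le> B F F"
proof -
  obtain c where c: "c > 0" "\<And>F. W F \<ge> ennreal (c * (infdist F SO3)^2)" using W_ge_infdist by blast
  have "2 * c * (norm (sym_part F))^2 \<le> B F F" for F
  proof -
    let ?low = "\<lambda>t. max 0 (norm (sym_part F) - 4 * t * (norm F)^2)"
    have "((\<lambda>t. c * (?low t)^2) \<longlongrightarrow> c * (max 0 (norm (sym_part F) - 4 * 0 * (norm F)^2))^2) (at_right 0)"
      by (intro tendsto_intros)
    then have lim: "((\<lambda>t. c * (?low t)^2) \<longlongrightarrow> c * (norm (sym_part F))^2) (at_right 0)" by simp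
    have "((\<lambda>t. mat 1 + t *\<^sub>R F) \<longlongrightarrow> mat 1 + 0 *\<^sub>R F) (at_right 0)" by (intro tendsto_intros)
    then have "\<forall>\<^sub>F t in at_right 0. mat 1 + t *\<^sub>R F \<in> finite_nhd"
      using topological_tendstoD[OF _ finite_nhd(1)] mat_1_in_finite_nhd by simp
    then have "\<forall>\<^sub>F t in at_right 0. c * (?low t)^2 \<le> Wr (mat 1 + t *\<^sub>R F) / t^2"
      using eventually_at_right_less[of 0]
    proof eventually_elim
      case (elim t)
      let ?d = "infdist (mat 1 + t *\<^sub>R F) SO3"
      have d: "0 \<le> ?d" "?d \<le> t * norm F"
        using infdist_SO3_le[OF mat1_SO3, of "mat 1 + t *\<^sub>R F"] elim(2) by (simp_all add: infdist_nonneg)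
      have "sym_part (mat 1 + t *\<^sub>R F) - mat 1 = t *\<^sub>R sym_part F"
        by (simp add: sym_part_nth vec_eq_iff mat_def algebra_simps)
      then have "t * norm (sym_part F) \<le> ?d + (?d + t * norm F)^2"
        using norm_sym_part_minus_id_le[of "mat 1 + t *\<^sub>R F"] elim(2) by simp
      also have "(?d + t * norm F)^2 \<le> (2 * (t * norm F))^2" using d by (intro power_mono) auto
      finally have "t * ?low t \<le> ?d"
        using d elim(2) by (simp add: max_def power2_eq_square algebra_simps)
      then have "(t * ?low t)^2 \<le> ?d^2" using elim(2) by (intro power_mono) auto
      then have "c * (t * ?low t)^2 \<le> c * ?d^2" using c(1) by (intro mult_left_mono) auto
      also have "\<dots> \<le> Wr (mat 1 + t *\<^sub>R F)"
        using c(2)[of "mat 1 + t *\<^sub>R F"] W_eq_Wr[OF elim(1)] Wr_nonneg by (simp add: ennreal_le_iff)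
      finally show ?case using elim(2) by (simp add: pos_le_divide_eq power_mult_distrib mult_ac)
    qed
    from tendsto_le[OF _ Wr_second_order_limit[OF tendsto_const] lim this] show ?thesis by simp
  qed
  then show ?thesis using c(1) by (intro exI[of _ "2 * c"]) auto
qed

lemma B_nonneg: "B F F \<ge> 0"
proof -
  obtain c where "c > 0" "c * (norm (sym_part F))^2 \<le> B F F" using B_coercive by blast
  then show ?thesis by (meson less_imp_le mult_nonneg_nonneg order_trans zero_le_power2)
qed

lemma B_Cauchy_Schwarz: "(B F G)^2 \<le> B F F * B G G"
  by (rule Cauchy_Schwarz_of_nonneg_quadratic) (use B_nonneg B_quadratic in metis)+

lemma B_eq_0_if_tangent_to_SO3:
  assumes R: "\<And>t. R t \<in> SO3" and lim: "((\<lambda>t. (1 / t) *\<^sub>R (R t - mat 1)) \<longlongrightarrow> S) (at_right 0)"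
  shows "B S S = 0"
proof -
  have "\<forall>\<^sub>F t in at_right 0. Wr (mat 1 + t *\<^sub>R ((1 / t) *\<^sub>R (R t - mat 1))) / t^2 = 0"
    using eventually_at_right_less[of 0] by eventually_elim (simp add: Wr_SO3[OF R])
  then have "((\<lambda>t. Wr (mat 1 + t *\<^sub>R ((1 / t) *\<^sub>R (R t - mat 1))) / t^2) \<longlongrightarrow> 0) (at_right 0)"
    by (rule tendsto_eventually)
  from tendsto_unique[OF _ this Wr_second_order_limit[OF lim]] show ?thesis by simp
qed

end

definition rotation :: "3 \<Rightarrow> 3 \<Rightarrow> real \<Rightarrow> real^3^3" where
  "rotation i j t = (\<chi> a b. if a = b \<and> (a = i \<or> a = j) then cos t else if a = j \<and> b = i then sin t
    else if a = i \<and> b = j then - sin t else if a = b then 1 else 0)"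

definition skew_unit :: "3 \<Rightarrow> 3 \<Rightarrow> real^3^3" where
  "skew_unit i j = (\<chi> a b. if a = j \<and> b = i then 1 else if a = i \<and> b = j then - 1 else 0)"

lemma rotation_SO3:
  assumes "i \<noteq> j"
  shows "rotation i j t \<in> SO3"
proof -
  have cos_sin: "cos t * cos t = 1 - sin t * sin t" using sin_cos_squared_add[of t] by (simp add: power2_eq_square)
  consider "i = 1 \<and> j = 2" | "i = 1 \<and> j = 3" | "i = 2 \<and> j = 1" | "i = 2 \<and> j = 3" | "i = 3 \<and> j = 1" | "i = 3 \<and> j = 2"
    using assms exhaust_3[of i] exhaust_3[of j] by blast
  then have "transpose (rotation i j t) ** rotation i j t = mat 1 \<and> det (rotation i j t) = 1"
    by cases (simp_all add: vec_eq_iff forall_3 matrix_matrix_mult_def transpose_def mat_def sum_3 det_3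
      rotation_def cos_sin)
  then show ?thesis by (simp add: SO3_def orthogonal_matrix)
qed

lemma rotation_difference_quotient:
  assumes "i \<noteq> j"
  shows "((\<lambda>t. (1 / t) *\<^sub>R (rotation i j t - mat 1)) \<longlongrightarrow> skew_unit i j) (at_right 0)"
proof (intro vec_tendstoI)
  fix a b :: 3
  have "(cos has_real_derivative - sin 0) (at 0)" "(sin has_real_derivative cos 0) (at (0::real))"
    by (auto intro!: derivative_eq_intros)
  then have limits: "((\<lambda>t::real. (cos t - 1) / t) \<longlongrightarrow> 0) (at_right 0)" "((\<lambda>t::real. sin t / t) \<longlongrightarrow> 1) (at_right 0)"
    by (auto simp: has_field_derivative_iff intro: tendsto_mono[OF at_le])
  have quotient: "((1 / t) *\<^sub>R (rotation i j t - mat 1)) $ a $ b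
    = of_bool (a = b \<and> (a = i \<or> a = j)) * ((cos t - 1) / t) + skew_unit i j $ a $ b * (sin t / t)" for t
    using assms by (auto simp: rotation_def skew_unit_def mat_def)
  have "((\<lambda>t. of_bool (a = b \<and> (a = i \<or> a = j)) * ((cos t - 1) / t) + skew_unit i j $ a $ b * (sin t / t))
    \<longlongrightarrow> of_bool (a = b \<and> (a = i \<or> a = j)) * 0 + skew_unit i j $ a $ b * 1) (at_right 0)"
    by (intro tendsto_intros limits)
  then show "((\<lambda>t. ((1 / t) *\<^sub>R (rotation i j t - mat 1)) $ a $ b) \<longlongrightarrow> skew_unit i j $ a $ b) (at_right 0)"
    unfolding quotient by simp
qed

context admissible
begin

lemma B_skew:
  assumes skew: "transpose A = - A"
  shows "B F A = 0"
proof -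
  have unit: "B F (skew_unit i j) = 0" if "i \<noteq> j" for i j
    using B_Cauchy_Schwarz[of F "skew_unit i j"]
      B_eq_0_if_tangent_to_SO3[OF rotation_SO3[OF that] rotation_difference_quotient[OF that]] by simp
  have "A $ i $ j = - A $ j $ i" for i j
    using arg_cong[OF skew, of "\<lambda>M. M $ j $ i"] by (simp add: transpose_def)
  from this[of 1 1] this[of 2 2] this[of 3 3] this[of 1 2] this[of 1 3] this[of 2 3]
  have "A = A $ 2 $ 1 *\<^sub>R skew_unit 1 2 + A $ 3 $ 1 *\<^sub>R skew_unit 1 3 + A $ 3 $ 2 *\<^sub>R skew_unit 2 3"
    by (simp add: vec_eq_iff forall_3 skew_unit_def)
  also have "B F \<dots> = 0" by (simp add: B.add_right B.scaleR_right unit)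
  finally show ?thesis .
qed

lemma B_sym_part: "B F (sym_part G) = B F G"
proof -
  have "transpose (sym_part G - G) = - (sym_part G - G)"
    by (simp add: vec_eq_iff transpose_def sym_part_nth field_simps)
  from B_skew[OF this, of F] show ?thesis by (simp add: B.diff_right)
qed

lemma minor22_eq_iff: "minor22 F = minor22 G \<longleftrightarrow> (\<forall>i\<in>{1,2}. \<forall>j\<in>{1,2}. F $ i $ j = G $ i $ j)"
  by (auto simp: minor22_def vec_eq_iff forall_2)

lemma B_minimizer_exists: "\<exists>M. minor22 M = mat 1 \<and> (\<forall>X. minor22 X = mat 1 \<longrightarrow> B M M \<le> B X X)"
proof -
  obtain c where c: "c > 0" "\<And>F. c * (norm (sym_part F))^2 \<le> B F F" using B_coercive by blast
  define I where "I = (mat 1 :: real^3^3)"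
  have minor: "minor22 X = mat 1 \<longleftrightarrow> (\<forall>i\<in>{1,2}. \<forall>j\<in>{1,2}. X $ i $ j = I $ i $ j)" for X
  proof -
    have "minor22 I = mat 1" by (simp add: I_def minor22_def mat_def vec_eq_iff forall_2)
    then show ?thesis using minor22_eq_iff[of X I] by simp
  qed
  define \<rho> where "\<rho> = sqrt (B I I / c) + norm I"
  define K where "K = {X. \<forall>i\<in>{1,2}. \<forall>j\<in>{1,2}. X $ i $ j = I $ i $ j} \<inter> cball 0 \<rho>"
  have "closed {X::real^3^3. \<forall>i\<in>{1,2}. \<forall>j\<in>{1,2}. X $ i $ j = I $ i $ j}"
    by (simp, intro closed_Collect_conj closed_Collect_eq continuous_intros)
  then have "compact K" unfolding K_def by (simp add: closed_Int_compact)
  moreover have I_in_K: "I \<in> K" using B_nonneg[of I] c(1) by (simp add: K_def \<rho>_def)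
  moreover have "continuous_on K (\<lambda>X. B X X)" by (intro B.continuous_on continuous_on_id)
  ultimately obtain M where M: "M \<in> K" "\<And>X. X \<in> K \<Longrightarrow> B M M \<le> B X X"
    using continuous_attains_inf[of K "\<lambda>X. B X X"] by blast
  have "B M M \<le> B X X" if X: "minor22 X = mat 1" for X
  proof (cases "norm (sym_part X) \<le> \<rho>")
    case True
    have "I $ i $ j = I $ j $ i" for i j by (simp add: I_def mat_def)
    then have "sym_part X \<in> K" using X True unfolding minor by (auto simp: K_def sym_part_nth)
    then show ?thesis using M(2) B_sym_part[of "sym_part X" X] B_sym_part[of X X] B_commute by metis
  next
    case False
    then have "sqrt (B I I / c) \<le> norm (sym_part X)" using norm_ge_zero[of I] unfolding \<rho>_def by linarith
    then have "B I I / c \<le> (norm (sym_part X))^2"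
      using power_mono[of "sqrt (B I I / c)" "norm (sym_part X)" 2] B_nonneg[of I] c(1) by simp
    then have "B I I \<le> c * (norm (sym_part X))^2" using c(1) by (simp add: field_simps)
    then show ?thesis using c(2)[of X] M(2)[OF I_in_K] by linarith
  qed
  moreover have "minor22 M = mat 1" using M(1) unfolding minor by (simp add: K_def)
  ultimately show ?thesis by blast
qed

definition "minimizer = (SOME M. minor22 M = mat 1 \<and> (\<forall>X. minor22 X = mat 1 \<longrightarrow> B M M \<le> B X X))"

lemma minimizer: "minor22 minimizer = mat 1" "minor22 X = mat 1 \<Longrightarrow> B minimizer minimizer \<le> B X X"
  using someI_ex[OF B_minimizer_exists] unfolding minimizer_def[symmetric] by blast+

lemma Q2_eq: "Q2 W (mat 1) = B minimizer minimizer"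
  unfolding Q2_def D2W_eq_B by (rule cInf_eq_minimum) (use minimizer in auto)

lemma Q2_pos: "Q2 W (mat 1) > 0"
proof -
  obtain c where c: "c > 0" "c * (norm (sym_part minimizer))^2 \<le> B minimizer minimizer" using B_coercive by blast
  have "minimizer $ 1 $ 1 = 1" using minimizer(1) by (simp add: minor22_def mat_def vec_eq_iff forall_2)
  then have "sym_part minimizer $ 1 $ 1 = 1" by (simp add: sym_part_nth)
  then have "sym_part minimizer \<noteq> 0" by auto
  then have "c * (norm (sym_part minimizer))^2 > 0" using c(1) by simp
  then show ?thesis using c(2) unfolding Q2_eq by linarith
qed

lemma B_minimizer_eq_0:
  assumes N: "\<And>i j. i \<in> {1,2} \<Longrightarrow> j \<in> {1,2} \<Longrightarrow> N $ i $ j = 0"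
  shows "B minimizer N = 0"
proof -
  have "0 \<le> 0 + 2 * t * B minimizer N + t^2 * B N N" for t
  proof -
    have "minor22 (minimizer + t *\<^sub>R N) = minor22 minimizer" using N by (simp add: minor22_eq_iff)
    then show ?thesis using minimizer(2)[of "minimizer + t *\<^sub>R N"] minimizer(1) by (simp add: B_quadratic)
  qed
  from Cauchy_Schwarz_of_nonneg_quadratic[OF this B_nonneg] show ?thesis by simp
qed

text \<open>The functional is \<open>B M\<close> for the minimizer \<open>M\<close> defining \<open>Q2 W (mat 1)\<close>. By minimality it only sees
  the principal minor.\<close>

lemma dual_functional:
  obtains p q r where "p + r = Q2 W (mat 1)"
    "\<And>E. (p * E $ 1 $ 1 + q * (E $ 1 $ 2 + E $ 2 $ 1) + r * E $ 2 $ 2)^2 \<le> Q2 W (mat 1) * B E E"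
proof -
  define unit :: "3 \<Rightarrow> 3 \<Rightarrow> real^3^3" where "unit i j = (\<chi> a b. if a = i \<and> b = j then 1 else 0)" for i j
  define \<beta> where "\<beta> i j = B minimizer (unit i j)" for i j
  have "transpose (unit 2 1 - unit 1 2) = - (unit 2 1 - unit 1 2)"
    by (simp add: unit_def transpose_def vec_eq_iff)
  from B_skew[OF this] have sym: "\<beta> 2 1 = \<beta> 1 2" by (simp add: \<beta>_def B.diff_right)
  have functional: "B minimizer E = \<beta> 1 1 * E $ 1 $ 1 + \<beta> 1 2 * (E $ 1 $ 2 + E $ 2 $ 1) + \<beta> 2 2 * E $ 2 $ 2" for E
  proof -
    define P where "P = E $ 1 $ 1 *\<^sub>R unit 1 1 + E $ 1 $ 2 *\<^sub>R unit 1 2 + E $ 2 $ 1 *\<^sub>R unit 2 1 + E $ 2 $ 2 *\<^sub>R unit 2 2"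
    have "B minimizer (E - P) = 0" by (rule B_minimizer_eq_0) (auto simp: P_def unit_def)
    then have "B minimizer E = B minimizer P" by (simp add: B.diff_right)
    also have "\<dots> = \<beta> 1 1 * E $ 1 $ 1 + \<beta> 1 2 * (E $ 1 $ 2 + E $ 2 $ 1) + \<beta> 2 2 * E $ 2 $ 2"
      using sym by (simp add: P_def B.add_right B.scaleR_right \<beta>_def algebra_simps)
    finally show ?thesis .
  qed
  have "minimizer $ 1 $ 1 = 1" "minimizer $ 1 $ 2 = 0" "minimizer $ 2 $ 1 = 0" "minimizer $ 2 $ 2 = 1"
    using minimizer(1) by (simp_all add: minor22_def mat_def vec_eq_iff forall_2)
  then have "\<beta> 1 1 + \<beta> 2 2 = Q2 W (mat 1)" using functional[of minimizer] by (simp add: Q2_eq)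
  moreover have "(\<beta> 1 1 * E $ 1 $ 1 + \<beta> 1 2 * (E $ 1 $ 2 + E $ 2 $ 1) + \<beta> 2 2 * E $ 2 $ 2)^2 \<le> Q2 W (mat 1) * B E E" for E
    using B_Cauchy_Schwarz[of minimizer E] by (simp add: functional[of E] Q2_eq)
  ultimately show thesis by (rule that)
qed

end

section \<open>A divergence free test stress\<close>

fun profile :: "nat \<Rightarrow> real \<Rightarrow> real" where
  "profile 0 s = flat_exp 1 (1 - s^2)"
| "profile (Suc 0) s = - 2 * s * flat_exp (flat_deriv 1) (1 - s^2)"
| "profile (Suc (Suc 0)) s = - 2 * flat_exp (flat_deriv 1) (1 - s^2) + 4 * s^2 * flat_exp (flat_deriv (flat_deriv 1)) (1 - s^2)"
| "profile (Suc (Suc (Suc i))) s = 12 * s * flat_exp (flat_deriv (flat_deriv 1)) (1 - s^2)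
    - 8 * s^3 * flat_exp (flat_deriv (flat_deriv (flat_deriv 1))) (1 - s^2)"

lemma profile_deriv:
  assumes "i \<le> 2"
  shows "(profile i has_real_derivative profile (Suc i) s) (at s)"
proof -
  have flat: "((\<lambda>s. flat_exp p (1 - s^2)) has_real_derivative - 2 * s * flat_exp (flat_deriv p) (1 - s^2)) (at s)" for p
    by (rule DERIV_chain2[OF flat_exp_deriv, THEN DERIV_cong]) (auto intro!: derivative_eq_intros)
  consider "i = 0" | "i = 1" | "i = 2" using assms by linarith
  then show ?thesis
  proof cases
    case 1
    have "profile 0 = (\<lambda>s. flat_exp 1 (1 - s^2))" by auto
    then show ?thesis using 1 flat[of 1] by simp
  next
    case 2
    have "profile 1 = (\<lambda>s. - 2 * s * flat_exp (flat_deriv 1) (1 - s^2))" by auto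
    moreover have "((\<lambda>s. - 2 * s * flat_exp (flat_deriv 1) (1 - s^2)) has_real_derivative profile (Suc 1) s) (at s)"
      by (rule derivative_eq_intros flat refl)+ (simp add: power2_eq_square)
    ultimately show ?thesis using 2 by simp
  next
    case 3
    have "profile 2 = (\<lambda>s. - 2 * flat_exp (flat_deriv 1) (1 - s^2) + 4 * s^2 * flat_exp (flat_deriv (flat_deriv 1)) (1 - s^2))"
      by (auto simp: numeral_2_eq_2)
    moreover have "((\<lambda>s. - 2 * flat_exp (flat_deriv 1) (1 - s^2) + 4 * s^2 * flat_exp (flat_deriv (flat_deriv 1)) (1 - s^2))
      has_real_derivative profile (Suc 2) s) (at s)"
      by (rule derivative_eq_intros flat refl)+ (simp add: numeral_2_eq_2 power2_eq_square power3_eq_cube)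
    ultimately show ?thesis using 3 by simp
  qed
qed

lemma continuous_on_profile: "continuous_on S (profile i)"
proof -
  note [continuous_intros] = continuous_on_UNIV_compose[OF continuous_on_flat_exp]
  have "continuous_on S (\<lambda>s. profile i s)"
    by (cases "(i, 0 :: real)" rule: profile.cases) (auto intro!: continuous_intros)
  then show ?thesis by simp
qed

lemma profile_zero:
  assumes "1 \<le> \<bar>s\<bar>"
  shows "profile i s = 0"
proof -
  have "1 - s^2 \<le> 0" using abs_le_square_iff[of 1 s] assms by simp
  then have "flat_exp p (1 - s^2) = 0" for p by (simp add: flat_exp_def)
  then show ?thesis by (cases "(i, s)" rule: profile.cases) simp_all
qed

lemma profile_bounded: "\<exists>M. \<forall>i\<le>2. \<forall>s. \<bar>profile i s\<bar> \<le> M"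
proof -
  have "\<exists>M. \<forall>s. \<bar>profile i s\<bar> \<le> M" for i
  proof -
    have "bounded (profile i ` {-1..1})"
      by (intro compact_imp_bounded compact_continuous_image continuous_on_profile) auto
    then obtain M where M: "\<forall>s\<in>{-1..1}. \<bar>profile i s\<bar> \<le> M" unfolding bounded_iff by auto
    then have "0 \<le> M" by (force intro: order_trans[OF abs_ge_zero])
    then have "\<bar>profile i s\<bar> \<le> M" for s
      using profile_zero[of s i] M by (cases "s \<in> {-1..1}") auto
    then show ?thesis by blast
  qed
  then obtain M where "\<And>i s. \<bar>profile i s\<bar> \<le> M i" by metis
  then have "\<forall>i\<le>2. \<forall>s. \<bar>profile i s\<bar> \<le> Max (M ` {..2})"
    by (meson Max_ge atMost_iff finite_atMost finite_imageI imageI order_trans)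
  then show ?thesis by blast
qed

definition profile_max :: real where "profile_max = (SOME M. \<forall>i\<le>2. \<forall>s. \<bar>profile i s\<bar> \<le> M)"

lemma abs_profile_le: "i \<le> 2 \<Longrightarrow> \<bar>profile i s\<bar> \<le> profile_max"
  using someI_ex[OF profile_bounded] unfolding profile_max_def by blast

lemma profile_nonneg: "profile 0 s \<ge> 0"
  by (simp add: flat_exp_def)

lemma profile_lower:
  assumes "\<bar>s\<bar> \<le> 1 / 2"
  shows "profile 0 s \<ge> exp (- 4 / 3)"
proof -
  have "s^2 \<le> (1 / 2)^2" using assms by (intro abs_le_square_iff[THEN iffD1]) auto
  then have pos: "1 - s^2 \<ge> 3 / 4" by (simp add: power2_eq_square)
  then have "1 / (1 - s^2) \<le> 1 / (3 / 4)" by (intro divide_left_mono) auto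
  then show ?thesis using pos by (simp add: flat_exp_def)
qed

lemma profile_max_pos: "profile_max > 0"
proof -
  have "exp (- 4 / 3) \<le> profile_max" using profile_lower[of 0] abs_profile_le[of 0 0] by linarith
  then show ?thesis by (rule less_le_trans[OF exp_gt_zero])
qed

definition lateral_profile :: "real \<Rightarrow> nat \<Rightarrow> real \<Rightarrow> real" where
  "lateral_profile l i s = profile i (s / l) / l^i"

text \<open>Supported in \<open>{0..1/4}\<close>, so that all moments of the cutoff are positive.\<close>

definition vertical_profile :: "nat \<Rightarrow> real \<Rightarrow> real" where
  "vertical_profile i s = 8^i * profile i (8 * s - 1)"

lemma lateral_profile_deriv:
  assumes "i \<le> 2"
  shows "(lateral_profile l i has_real_derivative lateral_profile l (Suc i) s) (at s)"
proof -
  have "((\<lambda>s::real. s / l) has_real_derivative 1 / l) (at s)" using DERIV_cdivide[OF DERIV_ident] .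
  from DERIV_cdivide[OF DERIV_chain2[OF profile_deriv[OF assms] this], of "l^i"]
  show ?thesis unfolding lateral_profile_def by (simp add: mult.commute)
qed

lemma vertical_profile_deriv:
  assumes "i \<le> 2"
  shows "(vertical_profile i has_real_derivative vertical_profile (Suc i) s) (at s)"
proof -
  have "((\<lambda>s::real. 8 * s - 1) has_real_derivative 8) (at s)" by (auto intro!: derivative_eq_intros)
  from DERIV_cmult[OF DERIV_chain2[OF profile_deriv[OF assms] this], of "8^i"]
  show ?thesis unfolding vertical_profile_def by (simp add: mult_ac)
qed

lemma continuous_on_lateral_profile: "continuous_on S (lateral_profile l i)"
  unfolding lateral_profile_def divide_inverse
  by (intro continuous_intros continuous_on_UNIV_compose[OF continuous_on_profile])

lemma continuous_on_vertical_profile: "continuous_on S (vertical_profile i)"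
  unfolding vertical_profile_def
  by (intro continuous_intros continuous_on_UNIV_compose[OF continuous_on_profile])

definition half_widths :: "real \<Rightarrow> real^3" where "half_widths l = vector [l, l, 1 / 4]"

lemma half_widths_nth [simp]: "half_widths l $ 1 = l" "half_widths l $ 2 = l" "half_widths l $ 3 = 1 / 4"
  by (simp_all add: half_widths_def)

abbreviation cell :: "real \<Rightarrow> (real^3) set" where "cell l \<equiv> cuboid (half_widths l) 0"

definition cell_cutoff :: "real \<Rightarrow> nat \<Rightarrow> nat \<Rightarrow> nat \<Rightarrow> real^3 \<Rightarrow> real" where
  "cell_cutoff l i j k y = lateral_profile l i (y $ 1) * lateral_profile l j (y $ 2) * vertical_profile k (y $ 3)"

lemma continuous_on_cell_cutoff: "continuous_on S (cell_cutoff l i j k)"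
  unfolding cell_cutoff_def
  by (intro continuous_intros continuous_on_UNIV_compose[OF continuous_on_lateral_profile]
    continuous_on_UNIV_compose[OF continuous_on_vertical_profile])

lemma has_grad_cell_cutoff:
  assumes "i \<le> 2" "j \<le> 2" "k \<le> 2"
  shows "has_grad (cell_cutoff l i j k)
    (\<lambda>y. vector [cell_cutoff l (Suc i) j k y, cell_cutoff l i (Suc j) k y, cell_cutoff l i j (Suc k) y])"
proof -
  note lateral1 = has_grad_real_compose[OF has_grad_coord[of 1] lateral_profile_deriv[OF assms(1), of l] continuous_on_lateral_profile]
  note lateral2 = has_grad_real_compose[OF has_grad_coord[of 2] lateral_profile_deriv[OF assms(2), of l] continuous_on_lateral_profile]
  note vertical = has_grad_real_compose[OF has_grad_coord[of 3] vertical_profile_deriv[OF assms(3)] continuous_on_vertical_profile]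
  show ?thesis
    by (rule has_grad_cong[OF has_grad_mult[OF has_grad_mult[OF lateral1 lateral2] vertical]])
      (simp_all add: cell_cutoff_def vec_eq_iff forall_3 axis_def mult_ac)
qed

lemma cell_cutoff_zero:
  assumes y: "y \<notin> cell l" and l: "l > 0"
  shows "cell_cutoff l i j k y = 0"
proof -
  have "\<bar>y $ 1\<bar> > l \<or> \<bar>y $ 2\<bar> > l \<or> \<bar>y $ 3\<bar> > 1 / 4"
    using y by (auto simp: mem_cuboid forall_3)
  moreover have "lateral_profile l i s = 0" if "\<bar>s\<bar> > l" for s i
    using that l by (simp add: lateral_profile_def profile_zero)
  moreover have "vertical_profile i s = 0" if "\<bar>s\<bar> > 1 / 4" for s i
  proof -
    have "1 \<le> \<bar>8 * s - 1\<bar>" using that by linarith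
    then show ?thesis by (simp add: vertical_profile_def profile_zero)
  qed
  ultimately show ?thesis by (auto simp: cell_cutoff_def)
qed

lemma integral_cell_cutoff_by_parts:
  assumes f: "has_grad f F" and orders: "i \<le> 2" "j \<le> 2" "k \<le> 2" and l: "l > 0"
  shows "integral (cell l) (\<lambda>y. F y $ 1 * cell_cutoff l i j k y) = - integral (cell l) (\<lambda>y. f y * cell_cutoff l (Suc i) j k y)"
    "integral (cell l) (\<lambda>y. F y $ 2 * cell_cutoff l i j k y) = - integral (cell l) (\<lambda>y. f y * cell_cutoff l i (Suc j) k y)"
    "integral (cell l) (\<lambda>y. F y $ 3 * cell_cutoff l i j k y) = - integral (cell l) (\<lambda>y. f y * cell_cutoff l i j (Suc k) y)"
proof -
  have parts: "integral (cell l) (\<lambda>y. F y $ c * cell_cutoff l i j k y) = - integral (cell l)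
    (\<lambda>y. f y * vector [cell_cutoff l (Suc i) j k y, cell_cutoff l i (Suc j) k y, cell_cutoff l i j (Suc k) y] $ c)" for c
    unfolding cuboid_def
    by (rule integral_by_parts[OF f has_grad_cell_cutoff[OF orders]])
      (use cell_cutoff_zero l in \<open>simp add: cuboid_def\<close>)
  show "integral (cell l) (\<lambda>y. F y $ 1 * cell_cutoff l i j k y) = - integral (cell l) (\<lambda>y. f y * cell_cutoff l (Suc i) j k y)"
    "integral (cell l) (\<lambda>y. F y $ 2 * cell_cutoff l i j k y) = - integral (cell l) (\<lambda>y. f y * cell_cutoff l i (Suc j) k y)"
    "integral (cell l) (\<lambda>y. F y $ 3 * cell_cutoff l i j k y) = - integral (cell l) (\<lambda>y. f y * cell_cutoff l i j (Suc k) y)"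
    using parts[of 1] parts[of 2] parts[of 3] by simp_all
qed

definition cutoff_bound :: real where "cutoff_bound = 64 * profile_max^3"

lemma cutoff_bound_pos: "cutoff_bound > 0"
  using profile_max_pos by (simp add: cutoff_bound_def)

lemma abs_cell_cutoff_le:
  assumes orders: "i \<le> 2" "j \<le> 2" "k \<le> 2" and l: "l > 0"
  shows "\<bar>cell_cutoff l i j k y\<bar> \<le> cutoff_bound / l^(i + j)"
proof -
  have lateral: "\<bar>lateral_profile l i s\<bar> \<le> profile_max / l^i" if "i \<le> 2" for i s
    using abs_profile_le[OF that, of "s / l"] l by (simp add: lateral_profile_def abs_mult divide_right_mono)
  have "\<bar>vertical_profile k s\<bar> \<le> 8^2 * profile_max" for s
    using abs_profile_le[OF orders(3), of "8 * s - 1"] power_increasing[OF orders(3), of "8 :: real"] profile_max_pos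
    unfolding vertical_profile_def abs_mult by (intro mult_mono) auto
  then have "\<bar>cell_cutoff l i j k y\<bar> \<le> (profile_max / l^i) * (profile_max / l^j) * (8^2 * profile_max)"
    unfolding cell_cutoff_def abs_mult using l profile_max_pos by (intro mult_mono lateral orders mult_nonneg_nonneg) auto
  also have "\<dots> = cutoff_bound / l^(i + j)" by (simp add: cutoff_bound_def power_add power3_eq_cube)
  finally show ?thesis .
qed

lemma abs_cell_cutoff_le_divide:
  assumes orders: "i \<le> 2" "j \<le> 2" "k \<le> 2" "1 \<le> i + j" and l: "l \<ge> 1"
  shows "\<bar>cell_cutoff l i j k y\<bar> \<le> cutoff_bound / l"
proof -
  have "\<bar>cell_cutoff l i j k y\<bar> \<le> cutoff_bound / l^(i + j)" using orders l by (intro abs_cell_cutoff_le) auto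
  also have "\<dots> \<le> cutoff_bound / l^1"
    using l orders(4) cutoff_bound_pos by (intro divide_left_mono power_increasing) auto
  finally show ?thesis by simp
qed

definition shear_stress :: "real \<Rightarrow> real \<Rightarrow> real \<Rightarrow> real^3 \<Rightarrow> real" where
  "shear_stress l p q y = p * cell_cutoff l 1 0 1 y + q * cell_cutoff l 0 1 1 y"

definition normal_stress :: "real \<Rightarrow> real \<Rightarrow> real \<Rightarrow> real \<Rightarrow> real^3 \<Rightarrow> real" where
  "normal_stress l p q r y = p * cell_cutoff l 2 0 0 y + 2 * q * cell_cutoff l 1 1 0 y + r * cell_cutoff l 0 2 0 y"

text \<open>The stress is built from an Airy-type potential, so it is symmetric and divergence free.\<close>

definition stress :: "real \<Rightarrow> real \<Rightarrow> real \<Rightarrow> real \<Rightarrow> real^3 \<Rightarrow> real^3^3" where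
  "stress l p q r y =
    vector [vector [p * cell_cutoff l 0 0 2 y, q * cell_cutoff l 0 0 2 y, - shear_stress l p q y],
      vector [q * cell_cutoff l 0 0 2 y, r * cell_cutoff l 0 0 2 y, - shear_stress l q r y],
      vector [- shear_stress l p q y, - shear_stress l q r y, normal_stress l p q r y]]"

lemma continuous_on_stress: "continuous_on S (stress l p q r)"
proof -
  have "continuous_on S (\<lambda>y. stress l p q r y $ i $ j)" for i j
    using exhaust_3[of i] exhaust_3[of j]
    by (elim disjE; simp add: stress_def shear_stress_def normal_stress_def; intro continuous_intros continuous_on_cell_cutoff)
  then have "continuous_on S (\<lambda>y. \<chi> i j. stress l p q r y $ i $ j)" by (intro continuous_on_vec_lambda)
  then show ?thesis by simp
qed

lemma stress_inner:
  "stress l p q r y \<bullet> E = cell_cutoff l 0 0 2 y * (p * E $ 1 $ 1 + q * (E $ 1 $ 2 + E $ 2 $ 1) + r * E $ 2 $ 2)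
    - shear_stress l p q y * (E $ 1 $ 3 + E $ 3 $ 1) - shear_stress l q r y * (E $ 2 $ 3 + E $ 3 $ 2)
    + normal_stress l p q r y * E $ 3 $ 3"
  by (simp add: inner_vec_def sum_3 stress_def algebra_simps)

lemma stress_orthogonal:
  assumes V: "has_jac v V" and l: "l > 0"
  shows "integral (cell l) (\<lambda>y. stress l p q r y \<bullet> V y) = 0"
proof -
  let ?I = "\<lambda>a b i j k. integral (cell l) (\<lambda>y. V y $ a $ b * cell_cutoff l i j k y)"
  have integral: "((\<lambda>y. V y $ a $ b * cell_cutoff l i j k y) has_integral ?I a b i j k) (cell l)" for a b i j k
    by (intro integrable_integral integrable_on_cuboid continuous_intros continuous_on_cell_cutoff has_jac_continuous[OF V])
  have expand: "stress l p q r y \<bullet> V y =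
    p * (V y $ 1 $ 1 * cell_cutoff l 0 0 2 y - V y $ 1 $ 3 * cell_cutoff l 1 0 1 y
      - V y $ 3 $ 1 * cell_cutoff l 1 0 1 y + V y $ 3 $ 3 * cell_cutoff l 2 0 0 y)
    + q * (V y $ 1 $ 2 * cell_cutoff l 0 0 2 y - V y $ 1 $ 3 * cell_cutoff l 0 1 1 y
      - V y $ 3 $ 1 * cell_cutoff l 0 1 1 y + V y $ 3 $ 3 * cell_cutoff l 1 1 0 y)
    + q * (V y $ 2 $ 1 * cell_cutoff l 0 0 2 y - V y $ 2 $ 3 * cell_cutoff l 1 0 1 y
      - V y $ 3 $ 2 * cell_cutoff l 1 0 1 y + V y $ 3 $ 3 * cell_cutoff l 1 1 0 y)
    + r * (V y $ 2 $ 2 * cell_cutoff l 0 0 2 y - V y $ 2 $ 3 * cell_cutoff l 0 1 1 y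
      - V y $ 3 $ 2 * cell_cutoff l 0 1 1 y + V y $ 3 $ 3 * cell_cutoff l 0 2 0 y)" for y
    by (simp add: stress_inner shear_stress_def normal_stress_def algebra_simps)
  have "((\<lambda>y. stress l p q r y \<bullet> V y) has_integral
    p * (?I 1 1 0 0 2 - ?I 1 3 1 0 1 - ?I 3 1 1 0 1 + ?I 3 3 2 0 0)
    + q * (?I 1 2 0 0 2 - ?I 1 3 0 1 1 - ?I 3 1 0 1 1 + ?I 3 3 1 1 0)
    + q * (?I 2 1 0 0 2 - ?I 2 3 1 0 1 - ?I 3 2 1 0 1 + ?I 3 3 1 1 0)
    + r * (?I 2 2 0 0 2 - ?I 2 3 0 1 1 - ?I 3 2 0 1 1 + ?I 3 3 0 2 0)) (cell l)"
    unfolding expand by (intro has_integral_add has_integral_diff has_integral_mult_right integral)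
  moreover note parts = integral_cell_cutoff_by_parts[OF has_jac_nth[OF V] _ _ _ l]
  have "?I 1 1 0 0 2 = ?I 1 3 1 0 1" "?I 1 2 0 0 2 = ?I 1 3 0 1 1" "?I 2 1 0 0 2 = ?I 2 3 1 0 1" "?I 2 2 0 0 2 = ?I 2 3 0 1 1"
    "?I 3 3 2 0 0 = ?I 3 1 1 0 1" "?I 3 3 1 1 0 = ?I 3 1 0 1 1" "?I 3 2 1 0 1 = ?I 3 1 0 1 1" "?I 3 3 0 2 0 = ?I 3 2 0 1 1"
    by (simp_all add: parts eval_nat_numeral)
  ultimately show ?thesis by (auto dest!: integral_unique)
qed

lemma prod_3: "(\<Prod>i\<in>(UNIV::3 set). f i) = f 1 * f 2 * (f 3 :: real)"
  unfolding UNIV_3 by (simp add: mult.assoc)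

lemma content_cell:
  assumes "l > 0"
  shows "measure lborel (cell l) = 2 * l^2"
proof -
  have "cbox (- (half_widths l + vec 0)) (half_widths l + vec 0) \<noteq> {}"
    using assms by (simp add: interval_ne_empty_cart forall_3)
  from content_cbox_cart[OF this] show ?thesis unfolding cuboid_def prod_3 by (simp add: power2_eq_square)
qed

lemma cell_cutoff_moment_lower:
  assumes l: "l > 0"
  shows "integral (cell l) (\<lambda>y. (y $ 3)^n * cell_cutoff l 0 0 0 y) \<ge> exp (- 4 / 3)^3 * (1 / 16)^n / 8 * l^2"
proof -
  let ?f = "\<lambda>y::real^3. (y $ 3)^n * cell_cutoff l 0 0 0 y"
  define a :: "real^3" where "a = vector [- l / 2, - l / 2, 1 / 16]"
  define b :: "real^3" where "b = vector [l / 2, l / 2, 3 / 16]"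
  have nth: "a $ 1 = - l / 2" "a $ 2 = - l / 2" "a $ 3 = 1 / 16" "b $ 1 = l / 2" "b $ 2 = l / 2" "b $ 3 = 3 / 16"
    by (simp_all add: a_def b_def)
  have cont: "continuous_on S ?f" for S by (intro continuous_intros continuous_on_cell_cutoff)
  have sub: "cbox a b \<subseteq> cell l" using l by (auto simp: mem_cuboid mem_box_cart forall_3 nth)
  have "cbox a b \<noteq> {}" using l by (simp add: interval_ne_empty_cart forall_3 nth)
  from content_cbox_cart[OF this] have vol: "measure lborel (cbox a b) = l^2 / 8"
    unfolding prod_3 by (simp add: nth power2_eq_square)
  have nonneg: "0 \<le> ?f y" for y
  proof (cases "y $ 3 \<ge> 0")
    case True
    then show ?thesis
      by (auto simp: cell_cutoff_def lateral_profile_def vertical_profile_def profile_nonneg simp del: profile.simps)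
  qed (simp add: cell_cutoff_def vertical_profile_def profile_zero del: profile.simps)
  have lower: "exp (- 4 / 3)^3 * (1 / 16)^n \<le> ?f y" if y: "y \<in> cbox a b" for y
  proof -
    have "\<bar>y $ 1\<bar> \<le> l / 2 \<and> \<bar>y $ 2\<bar> \<le> l / 2 \<and> 1 / 16 \<le> y $ 3 \<and> y $ 3 \<le> 3 / 16"
      using y by (auto simp: mem_box_cart forall_3 nth)
    then have y': "\<bar>y $ 1\<bar> \<le> l / 2" "\<bar>y $ 2\<bar> \<le> l / 2" "1 / 16 \<le> y $ 3" "\<bar>8 * y $ 3 - 1\<bar> \<le> 1 / 2"
      unfolding abs_le_iff by linarith+
    then have "\<bar>y $ 1 / l\<bar> \<le> 1 / 2" "\<bar>y $ 2 / l\<bar> \<le> 1 / 2" using l by (auto simp: field_simps)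
    then have "exp (- 4 / 3) \<le> lateral_profile l 0 (y $ 1)" "exp (- 4 / 3) \<le> lateral_profile l 0 (y $ 2)"
      "exp (- 4 / 3) \<le> vertical_profile 0 (y $ 3)"
      using profile_lower y'(4) by (simp_all add: lateral_profile_def vertical_profile_def del: profile.simps)
    then have "exp (- 4 / 3) * exp (- 4 / 3) * exp (- 4 / 3) \<le> cell_cutoff l 0 0 0 y"
      unfolding cell_cutoff_def by (intro mult_mono mult_nonneg_nonneg) (auto intro: order_trans[OF exp_ge_zero])
    moreover have "(1 / 16)^n \<le> (y $ 3)^n" using y'(3) by (intro power_mono) auto
    ultimately have "(1 / 16)^n * (exp (- 4 / 3) * exp (- 4 / 3) * exp (- 4 / 3)) \<le> ?f y"
      by (intro mult_mono) (auto intro: order_trans[of 0 "(1 / 16)^n"])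
    then show ?thesis by (simp add: power3_eq_cube mult.commute)
  qed
  have "exp (- 4 / 3)^3 * (1 / 16)^n / 8 * l^2 = integral (cbox a b) (\<lambda>y. exp (- 4 / 3)^3 * (1 / 16)^n)"
    by (simp add: vol)
  also have "\<dots> \<le> integral (cbox a b) ?f"
    by (intro integral_le integrable_continuous cont continuous_on_const lower)
  also have "\<dots> \<le> integral (cell l) ?f"
    using nonneg by (intro integral_subset_le sub integrable_continuous integrable_on_cuboid cont) auto
  finally show ?thesis .
qed

lemma stress_moment:
  assumes l: "l > 0"
  shows "integral (cell l) (\<lambda>y. (y $ 3)^Suc (Suc n) * (stress l p q r y \<bullet> mat 1))
    = (p + r) * (real (n + 2) * real (n + 1)) * integral (cell l) (\<lambda>y. (y $ 3)^n * cell_cutoff l 0 0 0 y)"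
proof -
  let ?f = "\<lambda>y::real^3. (y $ 3)^Suc (Suc n)" and ?f' = "\<lambda>y::real^3. real (n + 2) * (y $ 3)^Suc n"
  let ?f'' = "\<lambda>y::real^3. real (n + 2) * (real (n + 1) * (y $ 3)^n)"
  have power: "((\<lambda>s. s^Suc k) has_real_derivative real (k + 1) * s^k) (at s)" for s :: real and k
    using DERIV_pow[of "Suc k" s] by simp
  have f: "has_grad ?f (\<lambda>y. ?f' y *\<^sub>R axis 3 1)"
    using has_grad_real_compose[OF has_grad_coord[of 3] power[of "Suc n"]] by (simp add: continuous_intros)
  have f': "has_grad ?f' (\<lambda>y. ?f'' y *\<^sub>R axis 3 1)"
    using has_grad_cmult[OF has_grad_real_compose[OF has_grad_coord[of 3] power[of n]], of "real (n + 2)"]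
    by (simp add: continuous_intros mult.assoc)
  note parts = integral_cell_cutoff_by_parts[OF f _ _ _ l] and parts' = integral_cell_cutoff_by_parts[OF f' _ _ _ l]
  let ?I = "\<lambda>f i j k. integral (cell l) (\<lambda>y. f y * cell_cutoff l i j k y)"
  have lateral: "?I ?f 2 0 0 = 0" "?I ?f 1 1 0 = 0" "?I ?f 0 2 0 = 0"
    using parts(1)[of 1 0 0] parts(1)[of 0 1 0] parts(2)[of 0 1 0] by (simp_all add: axis_def numeral_2_eq_2)
  have "?I ?f 0 0 2 = - ?I ?f' 0 0 1" using parts(3)[of 0 0 1] by (simp add: axis_def numeral_2_eq_2)
  also have "\<dots> = ?I ?f'' 0 0 0" using parts'(3)[of 0 0 0] by (simp add: axis_def)
  also have "\<dots> = integral (cell l) (\<lambda>y. (real (n + 2) * real (n + 1)) * ((y $ 3)^n * cell_cutoff l 0 0 0 y))"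
    by (simp add: mult.assoc)
  also have "\<dots> = real (n + 2) * real (n + 1) * integral (cell l) (\<lambda>y. (y $ 3)^n * cell_cutoff l 0 0 0 y)"
    by (rule integral_mult_right)
  finally have vertical: "?I ?f 0 0 2 = real (n + 2) * real (n + 1) * integral (cell l) (\<lambda>y. (y $ 3)^n * cell_cutoff l 0 0 0 y)" .
  have integral: "((\<lambda>y. ?f y * cell_cutoff l i j k y) has_integral ?I ?f i j k) (cell l)" for i j k
    by (intro integrable_integral integrable_on_cuboid continuous_intros continuous_on_cell_cutoff)
  have expand: "?f y * (stress l p q r y \<bullet> mat 1) = (p + r) * (?f y * cell_cutoff l 0 0 2 y) + p * (?f y * cell_cutoff l 2 0 0 y)
    + 2 * q * (?f y * cell_cutoff l 1 1 0 y) + r * (?f y * cell_cutoff l 0 2 0 y)" for y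
    by (simp add: stress_inner normal_stress_def mat_def algebra_simps)
  have "((\<lambda>y. ?f y * (stress l p q r y \<bullet> mat 1))
    has_integral (p + r) * ?I ?f 0 0 2 + p * ?I ?f 2 0 0 + 2 * q * ?I ?f 1 1 0 + r * ?I ?f 0 2 0) (cell l)"
    unfolding expand by (intro has_integral_add has_integral_mult_right integral)
  from integral_unique[OF this] show ?thesis unfolding lateral vertical by (simp only: mult_zero_right add_0_right mult.assoc)
qed

definition moment_const :: "nat \<Rightarrow> real" where
  "moment_const n = real n * real (n - 1) * (exp (- 4 / 3)^3 * (1 / 16)^(n - 2) / 8)"

lemma moment_const_pos: "n \<ge> 2 \<Longrightarrow> moment_const n > 0"
  by (simp add: moment_const_def)

lemma abs_stress_inner_le:
  fixes E :: "real^3^3" and p q r :: real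
  assumes l: "l \<ge> 1"
  defines "\<Theta> \<equiv> \<bar>p\<bar> + 2 * \<bar>q\<bar> + \<bar>r\<bar>"
  shows "\<bar>stress l p q r y \<bullet> E - cell_cutoff l 0 0 2 y * (p * E $ 1 $ 1 + q * (E $ 1 $ 2 + E $ 2 $ 1) + r * E $ 2 $ 2)\<bar>
    \<le> 5 * (\<Theta> * (cutoff_bound / l)) * norm (sym_part E)"
proof -
  define d where "d = cutoff_bound / l"
  have d: "d \<ge> 0" using cutoff_bound_pos l by (simp add: d_def)
  have cutoff: "\<bar>u * cell_cutoff l i j k y\<bar> \<le> \<bar>u\<bar> * d" if "i \<le> 2" "j \<le> 2" "k \<le> 2" "1 \<le> i + j" for u i j k
    using abs_cell_cutoff_le_divide[OF that l, of y] unfolding abs_mult d_def by (rule mult_left_mono) simp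
  define a b c where "a = \<bar>p\<bar> * d" and "b = \<bar>q\<bar> * d" and "c = \<bar>r\<bar> * d"
  then have \<Theta>: "\<Theta> * d = a + 2 * b + c" "0 \<le> a" "0 \<le> b" "0 \<le> c"
    using d by (simp_all add: \<Theta>_def algebra_simps)
  have shear: "\<bar>shear_stress l u w y\<bar> \<le> \<bar>u\<bar> * d + \<bar>w\<bar> * d" for u w
    unfolding shear_stress_def
    by (rule order_trans[OF abs_triangle_ineq]) (intro add_mono cutoff; simp)
  have shear_le: "\<bar>shear_stress l p q y\<bar> \<le> \<Theta> * d" "\<bar>shear_stress l q r y\<bar> \<le> \<Theta> * d"
    using shear[of p q] shear[of q r] \<Theta> unfolding a_def[symmetric] b_def[symmetric] c_def[symmetric] by simp_all
  have "\<bar>normal_stress l p q r y\<bar> \<le> \<bar>p\<bar> * d + \<bar>2 * q\<bar> * d + \<bar>r\<bar> * d"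
    unfolding normal_stress_def
    by (rule order_trans[OF abs_triangle_ineq] add_mono cutoff | simp)+
  then have normal_le: "\<bar>normal_stress l p q r y\<bar> \<le> \<Theta> * d"
    using \<Theta>(1) by (simp add: a_def b_def c_def abs_mult)
  have entry: "\<bar>E $ i $ j + E $ j $ i\<bar> \<le> 2 * norm (sym_part E)" for i j
    using abs_entry_le_norm[of "sym_part E" i j] by (simp add: sym_part_nth)
  have product: "\<bar>u * x\<bar> \<le> \<Theta> * d * b" if "\<bar>u\<bar> \<le> \<Theta> * d" "\<bar>x\<bar> \<le> b" for u x b
    unfolding abs_mult using that \<Theta> by (intro mult_mono) simp_all
  have "\<bar>E $ 3 $ 3\<bar> \<le> norm (sym_part E)" using entry[of 3 3] by simp
  from product[OF normal_le this] product[OF shear_le(1) entry] product[OF shear_le(2) entry]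
  have "\<bar>normal_stress l p q r y * E $ 3 $ 3\<bar> \<le> \<Theta> * d * norm (sym_part E)"
    "\<bar>shear_stress l p q y * (E $ 1 $ 3 + E $ 3 $ 1)\<bar> \<le> \<Theta> * d * (2 * norm (sym_part E))"
    "\<bar>shear_stress l q r y * (E $ 2 $ 3 + E $ 3 $ 2)\<bar> \<le> \<Theta> * d * (2 * norm (sym_part E))" .
  then show ?thesis unfolding stress_inner d_def[symmetric] by (simp add: abs_le_iff)
qed

locale test_stress = admissible +
  fixes l :: real and \<sigma> :: "real^3 \<Rightarrow> real^3^3"
  assumes l_ge_1: "l \<ge> 1" and continuous_\<sigma>: "continuous_on S \<sigma>"
    and dual: "(\<sigma> y \<bullet> E)^2 \<le> 3 * cutoff_bound^2 * Q2 W (mat 1) * B E E"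
    and orthogonal: "has_jac v V \<Longrightarrow> integral (cell l) (\<lambda>y. \<sigma> y \<bullet> V y) = 0"
    and moment: "n \<ge> 2 \<Longrightarrow> moment_const n * Q2 W (mat 1) * l^2 \<le> integral (cell l) (\<lambda>y. (y $ 3)^n * (\<sigma> y \<bullet> mat 1))"

context admissible
begin

lemma stress_dual:
  assumes coercive: "\<And>E. c * (norm (sym_part E))^2 \<le> B E E" and l: "l \<ge> 1"
    and functional: "\<And>E. (p * E $ 1 $ 1 + q * (E $ 1 $ 2 + E $ 2 $ 1) + r * E $ 2 $ 2)^2 \<le> Q * B E E" and Q: "Q \<ge> 0"
    and wide: "50 * (\<bar>p\<bar> + 2 * \<bar>q\<bar> + \<bar>r\<bar>)^2 \<le> l^2 * (c * Q)"
  shows "(stress l p q r y \<bullet> E)^2 \<le> 3 * cutoff_bound^2 * Q * B E E"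
proof -
  define \<Theta> where "\<Theta> = \<bar>p\<bar> + 2 * \<bar>q\<bar> + \<bar>r\<bar>"
  define main where "main = cell_cutoff l 0 0 2 y * (p * E $ 1 $ 1 + q * (E $ 1 $ 2 + E $ 2 $ 1) + r * E $ 2 $ 2)"
  have "\<bar>cell_cutoff l 0 0 2 y\<bar> \<le> cutoff_bound" using abs_cell_cutoff_le[of 0 0 2 l y] l by simp
  then have "main^2 \<le> cutoff_bound^2 * (Q * B E E)"
    unfolding main_def power_mult_distrib using functional[of E]
    by (intro mult_mono) (auto intro: abs_le_square_iff[THEN iffD1] order_trans[OF _ abs_ge_self])
  moreover have "2 * (stress l p q r y \<bullet> E - main)^2 \<le> cutoff_bound^2 * (Q * B E E)"
  proof -
    have "(stress l p q r y \<bullet> E - main)^2 \<le> (5 * (\<Theta> * (cutoff_bound / l)) * norm (sym_part E))^2"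
      using abs_stress_inner_le[OF l, of p q r y E] unfolding main_def \<Theta>_def
      by (intro abs_le_square_iff[THEN iffD1] order_trans[OF _ abs_ge_self])
    then have "2 * (stress l p q r y \<bullet> E - main)^2 \<le> 2 * (5 * (\<Theta> * (cutoff_bound / l)) * norm (sym_part E))^2" by simp
    also have "\<dots> = cutoff_bound^2 * (50 * \<Theta>^2) * ((norm (sym_part E))^2 / l^2)"
      by (simp add: power_mult_distrib power_divide)
    also have "\<dots> \<le> cutoff_bound^2 * (l^2 * (c * Q)) * ((norm (sym_part E))^2 / l^2)"
      using wide unfolding \<Theta>_def by (intro mult_right_mono mult_left_mono) auto
    also have "\<dots> = cutoff_bound^2 * (Q * (c * (norm (sym_part E))^2))" using l by simp
    also have "\<dots> \<le> cutoff_bound^2 * (Q * B E E)" using coercive Q by (intro mult_left_mono) auto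
    finally show ?thesis .
  qed
  moreover have "(stress l p q r y \<bullet> E)^2 \<le> 2 * main^2 + 2 * (stress l p q r y \<bullet> E - main)^2"
    using sum_sq_le[of main "stress l p q r y \<bullet> E - main"] by simp
  ultimately have "(stress l p q r y \<bullet> E)^2 \<le> 3 * (cutoff_bound^2 * (Q * B E E))" by linarith
  then show ?thesis by (simp add: mult.assoc)
qed

text \<open>The functional \<open>p E\<^sub>1\<^sub>1 + q (E\<^sub>1\<^sub>2 + E\<^sub>2\<^sub>1) + r E\<^sub>2\<^sub>2\<close> is dual to \<open>Q2\<close>. On a wide cell the other
  components of the stress are negligible.\<close>

theorem test_stress_exists: "\<exists>l \<sigma>. test_stress W l \<sigma>"
proof -
  define Q where "Q = Q2 W (mat 1)"
  have Q: "Q > 0" using Q2_pos by (simp add: Q_def)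
  obtain c where c: "c > 0" "\<And>E. c * (norm (sym_part E))^2 \<le> B E E" using B_coercive by blast
  obtain p q r where trace: "p + r = Q"
    and functional: "\<And>E. (p * E $ 1 $ 1 + q * (E $ 1 $ 2 + E $ 2 $ 1) + r * E $ 2 $ 2)^2 \<le> Q * B E E"
    using dual_functional unfolding Q_def by blast
  define \<Theta> where "\<Theta> = \<bar>p\<bar> + 2 * \<bar>q\<bar> + \<bar>r\<bar>"
  define l where "l = 1 + 50 * \<Theta>^2 / (c * Q)"
  have l: "l \<ge> 1" using c(1) Q by (simp add: l_def)
  have "50 * \<Theta>^2 / (c * Q) \<le> l" by (simp add: l_def)
  also have "\<dots> \<le> l^2" using l by (simp add: power2_eq_square)
  finally have wide: "50 * \<Theta>^2 \<le> l^2 * (c * Q)" using c(1) Q by (simp add: pos_divide_le_eq)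
  have "test_stress W l (stress l p q r)"
  proof
    show "(stress l p q r y \<bullet> E)^2 \<le> 3 * cutoff_bound^2 * Q2 W (mat 1) * B E E" for y E
      using stress_dual[OF c(2) l functional less_imp_le[OF Q] wide[unfolded \<Theta>_def]] by (simp add: Q_def)
    show "moment_const n * Q2 W (mat 1) * l^2 \<le> integral (cell l) (\<lambda>y. (y $ 3)^n * (stress l p q r y \<bullet> mat 1))"
      if "n \<ge> 2" for n
    proof -
      define m where "m = n - 2"
      then have m: "n = Suc (Suc m)" using that by simp
      have l_pos: "l > 0" using l by simp
      have "moment_const n * Q * l^2 = Q * (real (m + 2) * real (m + 1)) * (exp (- 4 / 3)^3 * (1 / 16)^m / 8 * l^2)"
        by (simp add: moment_const_def m)
      also have "\<dots> \<le> Q * (real (m + 2) * real (m + 1)) * integral (cell l) (\<lambda>y. (y $ 3)^m * cell_cutoff l 0 0 0 y)"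
        using Q by (intro mult_left_mono cell_cutoff_moment_lower l_pos) auto
      finally show ?thesis unfolding m stress_moment[OF l_pos] trace Q_def .
    qed
  qed (use l in \<open>auto intro: continuous_on_stress stress_orthogonal\<close>)
  then show ?thesis by blast
qed

end

section \<open>The energy of a cell\<close>

lemma ennreal_le_plus_if_diff_le:
  fixes w :: ennreal
  assumes "ennreal x \<le> w + ennreal y" "0 \<le> y" "0 \<le> z" "g - z \<le> x - y"
  shows "ennreal g \<le> w + ennreal z"
proof (cases w)
  case (real r)
  then have "x \<le> r + y" using assms(1,2) by (simp flip: ennreal_plus)
  then have "g \<le> r + z" using assms(4) by linarith
  then show ?thesis using real assms(3) by (simp add: ennreal_leI flip: ennreal_plus)
qed simp

lemma twice_le_add_if_sq_le_mult:
  fixes x p q :: real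
  assumes "x^2 \<le> p * q" "0 \<le> p" "0 \<le> q"
  shows "2 * x \<le> p + q"
proof -
  have "(2 * x)^2 \<le> 4 * (p * q)" using assms(1) by (simp add: power_mult_distrib)
  also have "\<dots> \<le> (p + q)^2" using zero_le_power2[of "p - q"] by (simp add: power2_eq_square algebra_simps)
  finally show ?thesis using assms(2,3) by (intro power2_le_imp_le[of "2 * x"]) auto
qed

lemma sum3_sq_le: "(a + b + c)^2 \<le> 3 * a^2 + 3 * b^2 + 3 * (c::real)^2"
proof -
  have "0 \<le> (a - b)^2 + (a - c)^2 + (b - c)^2" by simp
  then show ?thesis by (simp add: power2_eq_square algebra_simps)
qed

lemma mult_le_sq_add_sq: "0 \<le> x * y \<Longrightarrow> x * y \<le> x^2 + (y::real)^2"
  using zero_le_power2[of "x - y"] by (simp add: power2_diff)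

lemma twice_mult_le_cube_add:
  fixes x y :: real
  assumes "x > 0"
  shows "2 * x * y \<le> x^3 + y^2 / x"
proof -
  have "0 \<le> (x^2 - y)^2 / x" using assms by simp
  also have "\<dots> = x^3 + y^2 / x - 2 * x * y"
    using assms by (simp add: power2_diff diff_divide_distrib add_divide_distrib) (simp add: eval_nat_numeral)
  finally show ?thesis by simp
qed

lemma ex_small_factor:
  fixes c d :: real
  assumes "c \<ge> 0" "d > 0"
  obtains x where "x > 0" "\<And>y. 0 \<le> y \<Longrightarrow> y \<le> x \<Longrightarrow> y * c \<le> d"
proof
  show "d / (c + 1) > 0" using assms by simp
  show "y * c \<le> d" if "0 \<le> y" "y \<le> d / (c + 1)" for y
  proof -
    have "y * c \<le> y * (c + 1)" using that by (simp add: algebra_simps)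
    also have "\<dots> \<le> d" using that assms by (simp add: pos_le_divide_eq)
    finally show ?thesis .
  qed
qed

lemma ennreal_integral_cuboid_le:
  fixes g :: "real^'n \<Rightarrow> real"
  assumes g: "continuous_on UNIV g"
  shows "ennreal (integral (cuboid l t) g) \<le> (\<integral>\<^sup>+x\<in>cuboid l t. ennreal (g x) \<partial>lborel)"
proof -
  have pos_part: "continuous_on UNIV (\<lambda>x. max 0 (g x))" by (intro continuous_intros g)
  have "integral (cuboid l t) g \<le> integral (cuboid l t) (\<lambda>x. max 0 (g x))"
    by (intro integral_le integrable_on_cuboid g pos_part) auto
  then have "ennreal (integral (cuboid l t) g) \<le> ennreal (integral (cuboid l t) (\<lambda>x. max 0 (g x)))" by (rule ennreal_leI)
  also have "\<dots> = (\<integral>\<^sup>+x\<in>cuboid l t. ennreal (max 0 (g x)) \<partial>lborel)"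
    by (rule nn_integral_compact_continuous[OF compact_cuboid continuous_on_UNIV_subset[OF pos_part], symmetric]) simp
  also have "(\<lambda>x. ennreal (max 0 (g x))) = (\<lambda>x. ennreal (g x))" by (auto simp: fun_eq_iff max_def ennreal_neg)
  finally show ?thesis by (simp add: fun_eq_iff)
qed

lemma infdist_SO3_sq_le_scaled:
  assumes f: "\<bar>f - 1\<bar> \<le> \<kappa>" "\<kappa> \<le> 1 / 2"
  shows "(infdist V SO3)^2 \<le> 12 * (infdist (f *\<^sub>R D) SO3)^2 + 48 * (norm (V - D))^2 + 48 * \<kappa>^2"
proof -
  define x where "x = infdist V SO3"
  define d where "d = infdist (f *\<^sub>R D) SO3"
  have nonneg: "0 \<le> x" "0 \<le> d" "0 \<le> \<kappa>" using f(1) by (auto simp: x_def d_def infdist_nonneg)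
  have "V - f *\<^sub>R D = f *\<^sub>R (V - D) + (1 - f) *\<^sub>R V" by (simp add: algebra_simps)
  then have "norm (V - f *\<^sub>R D) \<le> \<bar>f\<bar> * norm (V - D) + \<bar>1 - f\<bar> * norm V"
    using norm_triangle_ineq[of "f *\<^sub>R (V - D)" "(1 - f) *\<^sub>R V"] by simp
  also have "\<dots> \<le> 2 * norm (V - D) + \<kappa> * (x + 2)"
    using f nonneg norm_le_infdist_SO3[of V] by (intro add_mono mult_mono) (auto simp: x_def)
  also have "\<kappa> * (x + 2) \<le> x / 2 + 2 * \<kappa>" using mult_right_mono[OF f(2) nonneg(1)] by (simp add: algebra_simps)
  finally have "x \<le> 2 * d + 4 * norm (V - D) + 4 * \<kappa>"
    using infdist_SO3_diff[of V "f *\<^sub>R D"] by (simp add: x_def d_def)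
  then have "x^2 \<le> (2 * d + 4 * norm (V - D) + 4 * \<kappa>)^2" using nonneg by (intro power_mono) auto
  also have "\<dots> \<le> 3 * (2 * d)^2 + 3 * (4 * norm (V - D))^2 + 3 * (4 * \<kappa>)^2" by (rule sum3_sq_le)
  finally show ?thesis by (simp add: x_def d_def power_mult_distrib)
qed

definition strain :: "real^3^3 \<Rightarrow> real^3^3 \<Rightarrow> real^3^3" where
  "strain R F = transpose R ** F - mat 1"

lemma norm_strain:
  assumes "R \<in> SO3"
  shows "norm (strain R F) = norm (F - R)"
proof -
  have "strain R F = transpose R ** (F - R)"
    using SO3_D(1)[OF assms] by (simp add: strain_def matrix_diff_mult)
  then show ?thesis by (simp add: norm_SO3_mult[OF SO3_transpose[OF assms]])
qed

lemma mat_1_nth: "mat 1 $ i = axis i 1"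
  by (simp add: mat_def axis_def vec_eq_iff)

lemma has_jac_strain:
  assumes "has_jac v V"
  shows "has_jac (\<lambda>x. transpose R *v v x - x) (\<lambda>x. strain R (V x))"
proof -
  have "has_grad (\<lambda>x. (transpose R *v v x) $ i - x $ i) (\<lambda>x. (transpose R ** V x) $ i - axis i 1)" for i
    by (intro has_grad_diff has_grad_coord has_jac_nth[OF has_jac_left_mult[OF assms]])
  then show ?thesis by (simp add: has_jac_def strain_def mat_1_nth)
qed

lemma strain_scaleR:
  "strain R (f *\<^sub>R D) = f *\<^sub>R strain R V + (f - 1) *\<^sub>R mat 1 + f *\<^sub>R (transpose R ** (D - V))"
proof -
  have "transpose R ** (f *\<^sub>R D) = f *\<^sub>R (transpose R ** D)"
    by (rule linear_cmul[OF bounded_linear.linear[OF bounded_linear_matrix_mult]])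
  then show ?thesis by (simp add: strain_def matrix_diff_mult algebra_simps)
qed

context
  fixes R :: "real^3^3" and f \<kappa> :: real
  assumes R: "R \<in> SO3" and f: "\<bar>f - 1\<bar> \<le> \<kappa>" "\<kappa> \<le> 1"
begin

lemma norm_transpose_mult_diff: "norm (transpose R ** (D - V)) = norm (V - D)" for D :: "real^3^3"
  by (simp add: norm_SO3_mult[OF SO3_transpose[OF R]] norm_minus_commute[of V D])

lemma norm_strain_scaleR_sq_le:
  "(norm (strain R (f *\<^sub>R D)))^2 \<le> 12 * (norm (V - R))^2 + 12 * \<kappa>^2 + 12 * (norm (V - D))^2"
proof -
  have "norm (strain R (f *\<^sub>R D)) \<le> norm (f *\<^sub>R strain R V) + norm ((f - 1) *\<^sub>R (mat 1 :: real^3^3))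
      + norm (f *\<^sub>R (transpose R ** (D - V)))"
    unfolding strain_scaleR[of R f D V] by (meson norm_triangle_ineq order_trans add_right_mono)
  also have "\<dots> = \<bar>f\<bar> * norm (V - R) + \<bar>f - 1\<bar> * norm (mat 1 :: real^3^3) + \<bar>f\<bar> * norm (V - D)"
    by (simp add: norm_strain[OF R] norm_transpose_mult_diff)
  also have "\<dots> \<le> 2 * norm (V - R) + \<kappa> * 2 + 2 * norm (V - D)"
    using f by (intro add_mono mult_mono norm_SO3(2) mat1_SO3) auto
  finally have "(norm (strain R (f *\<^sub>R D)))^2 \<le> (2 * norm (V - R) + \<kappa> * 2 + 2 * norm (V - D))^2"
    by (intro power_mono) auto
  also have "\<dots> \<le> 3 * (2 * norm (V - R))^2 + 3 * (\<kappa> * 2)^2 + 3 * (2 * norm (V - D))^2" by (rule sum3_sq_le)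
  finally show ?thesis by (simp add: power_mult_distrib)
qed

lemma abs_inner_strain_scaleR_le:
  assumes "norm s \<le> M"
  shows "\<bar>s \<bullet> strain R (f *\<^sub>R D) - s \<bullet> strain R V - (f - 1) * (s \<bullet> mat 1)\<bar> \<le> \<kappa> * (M * norm (V - R)) + 2 * (M * norm (V - D))"
proof -
  have inner: "\<bar>s \<bullet> X\<bar> \<le> M * norm X" for X
    using Cauchy_Schwarz_ineq2[of s X] mult_right_mono[OF assms norm_ge_zero[of X]] by linarith
  have "s \<bullet> strain R (f *\<^sub>R D) - s \<bullet> strain R V - (f - 1) * (s \<bullet> mat 1)
    = (f - 1) * (s \<bullet> strain R V) + f * (s \<bullet> (transpose R ** (D - V)))"
    unfolding strain_scaleR[of R f D V] by (simp add: inner_add_right algebra_simps)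
  moreover have "\<bar>(f - 1) * (s \<bullet> strain R V)\<bar> \<le> \<kappa> * (M * norm (V - R))"
    unfolding abs_mult using f inner[of "strain R V"] by (intro mult_mono) (auto simp: norm_strain[OF R])
  moreover have "\<bar>f * (s \<bullet> (transpose R ** (D - V)))\<bar> \<le> 2 * (M * norm (V - D))"
    unfolding abs_mult using f inner[of "transpose R ** (D - V)"]
    by (intro mult_mono) (auto simp: norm_transpose_mult_diff)
  ultimately show ?thesis using abs_triangle_ineq by (smt (verit))
qed

end

context admissible
begin

lemma W_strain: "R \<in> SO3 \<Longrightarrow> W (mat 1 + strain R F) = W F"
  using W_SO3_mult[OF SO3_transpose] by (simp add: strain_def)

text \<open>Fenchel's inequality for \<open>B\<close>, where the Taylor expansion fails for large \<open>E\<close> but the linear term is then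
  dominated by a quadratic one.\<close>

lemma W_ge_linear:
  assumes Taylor: "\<And>F. norm F < \<delta> \<Longrightarrow> mat 1 + F \<in> finite_nhd \<and> \<bar>Wr (mat 1 + F) - B F F / 2\<bar> \<le> \<eta> * (norm F)^2"
    and pos: "\<delta> > 0" "\<eta> \<ge> 0" "S \<ge> 0" and s: "norm s \<le> M" "\<And>E. (s \<bullet> E)^2 \<le> S * B E E"
  shows "ennreal (c * (s \<bullet> E) - c^2 * S / 2) \<le> W (mat 1 + E) + ennreal ((\<eta> + \<bar>c\<bar> * M / \<delta>) * (norm E)^2)"
proof -
  have M: "M \<ge> 0" using s(1) norm_ge_zero[of s] by linarith
  define y where "y = \<bar>c\<bar> * M / \<delta> * (norm E)^2"
  have y: "y \<ge> 0" using M pos by (simp add: y_def)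
  have split: "(\<eta> + \<bar>c\<bar> * M / \<delta>) * (norm E)^2 = \<eta> * (norm E)^2 + y" by (simp add: y_def algebra_simps)
  have nonneg: "0 \<le> \<eta> * (norm E)^2" using pos by simp
  show ?thesis
  proof (cases "norm E < \<delta>")
    case True
    have "(c * (s \<bullet> E))^2 \<le> (c^2 * S) * B E E"
      unfolding power_mult_distrib using s(2)[of E] by (simp add: mult.assoc mult_left_mono)
    then have "2 * (c * (s \<bullet> E)) \<le> c^2 * S + B E E"
      by (rule twice_le_add_if_sq_le_mult) (use pos B_nonneg in auto)
    then have "c * (s \<bullet> E) - c^2 * S / 2 \<le> Wr (mat 1 + E) + (\<eta> * (norm E)^2 + y)"
      using Taylor[OF True] y unfolding abs_le_iff by linarith
    then show ?thesis unfolding split using Taylor[OF True] Wr_nonneg[of "mat 1 + E"] nonneg y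
      by (simp add: W_eq_Wr ennreal_leI flip: ennreal_plus)
  next
    case False
    then have "1 \<le> norm E / \<delta>" using pos by simp
    then have "\<bar>c\<bar> * M * norm E * 1 \<le> \<bar>c\<bar> * M * norm E * (norm E / \<delta>)" using M by (intro mult_left_mono) auto
    moreover have "\<bar>c\<bar> * M * norm E * (norm E / \<delta>) = y" by (simp add: y_def power2_eq_square)
    moreover have "\<bar>c * (s \<bullet> E)\<bar> \<le> \<bar>c\<bar> * (norm s * norm E)"
      unfolding abs_mult by (intro mult_left_mono Cauchy_Schwarz_ineq2) auto
    moreover have "\<bar>c\<bar> * (norm s * norm E) \<le> \<bar>c\<bar> * (M * norm E)" using s(1) by (intro mult_left_mono mult_right_mono) auto
    moreover have "0 \<le> c^2 * S / 2" using pos by simp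
    ultimately have "c * (s \<bullet> E) - c^2 * S / 2 \<le> \<eta> * (norm E)^2 + y" using nonneg by (simp add: mult.assoc)
    then have "ennreal (c * (s \<bullet> E) - c^2 * S / 2) \<le> ennreal (\<eta> * (norm E)^2 + y)" by (rule ennreal_leI)
    also have "\<dots> \<le> W (mat 1 + E) + ennreal (\<eta> * (norm E)^2 + y)" by simp
    finally show ?thesis unfolding split .
  qed
qed

lemma nn_integral_defect_le:
  assumes c: "c > 0" "\<And>F. W F \<ge> ennreal (c * (infdist F SO3)^2)"
    and f: "\<And>y. y \<in> S \<Longrightarrow> \<bar>f y - 1\<bar> \<le> \<kappa>" "\<kappa> \<le> 1 / 2"
    and [measurable]: "f \<in> borel_measurable borel" "D \<in> borel_measurable borel" "V \<in> borel_measurable borel" "S \<in> sets borel"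
  shows "nn_L2sq S (rot_defect V) \<le> ennreal (12 / c) * (\<integral>\<^sup>+y\<in>S. W (f y *\<^sub>R D y) \<partial>lborel)
    + 48 * nn_L2sq S (\<lambda>y. V y - D y) + ennreal (48 * \<kappa>^2) * emeasure lborel S"
proof -
  have "ennreal ((norm (infdist (V y) SO3))^2) \<le> ennreal (12 / c) * W (f y *\<^sub>R D y)
    + 48 * ennreal ((norm (V y - D y))^2) + ennreal (48 * \<kappa>^2)" if "y \<in> S" for y
  proof -
    define d where "d = infdist (f y *\<^sub>R D y) SO3"
    have "ennreal ((norm (infdist (V y) SO3))^2) \<le> ennreal (12 / c * (c * d^2) + 48 * (norm (V y - D y))^2 + 48 * \<kappa>^2)"
      using infdist_SO3_sq_le_scaled[OF f(1)[OF that] f(2), of "V y" "D y"] c(1) by (intro ennreal_leI) (simp add: d_def)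
    also have "\<dots> = ennreal (12 / c) * ennreal (c * d^2) + 48 * ennreal ((norm (V y - D y))^2) + ennreal (48 * \<kappa>^2)"
      using c(1) by (simp flip: ennreal_numeral ennreal_mult' ennreal_plus)
    also have "\<dots> \<le> ennreal (12 / c) * W (f y *\<^sub>R D y) + 48 * ennreal ((norm (V y - D y))^2) + ennreal (48 * \<kappa>^2)"
      unfolding d_def by (intro add_mono mult_left_mono c(2)) auto
    finally show ?thesis .
  qed
  then have "nn_L2sq S (rot_defect V) \<le> (\<integral>\<^sup>+y. ennreal (12 / c) * (W (f y *\<^sub>R D y) * indicator S y)
    + 48 * (ennreal ((norm (V y - D y))^2) * indicator S y) + ennreal (48 * \<kappa>^2) * indicator S y \<partial>lborel)"
    by (intro nn_integral_mono) (auto split: split_indicator)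
  also have "\<dots> = ennreal (12 / c) * (\<integral>\<^sup>+y\<in>S. W (f y *\<^sub>R D y) \<partial>lborel)
    + 48 * nn_L2sq S (\<lambda>y. V y - D y) + ennreal (48 * \<kappa>^2) * emeasure lborel S"
    by (simp add: nn_integral_add nn_integral_cmult)
  finally show ?thesis .
qed

lemma L2sq_defect_le:
  assumes c: "c > 0" "\<And>F. W F \<ge> ennreal (c * (infdist F SO3)^2)" and "0 \<le> K" "0 \<le> e" "e \<le> 1"
    and f: "\<And>y. y \<in> cuboid L t \<Longrightarrow> \<bar>f y - 1\<bar> \<le> k * e" "k * e \<le> 1 / 2"
    and measurable: "f \<in> borel_measurable borel" "D \<in> borel_measurable borel" and V: "continuous_on UNIV V"
    and close: "nn_L2sq (cuboid L t) (\<lambda>y. V y - D y) \<le> ennreal (e^4)"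
    and energy: "(\<integral>\<^sup>+y\<in>cuboid L t. W (f y *\<^sub>R D y) \<partial>lborel) \<le> ennreal (K * e^2)"
  shows "L2sq L t (rot_defect V) \<le> (12 * K / c + 48 + 48 * k^2 * measure lborel (cuboid L t)) * e^2"
proof -
  have "continuous_on (cuboid L t) (\<lambda>y. (norm (infdist (V y) SO3))^2)"
    by (intro continuous_intros continuous_on_UNIV_subset[OF V])
  then have "ennreal (L2sq L t (rot_defect V)) = nn_L2sq (cuboid L t) (rot_defect V)"
    unfolding L2sq_def by (rule nn_integral_compact_continuous[OF compact_cuboid, symmetric]) simp
  also have "\<dots> \<le> ennreal (12 / c) * (\<integral>\<^sup>+y\<in>cuboid L t. W (f y *\<^sub>R D y) \<partial>lborel)
    + 48 * nn_L2sq (cuboid L t) (\<lambda>y. V y - D y) + ennreal (48 * (k * e)^2) * emeasure lborel (cuboid L t)"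
    by (rule nn_integral_defect_le[OF c f measurable borel_measurable_continuous_onI[OF V] cuboid_borel])
  also have "\<dots> \<le> ennreal (12 / c) * ennreal (K * e^2) + 48 * ennreal (e^4)
    + ennreal (48 * (k * e)^2) * ennreal (measure lborel (cuboid L t))"
    unfolding emeasure_cuboid by (intro add_mono mult_left_mono close energy order_refl) auto
  also have "\<dots> = ennreal (12 / c * (K * e^2) + 48 * e^4 + 48 * (k * e)^2 * measure lborel (cuboid L t))"
    using c(1) assms(3) by (simp flip: ennreal_numeral ennreal_mult' ennreal_plus)
  finally have "L2sq L t (rot_defect V) \<le> 12 / c * (K * e^2) + 48 * e^4 + 48 * (k * e)^2 * measure lborel (cuboid L t)"
    using c(1) assms(3) by (subst (asm) ennreal_le_iff) auto
  also have "\<dots> \<le> 12 / c * (K * e^2) + 48 * e^2 + 48 * (k * e)^2 * measure lborel (cuboid L t)"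
    using assms(4,5) by (intro add_mono mult_left_mono power_decreasing order_refl) auto
  also have "\<dots> = (12 * K / c + 48 + 48 * k^2 * measure lborel (cuboid L t)) * e^2"
    by (simp add: algebra_simps power_mult_distrib)
  finally show ?thesis .
qed

definition low_energy_rigid :: "real^3 \<Rightarrow> real \<Rightarrow> real \<Rightarrow> real \<Rightarrow> real \<Rightarrow> real \<Rightarrow> bool" where
  "low_energy_rigid L t K k C e0 \<longleftrightarrow> (\<forall>e f D v V. 0 < e \<longrightarrow> e \<le> e0 \<longrightarrow>
    f \<in> borel_measurable borel \<longrightarrow> D \<in> borel_measurable borel \<longrightarrow> has_jac v V \<longrightarrow>
    (\<forall>y\<in>cuboid L t. \<bar>f y - 1\<bar> \<le> k * e) \<longrightarrow> nn_L2sq (cuboid L t) (\<lambda>y. V y - D y) \<le> ennreal (e^4) \<longrightarrow>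
    (\<integral>\<^sup>+y\<in>cuboid L t. W (f y *\<^sub>R D y) \<partial>lborel) \<le> ennreal (K * e^2) \<longrightarrow> (\<exists>R\<in>SO3. L2sq L 0 (\<lambda>y. V y - R) \<le> C * e^2))"

lemma low_energy_rigidity:
  assumes L: "\<And>i. L $ i > 0" and t: "t > 0" and K: "K \<ge> 0" and k: "k \<ge> 0"
  shows "\<exists>C\<ge>0. \<exists>e0>0. low_energy_rigid L t K k C e0"
proof -
  obtain c where c: "c > 0" "\<And>F. W F \<ge> ennreal (c * (infdist F SO3)^2)" using W_ge_infdist by blast
  define H where "H = 12 * K / c + 48 + 48 * k^2 * measure lborel (cuboid L t)"
  have H: "H > 0" using K c(1) by (simp add: H_def add_nonneg_pos add_pos_nonneg)
  have "\<exists>C\<ge>0. \<exists>e_rigid>0. \<forall>v F e. has_jac v F \<longrightarrow> 0 < e \<longrightarrow> e \<le> e_rigid \<longrightarrow> L2sq L (16 * (t / 16)) (rot_defect F) \<le> e^2 \<longrightarrow>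
    (\<exists>R\<in>SO3. L2sq L 0 (\<lambda>x. F x - R) \<le> C * e^2)"
    by (rule interior_rigidity) (use L t in auto)
  then obtain C e_rigid where C: "C \<ge> 0" "e_rigid > 0" and rigid: "\<And>v F e. has_jac v F \<Longrightarrow> 0 < e \<Longrightarrow> e \<le> e_rigid \<Longrightarrow>
    L2sq L t (rot_defect F) \<le> e^2 \<Longrightarrow> \<exists>R\<in>SO3. L2sq L 0 (\<lambda>x. F x - R) \<le> C * e^2" by auto
  define e0 where "e0 = min 1 (min (e_rigid / sqrt H) (1 / (2 * k + 1)))"
  have e0: "e0 > 0" using C(2) H k by (simp add: e0_def add_nonneg_pos)
  have "\<exists>R\<in>SO3. L2sq L 0 (\<lambda>y. V y - R) \<le> C * H * e^2"
    if e: "0 < e" "e \<le> e0" and measurable: "f \<in> borel_measurable borel" "D \<in> borel_measurable borel" and V: "has_jac v V"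
      and f: "\<forall>y\<in>cuboid L t. \<bar>f y - 1\<bar> \<le> k * e" and close: "nn_L2sq (cuboid L t) (\<lambda>y. V y - D y) \<le> ennreal (e^4)"
      and energy: "(\<integral>\<^sup>+y\<in>cuboid L t. W (f y *\<^sub>R D y) \<partial>lborel) \<le> ennreal (K * e^2)" for e f D v V
  proof -
    have small: "e \<le> 1" "e \<le> e_rigid / sqrt H" "e \<le> 1 / (2 * k + 1)" using e(2) by (auto simp: e0_def)
    have "e * (2 * k + 1) \<le> 1" using small(3) k by (simp add: field_simps)
    then have "k * e \<le> 1 / 2" using e(1) by (simp add: algebra_simps)
    then have "L2sq L t (rot_defect V) \<le> H * e^2"
      unfolding H_def using f
      by (intro L2sq_defect_le[OF c K less_imp_le[OF e(1)] small(1) _ _ measurable has_jac_continuous(1)[OF V] close energy]) auto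
    also have "\<dots> = (sqrt H * e)^2" using H by (simp add: power_mult_distrib)
    finally have "\<exists>R\<in>SO3. L2sq L 0 (\<lambda>x. V x - R) \<le> C * (sqrt H * e)^2"
      using H e(1) small(2) by (intro rigid[OF V]) (simp_all add: field_simps)
    then show ?thesis using H by (simp add: power_mult_distrib mult.assoc)
  qed
  then have "low_energy_rigid L t K k (C * H) e0" unfolding low_energy_rigid_def by blast
  moreover have "C * H \<ge> 0" using C(1) H by simp
  ultimately show ?thesis using e0 by blast
qed

end

abbreviation large_cell :: "real \<Rightarrow> (real^3) set" where "large_cell l \<equiv> cuboid (half_widths l) (1 / 8)"

abbreviation (in admissible) cell_energy :: "real \<Rightarrow> (real \<Rightarrow> real) \<Rightarrow> (real^3 \<Rightarrow> real^3^3) \<Rightarrow> ennreal" where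
  "cell_energy l f D \<equiv> (\<integral>\<^sup>+y\<in>large_cell l. W (f (y $ 3) *\<^sub>R D y) \<partial>lborel)"

context test_stress
begin

definition gain :: "real \<Rightarrow> nat \<Rightarrow> real" where
  "gain a n = moment_const n^2 / (12 * cutoff_bound^2) * a^2 * Q2 W (mat 1) * l^2"

lemma gain_nonneg: "gain a n \<ge> 0"
  using Q2_pos by (simp add: gain_def)

lemma gain_pos: "n \<ge> 2 \<Longrightarrow> a \<noteq> 0 \<Longrightarrow> gain a n > 0"
  using Q2_pos moment_const_pos[of n] cutoff_bound_pos l_ge_1 by (simp add: gain_def)

lemma gain_le:
  assumes n: "n \<ge> 2" and \<mu>: "\<mu> = - a * moment_const n / (6 * cutoff_bound^2)"
  shows "gain a n \<le> - \<mu> * a * integral (cell l) (\<lambda>y. (y $ 3)^n * (\<sigma> y \<bullet> mat 1))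
    - \<mu>^2 * (3 * cutoff_bound^2 * Q2 W (mat 1)) * l^2"
proof -
  have "- \<mu> * a = a^2 * (moment_const n / (6 * cutoff_bound^2))" by (simp add: \<mu> power2_eq_square)
  then have "- \<mu> * a * (moment_const n * Q2 W (mat 1) * l^2) \<le> - \<mu> * a * integral (cell l) (\<lambda>y. (y $ 3)^n * (\<sigma> y \<bullet> mat 1))"
    using moment_const_pos[OF n] moment[OF n] by (intro mult_left_mono) auto
  moreover have "- \<mu> * a * (moment_const n * Q2 W (mat 1) * l^2) = 2 * gain a n"
    using cutoff_bound_pos by (simp add: \<mu> gain_def power2_eq_square)
  moreover have "\<mu>^2 * (3 * cutoff_bound^2 * Q2 W (mat 1)) * l^2 = gain a n"
    using cutoff_bound_pos by (simp add: \<mu> gain_def power2_eq_square)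
  ultimately show ?thesis by linarith
qed

end

locale near_rigid_cell = test_stress W l \<sigma> for W l \<sigma> +
  fixes M \<delta> \<eta> a \<mu> k \<rho> e :: real and n :: nat and f :: "real \<Rightarrow> real"
    and v :: "real^3 \<Rightarrow> real^3" and V D :: "real^3 \<Rightarrow> real^3^3" and R :: "real^3^3"
  assumes \<sigma>_le: "y \<in> cell l \<Longrightarrow> norm (\<sigma> y) \<le> M"
    and Taylor: "norm F < \<delta> \<Longrightarrow> mat 1 + F \<in> finite_nhd \<and> \<bar>Wr (mat 1 + F) - B F F / 2\<bar> \<le> \<eta> * (norm F)^2"
    and pos: "\<delta> > 0" "\<eta> \<ge> 0" "e > 0" "e \<le> 1" and k: "k \<ge> 0" "k * e \<le> 1"
    and factor: "\<bar>t\<bar> \<le> 1 / 2 \<Longrightarrow> \<bar>f t - 1\<bar> \<le> k * e" "\<bar>t\<bar> \<le> 1 / 2 \<Longrightarrow> \<bar>f t - 1 + a * e * t^n\<bar> \<le> \<rho> * e"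
    and rotation: "R \<in> SO3" and jac: "has_jac v V"
begin

definition "m = \<bar>\<mu>\<bar> * M"

definition "w = \<eta> + e * m / \<delta>"

definition "S = 3 * cutoff_bound^2 * Q2 W (mat 1)"

definition lower_density :: "real^3 \<Rightarrow> real" where
  "lower_density y = e * \<mu> * (\<sigma> y \<bullet> strain R (V y)) - e^2 * \<mu> * a * ((y $ 3)^n * (\<sigma> y \<bullet> mat 1))
    - (12 * w + m * k * e) * (norm (V y - R))^2 - e^2 * (12 * w * k^2 + 2 * m * \<rho> + m * (k + 1) * e + \<mu>^2 * S / 2)"

lemma in_cell: "y \<in> cell l \<Longrightarrow> \<bar>y $ 3\<bar> \<le> 1 / 2"
  by (auto simp: mem_cuboid dest!: spec[of _ "3::3"])

lemma nonneg: "M \<ge> 0" "m \<ge> 0" "w \<ge> 0" "S \<ge> 0"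
proof -
  have "0 \<in> cell l" using l_ge_1 by (simp add: mem_cuboid forall_3)
  then show "M \<ge> 0" using \<sigma>_le norm_ge_zero order_trans by blast
  then show m: "m \<ge> 0" by (simp add: m_def)
  show "w \<ge> 0" using pos m by (simp add: w_def)
  show "S \<ge> 0" using Q2_pos by (simp add: S_def)
qed

lemma linear_term_ge:
  assumes y: "y \<in> cell l"
  shows "e * \<mu> * (\<sigma> y \<bullet> strain R (V y)) - e^2 * \<mu> * a * ((y $ 3)^n * (\<sigma> y \<bullet> mat 1)) - m * k * e * (norm (V y - R))^2
    - e^2 * (2 * m * \<rho> + m * (k + 1) * e) - m / e * (norm (V y - D y))^2
    \<le> e * \<mu> * (\<sigma> y \<bullet> strain R (f (y $ 3) *\<^sub>R D y))"
proof -
  define p q where "p = norm (V y - R)" and "q = norm (V y - D y)"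
  define E A where "E = \<sigma> y \<bullet> strain R (f (y $ 3) *\<^sub>R D y)" and "A = \<sigma> y \<bullet> strain R (V y)"
  define \<phi> \<tau> where "\<phi> = f (y $ 3) - 1" and "\<tau> = \<sigma> y \<bullet> mat 1"
  note y3 = in_cell[OF y]
  have "\<bar>E - A - \<phi> * \<tau>\<bar> \<le> k * e * (M * p) + 2 * (M * q)"
    unfolding E_def A_def \<phi>_def \<tau>_def p_def q_def
    by (rule abs_inner_strain_scaleR_le[OF rotation factor(1)[OF y3] k(2) \<sigma>_le[OF y]])
  then have "\<bar>e * \<mu> * (E - A - \<phi> * \<tau>)\<bar> \<le> \<bar>e * \<mu>\<bar> * (k * e * (M * p) + 2 * (M * q))"
    unfolding abs_mult[of "e * \<mu>" "E - A - \<phi> * \<tau>"] by (rule mult_left_mono) simp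
  moreover have "\<bar>e * \<mu>\<bar> * (k * e * (M * p) + 2 * (M * q)) = m * k * e * (e * p) + m * (2 * e * q)"
    using pos(3) by (simp add: abs_mult m_def algebra_simps)
  moreover have "m * k * e * (e * p) \<le> m * k * e * (e^2 + p^2)"
    using nonneg(2) k(1) pos(3) by (intro mult_left_mono mult_le_sq_add_sq) (auto simp: p_def)
  moreover have "m * (2 * e * q) \<le> m * (e^3 + q^2 / e)"
    by (intro mult_left_mono twice_mult_le_cube_add nonneg(2) pos(3))
  moreover have "\<bar>e * \<mu> * (\<phi> + a * e * (y $ 3)^n) * \<tau>\<bar> \<le> \<bar>e * \<mu>\<bar> * (\<rho> * e) * (M * 2)"
  proof -
    have "norm (\<sigma> y) * norm (mat 1 :: real^3^3) \<le> M * 2"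
      using \<sigma>_le[OF y] norm_SO3(2)[OF mat1_SO3] nonneg(1) by (intro mult_mono) auto
    then have "\<bar>\<tau>\<bar> \<le> M * 2" unfolding \<tau>_def by (rule order_trans[OF Cauchy_Schwarz_ineq2])
    then show ?thesis unfolding abs_mult[of "e * \<mu> * (\<phi> + a * e * (y $ 3)^n)"] abs_mult[of "e * \<mu>" "\<phi> + a * e * (y $ 3)^n"]
      using factor(2)[OF y3] by (intro mult_mono mult_left_mono) (auto simp: \<phi>_def)
  qed
  moreover have "\<bar>e * \<mu>\<bar> * (\<rho> * e) * (M * 2) = e^2 * (2 * m * \<rho>)"
    using pos(3) by (simp add: abs_mult m_def power2_eq_square)
  moreover have "m * k * e * (e^2 + p^2) + m * (e^3 + q^2 / e) = m * k * e * p^2 + e^2 * (m * (k + 1) * e) + m / e * q^2"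
    by (simp add: algebra_simps power2_eq_square power3_eq_cube)
  moreover have "e * \<mu> * E = e * \<mu> * A + e * \<mu> * (E - A - \<phi> * \<tau>) + e * \<mu> * (\<phi> + a * e * (y $ 3)^n) * \<tau>
    - e^2 * \<mu> * a * ((y $ 3)^n * \<tau>)"
    by (simp add: algebra_simps power2_eq_square)
  ultimately show ?thesis
    unfolding E_def[symmetric] A_def[symmetric] p_def[symmetric] q_def[symmetric] \<tau>_def[symmetric] abs_le_iff distrib_left[of "e^2"]
    by linarith
qed

lemma lower_density_le:
  assumes y: "y \<in> cell l"
  shows "ennreal (lower_density y) \<le> W (f (y $ 3) *\<^sub>R D y) + ennreal ((12 * w + m / e) * (norm (V y - D y))^2)"
proof -
  define E where "E = strain R (f (y $ 3) *\<^sub>R D y)"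
  define p q where "p = (norm (V y - R))^2" and "q = (norm (V y - D y))^2"
  have "ennreal (e * \<mu> * (\<sigma> y \<bullet> E) - (e * \<mu>)^2 * S / 2) \<le> W (mat 1 + E) + ennreal ((\<eta> + \<bar>e * \<mu>\<bar> * M / \<delta>) * (norm E)^2)"
    by (rule W_ge_linear[OF Taylor pos(1,2) nonneg(4) \<sigma>_le[OF y] dual[folded S_def]])
  then have low: "ennreal (e * \<mu> * (\<sigma> y \<bullet> E) - (e * \<mu>)^2 * S / 2) \<le> W (f (y $ 3) *\<^sub>R D y) + ennreal (w * (norm E)^2)"
    using pos(3) by (simp add: E_def W_strain[OF rotation] w_def m_def abs_mult mult.assoc)
  have "(norm E)^2 \<le> 12 * p + 12 * (k * e)^2 + 12 * q"
    unfolding E_def p_def q_def by (rule norm_strain_scaleR_sq_le[OF rotation factor(1)[OF in_cell[OF y]] k(2)])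
  then have "w * (norm E)^2 \<le> w * (12 * p + 12 * (k * e)^2 + 12 * q)" using nonneg(3) by (rule mult_left_mono)
  moreover have "lower_density y - (12 * w + m / e) * q = (e * \<mu> * (\<sigma> y \<bullet> strain R (V y)) - e^2 * \<mu> * a * ((y $ 3)^n * (\<sigma> y \<bullet> mat 1))
    - m * k * e * p - e^2 * (2 * m * \<rho> + m * (k + 1) * e) - m / e * q)
    - (e * \<mu>)^2 * S / 2 - w * (12 * p + 12 * (k * e)^2 + 12 * q)"
    unfolding lower_density_def p_def[symmetric] by (simp add: algebra_simps power_mult_distrib)
  ultimately have "lower_density y - (12 * w + m / e) * q \<le> e * \<mu> * (\<sigma> y \<bullet> E) - (e * \<mu>)^2 * S / 2 - w * (norm E)^2"
    using linear_term_ge[OF y] unfolding E_def p_def q_def by linarith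
  then show ?thesis
    unfolding q_def using nonneg pos(3) by (intro ennreal_le_plus_if_diff_le[OF low]) auto
qed

lemma continuous_on_lower_density: "continuous_on UNIV lower_density"
  unfolding lower_density_def[abs_def]
  by (intro continuous_intros continuous_\<sigma> has_jac_continuous(1)[OF has_jac_strain[OF jac]] has_jac_continuous(1)[OF jac])

lemma integral_lower_density:
  "integral (cell l) lower_density = - (e^2 * \<mu> * a * integral (cell l) (\<lambda>y. (y $ 3)^n * (\<sigma> y \<bullet> mat 1)))
    - (12 * w + m * k * e) * L2sq (half_widths l) 0 (\<lambda>y. V y - R)
    - e^2 * (12 * w * k^2 + 2 * m * \<rho> + m * (k + 1) * e + \<mu>^2 * S / 2) * (2 * l^2)"
proof -
  let ?c = "e^2 * (12 * w * k^2 + 2 * m * \<rho> + m * (k + 1) * e + \<mu>^2 * S / 2)"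
  have "((\<lambda>y::real^3. ?c) has_integral 2 * l^2 * ?c) (cell l)"
    using has_integral_const[of ?c "- (half_widths l + vec 0)" "half_widths l + vec 0"] content_cell[of l] l_ge_1
    unfolding cuboid_def by simp
  then have "(lower_density has_integral e * \<mu> * integral (cell l) (\<lambda>y. \<sigma> y \<bullet> strain R (V y))
    - e^2 * \<mu> * a * integral (cell l) (\<lambda>y. (y $ 3)^n * (\<sigma> y \<bullet> mat 1))
    - (12 * w + m * k * e) * integral (cell l) (\<lambda>y. (norm (V y - R))^2) - 2 * l^2 * ?c) (cell l)"
    unfolding lower_density_def[abs_def]
    by (intro has_integral_diff has_integral_mult_right integrable_integral integrable_on_cuboid continuous_intros
      continuous_\<sigma> has_jac_continuous(1)[OF has_jac_strain[OF jac]] has_jac_continuous(1)[OF jac])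
  then show ?thesis
    unfolding orthogonal[OF has_jac_strain[OF jac]] L2sq_def by (simp add: integral_unique mult.commute)
qed

lemma energy_ge:
  assumes [measurable]: "f \<in> borel_measurable borel" "D \<in> borel_measurable borel"
    and rigid: "L2sq (half_widths l) 0 (\<lambda>y. V y - R) \<le> C * e^2"
    and close: "nn_L2sq (large_cell l) (\<lambda>y. V y - D y) \<le> ennreal (e^4)"
  shows "ennreal ((- \<mu> * a * integral (cell l) (\<lambda>y. (y $ 3)^n * (\<sigma> y \<bullet> mat 1)) - \<mu>^2 * S * l^2 - 12 * w * (C + k^2 * (2 * l^2) + 1)
      - 2 * m * \<rho> * (2 * l^2) - m * (k * C + (k + 1) * (2 * l^2) + 1) * e) * e^2)
    \<le> cell_energy l f D" (is "ennreal (?gain * e^2) \<le> _")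
proof -
  have [measurable]: "V \<in> borel_measurable borel" by (rule borel_measurable_continuous_onI[OF has_jac_continuous(1)[OF jac]])
  have coeff: "0 \<le> 12 * w + m / e" using nonneg pos(3) by simp
  have "ennreal (integral (cell l) lower_density) \<le> (\<integral>\<^sup>+y\<in>cell l. ennreal (lower_density y) \<partial>lborel)"
    by (rule ennreal_integral_cuboid_le[OF continuous_on_lower_density])
  also have "\<dots> \<le> (\<integral>\<^sup>+y. W (f (y $ 3) *\<^sub>R D y) * indicator (large_cell l) y
    + ennreal (12 * w + m / e) * (ennreal ((norm (V y - D y))^2) * indicator (large_cell l) y) \<partial>lborel)"
    using lower_density_le coeff cuboid_mono[of 0 "1 / 8" "half_widths l"]
    by (intro nn_integral_mono) (auto split: split_indicator simp: ennreal_mult)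
  also have "\<dots> = cell_energy l f D + ennreal (12 * w + m / e) * nn_L2sq (large_cell l) (\<lambda>y. V y - D y)"
    by (simp add: nn_integral_add nn_integral_cmult)
  also have "\<dots> \<le> cell_energy l f D + ennreal (12 * w + m / e) * ennreal (e^4)"
    by (intro add_left_mono mult_left_mono close) simp
  also have "ennreal (12 * w + m / e) * ennreal (e^4) = ennreal ((12 * w + m / e) * e^4)"
    using coeff by (simp add: ennreal_mult)
  finally have upper: "ennreal (integral (cell l) lower_density)
    \<le> cell_energy l f D + ennreal ((12 * w + m / e) * e^4)" .
  have "(12 * w + m * k * e) * L2sq (half_widths l) 0 (\<lambda>y. V y - R) \<le> (12 * w + m * k * e) * (C * e^2)"
    using nonneg k(1) pos(3) by (intro mult_left_mono rigid) auto
  moreover have "(12 * w + m / e) * e^4 \<le> (12 * w + m * e) * e^2"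
  proof -
    have "(12 * w + m / e) * e^4 = (12 * w * e^2 + m * e) * e^2"
      using pos(3) by (simp add: field_simps eval_nat_numeral)
    moreover have "12 * w * e^2 \<le> 12 * w * 1" using nonneg(3) pos(3,4) by (intro mult_left_mono power_le_one) auto
    ultimately show ?thesis by (simp add: mult_right_mono)
  qed
  moreover have "?gain * e^2 = - (e^2 * \<mu> * a * integral (cell l) (\<lambda>y. (y $ 3)^n * (\<sigma> y \<bullet> mat 1)))
    - (12 * w + m * k * e) * (C * e^2) - e^2 * (12 * w * k^2 + 2 * m * \<rho> + m * (k + 1) * e + \<mu>^2 * S / 2) * (2 * l^2)
    - (12 * w + m * e) * e^2"
    by (simp add: algebra_simps)
  ultimately have "?gain * e^2 - 0 \<le> integral (cell l) lower_density - (12 * w + m / e) * e^4"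
    unfolding integral_lower_density by linarith
  then have "ennreal (?gain * e^2) \<le> cell_energy l f D + ennreal 0"
    using coeff by (intro ennreal_le_plus_if_diff_le[OF upper]) auto
  then show ?thesis by simp
qed

text \<open>The choice \<open>\<mu> = - a moment_const n / (6 cutoff_bound\<^sup>2)\<close> maximizes the leading term.\<close>

lemma energy_ge_half_gain:
  assumes \<mu>: "\<mu> = - a * moment_const n / (6 * cutoff_bound^2)" and n: "n \<ge> 2"
    and measurable: "f \<in> borel_measurable borel" "D \<in> borel_measurable borel"
    and rigid: "L2sq (half_widths l) 0 (\<lambda>y. V y - R) \<le> C * e^2"
    and close: "nn_L2sq (large_cell l) (\<lambda>y. V y - D y) \<le> ennreal (e^4)"
    and \<eta>: "12 * \<eta> * (C + k^2 * (2 * l^2) + 1) \<le> gain a n / 8" and \<rho>: "\<rho> * (2 * m * (2 * l^2)) \<le> gain a n / 8"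
    and e: "e * (12 * (m / \<delta>) * (C + k^2 * (2 * l^2) + 1) + m * (k * C + (k + 1) * (2 * l^2) + 1)) \<le> gain a n / 8"
  shows "ennreal (gain a n / 2 * e^2) \<le> cell_energy l f D"
proof -
  define J where "J = integral (cell l) (\<lambda>y. (y $ 3)^n * (\<sigma> y \<bullet> mat 1))"
  define G where "G = C + k^2 * (2 * l^2) + 1"
  define H where "H = m * (k * C + (k + 1) * (2 * l^2) + 1)"
  have leading: "gain a n \<le> - \<mu> * a * J - \<mu>^2 * S * l^2"
    unfolding J_def S_def by (rule gain_le[OF n \<mu>])
  have "12 * w * G = 12 * \<eta> * G + e * (12 * (m / \<delta>) * G)" by (simp add: w_def algebra_simps)
  then have "12 * w * G + 2 * m * \<rho> * (2 * l^2) + H * e \<le> 3 * (gain a n / 8)"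
    using \<eta> \<rho> e unfolding G_def[symmetric] H_def[symmetric] by (simp add: algebra_simps)
  then have "gain a n / 2 \<le> - \<mu> * a * J - \<mu>^2 * S * l^2 - 12 * w * G - 2 * m * \<rho> * (2 * l^2) - H * e"
    using leading gain_nonneg[of a n] by linarith
  then have "gain a n / 2 * e^2 \<le> (- \<mu> * a * J - \<mu>^2 * S * l^2 - 12 * w * G - 2 * m * \<rho> * (2 * l^2) - H * e) * e^2"
    by (rule mult_right_mono) simp
  from order_trans[OF ennreal_leI[OF this]] energy_ge[OF measurable rigid close]
  show ?thesis unfolding G_def H_def J_def .
qed

end

lemma abs_le_if_expansion:
  fixes x :: real
  assumes "\<bar>t\<bar> \<le> 1 / 2" "\<bar>x - a * e * t^n\<bar> \<le> \<rho> * e" "\<rho> \<le> 1" "e > 0"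
  shows "\<bar>x\<bar> \<le> (\<bar>a\<bar> + 1) * e"
proof -
  have "\<bar>t^n\<bar> \<le> 1" unfolding power_abs using assms(1) by (intro power_le_one) auto
  then have "\<bar>a * e * t^n\<bar> \<le> \<bar>a\<bar> * e * 1" unfolding abs_mult using assms(4) by (intro mult_mono) auto
  moreover have "\<rho> * e \<le> 1 * e" using assms(3,4) by (intro mult_right_mono) auto
  moreover have "(\<bar>a\<bar> + 1) * e = \<bar>a\<bar> * e * 1 + 1 * e" by (simp add: algebra_simps)
  ultimately show ?thesis using assms(2) by linarith
qed

context test_stress
begin

lemma energy_ge_if_constants:
  fixes a :: real and n :: nat
  defines "k \<equiv> \<bar>a\<bar> + 1" and "\<mu> \<equiv> - a * moment_const n / (6 * cutoff_bound^2)"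
  assumes n: "n \<ge> 2" and M: "\<And>y. y \<in> cell l \<Longrightarrow> norm (\<sigma> y) \<le> M"
    and C: "low_energy_rigid (half_widths l) (1 / 8) (gain a n / 2) k C e1"
    and \<eta>: "\<eta> \<ge> 0" "12 * \<eta> * (C + k^2 * (2 * l^2) + 1) \<le> gain a n / 8" and \<delta>: "\<delta> > 0"
    and Taylor: "\<And>F. norm F < \<delta> \<Longrightarrow> mat 1 + F \<in> finite_nhd \<and> \<bar>Wr (mat 1 + F) - B F F / 2\<bar> \<le> \<eta> * (norm F)^2"
    and \<rho>: "\<rho> \<le> 1" "\<rho> * (2 * (\<bar>\<mu>\<bar> * M) * (2 * l^2)) \<le> gain a n / 8"
    and e: "0 < e" "e \<le> e1" "e \<le> 1" "k * e \<le> 1" "e * (12 * (\<bar>\<mu>\<bar> * M / \<delta>) * (C + k^2 * (2 * l^2) + 1)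
      + \<bar>\<mu>\<bar> * M * (k * C + (k + 1) * (2 * l^2) + 1)) \<le> gain a n / 8"
    and measurable: "f \<in> borel_measurable borel" "D \<in> borel_measurable borel" and limit: "jac_limit (large_cell l) D"
    and f: "\<And>t. \<bar>t\<bar> \<le> 1 / 2 \<Longrightarrow> \<bar>f t - 1 + a * e * t^n\<bar> \<le> \<rho> * e"
  shows "ennreal (gain a n / 2 * e^2) \<le> cell_energy l f D"
proof (cases "cell_energy l f D \<le> ennreal (gain a n / 2 * e^2)")
  case low: True
  have factor: "\<bar>f t - 1\<bar> \<le> k * e" if "\<bar>t\<bar> \<le> 1 / 2" for t
    using abs_le_if_expansion[OF that, of "f t - 1" "- a" e n \<rho>] f[OF that] \<rho>(1) e(1) by (simp add: k_def)
  then have factor_cell: "\<forall>y\<in>large_cell l. \<bar>f (y $ 3) - 1\<bar> \<le> k * e" by (auto simp: mem_cuboid dest!: spec[of _ "3::3"])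
  have f_measurable: "(\<lambda>y::real^3. f (y $ 3)) \<in> borel_measurable borel"
    by (rule measurable_compose[OF measurable_vec_nth measurable(1)]) simp
  obtain v V where V: "has_jac v V" and close: "nn_L2sq (large_cell l) (\<lambda>y. V y - D y) \<le> ennreal (e^4)"
    using limit e(1) unfolding jac_limit_def by (meson zero_less_power)
  obtain R where R: "R \<in> SO3" "L2sq (half_widths l) 0 (\<lambda>y. V y - R) \<le> C * e^2"
    using C[unfolded low_energy_rigid_def, rule_format, OF e(1,2) f_measurable measurable(2) V _ close low] factor_cell by blast
  interpret near_rigid_cell W l \<sigma> M \<delta> \<eta> a \<mu> k \<rho> e n f v V D R
    by unfold_locales (fact M Taylor \<delta> \<eta>(1) e factor f R(1) V | simp add: k_def)+
  show ?thesis
    using \<eta>(2) \<rho>(2) e(5) unfolding m_def[symmetric]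
    by (intro energy_ge_half_gain[OF _ n measurable R(2) close]) (auto simp: \<mu>_def)
qed simp

lemma cell_energy_ge:
  assumes n: "n \<ge> 2" and a: "a \<noteq> 0"
  shows "\<exists>\<rho>>0. \<exists>e0>0. \<forall>e f D. 0 < e \<longrightarrow> e \<le> e0 \<longrightarrow> f \<in> borel_measurable borel \<longrightarrow> D \<in> borel_measurable borel \<longrightarrow>
    jac_limit (large_cell l) D \<longrightarrow> (\<forall>t. \<bar>t\<bar> \<le> 1 / 2 \<longrightarrow> \<bar>f t - 1 + a * e * t^n\<bar> \<le> \<rho> * e) \<longrightarrow>
    ennreal (gain a n / 2 * e^2) \<le> cell_energy l f D"
proof -
  define k \<mu> where "k = \<bar>a\<bar> + 1" and "\<mu> = - a * moment_const n / (6 * cutoff_bound^2)"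
  have gain: "gain a n / 8 > 0" using gain_pos[OF n a] by simp
  obtain M where M: "M > 0" "\<And>y. y \<in> cell l \<Longrightarrow> norm (\<sigma> y) \<le> M"
    using compact_continuous_image[OF continuous_\<sigma> compact_cuboid, THEN compact_imp_bounded, THEN bounded_pos[THEN iffD1]]
    by (metis imageI)
  have "half_widths l $ i > 0" for i using exhaust_3[of i] l_ge_1 by auto
  then obtain C e1 where C: "C \<ge> 0" "e1 > 0" "low_energy_rigid (half_widths l) (1 / 8) (gain a n / 2) k C e1"
    using low_energy_rigidity[of "half_widths l" "1 / 8" "gain a n / 2" k] gain by (auto simp: k_def)
  define G where "G = C + k^2 * (2 * l^2) + 1"
  have G: "G > 0" using C by (simp add: G_def add_nonneg_pos)
  define \<eta> where "\<eta> = gain a n / (96 * G)"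
  have \<eta>: "\<eta> > 0" "12 * \<eta> * G \<le> gain a n / 8" using gain G by (simp_all add: \<eta>_def)
  obtain \<delta> where \<delta>: "\<delta> > 0"
    and Taylor: "\<And>F. norm F < \<delta> \<Longrightarrow> mat 1 + F \<in> finite_nhd \<and> \<bar>Wr (mat 1 + F) - B F F / 2\<bar> \<le> \<eta> * (norm F)^2"
    using Wr_Taylor[OF \<eta>(1)] by blast
  have "2 * (\<bar>\<mu>\<bar> * M) * (2 * l^2) \<ge> 0" using M(1) by simp
  then obtain \<rho> where \<rho>: "\<rho> > 0" "\<And>x. 0 \<le> x \<Longrightarrow> x \<le> \<rho> \<Longrightarrow> x * (2 * (\<bar>\<mu>\<bar> * M) * (2 * l^2)) \<le> gain a n / 8"
    using gain by (rule ex_small_factor) blast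
  define H where "H = 12 * (\<bar>\<mu>\<bar> * M / \<delta>) * G + \<bar>\<mu>\<bar> * M * (k * C + (k + 1) * (2 * l^2) + 1)"
  have "H \<ge> 0" using M(1) \<delta> G C by (simp add: H_def k_def)
  then obtain e2 where e2: "e2 > 0" "\<And>e. 0 \<le> e \<Longrightarrow> e \<le> e2 \<Longrightarrow> e * H \<le> gain a n / 8"
    using gain by (rule ex_small_factor) blast
  define e0 where "e0 = min (min 1 e1) (min (1 / k) e2)"
  have "ennreal (gain a n / 2 * e^2) \<le> cell_energy l f D"
    if e: "0 < e" "e \<le> e0" and data: "f \<in> borel_measurable borel" "D \<in> borel_measurable borel" "jac_limit (large_cell l) D"
      "\<And>t. \<bar>t\<bar> \<le> 1 / 2 \<Longrightarrow> \<bar>f t - 1 + a * e * t^n\<bar> \<le> min 1 \<rho> * e" for e f D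
  proof (rule energy_ge_if_constants[OF n M(2) C(3)[unfolded k_def] less_imp_le[OF \<eta>(1)] _ \<delta> Taylor _ _ e(1) _ _ _ _ data])
    show "12 * \<eta> * (C + (\<bar>a\<bar> + 1)^2 * (2 * l^2) + 1) \<le> gain a n / 8" using \<eta>(2) by (simp only: G_def k_def)
    show "min 1 \<rho> * (2 * (\<bar>- a * moment_const n / (6 * cutoff_bound^2)\<bar> * M) * (2 * l^2)) \<le> gain a n / 8"
      using \<rho>(1) unfolding \<mu>_def[symmetric] by (intro \<rho>(2)) auto
    show "e \<le> e1" "e \<le> 1" "(\<bar>a\<bar> + 1) * e \<le> 1" using e(2) by (auto simp: e0_def k_def field_simps)
    show "e * (12 * (\<bar>- a * moment_const n / (6 * cutoff_bound^2)\<bar> * M / \<delta>) * (C + (\<bar>a\<bar> + 1)^2 * (2 * l^2) + 1)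
      + \<bar>- a * moment_const n / (6 * cutoff_bound^2)\<bar> * M * ((\<bar>a\<bar> + 1) * C + (\<bar>a\<bar> + 1 + 1) * (2 * l^2) + 1)) \<le> gain a n / 8"
      unfolding \<mu>_def[symmetric] k_def[symmetric] G_def[symmetric] H_def[symmetric] using e by (intro e2(2)) (auto simp: e0_def)
  qed auto
  moreover have "min 1 \<rho> > 0" "e0 > 0" using \<rho>(1) C(2) e2(1) by (simp_all add: e0_def k_def)
  ultimately show ?thesis by (intro exI[of _ "min 1 \<rho>"] exI[of _ e0] conjI allI impI) simp_all
qed

end

theorem (in admissible) cell_energy_bound:
  assumes "n \<ge> 2" "a \<noteq> 0"
  shows "\<exists>l\<ge>1. \<exists>\<rho>>0. \<exists>e0>0. \<forall>e f D. 0 < e \<longrightarrow> e \<le> e0 \<longrightarrow> f \<in> borel_measurable borel \<longrightarrow> D \<in> borel_measurable borel \<longrightarrow>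
    jac_limit (large_cell l) D \<longrightarrow> (\<forall>t. \<bar>t\<bar> \<le> 1 / 2 \<longrightarrow> \<bar>f t - 1 + a * e * t^n\<bar> \<le> \<rho> * e) \<longrightarrow>
    ennreal (moment_const n^2 / (24 * cutoff_bound^2) * a^2 * Q2 W (mat 1) * l^2 * e^2)
      \<le> cell_energy l f D"
proof -
  obtain l \<sigma> where "test_stress W l \<sigma>" using test_stress_exists by blast
  then interpret test_stress W l \<sigma> .
  show ?thesis using l_ge_1 cell_energy_ge[OF assms] by (auto simp: gain_def)
qed

section \<open>The conformal factor and the upper bound\<close>

lemma smooth_on_real_derivative:
  fixes f :: "real \<Rightarrow> real"
  assumes f: "smooth_on S f"
  shows "smooth_on S (\<lambda>x. frechet_derivative f (at x) 1)"
    "x \<in> S \<Longrightarrow> (f has_real_derivative frechet_derivative f (at x) 1) (at x)"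
proof -
  have "Ck_on k S (\<lambda>x. frechet_derivative f (at x) 1)" for k
    using f[unfolded smooth_on_def, rule_format, of "Suc k"] by simp
  then show "smooth_on S (\<lambda>x. frechet_derivative f (at x) 1)" by (simp add: smooth_on_def)
  assume "x \<in> S"
  then have "f differentiable at x" using f[unfolded smooth_on_def, rule_format, of "Suc 0"] by simp
  then have deriv: "(f has_derivative frechet_derivative f (at x)) (at x)" by (rule frechet_derivative_works[THEN iffD1])
  have "frechet_derivative f (at x) h = frechet_derivative f (at x) 1 * h" for h
    using linear_cmul[OF has_derivative_linear[OF deriv], of h 1] by (simp add: mult.commute)
  then have "frechet_derivative f (at x) = (\<lambda>h. frechet_derivative f (at x) 1 * h)" by (rule ext)
  with deriv show "(f has_real_derivative frechet_derivative f (at x) 1) (at x)"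
    unfolding has_field_derivative_def by simp
qed

lemma smooth_on_iterated_deriv:
  fixes f :: "real \<Rightarrow> real"
  assumes S: "open S" and f: "smooth_on S f"
  obtains g where "smooth_on S g" "\<And>x. x \<in> S \<Longrightarrow> ((deriv ^^ k) f has_real_derivative g x) (at x)"
proof (induction k arbitrary: thesis)
  case 0
  show ?case using 0[OF smooth_on_real_derivative(1)[OF f]] smooth_on_real_derivative(2)[OF f] by simp
next
  case (Suc k)
  obtain g where g: "smooth_on S g" "\<And>x. x \<in> S \<Longrightarrow> ((deriv ^^ k) f has_real_derivative g x) (at x)"
    using Suc.IH by blast
  have "((deriv ^^ Suc k) f has_real_derivative frechet_derivative g (at x) 1) (at x)" if x: "x \<in> S" for x
    by (rule has_field_derivative_transform_within_open[OF smooth_on_real_derivative(2)[OF g(1) x] S x])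
      (simp add: DERIV_imp_deriv[OF g(2)])
  then show ?case by (rule Suc.prems[OF smooth_on_real_derivative(1)[OF g(1)]])
qed

lemma smooth_on_has_real_derivative_iterated:
  fixes f :: "real \<Rightarrow> real"
  assumes "open S" "smooth_on S f" "x \<in> S"
  shows "((deriv ^^ k) f has_real_derivative (deriv ^^ Suc k) f x) (at x)"
  using smooth_on_iterated_deriv[OF assms(1,2), of k] assms(3) DERIV_imp_deriv by (metis comp_apply funpow.simps(2))

lemma abs_exp_minus_quadratic_le:
  fixes u :: real
  assumes "\<bar>u\<bar> \<le> 1"
  shows "\<bar>exp (- u) - 1 + u\<bar> \<le> 2 * u^2"
proof -
  obtain t where t: "\<bar>t\<bar> \<le> \<bar>- u\<bar>" "exp (- u) = (\<Sum>m<2. (- u)^m / fact m) + exp t / fact 2 * (- u)^2"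
    using Maclaurin_exp_le by blast
  have "exp t \<le> 3" using t(1) assms exp_le by (intro order_trans[of "exp t" "exp 1" 3]) auto
  then have "exp t / 2 * u^2 \<le> 2 * u^2" by (intro mult_right_mono) auto
  moreover have "exp (- u) - 1 + u = exp t / 2 * u^2" using t(2) by (simp add: numeral_2_eq_2)
  moreover have "0 \<le> exp t / 2 * u^2" by simp
  ultimately show ?thesis by linarith
qed

locale flat_metric =
  fixes \<phi> :: "real \<Rightarrow> real" and n :: nat
  assumes smooth: "smooth_on {-1/2<..<1/2} \<phi>" and n: "n > 2"
    and flat: "\<forall>k\<in>{1..n-1}. (deriv ^^ k) \<phi> 0 = 0"
begin

definition "a = (deriv ^^ n) \<phi> 0 / fact n"

lemma Taylor_flat:
  assumes "\<bar>x\<bar> < 1 / 2"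
  obtains t where "\<bar>t\<bar> \<le> \<bar>x\<bar>" "\<phi> x = \<phi> 0 + (deriv ^^ n) \<phi> t / fact n * x^n"
proof -
  have "((deriv ^^ k) \<phi> has_real_derivative (deriv ^^ Suc k) \<phi> t) (at t)" if "\<bar>t\<bar> \<le> \<bar>x\<bar>" for k t
    by (rule smooth_on_has_real_derivative_iterated[OF _ smooth]) (use that assms in auto)
  then obtain t where t: "\<bar>t\<bar> \<le> \<bar>x\<bar>" "\<phi> x = (\<Sum>m<n. (deriv ^^ m) \<phi> 0 / fact m * x^m) + (deriv ^^ n) \<phi> t / fact n * x^n"
    using Maclaurin_bi_le[of "\<lambda>m. (deriv ^^ m) \<phi>" \<phi> n x] by auto
  have "(deriv ^^ m) \<phi> 0 = 0" if "m \<in> {..<n} - {0}" for m by (rule flat[rule_format]) (use that in auto)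
  then have "(\<Sum>m<n. (deriv ^^ m) \<phi> 0 / fact m * x^m) = (\<Sum>m\<in>{0}. (deriv ^^ m) \<phi> 0 / fact m * x^m)"
    by (intro sum.mono_neutral_right) (use n in auto)
  then show ?thesis using t that by simp
qed

lemma exponent_expansion:
  assumes "\<delta> > 0"
  obtains r where "r > 0" "\<And>x. \<bar>x\<bar> \<le> r \<Longrightarrow> \<bar>\<phi> x - \<phi> 0 - a * x^n\<bar> \<le> \<delta> * \<bar>x^n\<bar>"
proof -
  let ?d = "(deriv ^^ n) \<phi>"
  have "isCont ?d 0"
    by (rule DERIV_isCont[OF smooth_on_has_real_derivative_iterated[OF _ smooth]]) auto
  then obtain s where s: "s > 0" "\<And>x. \<bar>x\<bar> < s \<Longrightarrow> \<bar>?d x - ?d 0\<bar> < \<delta>"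
    using assms unfolding continuous_at_eps_delta by (auto simp: dist_real_def)
  define r where "r = min (s / 2) (1 / 4)"
  have "\<bar>\<phi> x - \<phi> 0 - a * x^n\<bar> \<le> \<delta> * \<bar>x^n\<bar>" if x: "\<bar>x\<bar> \<le> r" for x
  proof -
    obtain t where t: "\<bar>t\<bar> \<le> \<bar>x\<bar>" "\<phi> x = \<phi> 0 + ?d t / fact n * x^n"
      by (rule Taylor_flat[of x]) (use x r_def in auto)
    have "\<bar>t\<bar> < s" using t(1) x s(1) by (simp add: r_def)
    then have "\<bar>?d t - ?d 0\<bar> / fact n \<le> \<delta> / 1" using s(2)[of t] assms fact_ge_1 by (intro frac_le) auto
    then have "\<bar>?d t - ?d 0\<bar> / fact n * \<bar>x^n\<bar> \<le> \<delta> * \<bar>x^n\<bar>" by (intro mult_right_mono) auto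
    moreover have "\<phi> x - \<phi> 0 - a * x^n = (?d t - ?d 0) / fact n * x^n"
      by (simp add: t(2) a_def diff_divide_distrib left_diff_distrib)
    ultimately show ?thesis by (simp add: abs_mult)
  qed
  then show ?thesis using s(1) by (intro that[of r]) (auto simp: r_def)
qed

lemma conformal_factor_expansion:
  assumes \<rho>: "\<rho> > 0"
  obtains h0 where "h0 > 0" "h0 \<le> 1"
    "\<And>h t. 0 < h \<Longrightarrow> h < h0 \<Longrightarrow> \<bar>t\<bar> \<le> 1 / 2 \<Longrightarrow> \<bar>exp (\<phi> 0 - \<phi> (h * t)) - 1 + a * h^n * t^n\<bar> \<le> \<rho> * h^n"
proof -
  define \<delta> c where "\<delta> = min 1 (\<rho> / 2)" and "c = \<bar>a\<bar> + 1"
  have c: "c \<ge> 1" by (simp add: c_def)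
  obtain r where r: "r > 0" "\<And>x. \<bar>x\<bar> \<le> r \<Longrightarrow> \<bar>\<phi> x - \<phi> 0 - a * x^n\<bar> \<le> \<delta> * \<bar>x^n\<bar>"
    by (rule exponent_expansion[of \<delta>]) (use \<rho> \<delta>_def in auto)
  define h0 where "h0 = min (min 1 r) (min (1 / c) (\<rho> / (4 * c^2)))"
  have "\<bar>exp (\<phi> 0 - \<phi> (h * t)) - 1 + a * h^n * t^n\<bar> \<le> \<rho> * h^n" if h: "0 < h" "h < h0" and t: "\<bar>t\<bar> \<le> 1 / 2" for h t
  proof -
    define e u where "e = h^n" and "u = \<phi> (h * t) - \<phi> 0"
    have small: "h \<le> 1" "h \<le> r" "c * h \<le> 1" "4 * c^2 * h \<le> \<rho>"
      using h(2) c by (auto simp: h0_def field_simps)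
    have e: "0 < e" "e \<le> h" using h(1) small(1) n power_decreasing[of 1 n h] by (auto simp: e_def)
    have "\<bar>h * t\<bar> \<le> h * 1" unfolding abs_mult using h(1) t by (intro mult_mono) auto
    then have "\<bar>u - a * (h * t)^n\<bar> \<le> \<delta> * \<bar>(h * t)^n\<bar>" unfolding u_def using small(2) by (intro r(2)) linarith
    also have "\<bar>(h * t)^n\<bar> \<le> e * 1"
      unfolding power_mult_distrib abs_mult power_abs e_def using h(1) t by (intro mult_mono power_le_one) auto
    finally have u_expansion: "\<bar>u - a * e * t^n\<bar> \<le> \<delta> * e"
      using \<rho> by (simp add: \<delta>_def e_def power_mult_distrib mult.assoc)
    then have "\<bar>u\<bar> \<le> c * e"
      unfolding c_def using e(1) by (intro abs_le_if_expansion[OF t]) (auto simp: \<delta>_def)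
    also have "c * e \<le> c * h" using c e(2) by (intro mult_left_mono) auto
    finally have "\<bar>exp (- u) - 1 + u\<bar> \<le> 2 * u^2" using small(3) by (intro abs_exp_minus_quadratic_le) simp
    moreover have "u^2 \<le> (c * e)^2" using \<open>\<bar>u\<bar> \<le> c * e\<close> by (intro abs_le_square_iff[THEN iffD1]) auto
    moreover have "2 * (c * e)^2 \<le> \<rho> / 2 * e"
    proof -
      have "4 * c^2 * e \<le> 4 * c^2 * h" using e(2) by (intro mult_left_mono) auto
      then have "4 * c^2 * e * e \<le> \<rho> * e" using small(4) e(1) by (intro mult_right_mono) auto
      then show ?thesis by (simp add: power2_eq_square mult_ac)
    qed
    moreover have "\<delta> * e \<le> \<rho> / 2 * e" using e(1) by (simp add: \<delta>_def)
    ultimately have "\<bar>exp (- u) - 1 + a * e * t^n\<bar> \<le> \<rho> * e" using u_expansion by linarith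
    then show ?thesis by (simp add: u_def e_def)
  qed
  then show ?thesis using r(1) c \<rho> by (intro that[of h0]) (auto simp: h0_def)
qed

end

lemma has_grad_if_has_derivative:
  fixes f :: "real^'n \<Rightarrow> real"
  assumes f: "\<And>x. (f has_derivative f' x) (at x)" and cont: "\<And>j. continuous_on UNIV (\<lambda>x. f' x (axis j 1))"
  shows "has_grad f (\<lambda>x. \<chi> j. f' x (axis j 1))"
  unfolding has_grad_def
proof (intro conjI allI continuous_on_vec_lambda cont)
  fix x
  have linear: "linear (f' x)" by (rule has_derivative_linear[OF f])
  have "f' x h = (\<chi> j. f' x (axis j 1)) \<bullet> h" for h
  proof -
    have "f' x h = f' x (\<Sum>j\<in>UNIV. h $ j *\<^sub>R axis j 1)"
      using basis_expansion[of h] by (simp add: scalar_mult_eq_scaleR)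
    also have "\<dots> = (\<Sum>j\<in>UNIV. h $ j * f' x (axis j 1))" by (simp add: linear_sum[OF linear] linear_cmul[OF linear])
    finally show ?thesis by (simp add: inner_vec_def mult.commute)
  qed
  then show "(f has_derivative (\<lambda>h. (\<chi> j. f' x (axis j 1)) \<bullet> h)) (at x)"
    by (intro has_derivative_eq_rhs[OF f] ext)
qed

lemma test_fn_has_grad:
  assumes "test_fn \<Omega> \<psi>"
  shows "has_grad \<psi> (\<lambda>x. \<chi> j. frechet_derivative \<psi> (at x) (axis j 1))"
proof -
  have "Ck_on (Suc 0) UNIV \<psi>" using assms by (simp add: test_fn_def smooth_on_def)
  then show ?thesis
    by (intro has_grad_if_has_derivative) (auto simp: axis_in_Basis_iff simp flip: frechet_derivative_works)
qed

lemma test_fn_zero: "test_fn \<Omega> \<psi> \<Longrightarrow> x \<notin> \<Omega> \<Longrightarrow> \<psi> x = 0"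
  using closure_subset[of "{x. \<psi> x \<noteq> 0}"] by (auto simp: test_fn_def)

lemma test_fn_frechet_derivative_zero:
  assumes \<psi>: "test_fn \<Omega> \<psi>" and x: "x \<notin> \<Omega>"
  shows "frechet_derivative \<psi> (at x) = (\<lambda>h. 0)"
proof -
  let ?C = "- closure {x. \<psi> x \<noteq> 0}"
  have "x \<in> ?C" using \<psi> x by (auto simp: test_fn_def)
  then have "(\<psi> has_derivative (\<lambda>h. 0)) (at x)"
    by (rule has_derivative_transform_within_open[OF has_derivative_const[of 0], rotated])
      (use closure_subset[of "{x. \<psi> x \<noteq> 0}"] in auto)
  then show ?thesis by (rule frechet_derivative_at[symmetric])
qed

lemma integrable_lebesgue_on_continuous:
  fixes f :: "'a::euclidean_space \<Rightarrow> real"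
  assumes "\<Omega> \<in> sets lebesgue" "\<Omega> \<subseteq> cbox a b" "continuous_on UNIV f"
  shows "integrable (lebesgue_on \<Omega>) f"
  using set_integrable_subset[OF absolutely_integrable_continuous[OF continuous_on_UNIV_subset[OF assms(3)]] assms(1,2)] assms(1)
  by (simp add: integrable_restrict_space set_integrable_def)

lemma integral_lebesgue_on_supported:
  fixes f :: "'a::euclidean_space \<Rightarrow> real"
  assumes \<Omega>: "\<Omega> \<in> sets lebesgue" "\<Omega> \<subseteq> cbox a b" and f: "continuous_on UNIV f" "\<And>x. x \<notin> \<Omega> \<Longrightarrow> f x = 0"
  shows "integral\<^sup>L (lebesgue_on \<Omega>) f = integral (cbox a b) f"
proof -
  have "integral\<^sup>L (lebesgue_on \<Omega>) f = integral \<Omega> f"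
    by (rule lebesgue_integral_eq_integral[OF integrable_lebesgue_on_continuous[OF \<Omega> f(1)] \<Omega>(1)])
  also have "\<dots> = integral (cbox a b) (\<lambda>x. if x \<in> \<Omega> then f x else 0)" using \<Omega>(2)
    by (simp add: Henstock_Kurzweil_Integration.integral_restrict_Int Int_absorb2)
  also have "(\<lambda>x. if x \<in> \<Omega> then f x else 0) = f" using f(2) by auto
  finally show ?thesis .
qed

lemma sobolev12_if_has_jac:
  assumes \<Omega>: "open \<Omega>" "bounded \<Omega>" and jac: "has_jac v V"
  shows "sobolev12 \<Omega> v V"
proof -
  have measurable: "\<Omega> \<in> sets lebesgue" using \<Omega>(1) by auto
  obtain a b where box: "\<Omega> \<subseteq> cbox a b" using bounded_subset_cbox_symmetric[OF \<Omega>(2)] by blast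
  have borel: "f \<in> borel_measurable (lebesgue_on \<Omega>)" if "continuous_on UNIV f" for f :: "real^3 \<Rightarrow> 'b::euclidean_space"
    using borel_measurable_continuous_onI[OF that] by (intro measurable_restrict_space1) (auto intro: measurable_completion)
  note cont [continuous_intros] = has_jac_continuous[OF jac]
  have weak: "(\<integral>x. v x $ i * frechet_derivative \<psi> (at x) (axis j 1) \<partial>(lebesgue_on \<Omega>))
    = - (\<integral>x. V x $ i $ j * \<psi> x \<partial>(lebesgue_on \<Omega>))" if \<psi>: "test_fn \<Omega> \<psi>" for \<psi> i j
  proof -
    note grad = test_fn_has_grad[OF \<psi>] and zero = test_fn_zero[OF \<psi>] test_fn_frechet_derivative_zero[OF \<psi>]
    have cont_partial: "continuous_on UNIV (\<lambda>x. frechet_derivative \<psi> (at x) (axis j 1))"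
      using continuous_on_component[OF has_grad_continuous_grad[OF grad], of UNIV j] by simp
    have "(\<integral>x. v x $ i * frechet_derivative \<psi> (at x) (axis j 1) \<partial>(lebesgue_on \<Omega>))
      = integral (cbox a b) (\<lambda>x. v x $ i * frechet_derivative \<psi> (at x) (axis j 1))"
      by (intro integral_lebesgue_on_supported measurable box continuous_intros cont_partial) (simp add: zero)
    also have "\<dots> = - integral (cbox a b) (\<lambda>x. V x $ i $ j * \<psi> x)"
      by (subst integral_by_parts[OF has_jac_nth[OF jac] grad]) (use zero(1) box in auto)
    also have "integral (cbox a b) (\<lambda>x. V x $ i $ j * \<psi> x) = (\<integral>x. V x $ i $ j * \<psi> x \<partial>(lebesgue_on \<Omega>))"
      by (intro integral_lebesgue_on_supported[symmetric] measurable box continuous_intros has_grad_continuous[OF grad])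
        (simp add: zero)
    finally show ?thesis .
  qed
  show ?thesis
    unfolding sobolev12_def
    by (intro conjI allI impI borel integrable_lebesgue_on_continuous[OF measurable box] weak continuous_intros)
qed

lemma open_Omega:
  assumes "open \<omega>"
  shows "open (Omega \<omega> h)"
proof -
  have "continuous_on UNIV (\<lambda>x::real^3. if i = 1 then x $ 1 else x $ 2)" for i :: 2
    by (cases "i = 1") (auto intro!: continuous_intros)
  then have "continuous_on UNIV (\<lambda>x::real^3. \<chi> i::2. if i = 1 then x $ 1 else x $ 2)"
    by (rule continuous_on_vec_lambda)
  moreover have "(\<lambda>x::real^3. \<chi> i::2. if i = 1 then x $ 1 else x $ 2) = (\<lambda>x. vector [x $ 1, x $ 2])"
    by (simp add: fun_eq_iff vec_eq_iff forall_2)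
  ultimately have "continuous_on UNIV (\<lambda>x::real^3. vector [x $ 1, x $ 2] :: real^2)" by (rule back_subst)
  then have "open ((\<lambda>x::real^3. vector [x $ 1, x $ 2] :: real^2) -` \<omega>)" by (rule open_vimage[OF assms])
  moreover have "open {x::real^3. \<bar>x $ 3\<bar> < h / 2}" by (intro open_Collect_less continuous_intros)
  moreover have "Omega \<omega> h = ((\<lambda>x. vector [x $ 1, x $ 2]) -` \<omega>) \<inter> {x. \<bar>x $ 3\<bar> < h / 2}" by (auto simp: Omega_def)
  ultimately show ?thesis by auto
qed

lemma Omega_subset_cbox:
  assumes "bounded \<omega>"
  obtains r where "r > 0" "\<And>h. Omega \<omega> h \<subseteq> cbox (- vector [r, r, h / 2]) (vector [r, r, h / 2])"
proof -
  obtain r where r: "r > 0" "\<And>q. q \<in> \<omega> \<Longrightarrow> norm q \<le> r" using assms unfolding bounded_pos by blast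
  have "x \<in> cbox (- vector [r, r, h / 2]) (vector [r, r, h / 2])" if x: "x \<in> Omega \<omega> h" for x h
  proof -
    have "norm (vector [x $ 1, x $ 2] :: real^2) \<le> r" using r(2) x by (simp add: Omega_def)
    then have "\<bar>(vector [x $ 1, x $ 2] :: real^2) $ i\<bar> \<le> r" for i using component_le_norm_cart order_trans by blast
    from this[of 1] this[of 2] have "\<bar>x $ 1\<bar> \<le> r" "\<bar>x $ 2\<bar> \<le> r" by simp_all
    moreover have "\<bar>x $ 3\<bar> \<le> h / 2" using x by (simp add: Omega_def)
    ultimately show ?thesis unfolding mem_box_cart forall_3 abs_le_iff by simp
  qed
  then show ?thesis using r(1) that by blast
qed

lemma emeasure_Omega_le:
  assumes "bounded \<omega>"
  obtains C where "C > 0" "\<And>h. h > 0 \<Longrightarrow> emeasure lebesgue (Omega \<omega> h) \<le> ennreal (C * h)"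
proof -
  obtain r where r: "r > 0" "\<And>h. Omega \<omega> h \<subseteq> cbox (- vector [r, r, h / 2]) (vector [r, r, h / 2])"
    using Omega_subset_cbox[OF assms] by blast
  have "emeasure lebesgue (Omega \<omega> h) \<le> ennreal ((2 * r)^2 * h)" if h: "h > 0" for h
  proof -
    let ?b = "vector [r, r, h / 2] :: real^3"
    have "cbox (- ?b) ?b \<noteq> {}" using r(1) h by (simp add: interval_ne_empty_cart forall_3)
    from content_cbox_cart[OF this] have "measure lborel (cbox (- ?b) ?b) = (2 * r)^2 * h"
      unfolding prod_3 by (simp add: power2_eq_square)
    moreover have "emeasure lebesgue (Omega \<omega> h) \<le> emeasure lebesgue (cbox (- ?b) ?b)" by (rule emeasure_mono[OF r(2)]) auto
    ultimately show ?thesis by (simp add: emeasure_eq_measure2[OF fmeasurable_cbox])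
  qed
  then show ?thesis using r(1) by (intro that[of "(2 * r)^2"]) auto
qed

lemma (in admissible) W_near_identity_le:
  obtains C \<delta> where "C > 0" "\<delta> > 0" "\<And>s. \<bar>s\<bar> < \<delta> \<Longrightarrow> W ((1 + s) *\<^sub>R mat 1) \<le> ennreal (C * s^2)"
proof -
  obtain \<delta> where \<delta>: "\<delta> > 0"
    and Taylor: "\<And>F. norm F < \<delta> \<Longrightarrow> mat 1 + F \<in> finite_nhd \<and> \<bar>Wr (mat 1 + F) - B F F / 2\<bar> \<le> 1 * (norm F)^2"
    using Wr_Taylor[of 1] by auto
  have "W ((1 + s) *\<^sub>R mat 1) \<le> ennreal ((B (mat 1) (mat 1) / 2 + 3) * s^2)" if s: "\<bar>s\<bar> < \<delta> / 2" for s
  proof -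
    define F where "F = s *\<^sub>R (mat 1 :: real^3^3)"
    have sq: "(norm F)^2 = 3 * s^2" by (simp add: F_def power_mult_distrib norm_SO3(1)[OF mat1_SO3])
    have "norm F \<le> \<bar>s\<bar> * 2" using norm_SO3(2)[OF mat1_SO3] by (simp add: F_def mult_left_mono)
    then have F: "norm F < \<delta>" using s by simp
    have "Wr (mat 1 + F) \<le> B F F / 2 + (norm F)^2" using Taylor[OF F] unfolding abs_le_iff by linarith
    also have "\<dots> = (B (mat 1) (mat 1) / 2 + 3) * s^2"
      unfolding sq by (simp add: F_def B.scaleR_left B.scaleR_right power2_eq_square algebra_simps)
    finally have "W (mat 1 + F) \<le> ennreal ((B (mat 1) (mat 1) / 2 + 3) * s^2)"
      using Taylor[OF F] by (simp add: W_eq_Wr ennreal_leI)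
    then show ?thesis by (simp add: F_def scaleR_add_left)
  qed
  moreover have "B (mat 1) (mat 1) / 2 + 3 > 0" using B_nonneg[of "mat 1"] by simp
  ultimately show ?thesis using \<delta> that[of "B (mat 1) (mat 1) / 2 + 3" "\<delta> / 2"] by auto
qed

lemma inf_energy_le_dilation:
  assumes "open \<omega>" "bounded \<omega>"
  shows "inf_energy W \<phi> \<omega> h \<le> ennreal (1 / h) * (\<integral>\<^sup>+x\<in>Omega \<omega> h. W (exp (\<phi> 0 - \<phi> (x $ 3)) *\<^sub>R mat 1) \<partial>lebesgue)"
proof -
  let ?c = "exp (\<phi> 0)"
  have "has_jac (\<lambda>x::real^3. ?c *\<^sub>R x) (\<lambda>x. ?c *\<^sub>R mat 1)"
    by (simp add: has_jac_def mat_1_nth has_grad_cmult[OF has_grad_coord])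
  moreover have "bounded (Omega \<omega> h)"
    using Omega_subset_cbox[OF assms(2)] bounded_subset[OF bounded_cbox] by metis
  ultimately have "sobolev12 (Omega \<omega> h) (\<lambda>x. ?c *\<^sub>R x) (\<lambda>x. ?c *\<^sub>R mat 1)"
    using sobolev12_if_has_jac[OF open_Omega[OF assms(1)]] by blast
  then have "inf_energy W \<phi> \<omega> h \<le> energy W \<phi> \<omega> h (\<lambda>x. ?c *\<^sub>R mat 1)"
    unfolding inf_energy_def by (intro INF_lower2[of "(\<lambda>x. ?c *\<^sub>R x, \<lambda>x. ?c *\<^sub>R mat 1)"]) auto
  then show ?thesis
    by (simp add: energy_def inv_sqrt_metricG scaleR_mat_1_mult mult_exp_exp)
qed

locale film = admissible W + flat_metric \<phi> n for W \<phi> n +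
  fixes \<omega> :: "(real^2) set"
  assumes open_\<omega>: "open \<omega>" and bounded_\<omega>: "bounded \<omega>"
begin

lemma inf_energy_le_if_pointwise:
  assumes pointwise: "\<And>x. x \<in> Omega \<omega> h \<Longrightarrow> W (exp (\<phi> 0 - \<phi> (x $ 3)) *\<^sub>R mat 1) \<le> ennreal c"
    and volume: "emeasure lebesgue (Omega \<omega> h) \<le> ennreal (C * h)" and pos: "c \<ge> 0" "C \<ge> 0" "h > 0"
  shows "inf_energy W \<phi> \<omega> h \<le> ennreal (c * C)"
proof -
  have "inf_energy W \<phi> \<omega> h \<le> ennreal (1 / h) * (\<integral>\<^sup>+x\<in>Omega \<omega> h. W (exp (\<phi> 0 - \<phi> (x $ 3)) *\<^sub>R mat 1) \<partial>lebesgue)"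
    by (rule inf_energy_le_dilation[OF open_\<omega> bounded_\<omega>])
  also have "\<dots> \<le> ennreal (1 / h) * (\<integral>\<^sup>+x\<in>Omega \<omega> h. ennreal c \<partial>lebesgue)"
    using pointwise by (intro mult_left_mono nn_integral_mono) (auto simp: indicator_def)
  also have "\<dots> = ennreal (1 / h) * (ennreal c * emeasure lebesgue (Omega \<omega> h))"
    using open_Omega[OF open_\<omega>] by (subst nn_integral_cmult_indicator) auto
  also have "\<dots> \<le> ennreal (1 / h) * (ennreal c * ennreal (C * h))"
    using volume by (intro mult_left_mono) auto
  also have "\<dots> = ennreal (1 / h * (c * (C * h)))" using pos by (simp flip: ennreal_mult')
  finally show ?thesis using pos(3) by simp
qed

theorem inf_energy_le:
  obtains C h0 where "C > 0" "h0 > 0" "h0 \<le> 1" "\<And>h. 0 < h \<Longrightarrow> h < h0 \<Longrightarrow> inf_energy W \<phi> \<omega> h \<le> ennreal (C * h^(2 * n))"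
proof -
  obtain h1 where h1: "h1 > 0" "h1 \<le> 1" and expansion: "\<And>h t. 0 < h \<Longrightarrow> h < h1 \<Longrightarrow> \<bar>t\<bar> \<le> 1 / 2 \<Longrightarrow>
    \<bar>exp (\<phi> 0 - \<phi> (h * t)) - 1 + a * h^n * t^n\<bar> \<le> 1 * h^n"
    by (rule conformal_factor_expansion[of 1]) auto
  obtain C \<delta> where C: "C > 0" "\<delta> > 0" and W_le: "\<And>s. \<bar>s\<bar> < \<delta> \<Longrightarrow> W ((1 + s) *\<^sub>R mat 1) \<le> ennreal (C * s^2)"
    using W_near_identity_le by blast
  obtain C' where C': "C' > 0" "\<And>h. h > 0 \<Longrightarrow> emeasure lebesgue (Omega \<omega> h) \<le> ennreal (C' * h)"
    using emeasure_Omega_le[OF bounded_\<omega>] by blast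
  define k where "k = \<bar>a\<bar> + 1"
  define h0 where "h0 = min h1 (\<delta> / k)"
  have "inf_energy W \<phi> \<omega> h \<le> ennreal (C * k^2 * C' * h^(2 * n))" if h: "0 < h" "h < h0" for h
  proof -
    have small: "h < h1" "k * h < \<delta>" "h \<le> 1" using h h1 by (auto simp: h0_def k_def field_simps)
    have pointwise: "W (exp (\<phi> 0 - \<phi> (x $ 3)) *\<^sub>R mat 1) \<le> ennreal (C * (k * h^n)^2)" if x: "x \<in> Omega \<omega> h" for x
    proof -
      define s where "s = exp (\<phi> 0 - \<phi> (x $ 3)) - 1"
      have t: "\<bar>x $ 3 / h\<bar> \<le> 1 / 2" using x h(1) by (simp add: Omega_def field_simps)
      have "\<bar>s + a * h^n * (x $ 3 / h)^n\<bar> \<le> 1 * h^n" using expansion[OF h(1) small(1) t] h(1) by (simp add: s_def)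
      then have s: "\<bar>s\<bar> \<le> k * h^n"
        unfolding k_def using abs_le_if_expansion[OF t, of s "- a" "h^n" n 1] h(1) by simp
      also have "k * h^n \<le> k * h" using power_decreasing[of 1 n h] h(1) small(3) n by (intro mult_left_mono) (auto simp: k_def)
      finally have "W ((1 + s) *\<^sub>R mat 1) \<le> ennreal (C * s^2)" using small(2) by (intro W_le) simp
      also have "\<dots> \<le> ennreal (C * (k * h^n)^2)"
        using C(1) s by (intro ennreal_leI mult_left_mono abs_le_square_iff[THEN iffD1]) auto
      finally show ?thesis by (simp add: s_def)
    qed
    have "inf_energy W \<phi> \<omega> h \<le> ennreal (C * (k * h^n)^2 * C')"
      using C(1) C'(1) h(1) by (intro inf_energy_le_if_pointwise pointwise C'(2)) auto
    then show ?thesis by (simp add: power_mult_distrib power_mult[symmetric] mult_ac)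
  qed
  then show ?thesis using C C'(1) h1 by (intro that[of "C * k^2 * C'" h0]) (auto simp: h0_def k_def)
qed

end

section \<open>The lower bound\<close>

lemma nn_integral_affine_image:
  fixes f :: "'a::euclidean_space \<Rightarrow> ennreal"
  assumes [measurable]: "f \<in> borel_measurable borel" and K: "compact K" and h: "h > 0"
  shows "(\<integral>\<^sup>+x\<in>(\<lambda>y. p + h *\<^sub>R y) ` K. f x \<partial>lborel) = ennreal (h ^ DIM('a)) * (\<integral>\<^sup>+y\<in>K. f (p + h *\<^sub>R y) \<partial>lborel)"
proof -
  let ?T = "\<lambda>y. p + h *\<^sub>R y"
  have "compact (?T ` K)" by (intro compact_continuous_image K continuous_intros)
  then have [measurable]: "?T ` K \<in> sets borel" by (rule borel_compact)
  have "inj ?T" using h by (auto simp: inj_def)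
  from inj_image_mem_iff[OF this] have "indicator (?T ` K) (?T y) = (indicator K y :: ennreal)" for y
    by (simp add: indicator_def)
  then show ?thesis using nn_integral_lborel_affine[of "\<lambda>x. f x * indicator (?T ` K) x" h p] h by simp
qed

lemma has_jac_rescale:
  assumes "has_jac v V" "h \<noteq> 0"
  shows "has_jac (\<lambda>x. (c / h) *\<^sub>R v (p + h *\<^sub>R x)) (\<lambda>x. c *\<^sub>R V (p + h *\<^sub>R x))"
  unfolding has_jac_def
proof
  fix i
  have "has_grad (\<lambda>x. c / h * v (p + h *\<^sub>R x) $ i) (\<lambda>x. (c / h) *\<^sub>R (h *\<^sub>R V (p + h *\<^sub>R x) $ i))"
    by (rule has_grad_cmult[OF has_grad_affine[OF has_jac_nth[OF assms(1)]]])
  then show "has_grad (\<lambda>x. ((c / h) *\<^sub>R v (p + h *\<^sub>R x)) $ i) (\<lambda>x. (c *\<^sub>R V (p + h *\<^sub>R x)) $ i)"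
    by (rule has_grad_cong) (use assms(2) in auto)
qed

lemma jac_limit_rescale:
  assumes limit: "jac_limit ((\<lambda>y. p + h *\<^sub>R y) ` K) D" and [measurable]: "D \<in> borel_measurable borel"
    and K: "compact K" and h: "h > 0" and c: "c \<noteq> 0"
  shows "jac_limit K (\<lambda>y. c *\<^sub>R D (p + h *\<^sub>R y))"
  unfolding jac_limit_def
proof (intro allI impI)
  fix e :: real
  assume e: "e > 0"
  then have "h^3 * (e / c^2) > 0" using h c by simp
  then obtain v V where V: "has_jac v V" and close: "nn_L2sq ((\<lambda>y. p + h *\<^sub>R y) ` K) (\<lambda>x. V x - D x) \<le> ennreal (h^3 * (e / c^2))"
    using limit unfolding jac_limit_def by blast
  have [measurable]: "V \<in> borel_measurable borel" by (rule borel_measurable_continuous_onI[OF has_jac_continuous(1)[OF V]])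
  have [measurable]: "K \<in> sets borel" using K by (rule borel_compact)
  have "ennreal (h^3) * nn_L2sq K (\<lambda>y. V (p + h *\<^sub>R y) - D (p + h *\<^sub>R y)) \<le> ennreal (h^3 * (e / c^2))"
    using close h nn_integral_affine_image[of "\<lambda>x. ennreal ((norm (V x - D x))^2)" K h p] K by simp
  also have "\<dots> = ennreal (h^3) * ennreal (e / c^2)" using h by (intro ennreal_mult') simp
  finally have "nn_L2sq K (\<lambda>y. V (p + h *\<^sub>R y) - D (p + h *\<^sub>R y)) \<le> ennreal (e / c^2)"
    using h by (simp add: ennreal_mult_le_mult_iff)
  then have "ennreal (c^2) * nn_L2sq K (\<lambda>y. V (p + h *\<^sub>R y) - D (p + h *\<^sub>R y)) \<le> ennreal (c^2) * ennreal (e / c^2)"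
    by (rule mult_left_mono) simp
  moreover have "nn_L2sq K (\<lambda>y. c *\<^sub>R V (p + h *\<^sub>R y) - c *\<^sub>R D (p + h *\<^sub>R y))
    = ennreal (c^2) * nn_L2sq K (\<lambda>y. V (p + h *\<^sub>R y) - D (p + h *\<^sub>R y))"
    by (subst nn_integral_cmult[symmetric])
      (simp_all add: power_mult_distrib ennreal_mult mult.assoc flip: scaleR_diff_right)
  moreover have "ennreal (c^2) * ennreal (e / c^2) = ennreal e" using c e by (simp flip: ennreal_mult)
  ultimately have "nn_L2sq K (\<lambda>y. c *\<^sub>R V (p + h *\<^sub>R y) - c *\<^sub>R D (p + h *\<^sub>R y)) \<le> ennreal e" by simp
  moreover have "has_jac (\<lambda>y. (c / h) *\<^sub>R v (p + h *\<^sub>R y)) (\<lambda>y. c *\<^sub>R V (p + h *\<^sub>R y))"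
    using h by (intro has_jac_rescale[OF V]) simp
  ultimately show "\<exists>v V. has_jac v V \<and> nn_L2sq K (\<lambda>y. V y - c *\<^sub>R D (p + h *\<^sub>R y)) \<le> ennreal e" by blast
qed

definition grid_point :: "real \<Rightarrow> int \<times> int \<Rightarrow> real^2" where
  "grid_point r z = vector [2 * r * of_int (fst z), 2 * r * of_int (snd z)]"

definition tile :: "real \<Rightarrow> int \<times> int \<Rightarrow> (real^2) set" where
  "tile r z = cbox (grid_point r z - vec r) (grid_point r z + vec r)"

lemma mem_tile: "q \<in> tile r z \<longleftrightarrow> \<bar>q $ 1 - 2 * r * of_int (fst z)\<bar> \<le> r \<and> \<bar>q $ 2 - 2 * r * of_int (snd z)\<bar> \<le> r"
  by (auto simp: tile_def grid_point_def mem_box_cart forall_2 abs_le_iff)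

lemma emeasure_tile:
  assumes "r > 0"
  shows "emeasure lborel (tile r z) = ennreal (4 * r^2)"
proof -
  have "cbox (grid_point r z - vec r) (grid_point r z + vec r) \<noteq> {}"
    using assms by (simp add: interval_ne_empty_cart)
  from content_cbox_cart[OF this] have "measure lborel (tile r z) = 4 * r^2"
    unfolding tile_def UNIV_2 by (simp add: power2_eq_square)
  then show ?thesis by (simp add: tile_def emeasure_eq_measure2[OF fmeasurable_cbox])
qed

lemma tile_cover:
  assumes "r > 0"
  shows "\<exists>z. q \<in> tile r z"
proof -
  have "\<bar>x - 2 * r * of_int (round (x / (2 * r)))\<bar> \<le> r" for x
  proof -
    have "x - 2 * r * of_int (round (x / (2 * r))) = - (2 * r) * (of_int (round (x / (2 * r))) - x / (2 * r))"
      using assms by (simp add: right_diff_distrib)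
    then have "\<bar>x - 2 * r * of_int (round (x / (2 * r)))\<bar> = 2 * r * \<bar>of_int (round (x / (2 * r))) - x / (2 * r)\<bar>"
      using assms by (simp add: abs_mult)
    also have "\<dots> \<le> 2 * r * (1 / 2)" using assms by (intro mult_left_mono of_int_round_abs_le) auto
    finally show ?thesis by simp
  qed
  then show ?thesis
    by (intro exI[of _ "(round (q $ 1 / (2 * r)), round (q $ 2 / (2 * r)))"]) (simp add: mem_tile)
qed

lemma dist_tile_le:
  assumes "p \<in> tile r z" "q \<in> tile r z"
  shows "dist p q \<le> 4 * r"
proof -
  have "norm (p - q) \<le> \<bar>p $ 1 - q $ 1\<bar> + \<bar>p $ 2 - q $ 2\<bar>" using norm_le_l1_cart[of "p - q"] by (simp add: sum_2)
  then show ?thesis using assms unfolding mem_tile dist_norm by linarith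
qed

lemma finite_tiles_meeting:
  assumes K: "bounded K" and r: "r > 0"
  shows "finite {z. tile r z \<inter> K \<noteq> {}}"
proof -
  obtain M where M: "\<And>q. q \<in> K \<Longrightarrow> norm q \<le> M" using K unfolding bounded_iff by blast
  define m where "m = \<lceil>(M + r) / (2 * r)\<rceil>"
  have index: "i \<in> {-m..m}" if "\<bar>x - 2 * r * of_int i\<bar> \<le> r" "\<bar>x\<bar> \<le> M" for x and i :: int
  proof -
    have "2 * r * \<bar>of_int i\<bar> = \<bar>2 * r * of_int i\<bar>" using r by (simp add: abs_mult)
    also have "\<dots> \<le> M + r" using that by linarith
    finally have "\<bar>real_of_int i\<bar> \<le> (M + r) / (2 * r)" using r by (simp add: pos_le_divide_eq mult.commute)
    then have "\<bar>real_of_int i\<bar> \<le> of_int m" unfolding m_def using le_of_int_ceiling order_trans by blast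
    then show ?thesis by (simp add: abs_le_iff)
  qed
  have "z \<in> {-m..m} \<times> {-m..m}" if "q \<in> tile r z" "q \<in> K" for q z
    using index[of "q $ 1" "fst z"] index[of "q $ 2" "snd z"] that M[of q] component_le_norm_cart[of q]
    unfolding mem_tile mem_Times_iff by (meson order_trans)
  then have "{z. tile r z \<inter> K \<noteq> {}} \<subseteq> {-m..m} \<times> {-m..m}" by blast
  then show ?thesis by (rule finite_subset) simp
qed

lemma measure_le_tiles_meeting:
  assumes K: "compact K" and r: "r > 0"
  shows "measure lborel K \<le> real (card {z. tile r z \<inter> K \<noteq> {}}) * (4 * r^2)"
proof -
  let ?I = "{z. tile r z \<inter> K \<noteq> {}}"
  have tile_sets: "tile r z \<in> sets lborel" for z by (simp add: tile_def)
  note finite = finite_tiles_meeting[OF compact_imp_bounded[OF K] r]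
  have "ennreal (measure lborel K) = emeasure lborel K"
    using emeasure_compact_finite[OF K] by (intro emeasure_eq_ennreal_measure[symmetric]) (simp add: less_top)
  also have "\<dots> \<le> emeasure lborel (\<Union>z\<in>?I. tile r z)"
    using tile_cover[OF r] finite tile_sets by (intro emeasure_mono) blast+
  also have "\<dots> \<le> (\<Sum>z\<in>?I. emeasure lborel (tile r z))"
    using finite tile_sets by (intro emeasure_subadditive_finite) auto
  also have "\<dots> = ennreal (real (card ?I) * (4 * r^2))"
    by (simp add: emeasure_tile[OF r] ennreal_of_nat_eq_real_of_nat flip: ennreal_mult')
  finally show ?thesis by (subst (asm) ennreal_le_iff) auto
qed

lemma tiles_inside_exist:
  assumes \<omega>: "open \<omega>" and K: "compact K" "K \<subseteq> \<omega>"
  obtains r0 where "r0 > 0" "\<And>r. 0 < r \<Longrightarrow> r < r0 \<Longrightarrow>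
    \<exists>I. finite I \<and> (\<forall>z\<in>I. tile r z \<subseteq> \<omega>) \<and> measure lborel K \<le> real (card I) * (4 * r^2)"
proof -
  obtain d where d: "d > 0" "(\<Union>x\<in>K. ball x d) \<subseteq> \<omega>"
    using compact_subset_open_imp_ball_epsilon_subset[OF K(1) \<omega> K(2)] by blast
  have "tile r z \<subseteq> \<omega>" if r: "r < d / 4" and z: "tile r z \<inter> K \<noteq> {}" for r z
  proof -
    obtain k where k: "k \<in> tile r z" "k \<in> K" using z by blast
    have "q \<in> ball k d" if "q \<in> tile r z" for q using dist_tile_le[OF k(1) that] r by simp
    then show ?thesis using d(2) k(2) by blast
  qed
  then show ?thesis
    using d(1) finite_tiles_meeting[OF compact_imp_bounded[OF K(1)]] measure_le_tiles_meeting[OF K(1)]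
    by (intro that[of "d / 4"] exI[of _ "{z. tile _ z \<inter> K \<noteq> {}}"]) auto
qed

lemma compact_inner_approximation:
  fixes S :: "'a::euclidean_space set"
  assumes S [measurable]: "S \<in> sets borel" "bounded S" and e: "e > 0"
  obtains K where "compact K" "K \<subseteq> S" "measure lborel S \<le> measure lborel K + e"
proof -
  have "S \<in> sets lebesgue" using S(1) by simp
  then obtain K where K: "closed K" "K \<subseteq> S" "emeasure lebesgue (S - K) < ennreal e"
    using e by (rule sets_lebesgue_inner_closed)
  have [measurable]: "K \<in> sets borel" using K(1) by simp
  have finite: "S \<in> fmeasurable lborel" "S - K \<in> fmeasurable lborel"
    using emeasure_bounded_finite[OF S(2)] emeasure_bounded_finite[OF bounded_subset[OF S(2)], of "S - K"]
    by (auto intro!: fmeasurableI)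
  have "measure lborel (S - K) < e"
    using K(3) emeasure_eq_measure2[OF finite(2)] by (simp add: ennreal_less_iff)
  moreover have "measure lborel (S - K) = measure lborel S - measure lborel K"
    by (rule measurable_measure_Diff[OF finite(1) _ K(2)]) simp
  ultimately have "measure lborel S \<le> measure lborel K + e" by simp
  moreover have "compact K" using K(1) bounded_subset[OF S(2) K(2)] by (simp add: compact_eq_bounded_closed)
  ultimately show ?thesis using K(2) that by blast
qed

lemma measure_lborel_open_pos:
  fixes S :: "'a::euclidean_space set"
  assumes S: "open S" "bounded S" "S \<noteq> {}"
  shows "measure lborel S > 0"
proof -
  have "emeasure lborel S \<noteq> 0"
    using open_not_negligible[OF S(1,3)] S(1) by (auto simp: negligible_iff_emeasure0)
  then show ?thesis using emeasure_bounded_finite[OF S(2)]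
    by (simp add: measure_def enn2real_positive_iff zero_less_iff_neq_zero)
qed

lemma half_tiles_exist:
  assumes \<omega>: "open \<omega>" "bounded \<omega>" "\<omega> \<noteq> {}"
  obtains r0 where "r0 > 0" "\<And>r. 0 < r \<Longrightarrow> r < r0 \<Longrightarrow>
    \<exists>I. finite I \<and> (\<forall>z\<in>I. tile r z \<subseteq> \<omega>) \<and> measure lborel \<omega> \<le> 2 * (real (card I) * (4 * r^2))"
proof -
  obtain K where K: "compact K" "K \<subseteq> \<omega>" "measure lborel \<omega> \<le> measure lborel K + measure lborel \<omega> / 2"
    using compact_inner_approximation[of \<omega> "measure lborel \<omega> / 2"] \<omega>(1,2) measure_lborel_open_pos[OF \<omega>] by auto
  obtain r0 where "r0 > 0" "\<And>r. 0 < r \<Longrightarrow> r < r0 \<Longrightarrow>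
    \<exists>I. finite I \<and> (\<forall>z\<in>I. tile r z \<subseteq> \<omega>) \<and> measure lborel K \<le> real (card I) * (4 * r^2)"
    using tiles_inside_exist[OF \<omega>(1) K(1,2)] by blast
  then show ?thesis using K(3) by (intro that[of r0]) fastforce+
qed

definition cell_center :: "real \<Rightarrow> int \<times> int \<Rightarrow> real^3" where
  "cell_center r z = vector [2 * r * of_int (fst z), 2 * r * of_int (snd z), 0]"

definition scaled_cell :: "real \<Rightarrow> real \<Rightarrow> int \<times> int \<Rightarrow> (real^3) set" where
  "scaled_cell l h z = (\<lambda>y. cell_center ((l + 1 / 4) * h) z + h *\<^sub>R y) ` large_cell l"

lemma compact_scaled_cell: "compact (scaled_cell l h z)"
  unfolding scaled_cell_def by (intro compact_continuous_image compact_cuboid continuous_intros)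

lemma scaled_cell_bounds:
  assumes x: "x \<in> scaled_cell l h z" and h: "h > 0"
  shows "\<bar>x $ 1 - 2 * ((l + 1 / 4) * h) * of_int (fst z)\<bar> \<le> (l + 1 / 8) * h"
    "\<bar>x $ 2 - 2 * ((l + 1 / 4) * h) * of_int (snd z)\<bar> \<le> (l + 1 / 8) * h" "\<bar>x $ 3\<bar> \<le> 3 / 8 * h"
proof -
  obtain y where y: "x = cell_center ((l + 1 / 4) * h) z + h *\<^sub>R y" "y \<in> large_cell l"
    using x unfolding scaled_cell_def by blast
  have "\<bar>y $ 1\<bar> \<le> l + 1 / 8" "\<bar>y $ 2\<bar> \<le> l + 1 / 8" "\<bar>y $ 3\<bar> \<le> 3 / 8"
    using y(2) by (auto simp: mem_cuboid forall_3)
  then have "\<bar>y $ 1\<bar> * h \<le> (l + 1 / 8) * h" "\<bar>y $ 2\<bar> * h \<le> (l + 1 / 8) * h" "\<bar>y $ 3\<bar> * h \<le> 3 / 8 * h"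
    using h by (simp_all add: mult_right_mono)
  then show "\<bar>x $ 1 - 2 * ((l + 1 / 4) * h) * of_int (fst z)\<bar> \<le> (l + 1 / 8) * h"
    "\<bar>x $ 2 - 2 * ((l + 1 / 4) * h) * of_int (snd z)\<bar> \<le> (l + 1 / 8) * h" "\<bar>x $ 3\<bar> \<le> 3 / 8 * h"
    using h by (simp_all add: y(1) cell_center_def abs_mult mult.commute[of h])
qed

lemma scaled_cell_subset_Omega:
  assumes "tile ((l + 1 / 4) * h) z \<subseteq> \<omega>" "h > 0"
  shows "scaled_cell l h z \<subseteq> Omega \<omega> h"
proof
  fix x assume x: "x \<in> scaled_cell l h z"
  have "(l + 1 / 8) * h \<le> (l + 1 / 4) * h" using assms(2) by simp
  then have "vector [x $ 1, x $ 2] \<in> tile ((l + 1 / 4) * h) z"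
    using scaled_cell_bounds(1,2)[OF x assms(2)] by (simp add: mem_tile del: mult_le_cancel_right)
  moreover have "\<bar>x $ 3\<bar> < h / 2" using scaled_cell_bounds(3)[OF x assms(2)] assms(2) by simp
  ultimately show "x \<in> Omega \<omega> h" using assms(1) by (auto simp: Omega_def)
qed

lemma grid_index_unique:
  fixes i j :: int and r s :: real
  assumes "\<bar>s - 2 * r * of_int i\<bar> < r" "\<bar>s - 2 * r * of_int j\<bar> < r"
  shows "i = j"
proof (rule ccontr)
  assume "i \<noteq> j"
  then have "1 \<le> \<bar>real_of_int i - real_of_int j\<bar>" by linarith
  moreover have "r > 0" using assms(1) by linarith
  ultimately have "2 * r * 1 \<le> 2 * r * \<bar>real_of_int i - real_of_int j\<bar>" by (intro mult_left_mono) auto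
  also have "\<dots> = \<bar>2 * r * of_int i - 2 * r * of_int j\<bar>"
    using \<open>r > 0\<close> by (simp add: abs_mult flip: right_diff_distrib)
  finally show False using assms by linarith
qed

lemma disjoint_scaled_cells:
  assumes h: "h > 0"
  shows "disjoint_family_on (scaled_cell l h) I"
proof -
  have "z = z'" if x: "x \<in> scaled_cell l h z" "x \<in> scaled_cell l h z'" for x z z'
  proof -
    have strict: "t < (l + 1 / 4) * h" if "t \<le> (l + 1 / 8) * h" for t
      using that h mult_strict_right_mono[of "l + 1 / 8" "l + 1 / 4" h] by linarith
    note bounds = scaled_cell_bounds(1,2)[OF x(1) h, THEN strict] scaled_cell_bounds(1,2)[OF x(2) h, THEN strict]
    show ?thesis by (rule prod_eqI[OF grid_index_unique[OF bounds(1,3)] grid_index_unique[OF bounds(2,4)]])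
  qed
  then show ?thesis unfolding disjoint_family_on_def by blast
qed

context film
begin

definition conformal_factor :: "real \<Rightarrow> real \<Rightarrow> real" where
  "conformal_factor h t = (if t \<in> {-1/2..1/2} then exp (\<phi> 0 - \<phi> (h * t)) else 1)"

lemma conformal_factor_eq: "\<bar>t\<bar> \<le> 1 / 2 \<Longrightarrow> conformal_factor h t = exp (\<phi> 0 - \<phi> (h * t))"
  by (auto simp: conformal_factor_def abs_le_iff)

lemma conformal_factor_measurable:
  assumes h: "0 < h" "h < 1"
  shows "conformal_factor h \<in> borel_measurable borel"
  unfolding conformal_factor_def[abs_def]
proof (rule borel_measurable_continuous_on_if)
  have \<phi>: "continuous_on {-1/2<..<1/2} \<phi>" using smooth[unfolded smooth_on_def, rule_format, of 0] by simp
  have "h * t \<in> {-1/2<..<1/2}" if "t \<in> {-1/2..1/2}" for t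
  proof -
    have "\<bar>h * t\<bar> \<le> h * (1 / 2)" unfolding abs_mult using that h(1) by (intro mult_mono) auto
    then have "\<bar>h * t\<bar> < 1 / 2" using h(2) by linarith
    then show ?thesis unfolding abs_less_iff by auto
  qed
  then have "continuous_on {-1/2..1/2} (\<lambda>t. \<phi> (h * t))"
    by (intro continuous_on_compose2[OF \<phi>] continuous_intros) auto
  then show "continuous_on {-1/2..1/2} (\<lambda>t. exp (\<phi> 0 - \<phi> (h * t)))" by (intro continuous_intros)
qed auto

definition scaled_density :: "real \<Rightarrow> (real^3 \<Rightarrow> real^3^3) \<Rightarrow> real^3 \<Rightarrow> ennreal" where
  "scaled_density h D x = W (conformal_factor h (x $ 3 / h) *\<^sub>R exp (- \<phi> 0) *\<^sub>R D x)"

lemma scaled_density_measurable: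
  assumes h: "0 < h" "h < 1" and [measurable]: "D \<in> borel_measurable borel"
  shows "scaled_density h D \<in> borel_measurable borel"
proof -
  have [measurable]: "(\<lambda>x::real^3. conformal_factor h (x $ 3 / h)) \<in> borel_measurable borel"
    by (rule measurable_compose[OF _ conformal_factor_measurable[OF h]]) measurable
  show ?thesis unfolding scaled_density_def[abs_def] by measurable
qed

lemma scaled_density_eq:
  assumes "x \<in> Omega \<omega> h" "h > 0"
  shows "scaled_density h D x = W (D x ** inv_sqrt (metricG \<phi> x))"
proof -
  have "\<bar>x $ 3 / h\<bar> \<le> 1 / 2" using assms by (simp add: Omega_def field_simps)
  moreover have "A ** (c *\<^sub>R mat 1) = c *\<^sub>R A" for A :: "real^3^3" and c
    by (simp add: matrix_eq scaleR_mat_1_mult_vec matrix_vector_mult_scaleR scaleR_matrix_vector_assoc[symmetric]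
      flip: matrix_vector_mul_assoc)
  ultimately show ?thesis
    using assms(2) by (simp add: scaled_density_def conformal_factor_eq inv_sqrt_metricG mult_exp_exp)
qed

lemma scaled_cell_energy:
  assumes h: "0 < h" "h < 1" and [measurable]: "D \<in> borel_measurable borel"
    and cell: "ennreal E \<le> cell_energy l (conformal_factor h)
      (\<lambda>y. exp (- \<phi> 0) *\<^sub>R D (cell_center ((l + 1 / 4) * h) z + h *\<^sub>R y))"
  shows "ennreal (h^3) * ennreal E \<le> (\<integral>\<^sup>+x\<in>scaled_cell l h z. scaled_density h D x \<partial>lborel)"
proof -
  have "(cell_center ((l + 1 / 4) * h) z + h *\<^sub>R y) $ 3 / h = y $ 3" for y
    using h(1) by (simp add: cell_center_def)
  then have "ennreal E \<le> (\<integral>\<^sup>+y\<in>large_cell l. scaled_density h D (cell_center ((l + 1 / 4) * h) z + h *\<^sub>R y) \<partial>lborel)"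
    using cell by (simp add: scaled_density_def)
  then have "ennreal (h^3) * ennreal E
    \<le> ennreal (h^3) * (\<integral>\<^sup>+y\<in>large_cell l. scaled_density h D (cell_center ((l + 1 / 4) * h) z + h *\<^sub>R y) \<partial>lborel)"
    by (intro mult_left_mono) auto
  then show ?thesis
    unfolding scaled_cell_def
    by (subst nn_integral_affine_image[OF scaled_density_measurable[OF h] compact_cuboid h(1)]) auto
qed

lemma energy_ge_cells:
  assumes h: "0 < h" "h < 1" and I: "finite I" "\<And>z. z \<in> I \<Longrightarrow> tile ((l + 1 / 4) * h) z \<subseteq> \<omega>" and "E \<ge> 0"
    and D: "D \<in> borel_measurable borel" "AE x in lborel. x \<in> Omega \<omega> h \<longrightarrow> D x = Du x"
    and cell: "\<And>z. z \<in> I \<Longrightarrow> ennreal E \<le> cell_energy l (conformal_factor h)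
      (\<lambda>y. exp (- \<phi> 0) *\<^sub>R D (cell_center ((l + 1 / 4) * h) z + h *\<^sub>R y))"
  shows "ennreal (real (card I) * h^2 * E) \<le> energy W \<phi> \<omega> h Du"
proof -
  have [measurable]: "scaled_cell l h z \<in> sets borel" for z by (rule borel_compact[OF compact_scaled_cell])
  note [measurable] = scaled_density_measurable[OF h D(1)]
  have "ennreal (real (card I) * (h^3 * E)) = (\<Sum>z\<in>I. ennreal (h^3) * ennreal E)"
    using h(1) \<open>E \<ge> 0\<close> by (simp add: ennreal_of_nat_eq_real_of_nat ennreal_mult)
  also have "\<dots> \<le> (\<Sum>z\<in>I. \<integral>\<^sup>+x\<in>scaled_cell l h z. scaled_density h D x \<partial>lborel)"
    by (intro sum_mono scaled_cell_energy h D(1) cell)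
  also have "\<dots> = (\<integral>\<^sup>+x. (\<Sum>z\<in>I. scaled_density h D x * indicator (scaled_cell l h z) x) \<partial>lborel)"
    by (rule nn_integral_sum[symmetric]) measurable
  also have "\<dots> = (\<integral>\<^sup>+x\<in>(\<Union>z\<in>I. scaled_cell l h z). scaled_density h D x \<partial>lborel)"
    by (simp add: indicator_UN_disjoint[OF I(1) disjoint_scaled_cells[OF h(1)]] sum_distrib_left)
  also have "\<dots> \<le> (\<integral>\<^sup>+x\<in>Omega \<omega> h. W (Du x ** inv_sqrt (metricG \<phi> x)) \<partial>lborel)"
  proof (rule nn_integral_mono_AE)
    have cells_in: "(\<Union>z\<in>I. scaled_cell l h z) \<subseteq> Omega \<omega> h" using scaled_cell_subset_Omega[OF I(2) h(1)] by blast
    from D(2) show "AE x in lborel. scaled_density h D x * indicator (\<Union>z\<in>I. scaled_cell l h z) x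
      \<le> W (Du x ** inv_sqrt (metricG \<phi> x)) * indicator (Omega \<omega> h) x"
      by eventually_elim (use cells_in in \<open>auto split: split_indicator simp: scaled_density_eq[OF _ h(1)]\<close>)
  qed
  also have "\<dots> = (\<integral>\<^sup>+x\<in>Omega \<omega> h. W (Du x ** inv_sqrt (metricG \<phi> x)) \<partial>lebesgue)"
    by (rule nn_integral_completion[symmetric])
  finally have "ennreal (1 / h) * ennreal (real (card I) * (h^3 * E)) \<le> energy W \<phi> \<omega> h Du"
    unfolding energy_def by (rule mult_left_mono) simp
  moreover have "1 / h * (real (card I) * (h^3 * E)) = real (card I) * h^2 * E"
    using h(1) by (simp add: power2_eq_square power3_eq_cube)
  ultimately show ?thesis using h(1) by (simp flip: ennreal_mult')
qed

lemma energy_ge_tiles: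
  assumes Du: "sobolev12 (Omega \<omega> h) u Du" and h: "0 < h" "h < 1"
    and I: "finite I" "\<And>z. z \<in> I \<Longrightarrow> tile ((l + 1 / 4) * h) z \<subseteq> \<omega>" and "E \<ge> 0"
    and cell: "\<And>D. D \<in> borel_measurable borel \<Longrightarrow> jac_limit (large_cell l) D \<Longrightarrow>
      ennreal E \<le> cell_energy l (conformal_factor h) D"
  shows "ennreal (real (card I) * h^2 * E) \<le> energy W \<phi> \<omega> h Du"
proof -
  have "bounded (Omega \<omega> h)" using Omega_subset_cbox[OF bounded_\<omega>] bounded_subset[OF bounded_cbox] by metis
  then obtain D where D: "D \<in> borel_measurable borel" "AE x in lborel. x \<in> Omega \<omega> h \<longrightarrow> D x = Du x"
    and limit: "\<And>K. compact K \<Longrightarrow> K \<subseteq> Omega \<omega> h \<Longrightarrow> jac_limit K D"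
    using sobolev12_jac_limit[OF open_Omega[OF open_\<omega>] _ Du] by blast
  note [measurable] = D(1)
  show ?thesis
  proof (rule energy_ge_cells[OF h I \<open>E \<ge> 0\<close> D])
    fix z assume "z \<in> I"
    then have "jac_limit (scaled_cell l h z) D"
      using scaled_cell_subset_Omega[OF I(2) h(1)] by (intro limit compact_scaled_cell)
    then have "jac_limit (large_cell l) (\<lambda>y. exp (- \<phi> 0) *\<^sub>R D (cell_center ((l + 1 / 4) * h) z + h *\<^sub>R y))"
      unfolding scaled_cell_def by (rule jac_limit_rescale[OF _ D(1) compact_cuboid h(1)]) simp
    then show "ennreal E \<le> cell_energy l (conformal_factor h)
      (\<lambda>y. exp (- \<phi> 0) *\<^sub>R D (cell_center ((l + 1 / 4) * h) z + h *\<^sub>R y))"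
      by (intro cell) measurable
  qed
qed

lemma energy_ge_area:
  assumes Du: "sobolev12 (Omega \<omega> h) u Du" and h: "0 < h" "h < 1" and l: "l \<ge> 1"
    and I: "finite I" "\<And>z. z \<in> I \<Longrightarrow> tile ((l + 1 / 4) * h) z \<subseteq> \<omega>" and E: "E \<ge> 0"
    and card: "measure lborel \<omega> \<le> 2 * (real (card I) * (4 * ((l + 1 / 4) * h)^2))"
    and cell: "\<And>D. D \<in> borel_measurable borel \<Longrightarrow> jac_limit (large_cell l) D \<Longrightarrow> ennreal E \<le> cell_energy l (conformal_factor h) D"
  shows "ennreal (measure lborel \<omega> / (32 * l^2) * E) \<le> energy W \<phi> \<omega> h Du"
proof -
  have "((l + 1 / 4) * h)^2 \<le> (2 * l * h)^2" using l h(1) by (intro power_mono mult_right_mono) auto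
  then have "2 * (real (card I) * (4 * ((l + 1 / 4) * h)^2)) \<le> 2 * (real (card I) * (4 * (2 * l * h)^2))"
    by (intro mult_left_mono) auto
  also have "\<dots> = (32 * l^2) * (real (card I) * h^2)" by (simp add: power_mult_distrib)
  finally have "measure lborel \<omega> / (32 * l^2) \<le> real (card I) * h^2"
    using card l by (simp add: pos_divide_le_eq mult.commute)
  then have "ennreal (measure lborel \<omega> / (32 * l^2) * E) \<le> ennreal (real (card I) * h^2 * E)"
    using E by (intro ennreal_leI mult_right_mono)
  also have "\<dots> \<le> energy W \<phi> \<omega> h Du" by (rule energy_ge_tiles[OF Du h I E cell])
  finally show ?thesis .
qed

theorem inf_energy_ge:
  assumes nonempty: "\<omega> \<noteq> {}" and a: "a \<noteq> 0"
  obtains h0 where "h0 > 0" "h0 \<le> 1" "\<And>h. 0 < h \<Longrightarrow> h < h0 \<Longrightarrow>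
    ennreal (moment_const n^2 / (768 * cutoff_bound^2) * a^2 * measure lborel \<omega> * Q2 W (mat 1) * h^(2 * n)) \<le> inf_energy W \<phi> \<omega> h"
proof -
  define E where "E l = moment_const n^2 / (24 * cutoff_bound^2) * a^2 * Q2 W (mat 1) * l^2" for l
  have E: "E l \<ge> 0" for l using Q2_pos by (simp add: E_def)
  have "n \<ge> 2" using n by simp
  from cell_energy_bound[OF this a] obtain l \<rho> e0 where l: "l \<ge> 1" and pos: "\<rho> > 0" "e0 > 0"
    and cell: "\<And>e f D. 0 < e \<Longrightarrow> e \<le> e0 \<Longrightarrow> f \<in> borel_measurable borel \<Longrightarrow> D \<in> borel_measurable borel \<Longrightarrow>
      jac_limit (large_cell l) D \<Longrightarrow> (\<forall>t. \<bar>t\<bar> \<le> 1 / 2 \<longrightarrow> \<bar>f t - 1 + a * e * t^n\<bar> \<le> \<rho> * e) \<Longrightarrow>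
      ennreal (E l * e^2) \<le> cell_energy l f D"
    unfolding E_def by blast
  obtain h1 where h1: "h1 > 0" "h1 \<le> 1" and expansion: "\<And>h t. 0 < h \<Longrightarrow> h < h1 \<Longrightarrow> \<bar>t\<bar> \<le> 1 / 2 \<Longrightarrow>
    \<bar>exp (\<phi> 0 - \<phi> (h * t)) - 1 + a * h^n * t^n\<bar> \<le> \<rho> * h^n"
    using conformal_factor_expansion[OF pos(1)] by blast
  obtain r0 where r0: "r0 > 0" and tiles: "\<And>r. 0 < r \<Longrightarrow> r < r0 \<Longrightarrow>
    \<exists>I. finite I \<and> (\<forall>z\<in>I. tile r z \<subseteq> \<omega>) \<and> measure lborel \<omega> \<le> 2 * (real (card I) * (4 * r^2))"
    using half_tiles_exist[OF open_\<omega> bounded_\<omega> nonempty] by blast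
  define h0 where "h0 = min (min h1 e0) (r0 / (l + 1 / 4))"
  have "ennreal (measure lborel \<omega> / (32 * l^2) * (E l * (h^n)^2)) \<le> energy W \<phi> \<omega> h Du"
    if h: "0 < h" "h < h0" and Du: "sobolev12 (Omega \<omega> h) u Du" for h u Du
  proof -
    have small: "h < h1" "h \<le> e0" "h < 1" "(l + 1 / 4) * h < r0" using h(2) h1 l by (auto simp: h0_def field_simps)
    obtain I where I: "finite I" "\<forall>z\<in>I. tile ((l + 1 / 4) * h) z \<subseteq> \<omega>"
      and card: "measure lborel \<omega> \<le> 2 * (real (card I) * (4 * ((l + 1 / 4) * h)^2))"
      using tiles[of "(l + 1 / 4) * h"] l h(1) small(4) by auto
    show ?thesis
    proof (rule energy_ge_area[OF Du h(1) small(3) l I(1) _ _ card])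
      have "h^n \<le> e0" using power_decreasing[of 1 n h] h(1) small n by simp
      then show "ennreal (E l * (h^n)^2) \<le> cell_energy l (conformal_factor h) D"
        if "D \<in> borel_measurable borel" "jac_limit (large_cell l) D" for D
        using h(1) expansion[OF h(1) small(1)]
        by (intro cell conformal_factor_measurable[OF h(1) small(3)] that) (simp_all add: conformal_factor_eq)
    qed (use I(2) E in auto)
  qed
  moreover have "measure lborel \<omega> / (32 * l^2) * (E l * (h^n)^2)
    = moment_const n^2 / (768 * cutoff_bound^2) * a^2 * measure lborel \<omega> * Q2 W (mat 1) * h^(2 * n)" for h
    using l by (simp add: E_def power_mult[symmetric] mult.commute[of n])
  ultimately have "ennreal (moment_const n^2 / (768 * cutoff_bound^2) * a^2 * measure lborel \<omega> * Q2 W (mat 1) * h^(2 * n))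
    \<le> inf_energy W \<phi> \<omega> h" if "0 < h" "h < h0" for h
    using that unfolding inf_energy_def by (intro INF_greatest) auto
  moreover have "h0 > 0" "h0 \<le> 1" using h1 pos(2) r0 l by (auto simp: h0_def)
  ultimately show ?thesis using that by blast
qed

end

definition lower_bound_const :: "nat \<Rightarrow> real" where
  "lower_bound_const n = (if n > 2 then moment_const n^2 / (768 * cutoff_bound^2) / (fact n)^2 else 1)"

lemma lower_bound_const_pos: "lower_bound_const n > 0"
  using moment_const_pos[of n] cutoff_bound_pos by (auto simp: lower_bound_const_def)

lemma Liminf_divide_power_ge:
  assumes c: "c \<ge> 0" and h0: "h0 > 0" and f: "\<And>h. 0 < h \<Longrightarrow> h < h0 \<Longrightarrow> ennreal (c * h^m) \<le> f h"
  shows "ennreal c \<le> Liminf (at_right 0) (\<lambda>h. f h / ennreal (h^m))"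
proof (rule Liminf_bounded)
  have "ennreal c \<le> f h / ennreal (h^m)" if h: "0 < h" "h < h0" for h
  proof -
    have "ennreal c = ennreal (c * h^m) / ennreal (h^m)" using h(1) c by (subst divide_ennreal) auto
    also have "\<dots> \<le> f h / ennreal (h^m)" by (intro divide_right_mono_ennreal f h)
    finally show ?thesis .
  qed
  then show "\<forall>\<^sub>F h in at_right 0. ennreal c \<le> f h / ennreal (h^m)"
    unfolding eventually_at_right_field using h0 by blast
qed

context film
begin

definition "limit_const = lower_bound_const n * ((deriv ^^ n) \<phi> 0)^2 * measure lborel \<omega> * Q2 W (mat 1)"

lemma inf_energy_ge_limit_const:
  assumes "\<omega> \<noteq> {}" "(deriv ^^ n) \<phi> 0 \<noteq> 0"
  obtains h0 where "h0 > 0" "h0 \<le> 1" "\<And>h. 0 < h \<Longrightarrow> h < h0 \<Longrightarrow> ennreal (limit_const * h^(2 * n)) \<le> inf_energy W \<phi> \<omega> h"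
proof -
  have "limit_const = moment_const n^2 / (768 * cutoff_bound^2) * a^2 * measure lborel \<omega> * Q2 W (mat 1)"
    using n by (simp add: limit_const_def lower_bound_const_def a_def power_divide)
  moreover have "a \<noteq> 0" using assms(2) by (simp add: a_def)
  ultimately show ?thesis using inf_energy_ge[OF assms(1)] that by metis
qed

lemma Liminf_inf_energy_ge:
  assumes "\<omega> \<noteq> {}"
  shows "ennreal limit_const \<le> Liminf (at_right 0) (\<lambda>h. inf_energy W \<phi> \<omega> h / ennreal (h^(2 * n)))"
proof (cases "(deriv ^^ n) \<phi> 0 = 0")
  case False
  have nonneg: "limit_const \<ge> 0" using lower_bound_const_pos[of n] Q2_pos by (simp add: limit_const_def)
  obtain h0 where h0: "h0 > 0" "\<And>h. 0 < h \<Longrightarrow> h < h0 \<Longrightarrow> ennreal (limit_const * h^(2 * n)) \<le> inf_energy W \<phi> \<omega> h"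
    using inf_energy_ge_limit_const[OF assms False] by blast
  show ?thesis by (rule Liminf_divide_power_ge[OF nonneg h0])
qed (simp add: limit_const_def)

lemma inf_energy_two_sided:
  assumes "\<omega> \<noteq> {}" "(deriv ^^ n) \<phi> 0 \<noteq> 0"
  shows "\<exists>c>0. \<exists>C>0. \<exists>h0>0. h0 \<le> 1 \<and> (\<forall>h. 0 < h \<and> h < h0 \<longrightarrow>
    ennreal (c * h^(2 * n)) \<le> inf_energy W \<phi> \<omega> h \<and> inf_energy W \<phi> \<omega> h \<le> ennreal (C * h^(2 * n)))"
proof -
  have "limit_const > 0"
    using lower_bound_const_pos[of n] Q2_pos measure_lborel_open_pos[OF open_\<omega> bounded_\<omega> assms(1)] assms(2)
    by (simp add: limit_const_def)
  moreover obtain h1 where "h1 > 0" "h1 \<le> 1" "\<And>h. 0 < h \<Longrightarrow> h < h1 \<Longrightarrow> ennreal (limit_const * h^(2 * n)) \<le> inf_energy W \<phi> \<omega> h"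
    using inf_energy_ge_limit_const[OF assms] by blast
  moreover obtain C h2 where "C > 0" "h2 > 0" "\<And>h. 0 < h \<Longrightarrow> h < h2 \<Longrightarrow> inf_energy W \<phi> \<omega> h \<le> ennreal (C * h^(2 * n))"
    by (rule inf_energy_le) blast
  ultimately show ?thesis
    by (intro exI[of _ limit_const] exI[of _ C] exI[of _ "min h1 h2"] conjI allI impI) auto
qed

end

theorem theorem9p1:
  shows "\<exists>cn :: nat \<Rightarrow> real. (\<forall>n. cn n > 0) \<and>
    (\<forall>(\<omega> :: (real^2) set) (W :: real^3^3 \<Rightarrow> ennreal) (\<phi> :: real \<Rightarrow> real) (n :: nat).
       lipschitz_domain \<omega> \<and> admissible_density W \<and> smooth_on {-1/2<..<1/2} \<phi> \<and>
       n > 2 \<and> (\<forall>k\<in>{1..n-1}. (deriv ^^ k) \<phi> 0 = 0) \<longrightarrow>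
       (\<exists>C>0. \<exists>h0>0. h0 \<le> 1 \<and>
          (\<forall>h. 0 < h \<and> h < h0 \<longrightarrow> inf_energy W \<phi> \<omega> h \<le> ennreal (C * h ^ (2 * n)))) \<and>
       Liminf (at_right 0) (\<lambda>h. inf_energy W \<phi> \<omega> h / ennreal (h ^ (2 * n)))
         \<ge> ennreal (cn n * ((deriv ^^ n) \<phi> 0)\<^sup>2 * measure lborel \<omega> * Q2 W (mat 1)) \<and>
       ((deriv ^^ n) \<phi> 0 \<noteq> 0 \<longrightarrow>
          (\<exists>c>0. \<exists>C>0. \<exists>h0>0. h0 \<le> 1 \<and> (\<forall>h. 0 < h \<and> h < h0 \<longrightarrow>
             ennreal (c * h ^ (2 * n)) \<le> inf_energy W \<phi> \<omega> h \<and>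
             inf_energy W \<phi> \<omega> h \<le> ennreal (C * h ^ (2 * n))))))"
proof (intro exI[of _ lower_bound_const] conjI allI impI)
  show "lower_bound_const n > 0" for n by (rule lower_bound_const_pos)
  fix \<omega> :: "(real^2) set" and W :: "real^3^3 \<Rightarrow> ennreal" and \<phi> :: "real \<Rightarrow> real" and n :: nat
  assume hyps: "lipschitz_domain \<omega> \<and> admissible_density W \<and> smooth_on {-1/2<..<1/2} \<phi> \<and>
    n > 2 \<and> (\<forall>k\<in>{1..n-1}. (deriv ^^ k) \<phi> 0 = 0)"
  then have \<omega>: "\<omega> \<noteq> {}" by (simp add: lipschitz_domain_def)
  interpret film W \<phi> n \<omega>
    by unfold_locales (use hyps in \<open>auto simp: lipschitz_domain_def\<close>)
  show "\<exists>C>0. \<exists>h0>0. h0 \<le> 1 \<and> (\<forall>h. 0 < h \<and> h < h0 \<longrightarrow> inf_energy W \<phi> \<omega> h \<le> ennreal (C * h^(2 * n)))"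
    by (rule inf_energy_le) blast
  show "ennreal (lower_bound_const n * ((deriv ^^ n) \<phi> 0)^2 * measure lborel \<omega> * Q2 W (mat 1))
    \<le> Liminf (at_right 0) (\<lambda>h. inf_energy W \<phi> \<omega> h / ennreal (h^(2 * n)))"
    using Liminf_inf_energy_ge[OF \<omega>] by (simp add: limit_const_def)
  show "\<exists>c>0. \<exists>C>0. \<exists>h0>0. h0 \<le> 1 \<and> (\<forall>h. 0 < h \<and> h < h0 \<longrightarrow> ennreal (c * h^(2 * n)) \<le> inf_energy W \<phi> \<omega> h &
    inf_energy W \<phi> \<omega> h \<le> ennreal (C * h^(2 * n)))" if "(deriv ^^ n) \<phi> 0 \<noteq> 0"
    by (rule inf_energy_two_sided[OF \<omega> that])
qed

end
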